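(* Let $P\subset\mathbb{R}^n$ be a smooth lattice polytope of dimension $n$ and let $A\subset P\cap\mathbb{Z}^n$. If $A$ contains the vertices of $P$ and their nearest lattice neighbors along the edges of $P$, then $\dim\operatorname{Sec}X_A=\dim\operatorname{Sec}X_P$ and $\deg\operatorname{Sec}X_A$ divides $\deg\operatorname{Sec}X_P$.
   Context: All varieties are over $\mathbb{C}$. For a reduced irreducible variety $X\subseteq\mathbb{P}^r$, $\operatorname{Sec}X$ is the closure of the union of all lines in $\mathbb{P}^r$ meeting $X$ in at least $2$ points. A lattice polytope $P$ is smooth if it is simple (each vertex lies on exactly $\dim P$ edges) and the first lattice vectors along the edges incident at any vertex form part of a $\mathbb{Z}$-basis of $\mathbb{Z}^n$. For a finite set $A=\{u_0,\dots,u_s\}\subset\mathbb{Z}^n$, $X_A\subset\mathbb{P}^s$ is the closure of the image of $(\mathbb{C}^* )^n$ under $x\mapsto[\chi^{u_0}(x):\cdots:\chi^{u_s}(x)]$, where $\chi^{u_i}$ are the characters of $(\mathbb{C}^* )^n$; and $X_P=X_{P\cap\mathbb{Z}^n}\subset\mathbb{P}^r$, $r=|P\cap\mathbb{Z}^n|-1$. The nearest neighbor of a vertex $v$ along an edge $\sigma\ni v$ is the lattice point of $\sigma\setminus\{v\}$ closest to $v$. *)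

theory Defs
  imports
    "HOL-Analysis.Analysis"
    "HOL-Library.Poly_Mapping"
    "HOL-Library.Extended_Nat"
    "HOL-Computational_Algebra.Polynomial"
begin

section \<open>Multivariate polynomials over the complex numbers\<close>

text \<open>
  A polynomial in variables of type \<open>'i\<close> is a finitely supported map from exponent vectors
  to coefficients, with the convolution product of \<open>HOL-Library.Poly_Mapping\<close>.
\<close>

type_synonym 'i cpoly = "('i \<Rightarrow>\<^sub>0 nat) \<Rightarrow>\<^sub>0 complex"

definition monom_degree :: "('i \<Rightarrow>\<^sub>0 nat) \<Rightarrow> nat"
  where "monom_degree m = (\<Sum>i\<in>Poly_Mapping.keys m. Poly_Mapping.lookup m i)"

definition monom_eval :: "('i \<Rightarrow>\<^sub>0 nat) \<Rightarrow> ('i \<Rightarrow> complex) \<Rightarrow> complex"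
  where "monom_eval m x = (\<Prod>i\<in>Poly_Mapping.keys m. x i ^ Poly_Mapping.lookup m i)"

definition cpoly_eval :: "'i cpoly \<Rightarrow> ('i \<Rightarrow> complex) \<Rightarrow> complex"
  where "cpoly_eval f x = (\<Sum>m\<in>Poly_Mapping.keys f. Poly_Mapping.lookup f m * monom_eval m x)"

definition cpoly_scale :: "complex \<Rightarrow> 'i cpoly \<Rightarrow> 'i cpoly"
  where "cpoly_scale c f = Poly_Mapping.single 0 c * f"

global_interpretation cpoly: vector_space cpoly_scale
  by unfold_locales
    (simp_all add: cpoly_scale_def algebra_simps single_add mult_single flip: mult.assoc)

text \<open>The degree \<open>d\<close> part of the polynomial ring in the variables indexed by \<open>I\<close>.\<close>

definition forms :: "'i set \<Rightarrow> nat \<Rightarrow> 'i cpoly set"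
  where "forms I d =
    {f. \<forall>m\<in>Poly_Mapping.keys f. Poly_Mapping.keys m \<subseteq> I \<and> monom_degree m = d}"

lemma monom_eval_superset:
  assumes "finite S" "Poly_Mapping.keys m \<subseteq> S"
  shows "monom_eval m x = (\<Prod>i\<in>S. x i ^ Poly_Mapping.lookup m i)"
  unfolding monom_eval_def
  by (rule prod.mono_neutral_left) (use assms in \<open>auto simp: in_keys_iff\<close>)

lemma monom_degree_superset:
  assumes "finite S" "Poly_Mapping.keys m \<subseteq> S"
  shows "monom_degree m = (\<Sum>i\<in>S. Poly_Mapping.lookup m i)"
  unfolding monom_degree_def
  by (rule sum.mono_neutral_left) (use assms in \<open>auto simp: in_keys_iff\<close>)

lemma monom_eval_add: "monom_eval (m + n) x = monom_eval m x * monom_eval n x"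
proof -
  let ?S = "Poly_Mapping.keys m \<union> Poly_Mapping.keys n"
  have "Poly_Mapping.keys (m + n) \<subseteq> ?S" by (rule Poly_Mapping.keys_add)
  then show ?thesis
    by (subst (1 2 3) monom_eval_superset[of ?S])
      (auto simp: lookup_add power_add prod.distrib)
qed

lemma monom_degree_add: "monom_degree (m + n) = monom_degree m + monom_degree n"
proof -
  let ?S = "Poly_Mapping.keys m \<union> Poly_Mapping.keys n"
  have "Poly_Mapping.keys (m + n) \<subseteq> ?S" by (rule Poly_Mapping.keys_add)
  then show ?thesis
    by (subst (1 2 3) monom_degree_superset[of ?S])
      (auto simp: lookup_add sum.distrib)
qed

lemma cpoly_eval_0 [simp]: "cpoly_eval 0 x = 0"
  by (simp add: cpoly_eval_def)

lemma cpoly_eval_1 [simp]: "cpoly_eval 1 x = 1"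
  by (simp add: cpoly_eval_def monom_eval_def)

lemma cpoly_eval_add: "cpoly_eval (f + g) x = cpoly_eval f x + cpoly_eval g x"
  unfolding cpoly_eval_def
  by (rule setsum_keys_plus_distrib) (simp_all add: distrib_right)

lemma cpoly_eval_sum: "cpoly_eval (sum f S) x = (\<Sum>s\<in>S. cpoly_eval (f s) x)"
  by (induction S rule: infinite_finite_induct) (simp_all add: cpoly_eval_add)

lemma cpoly_eval_single: "cpoly_eval (Poly_Mapping.single m c) x = c * monom_eval m x"
  by (simp add: cpoly_eval_def)

lemma cpoly_sum_monomials:
  fixes f :: "'i cpoly"
  shows "f = (\<Sum>m\<in>Poly_Mapping.keys f. Poly_Mapping.single m (Poly_Mapping.lookup f m))"
  by (rule poly_mapping_eqI)
    (simp add: lookup_sum lookup_single when_def in_keys_iff)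

lemma cpoly_eval_mult: "cpoly_eval (f * g) x = cpoly_eval f x * cpoly_eval g x"
proof -
  have "f * g = (\<Sum>m\<in>Poly_Mapping.keys f. \<Sum>n\<in>Poly_Mapping.keys g.
      Poly_Mapping.single (m + n) (Poly_Mapping.lookup f m * Poly_Mapping.lookup g n))"
    by (subst cpoly_sum_monomials[of f], subst cpoly_sum_monomials[of g])
      (simp add: sum_product mult_single)
  then show ?thesis
    by (simp add: cpoly_eval_sum cpoly_eval_single monom_eval_add)
      (simp add: cpoly_eval_def sum_product mult_ac)
qed

lemma forms_mult:
  assumes "f \<in> forms I d" "g \<in> forms I e"
  shows "f * g \<in> forms I (d + e)"
  unfolding forms_def
proof (intro CollectI ballI)
  fix k assume "k \<in> Poly_Mapping.keys (f * g)"
  then obtain m n where "k = m + n" "m \<in> Poly_Mapping.keys f" "n \<in> Poly_Mapping.keys g"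
    using keys_mult[of f g] by auto
  then show "Poly_Mapping.keys k \<subseteq> I \<and> monom_degree k = d + e"
    using assms Poly_Mapping.keys_add[of m n] by (fastforce simp: forms_def monom_degree_add)
qed

lemma cpoly_eval_homogeneous:
  assumes "f \<in> forms I d"
  shows "cpoly_eval f (\<lambda>i. c * x i) = c ^ d * cpoly_eval f x"
proof -
  have "monom_eval m (\<lambda>i. c * x i) = c ^ d * monom_eval m x" if "m \<in> Poly_Mapping.keys f" for m
    using that assms
    by (auto simp: forms_def monom_eval_def monom_degree_def power_mult_distrib prod.distrib power_sum)
  then show ?thesis
    by (simp add: cpoly_eval_def sum_distrib_left mult_ac)
qed


section \<open>Projective space and its Zariski topology\<close>

text \<open>
  For a finite set \<open>I\<close>, \<open>proj_space I\<close> is the projective space of dimension \<open>card I - 1\<close> whose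
  homogeneous coordinates are indexed by \<open>I\<close>; the coordinates outside \<open>I\<close> are set to 0. A point
  is the set of all its representatives.
\<close>

definition coord_space :: "'i set \<Rightarrow> ('i \<Rightarrow> complex) set"
  where "coord_space I = {x. \<forall>i. i \<notin> I \<longrightarrow> x i = 0}"

definition proj_pt :: "('i \<Rightarrow> complex) \<Rightarrow> ('i \<Rightarrow> complex) set"
  where "proj_pt x = {(\<lambda>i. c * x i) |c. c \<noteq> 0}"

definition proj_space :: "'i set \<Rightarrow> ('i \<Rightarrow> complex) set set"
  where "proj_space I = proj_pt ` (coord_space I - {\<lambda>_. 0})"

definition zero_locus :: "'i set \<Rightarrow> 'i cpoly set \<Rightarrow> ('i \<Rightarrow> complex) set set"
  where "zero_locus I F = {p \<in> proj_space I. \<forall>f\<in>F. \<forall>x\<in>p. cpoly_eval f x = 0}"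

definition zariski :: "'i set \<Rightarrow> ('i \<Rightarrow> complex) set topology"
  where "zariski I =
    topology (\<lambda>U. \<exists>F. F \<subseteq> (\<Union>d. forms I d) \<and> U = proj_space I - zero_locus I F)"

lemma zero_locus_rep:
  assumes "p \<in> proj_space I" "f \<in> forms I d" "x \<in> p" "y \<in> p" "cpoly_eval f x = 0"
  shows "cpoly_eval f y = 0"
proof -
  obtain z a b where "a \<noteq> 0" "x = (\<lambda>i. a * z i)" "y = (\<lambda>i. b * z i)"
    using assms by (auto simp: proj_space_def proj_pt_def)
  then show ?thesis
    using assms(5) by (simp add: cpoly_eval_homogeneous[OF assms(2)])
qed

lemma zero_locus_Un:
  assumes "F \<subseteq> (\<Union>d. forms I d)" "G \<subseteq> (\<Union>d. forms I d)"
  shows "zero_locus I F \<union> zero_locus I G = zero_locus I {f * g |f g. f \<in> F \<and> g \<in> G}"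
    (is "?L = ?R")
proof
  show "?L \<subseteq> ?R" by (auto simp: zero_locus_def cpoly_eval_mult)
next
  show "?R \<subseteq> ?L"
  proof (rule subsetI, rule ccontr)
    fix p assume p: "p \<in> ?R" "p \<notin> ?L"
    then have pI: "p \<in> proj_space I" by (simp add: zero_locus_def)
    obtain f x g y where f: "f \<in> F" "x \<in> p" "cpoly_eval f x \<noteq> 0"
      and g: "g \<in> G" "y \<in> p" "cpoly_eval g y \<noteq> 0"
      using p pI by (auto simp: zero_locus_def)
    obtain e where e: "g \<in> forms I e" using g(1) assms(2) by auto
    have "cpoly_eval g x \<noteq> 0" using zero_locus_rep[OF pI e f(2) g(2)] g(3) by blast
    moreover have "cpoly_eval (f * g) x = 0" using p(1) f g by (auto simp: zero_locus_def)
    ultimately show False using f(3) by (simp add: cpoly_eval_mult)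
  qed
qed

lemma istopology_zariski:
  "istopology (\<lambda>U. \<exists>F. F \<subseteq> (\<Union>d. forms I d) \<and> U = proj_space I - zero_locus I F)"
  unfolding istopology_def
proof (intro conjI allI impI)
  fix S T
  assume "\<exists>F. F \<subseteq> (\<Union>d. forms I d) \<and> S = proj_space I - zero_locus I F"
    and "\<exists>F. F \<subseteq> (\<Union>d. forms I d) \<and> T = proj_space I - zero_locus I F"
  then obtain F G where F: "F \<subseteq> (\<Union>d. forms I d)" "S = proj_space I - zero_locus I F"
    and G: "G \<subseteq> (\<Union>d. forms I d)" "T = proj_space I - zero_locus I G" by blast
  show "\<exists>F. F \<subseteq> (\<Union>d. forms I d) \<and> S \<inter> T = proj_space I - zero_locus I F"
  proof (intro exI conjI)
    show "{f * g |f g. f \<in> F \<and> g \<in> G} \<subseteq> (\<Union>d. forms I d)"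
      using F(1) G(1) by (blast intro: forms_mult)
    show "S \<inter> T = proj_space I - zero_locus I {f * g |f g. f \<in> F \<and> g \<in> G}"
      unfolding F(2) G(2) zero_locus_Un[OF F(1) G(1), symmetric] by blast
  qed
next
  fix K :: "('a \<Rightarrow> complex) set set set"
  assume "\<forall>U\<in>K. \<exists>F. F \<subseteq> (\<Union>d. forms I d) \<and> U = proj_space I - zero_locus I F"
  then obtain F where F: "\<And>U. U \<in> K \<Longrightarrow> F U \<subseteq> (\<Union>d. forms I d)"
    "\<And>U. U \<in> K \<Longrightarrow> U = proj_space I - zero_locus I (F U)" by metis
  show "\<exists>F. F \<subseteq> (\<Union>d. forms I d) \<and> \<Union>K = proj_space I - zero_locus I F"
  proof (intro exI conjI)
    show "(\<Union>U\<in>K. F U) \<subseteq> (\<Union>d. forms I d)" using F(1) by blast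
    have "\<Union>K = (\<Union>U\<in>K. proj_space I - zero_locus I (F U))" using F(2) by auto
    also have "\<dots> = proj_space I - zero_locus I (\<Union>U\<in>K. F U)"
      by (auto simp: zero_locus_def)
    finally show "\<Union>K = proj_space I - zero_locus I (\<Union>U\<in>K. F U)" .
  qed
qed

lemma openin_zariski:
  "openin (zariski I) U \<longleftrightarrow>
    (\<exists>F. F \<subseteq> (\<Union>d. forms I d) \<and> U = proj_space I - zero_locus I F)"
  unfolding zariski_def by (simp add: topology_inverse'[OF istopology_zariski])

lemma topspace_zariski [simp]: "topspace (zariski I) = proj_space I"
proof
  show "topspace (zariski I) \<subseteq> proj_space I"
    using openin_topspace[of "zariski I"] unfolding openin_zariski by auto
  have "1 \<in> forms I 0" by (simp add: forms_def monom_degree_def)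
  moreover have "zero_locus I {1} = {}"
    by (auto simp: zero_locus_def proj_space_def proj_pt_def)
  ultimately have "openin (zariski I) (proj_space I)"
    unfolding openin_zariski by (intro exI[of _ "{1}"]) auto
  then show "proj_space I \<subseteq> topspace (zariski I)" by (rule openin_subset)
qed

lemma closedin_zariski:
  "closedin (zariski I) Z \<longleftrightarrow> (\<exists>F. F \<subseteq> (\<Union>d. forms I d) \<and> Z = zero_locus I F)"
proof -
  have "zero_locus I F \<subseteq> proj_space I" for F by (auto simp: zero_locus_def)
  then show ?thesis
    unfolding closedin_def openin_zariski topspace_zariski
    by (metis double_diff order_refl)
qed


section \<open>Dimension and degree\<close>

definition irreducible_closedin :: "'a topology \<Rightarrow> 'a set \<Rightarrow> bool"
  where "irreducible_closedin T Z \<longleftrightarrow> closedin T Z \<and> Z \<noteq> {} \<and>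
    (\<forall>B C. closedin T B \<and> closedin T C \<and> Z = B \<union> C \<longrightarrow> Z = B \<or> Z = C)"

text \<open>
  The dimension of a topological space: the supremum of the lengths \<open>k\<close> of chains
  \<open>Z 0 \<subset> Z 1 \<subset> \<dots> \<subset> Z k\<close> of irreducible closed subsets. The empty space gets 0.
\<close>

definition krull_dim :: "'a topology \<Rightarrow> enat"
  where "krull_dim T = Sup {enat k |k. \<exists>Z :: nat \<Rightarrow> 'a set.
    (\<forall>i\<le>k. irreducible_closedin T (Z i)) \<and> (\<forall>i<k. Z i \<subset> Z (Suc i))}"

definition proj_dim :: "'i set \<Rightarrow> ('i \<Rightarrow> complex) set set \<Rightarrow> enat"
  where "proj_dim I X = krull_dim (subtopology (zariski I) X)"

text \<open>The degree \<open>d\<close> part of the homogeneous vanishing ideal of \<open>X\<close>.\<close>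

definition vanishing_forms :: "'i set \<Rightarrow> ('i \<Rightarrow> complex) set set \<Rightarrow> nat \<Rightarrow> 'i cpoly set"
  where "vanishing_forms I X d = {f \<in> forms I d. \<forall>p\<in>X. \<forall>x\<in>p. cpoly_eval f x = 0}"

text \<open>
  The dimension of the degree \<open>d\<close> part of the homogeneous coordinate ring of \<open>X\<close>. For finite
  \<open>I\<close> both spaces are finite dimensional and the second is a subspace of the first, so the
  difference of dimensions is the dimension of the quotient.
\<close>

definition hilbert_function :: "'i set \<Rightarrow> ('i \<Rightarrow> complex) set set \<Rightarrow> nat \<Rightarrow> nat"
  where "hilbert_function I X d = cpoly.dim (forms I d) - cpoly.dim (vanishing_forms I X d)"

definition hilbert_polynomial :: "'i set \<Rightarrow> ('i \<Rightarrow> complex) set set \<Rightarrow> rat poly"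
  where "hilbert_polynomial I X =
    (THE h. \<forall>\<^sub>F d in sequentially. poly h (of_nat d) = of_nat (hilbert_function I X d))"

text \<open>
  \<open>r!\<close> times the leading coefficient of the Hilbert polynomial, \<open>r\<close> being its degree (which is
  the dimension of \<open>X\<close>). This is a natural number, and the value is taken in \<^typ>\<open>nat\<close> so that
  divisibility of degrees has its usual meaning.
\<close>

definition proj_degree :: "'i set \<Rightarrow> ('i \<Rightarrow> complex) set set \<Rightarrow> nat"
  where "proj_degree I X = (THE e. of_nat e =
    fact (Polynomial.degree (hilbert_polynomial I X)) * lead_coeff (hilbert_polynomial I X))"


section \<open>Secant varieties\<close>

definition proj_lines :: "'i set \<Rightarrow> ('i \<Rightarrow> complex) set set set"
  where "proj_lines I =
    {{proj_pt (\<lambda>i. a * x i + b * y i) |a b. (a, b) \<noteq> (0, 0)} |x y.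
      x \<in> coord_space I - {\<lambda>_. 0} \<and> y \<in> coord_space I - {\<lambda>_. 0} \<and> proj_pt x \<noteq> proj_pt y}"

definition Sec :: "'i set \<Rightarrow> ('i \<Rightarrow> complex) set set \<Rightarrow> ('i \<Rightarrow> complex) set set"
  where "Sec I X =
    zariski I closure_of (\<Union>{L \<in> proj_lines I. \<exists>p q. p \<in> L \<inter> X \<and> q \<in> L \<inter> X \<and> p \<noteq> q})"


section \<open>Lattice polytopes\<close>

definition real_vec :: "int ^ 'n \<Rightarrow> real ^ 'n"
  where "real_vec u = (\<chi> i. real_of_int (u $ i))"

definition lattice_points :: "(real ^ 'n) set \<Rightarrow> (int ^ 'n) set"
  where "lattice_points P = {u. real_vec u \<in> P}"

definition lattice_polytope :: "(real ^ 'n) set \<Rightarrow> bool"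
  where "lattice_polytope P \<longleftrightarrow> (\<exists>V. finite V \<and> P = convex hull (real_vec ` V))"

definition simple_polytope :: "(real ^ 'n) set \<Rightarrow> bool"
  where "simple_polytope P \<longleftrightarrow> polytope P \<and>
    (\<forall>v. v extreme_point_of P \<longrightarrow> int (card {\<sigma>. \<sigma> edge_of P \<and> v \<in> \<sigma>}) = aff_dim P)"

definition nearest_neighbor :: "int ^ 'n \<Rightarrow> (real ^ 'n) set \<Rightarrow> int ^ 'n \<Rightarrow> bool"
  where "nearest_neighbor v \<sigma> w \<longleftrightarrow>
    is_arg_min (\<lambda>u. dist (real_vec v) (real_vec u)) (\<lambda>u. u \<in> lattice_points \<sigma> - {v}) w"

global_interpretation int_vec: module "(*s) :: int \<Rightarrow> int ^ 'n \<Rightarrow> int ^ 'n"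
  by unfold_locales (simp_all add: vec_eq_iff algebra_simps)

definition Z_basis :: "(int ^ 'n) set \<Rightarrow> bool"
  where "Z_basis B \<longleftrightarrow> int_vec.independent B \<and> int_vec.span B = UNIV"

text \<open>
  The first lattice vector along an edge \<open>\<sigma>\<close> at a vertex \<open>v\<close> is \<open>w - v\<close>, where \<open>w\<close> is the
  nearest neighbor of \<open>v\<close> along \<open>\<sigma>\<close>. Vertices of a lattice polytope are lattice points, so it is
  enough to let \<open>v\<close> range over lattice points.
\<close>

definition smooth_polytope :: "(real ^ 'n) set \<Rightarrow> bool"
  where "smooth_polytope P \<longleftrightarrow> lattice_polytope P \<and> simple_polytope P \<and>
    (\<forall>v. real_vec v extreme_point_of P \<longrightarrow>
      (\<exists>B. Z_basis B \<and>
        {w - v |w \<sigma>. \<sigma> edge_of P \<and> real_vec v \<in> \<sigma> \<and> nearest_neighbor v \<sigma> w} \<subseteq> B))"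


section \<open>Projective toric varieties\<close>

definition character :: "int ^ 'n \<Rightarrow> complex ^ 'n \<Rightarrow> complex"
  where "character u x = (\<Prod>i\<in>UNIV. (x $ i) powi (u $ i))"

text \<open>The homogeneous coordinates of the ambient projective space are indexed by \<open>A\<close> itself.\<close>

definition toric_variety :: "(int ^ 'n) set \<Rightarrow> (int ^ 'n \<Rightarrow> complex) set set"
  where "toric_variety A = zariski A closure_of
    {proj_pt (\<lambda>u. if u \<in> A then character u x else 0) |x. \<forall>i. x $ i \<noteq> 0}"

end

theory Submission
  imports
    Defs
    "HOL-Library.Function_Algebras"
    "HOL-Computational_Algebra.Fraction_Field"
    "HOL-Computational_Algebra.Fundamental_Theorem_Algebra"
begin

text \<open>
  Write \<open>z u = l * t^u + m * s^u\<close> for the coordinates of a general point on a secant line of the torus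
  orbit. The secant variety of \<open>X_A\<close> is the image of that of \<open>X_P\<close> under the projection to the
  coordinates in \<open>A\<close>, and both claims follow once this projection is finite, that is, once every
  \<open>z u\<close> with \<open>u\<close> in \<open>P\<close> is integral over the ring generated by the \<open>z a\<close> with \<open>a\<close> in \<open>A\<close>.

  By Chevalley's theorem it is enough to see that a valuation ring \<open>V\<close> of the function field
  that contains all \<open>z a\<close> contains \<open>z u\<close>. The valuation of \<open>p u = l * t^u\<close> is affine in \<open>u\<close>, so it is minimal
  at a vertex; the same holds for \<open>q u = m * s^u\<close>. If the minimal values are not in \<open>V\<close>, then
  they are attained at one vertex \<open>v\<close>, since \<open>p v + q v = z v\<close> lies in \<open>V\<close>. In the chart at \<open>v\<close>, whose
  coordinates are the nearest neighbors \<open>w\<close> of \<open>v\<close>, both points have coordinates in \<open>V\<close>, and so have the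
  products of \<open>p v\<close> with the coordinate differences, because all \<open>z w\<close> are in \<open>V\<close>. Hence \<open>z u\<close>, which
  differs from a \<open>V\<close>-multiple of \<open>z v\<close> by a \<open>V\<close>-combination of these products, is in \<open>V\<close>.

  For a finite projection, the coordinate ring above lies between two free modules of
  the same rank over the one below, which makes the degree a multiple, and
  lying over and incomparability make the Krull dimensions equal.
\<close>

subsection \<open>Polytopes with a smooth vertex\<close>

text \<open>Closed points of the secant variety include limits of secant lines, whose shape is hard
  to list. Valuations treat all limits alike: poles of \<open>p v\<close> and \<open>q v\<close>
  that cancel correspond to two points of the torus with the same limit, and then the pole of
  \<open>p v\<close> is compensated by the coordinate differences. Smoothness is what makes every
  lattice point of \<open>P\<close> a vertex plus a natural combination of primitive edge vectors.
  Laurent monomials have to be invertible, so valuations live on the fraction field of a polynomial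
  ring in the weights and the coordinates of two torus elements; the integral equations found there
  are then evaluated at points. Degree and dimension are read off graded pieces, so the equations
  must be made homogeneous, which works because multiples of secant points are secant points. Graded
  rings are modelled as spaces of functions on the affine cone over a variety, and linear algebra on
  these spaces takes the place of quotients by ideals. The factor between the two degrees is the
  size of a maximal family of monomials independent over the smaller ring.\<close>

lemma minimal_face_of_polytope:
  fixes P :: "'a::euclidean_space set"
  assumes P: "polytope P" and x: "x \<in> P"
  obtains F where "F face_of P" "x \<in> rel_interior F"
proof -
  define F where "F = \<Inter>{T. T face_of P \<and> x \<in> T}"
  have cP: "convex P" using P by (rule polytope_imp_convex)
  have F: "F face_of P"
    unfolding F_def by (rule face_of_Inter) (use x cP face_of_refl in auto)
  have xF: "x \<in> F" by (auto simp: F_def)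
  have polF: "polytope F" using face_of_polytope_polytope[OF P F] .
  have "x \<notin> rel_frontier F"
  proof
    assume "x \<in> rel_frontier F"
    then obtain G where G: "G face_of F" "G \<noteq> F" "x \<in> G"
      unfolding rel_frontier_of_polyhedron_alt[OF polytope_imp_polyhedron[OF polF]] by auto
    have "G face_of P" using face_of_trans[OF G(1) F] .
    then have "F \<subseteq> G" using G(3) by (auto simp: F_def)
    with face_of_imp_subset[OF G(1)] G(2) show False by auto
  qed
  then have "x \<in> rel_interior F"
    using xF closure_subset[of F] by (auto simp: rel_frontier_def)
  with F show ?thesis by (rule that)
qed

lemma polytope_eq_convex_hull_extreme:
  fixes P :: "'a::euclidean_space set"
  assumes "polytope P"
  shows "P = convex hull {x. x extreme_point_of P}"
  using Krein_Milman_Minkowski[OF polytope_imp_compact[OF assms] polytope_imp_convex[OF assms]] .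

lemma finite_extreme_points_polytope:
  fixes P :: "'a::euclidean_space set"
  shows "polytope P \<Longrightarrow> finite {x. x extreme_point_of P}"
  by (simp add: finite_polyhedron_extreme_points polytope_imp_polyhedron)

text \<open>Of two extreme points on one ray from \<open>v\<close>, the nearer one would lie
  strictly between \<open>v\<close> and the farther one.\<close>

lemma extreme_points_on_ray_eq:
  assumes "v extreme_point_of P" "w extreme_point_of P" "w' extreme_point_of P"
    and "w \<noteq> v" "w' \<noteq> v" and t: "0 < t" "0 < t'" and eq: "t *\<^sub>R (w - v) = t' *\<^sub>R (w' - v)"
  shows "w = w'"
proof -
  have aux: "w = w'" if "w extreme_point_of P" "w' extreme_point_of P" "w \<noteq> v" "w' \<noteq> v"
    "0 < t" "0 < t'" "t \<ge> t'"
    and eq: "t *\<^sub>R (w - v) = t' *\<^sub>R (w' - v)" for w w' t t'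
  proof (rule ccontr)
    assume ne: "w \<noteq> w'"
    have "w - v = (t' / t) *\<^sub>R (w' - v)" using eq that(5)
      by (metis (no_types, lifting) divide_inverse_commute less_irrefl scaleR_left_imp_eq scaleR_one scaleR_scaleR right_inverse)
    then have w: "w = (1 - t'/t) *\<^sub>R v + (t' / t) *\<^sub>R w'" by (simp add: algebra_simps)
    have "t' / t \<noteq> 1" using w ne by auto
    then have "t' / t < 1" "0 < t'/t" using that by (auto simp: field_simps)
    then have "w \<in> open_segment v w'" using w that(4) unfolding in_segment by auto
    moreover have "v \<in> P" "w' \<in> P" using assms(1) that(2) by (auto simp: extreme_point_of_def)
    ultimately show False using that(1) by (auto simp: extreme_point_of_def)
  qed
  show ?thesis
  proof (cases "t \<ge> t'")
    case True then show ?thesis using aux assms by blast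
  next
    case False then show ?thesis using aux[of w' w t' t] assms by auto
  qed
qed

text \<open>
  A vertex figure: cut \<open>P\<close> with a hyperplane separating the vertex \<open>v\<close> from the other vertices.
  The extreme points of the section are the points where the edges at \<open>v\<close> cross the hyperplane.
\<close>

lemma vertex_figure_extreme_point:
  fixes P :: "'a::euclidean_space set"
  assumes P: "polytope P" and v: "v extreme_point_of P"
    and av: "a \<bullet> v < b" and aQ: "\<And>w. w extreme_point_of P \<Longrightarrow> w \<noteq> v \<Longrightarrow> b < a \<bullet> w"
    and x: "x extreme_point_of (P \<inter> {y. a \<bullet> y = b})"
  shows "\<exists>w t. w extreme_point_of P \<and> closed_segment v w edge_of P \<and> w \<noteq> v \<and> 0 < t \<and>
    x - v = t *\<^sub>R (w - v)"
proof -
  define H where "H = {y. a \<bullet> y = b}"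
  have xP: "x \<in> P" "a \<bullet> x = b" using x by (auto simp: extreme_point_of_def)
  obtain F where F: "F face_of P" and xF: "x \<in> rel_interior F"
    using minimal_face_of_polytope[OF P xP(1)] .
  have xF': "x \<in> F" using xF rel_interior_subset by blast
  have cF: "convex F" using F face_of_imp_convex by blast
  have FP: "F \<subseteq> P" using F face_of_imp_subset by blast
  \<comment> \<open>As \<open>x\<close> is in the relative interior of \<open>F\<close>, the segment
    from \<open>y\<close> to \<open>x\<close> can be prolonged inside \<open>F\<close>. A second
    point \<open>y\<close> of \<open>F\<close> on the hyperplane would thus put the extreme point
    \<open>x\<close> inside a segment of the section.\<close>
  have FH: "y = x" if yF: "y \<in> F" "a \<bullet> y = b" for y
  proof (rule ccontr)
    assume ne: "y \<noteq> x"
    obtain e where e: "e > 1" "(1 - e) *\<^sub>R y + e *\<^sub>R x \<in> F"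
      using xF convex_rel_interior_iff[OF cF, of x] yF(1) by blast
    define y' where "y' = (1 - e) *\<^sub>R y + e *\<^sub>R x"
    have "a \<bullet> y' = b" using yF(2) xP(2) by (simp add: y'_def inner_add_right algebra_simps)
    then have y': "y' \<in> P \<inter> {y. a \<bullet> y = b}" using e FP by (auto simp: y'_def)
    have "x = (1 - 1/e) *\<^sub>R y + (1/e) *\<^sub>R y'"
    proof -
      have "(1/e) *\<^sub>R y' = ((1-e)/e) *\<^sub>R y + x" using e(1) by (simp add: y'_def scaleR_add_right)
      also have "(1-e)/e = 1/e - 1" using e(1) by (simp add: field_simps)
      finally show ?thesis by (simp add: algebra_simps)
    qed
    moreover have "0 < 1/e" "1/e < 1" using e(1) by auto
    moreover have "y \<noteq> y'"
    proof
      assume "y = y'"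
      then have "y = (1 - e) *\<^sub>R y + e *\<^sub>R x" using y'_def by metis
      moreover have "y = (1 - e) *\<^sub>R y + e *\<^sub>R y" by (simp add: scaleR_diff_left)
      ultimately have "(1 - e) *\<^sub>R y + e *\<^sub>R y = (1 - e) *\<^sub>R y + e *\<^sub>R x" by metis
      then have "e *\<^sub>R y = e *\<^sub>R x" by (simp only: add_left_cancel)
      then show False using e(1) ne by simp
    qed
    ultimately have "x \<in> open_segment y y'" unfolding in_segment by blast
    then show False using x y' yF FP unfolding extreme_point_of_def by blast
  qed
  have polF: "polytope F" using face_of_polytope_polytope[OF P F] .
  have extF: "w extreme_point_of P" "w \<in> F" if "w extreme_point_of F" for w
    using that extreme_point_of_face[OF F] by auto
  have hullF: "F = convex hull {w. w extreme_point_of F}"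
    using polytope_eq_convex_hull_extreme[OF polF] .
  have vF: "v extreme_point_of F"
  proof (rule ccontr)
    assume "\<not> v extreme_point_of F"
    then have "{w. w extreme_point_of F} \<subseteq> {y. a \<bullet> y > b}" using aQ extF by auto
    then have "F \<subseteq> {y. a \<bullet> y > b}"
      using hullF hull_minimal[of _ "{y. a \<bullet> y > b}" convex] convex_halfspace_gt by metis
    then show False using xF' xP by auto
  qed
  have "\<exists>w. w extreme_point_of F \<and> w \<noteq> v"
  proof (rule ccontr)
    assume "\<not> ?thesis"
    then have "{w. w extreme_point_of F} = {v}" using vF by blast
    then have "F = {v}" using hullF by (metis convex_hull_singleton)
    then show False using xF' xP av by auto
  qed
  then obtain w where w: "w extreme_point_of F" "w \<noteq> v" by blast
  \<comment> \<open>The segment from \<open>v\<close> to any other vertex of \<open>F\<close>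
    crosses the hyperplane, and by \<open>FH\<close> it does so at \<open>x\<close>. So these
    vertices lie on one ray, there is only one of them, and \<open>F\<close> is an edge.\<close>
  have ray: "\<exists>t>0. t < 1 \<and> x - v = t *\<^sub>R (w - v)" if w: "w extreme_point_of F" "w \<noteq> v" for w
  proof -
    have aw: "a \<bullet> w > b" using aQ extF w by auto
    define t where "t = (b - a \<bullet> v) / (a \<bullet> w - a \<bullet> v)"
    have t: "0 < t" "t < 1" using av aw by (auto simp: t_def field_simps)
    have "t * (a \<bullet> w - a \<bullet> v) = b - a \<bullet> v" using av aw by (simp add: t_def)
    then have "a \<bullet> ((1-t) *\<^sub>R v + t *\<^sub>R w) = b" by (simp add: inner_add_right algebra_simps)
    moreover have "(1-t) *\<^sub>R v + t *\<^sub>R w \<in> F"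
      using cF t vF w by (auto simp: convex_alt extreme_point_of_def)
    ultimately have "(1-t) *\<^sub>R v + t *\<^sub>R w = x" using FH by blast
    then have "x - v = t *\<^sub>R (w - v)" by (auto simp: algebra_simps)
    then show ?thesis using t by blast
  qed
  obtain t where t: "t > 0" "t < 1" "x - v = t *\<^sub>R (w - v)" using ray[OF w] by blast
  have "{w. w extreme_point_of F} = {v, w}"
  proof (rule ccontr)
    assume "\<not> ?thesis"
    then obtain w' where w': "w' extreme_point_of F" "w' \<noteq> v" "w' \<noteq> w" using vF w by auto
    obtain t' where t': "t' > 0" "x - v = t' *\<^sub>R (w' - v)" using ray[OF w'(1,2)] by blast
    have "w = w'" using extreme_points_on_ray_eq[OF vF w(1) w'(1) w(2) w'(2) t(1) t'(1)] t(3) t'(2) by simp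
    then show False using w' by simp
  qed
  then have "F = closed_segment v w" using hullF by (metis segment_convex_hull)
  then have "closed_segment v w edge_of P"
    using F w(2) unfolding edge_of_def by (auto simp: segment_convex_hull aff_dim_convex_hull aff_dim_2)
  then show ?thesis using extF(1)[OF w(1)] w(2) t by blast
qed

text \<open>A hyperplane separating \<open>v\<close> from the other vertices cuts \<open>P\<close>
  in the hull of points on the edges at \<open>v\<close>, which is contained in the cone
  \<open>C\<close>. Every point of \<open>P\<close> lies on a ray from \<open>v\<close> through this
  section.\<close>

lemma polytope_vertex_cone:
  fixes P :: "'a::euclidean_space set"
  assumes P: "polytope P" and v: "v extreme_point_of P" and u: "u \<in> P"
  defines "E \<equiv> {w. w extreme_point_of P \<and> w \<noteq> v \<and> closed_segment v w edge_of P}"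
  shows "\<exists>c. (\<forall>w\<in>E. 0 \<le> c w) \<and> u - v = (\<Sum>w\<in>E. c w *\<^sub>R (w - v))"
proof -
  define V where "V = {x. x extreme_point_of P}"
  have finV: "finite V" unfolding V_def by (rule finite_extreme_points_polytope[OF P])
  have finE: "finite E" using finV by (rule finite_subset[rotated]) (auto simp: E_def V_def)
  have PV: "P = convex hull V" unfolding V_def by (rule polytope_eq_convex_hull_extreme[OF P])
  have vV: "v \<in> V" using v by (simp add: V_def)
  define Q where "Q = convex hull (V - {v})"
  have "v \<notin> Q"
  proof
    assume "v \<in> Q"
    then have "convex hull (insert v (V - {v})) = Q" unfolding Q_def by (rule hull_redundant)
    then have "P = Q" using PV vV by (simp add: insert_absorb)
    then show False using extreme_point_of_convex_hull[of v "V - {v}"] v by (auto simp: Q_def)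
  qed
  moreover have "convex Q" "closed Q" using finV
    by (auto simp: Q_def finite_imp_compact_convex_hull compact_imp_closed)
  ultimately obtain a b where ab: "a \<bullet> v < b" "\<And>x. x \<in> Q \<Longrightarrow> b < a \<bullet> x"
    using separating_hyperplane_closed_point by metis
  have VQ: "V - {v} \<subseteq> Q" unfolding Q_def by (rule hull_subset)
  define C where "C = {y. \<exists>c. (\<forall>w\<in>E. 0 \<le> c w) \<and> y - v = (\<Sum>w\<in>E. c w *\<^sub>R (w - v))}"
  have scaleC: "z \<in> C" if "y \<in> C" "0 \<le> r" "z - v = r *\<^sub>R (y - v)" for y z r
  proof -
    obtain c where "\<forall>w\<in>E. 0 \<le> c w" "y - v = (\<Sum>w\<in>E. c w *\<^sub>R (w - v))"
      using \<open>y \<in> C\<close> by (auto simp: C_def)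
    then show ?thesis using that unfolding C_def
      by (intro CollectI exI[of _ "\<lambda>w. r * c w"]) (auto simp: scaleR_sum_right)
  qed
  have "convex C"
    unfolding convex_alt
  proof (intro ballI allI impI)
    fix x y t assume xy: "x \<in> C" "y \<in> C" and t: "0 \<le> t \<and> t \<le> (1::real)"
    obtain c where c: "\<forall>w\<in>E. 0 \<le> c w" "x - v = (\<Sum>w\<in>E. c w *\<^sub>R (w - v))"
      using \<open>x \<in> C\<close> by (auto simp: C_def)
    obtain d where d: "\<forall>w\<in>E. 0 \<le> d w" "y - v = (\<Sum>w\<in>E. d w *\<^sub>R (w - v))"
      using \<open>y \<in> C\<close> by (auto simp: C_def)
    have "((1 - t) *\<^sub>R x + t *\<^sub>R y) - v = (1-t) *\<^sub>R (x - v) + t *\<^sub>R (y - v)"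
      by (simp add: algebra_simps)
    also have "\<dots> = (\<Sum>w\<in>E. ((1-t) * c w + t * d w) *\<^sub>R (w - v))"
      by (simp add: c d scaleR_sum_right scaleR_add_left sum.distrib)
    finally show "(1 - t) *\<^sub>R x + t *\<^sub>R y \<in> C"
      unfolding C_def using c(1) d(1) t by (intro CollectI exI conjI) auto
  qed
  define S where "S = P \<inter> {y. a \<bullet> y = b}"
  have S: "compact S" "convex S" unfolding S_def
    using P by (auto intro!: compact_Int_closed closed_hyperplane convex_Int convex_hyperplane
        simp: polytope_imp_compact polytope_imp_convex)
  have "{x. x extreme_point_of S} \<subseteq> C"
  proof
    fix x assume "x \<in> {x. x extreme_point_of S}"
    then have "x extreme_point_of (P \<inter> {y. a \<bullet> y = b})" by (simp add: S_def)
    moreover have "b < a \<bullet> w" if "w extreme_point_of P" "w \<noteq> v" for w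
      using that VQ ab(2) by (auto simp: V_def)
    ultimately obtain w t where "w extreme_point_of P" "closed_segment v w edge_of P" "w \<noteq> v"
      and w': "0 < t" "x - v = t *\<^sub>R (w - v)"
      using vertex_figure_extreme_point[OF P v ab(1)] by blast
    then have w: "w \<in> E" "0 < t" "x - v = t *\<^sub>R (w - v)" by (simp_all add: E_def)
    have "w \<in> C" unfolding C_def using w finE
      by (intro CollectI exI[of _ "\<lambda>z. if z = w then 1 else 0"])
        (auto simp: if_distrib[of "\<lambda>c. c *\<^sub>R _"] sum.delta cong: if_cong)
    then show "x \<in> C" using scaleC[of w t x] w by simp
  qed
  then have SC: "S \<subseteq> C" using Krein_Milman_Minkowski[OF S] hull_minimal[of _ C convex] \<open>convex C\<close> by metis
  have vC: "v \<in> C" unfolding C_def by (intro CollectI exI[of _ "\<lambda>_. 0"]) auto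
  have "u \<in> C"
  proof (cases "V - {v} = {}")
    case True
    then have "P = {v}" using PV vV by (metis Diff_eq_empty_iff convex_hull_singleton empty_iff subset_singletonD)
    then show ?thesis using u vC by simp
  next
    case False
    have "P = convex hull (insert v (V - {v}))" using PV vV by (simp add: insert_absorb)
    then obtain s r q where q: "0 \<le> s" "0 \<le> r" "s + r = 1" "q \<in> Q" "u = s *\<^sub>R v + r *\<^sub>R q"
      using u convex_hull_insert[OF False, of v] unfolding Q_def by auto
    have aq: "b < a \<bullet> q" using ab q by auto
    define t where "t = (b - a \<bullet> v) / (a \<bullet> q - a \<bullet> v)"
    have t: "0 < t" "t < 1" using ab aq by (auto simp: t_def field_simps)
    have tt: "t * (a \<bullet> q - a \<bullet> v) = b - a \<bullet> v" using ab aq by (simp add: t_def)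
    \<comment> \<open>The point where the segment from \<open>v\<close> to \<open>q\<close> crosses
      the hyperplane; \<open>u\<close> lies on the ray from \<open>v\<close> through it.\<close>
    define h where "h = (1-t) *\<^sub>R v + t *\<^sub>R q"
    have "a \<bullet> h = b" using tt by (simp add: h_def inner_add_right algebra_simps)
    moreover have "Q \<subseteq> P" unfolding Q_def PV by (rule hull_mono) auto
    then have "h \<in> P" unfolding h_def using t v q polytope_imp_convex[OF P]
      by (auto simp: convex_alt extreme_point_of_def)
    ultimately have "h \<in> C" using SC by (auto simp: S_def)
    moreover have "u - v = (r / t) *\<^sub>R (h - v)"
    proof -
      have s: "s = 1 - r" using q by simp
      have "u - v = r *\<^sub>R (q - v)" unfolding q(5) s by (simp add: algebra_simps)
      moreover have "h - v = t *\<^sub>R (q - v)" by (simp add: h_def algebra_simps)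
      ultimately show ?thesis using t by simp
    qed
    ultimately show ?thesis using scaleC[of h "r/t" u] q t by auto
  qed
  then show ?thesis by (simp add: C_def)
qed


section \<open>Lattice points, primitive edge vectors and the chart at a vertex\<close>

lemma real_vec_inj [simp]: "real_vec u = real_vec w \<longleftrightarrow> u = w"
  by (simp add: real_vec_def vec_eq_iff)

lemma real_vec_diff: "real_vec (u - w) = real_vec u - real_vec w"
  and real_vec_scale: "real_vec (c *s u) = real_of_int c *\<^sub>R real_vec u"
  by (simp_all add: real_vec_def vec_eq_iff)

lemma finite_lattice_points:
  fixes S :: "(real ^ 'n) set"
  assumes "bounded S"
  shows "finite (lattice_points S)"
proof -
  obtain M where M: "\<And>x. x \<in> S \<Longrightarrow> norm x \<le> M" using assms by (auto simp: bounded_iff)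
  define I where "I = {- \<lceil>M\<rceil>..\<lceil>M\<rceil>}"
  have "lattice_points S \<subseteq> vec_lambda ` (\<Pi>\<^sub>E i\<in>UNIV. I)"
  proof
    fix u :: "int ^ 'n" assume u: "u \<in> lattice_points S"
    have "\<bar>real_of_int (u $ i)\<bar> \<le> M" for i
      using M[of "real_vec u"] component_le_norm_cart[of "real_vec u" i] u
      by (auto simp: lattice_points_def real_vec_def)
    note bound = this
    have "u $ i \<in> I" for i
    proof -
      have "\<bar>u $ i\<bar> \<le> \<lceil>M\<rceil>" using bound[of i] by linarith
      then show ?thesis by (auto simp: I_def)
    qed
    then have "vec_nth u \<in> (\<Pi>\<^sub>E i\<in>UNIV. I)" by auto
    then show "u \<in> vec_lambda ` (\<Pi>\<^sub>E i\<in>UNIV. I)" by (metis imageI vec_nth_inverse)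
  qed
  moreover have "finite (vec_lambda ` (\<Pi>\<^sub>E i\<in>(UNIV::'n set). I))"
    by (intro finite_imageI finite_PiE) (auto simp: I_def)
  ultimately show ?thesis by (rule finite_subset)
qed

text \<open>Division with remainder along the edge: going back from \<open>w\<close> by the largest
  number of primitive steps that fits would otherwise end in a lattice point of the edge closer to
  \<open>v\<close> than the nearest one.\<close>

lemma nearest_neighbor_divides_edge:
  fixes v w :: "int ^ 'n"
  assumes "v \<noteq> w"
  shows "\<exists>b N. nearest_neighbor v (closed_segment (real_vec v) (real_vec w)) (v + b) \<and>
    N \<ge> (1::nat) \<and> int N *s b = w - v"
proof -
  let ?S = "closed_segment (real_vec v) (real_vec w)"
  let ?L = "lattice_points ?S - {v}"
  have "finite ?L" by (intro finite_Diff finite_lattice_points) (simp add: compact_imp_bounded)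
  moreover have "w \<in> ?L" using assms by (auto simp: lattice_points_def)
  ultimately obtain x where x: "is_arg_min (\<lambda>u. dist (real_vec v) (real_vec u)) (\<lambda>u. u \<in> ?L) x"
    using ex_is_arg_min_if_finite by blast
  then have xL: "x \<in> ?L" and xmin: "\<And>y. y \<in> ?L \<Longrightarrow> \<not> dist (real_vec v) (real_vec y) < dist (real_vec v) (real_vec x)"
    by (auto simp: is_arg_min_def)
  define d where "d = real_vec w - real_vec v"
  have dnz: "norm d > 0" using assms by (simp add: d_def)
  have seg: "z \<in> ?S \<longleftrightarrow> (\<exists>t. 0 \<le> t \<and> t \<le> 1 \<and> z = real_vec v + t *\<^sub>R d)" for z
    by (auto simp: in_segment d_def algebra_simps)
  obtain t where t: "0 \<le> t" "t \<le> 1" "real_vec x = real_vec v + t *\<^sub>R d"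
    using xL seg by (auto simp: lattice_points_def)
  have "t \<noteq> 0" using t xL by auto
  then have t0: "t > 0" using t by simp
  define N where "N = nat \<lfloor>1 / t\<rfloor>"
  have "1 / t \<ge> 1" using t t0 by simp
  then have N1: "N \<ge> 1" and N: "real N \<le> 1/t" "1/t < real N + 1" unfolding N_def by linarith+
  define b where "b = x - v"
  have rb: "real_vec b = t *\<^sub>R d" using t by (simp add: b_def real_vec_diff)
  define y where "y = w - int N *s b"
  have y: "real_vec y = real_vec v + (1 - real N * t) *\<^sub>R d"
    unfolding y_def real_vec_diff real_vec_scale rb by (simp add: d_def algebra_simps)
  have r: "0 \<le> 1 - real N * t" "1 - real N * t < t" using N t0 by (simp_all add: field_simps)
  have "y \<in> lattice_points ?S" using r t y unfolding lattice_points_def seg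
    by (auto intro!: exI[of _ "1 - real N * t"])
  moreover have "dist (real_vec v) (real_vec y) < dist (real_vec v) (real_vec x)"
    unfolding y t(3) dist_norm using r t0 dnz by simp
  ultimately have "y = v" using xmin by blast
  then have "int N *s b = w - v" by (simp add: y_def algebra_simps)
  moreover have "nearest_neighbor v ?S (v + b)" using x by (simp add: nearest_neighbor_def b_def)
  ultimately show ?thesis using N1 by blast
qed

text \<open>A coordinate with respect to a basis of the lattice extends to a real linear functional
  \<open>\<phi>\<close>, determined by its values on the standard vectors. It can therefore be
  applied to relations with real coefficients, such as those expressing a point in the cone of the
  edges.\<close>

lemma Z_basis_coordinate_real:
  fixes Bz :: "(int ^ 'n) set" and x :: "int ^ 'n"
  assumes B: "Z_basis Bz"
    and eq: "real_vec x = (\<Sum>w\<in>E. c w *\<^sub>R real_vec (g w))"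
  shows "real_of_int (int_vec.representation Bz x b) =
    (\<Sum>w\<in>E. c w * real_of_int (int_vec.representation Bz (g w) b))"
proof -
  let ?R = "\<lambda>x. int_vec.representation Bz x b"
  have ind: "int_vec.independent Bz" and sp: "int_vec.span Bz = UNIV" using B by (auto simp: Z_basis_def)
  define \<phi> where "\<phi> y = (\<Sum>i\<in>UNIV. y $ i * real_of_int (?R (axis i 1)))" for y :: "real ^ 'n"
  have \<phi>: "\<phi> (real_vec u) = real_of_int (?R u)" for u
  proof -
    have "u = (\<Sum>i\<in>UNIV. (u $ i) *s axis i 1)"
      by (simp add: vec_eq_iff axis_def if_distrib sum.delta cong: if_cong)
    then have "?R u = ?R (\<Sum>i\<in>UNIV. (u $ i) *s axis i 1)" by simp
    also have "\<dots> = (\<Sum>i\<in>UNIV. (u $ i) * ?R (axis i 1))"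
      by (simp add: int_vec.representation_sum[OF ind] int_vec.representation_scale[OF ind] sp)
    finally show ?thesis by (simp add: \<phi>_def real_vec_def)
  qed
  have "\<phi> (\<Sum>w\<in>E. c w *\<^sub>R real_vec (g w)) = (\<Sum>w\<in>E. c w * \<phi> (real_vec (g w)))"
    unfolding \<phi>_def
    by (simp add: sum_distrib_left sum_distrib_right mult.assoc sum.swap[of _ E])
  then show ?thesis using eq by (simp flip: \<phi>)
qed

text \<open>
  A lattice vector in the cone spanned by the edges has nonnegative coordinates in the \<open>\<int>\<close>-basis,
  and they vanish off the edge vectors.
\<close>

lemma smooth_polytope_vertex_chart:
  fixes P :: "(real ^ 'n) set"
  assumes P: "smooth_polytope P" and v: "real_vec v extreme_point_of P"
  shows "\<exists>B. finite B \<and>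
    (\<forall>b\<in>B. (\<exists>\<sigma>. \<sigma> edge_of P \<and> real_vec v \<in> \<sigma> \<and> nearest_neighbor v \<sigma> (v + b)) \<and>
       (\<exists>N\<ge>(1::nat). \<exists>w. real_vec w extreme_point_of P \<and> int N *s b = w - v)) \<and>
    (\<forall>u\<in>lattice_points P. \<exists>k :: int ^ 'n \<Rightarrow> nat. u - v = (\<Sum>b\<in>B. int (k b) *s b))"
proof -
  have pol: "polytope P" using P by (auto simp: smooth_polytope_def simple_polytope_def)
  obtain V where V: "finite V" "P = convex hull (real_vec ` V)"
    using P by (auto simp: smooth_polytope_def lattice_polytope_def)
  have lat: "\<exists>w'. w = real_vec w'" if "w extreme_point_of P" for w
    using extreme_point_of_convex_hull that V(2) by blast
  obtain Bz where Bz: "Z_basis Bz"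
    "{w - v |w \<sigma>. \<sigma> edge_of P \<and> real_vec v \<in> \<sigma> \<and> nearest_neighbor v \<sigma> w} \<subseteq> Bz"
    using P v unfolding smooth_polytope_def by blast
  have ind: "int_vec.independent Bz" and sp: "int_vec.span Bz = UNIV" using Bz by (auto simp: Z_basis_def)
  define E where "E = {w. w extreme_point_of P \<and> w \<noteq> real_vec v \<and> closed_segment (real_vec v) w edge_of P}"
  have finE: "finite E" using finite_extreme_points_polytope[OF pol]
    by (rule finite_subset[rotated]) (auto simp: E_def)
  have "\<exists>b N w'. w = real_vec w' \<and> nearest_neighbor v (closed_segment (real_vec v) w) (v + b) \<and>
      N \<ge> (1::nat) \<and> int N *s b = w' - v" if "w \<in> E" for w
    using that lat[of w] nearest_neighbor_divides_edge[of v] by (fastforce simp: E_def)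
  then obtain b N w' where bN: "\<And>w. w \<in> E \<Longrightarrow> w = real_vec (w' w)"
    "\<And>w. w \<in> E \<Longrightarrow> nearest_neighbor v (closed_segment (real_vec v) w) (v + b w)"
    "\<And>w. w \<in> E \<Longrightarrow> N w \<ge> (1::nat)" "\<And>w. w \<in> E \<Longrightarrow> int (N w) *s b w = w' w - v" by metis
  have bBz: "b w \<in> Bz" if "w \<in> E" for w
    using bN(2)[OF that] that Bz(2) by (force simp: E_def)
  show ?thesis
  proof (intro exI[of _ "b ` E"] conjI ballI)
    show "finite (b ` E)" using finE by simp
  next
    fix x assume "x \<in> b ` E"
    then obtain w where w: "w \<in> E" "x = b w" by blast
    show "\<exists>\<sigma>. \<sigma> edge_of P \<and> real_vec v \<in> \<sigma> \<and> nearest_neighbor v \<sigma> (v + x)"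
      using w bN(2)[OF w(1)] by (auto simp: E_def)
    show "\<exists>N\<ge>(1::nat). \<exists>w. real_vec w extreme_point_of P \<and> int N *s x = w - v"
      using w bN(1,3,4)[OF w(1)] by (auto simp: E_def)
  next
    fix u assume "u \<in> lattice_points P"
    then obtain c where c: "\<And>w. w \<in> E \<Longrightarrow> 0 \<le> c w"
      "real_vec u - real_vec v = (\<Sum>w\<in>E. c w *\<^sub>R (w - real_vec v))"
      using polytope_vertex_cone[OF pol v, of "real_vec u"] by (auto simp: lattice_points_def E_def)
    \<comment> \<open>The cone is spanned by the vectors to the far ends of the edges, and each of
      these is \<open>N w\<close> times the primitive vector \<open>b w\<close>.\<close>
    have "real_vec (u - v) = (\<Sum>w\<in>E. (c w * real (N w)) *\<^sub>R real_vec (b w))"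
      unfolding real_vec_diff c(2)
    proof (rule sum.cong)
      fix w assume w: "w \<in> E"
      have "w - real_vec v = real_vec (int (N w) *s b w)"
        using bN(1,4)[OF w] by (simp add: real_vec_diff)
      then show "c w *\<^sub>R (w - real_vec v) = (c w * real (N w)) *\<^sub>R real_vec (b w)"
        by (simp add: real_vec_scale)
    qed simp
    note rep = Z_basis_coordinate_real[OF Bz(1) this]
    let ?r = "int_vec.representation Bz (u - v)"
    have rb: "int_vec.representation Bz (b w) x = (if x = b w then 1 else 0)" if "w \<in> E" for w x
      using int_vec.representation_basis[OF ind bBz[OF that]] by simp
    have nn: "0 \<le> (\<Sum>w\<in>E. (c w * real (N w)) * real_of_int (int_vec.representation Bz (b w) x))" for x
      by (rule sum_nonneg) (simp add: rb c)
    have pos: "0 \<le> ?r x" for x using rep[of x] nn[of x] by linarith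
    have zero: "?r x = 0" if "x \<notin> b ` E" for x
    proof -
      have "(\<Sum>w\<in>E. (c w * real (N w)) * real_of_int (int_vec.representation Bz (b w) x)) = 0"
        by (rule sum.neutral) (use that rb in auto)
      then show ?thesis using rep[of x] by simp
    qed
    have "u - v = (\<Sum>x | ?r x \<noteq> 0. ?r x *s x)"
      by (rule int_vec.sum_nonzero_representation_eq[OF ind, symmetric]) (simp add: sp)
    also have "\<dots> = (\<Sum>x\<in>b ` E. ?r x *s x)"
      by (rule sum.mono_neutral_left) (use zero finE in auto)
    also have "\<dots> = (\<Sum>x\<in>b ` E. int (nat (?r x)) *s x)" using pos by simp
    finally show "\<exists>k. u - v = (\<Sum>x\<in>b ` E. int (k x) *s x)"
      by (rule exI[of _ "\<lambda>x. nat (?r x)"])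
  qed
qed

subsection \<open>Polynomials\<close>

definition polys :: "'i set \<Rightarrow> 'i cpoly set"
  where "polys I = {f. \<forall>m\<in>Poly_Mapping.keys f. Poly_Mapping.keys m \<subseteq> I}"

lemma forms_subset_polys: "forms I d \<subseteq> polys I"
  by (auto simp: forms_def polys_def)

lemma polys_0 [simp]: "0 \<in> polys I"
  and polys_1 [simp]: "1 \<in> polys I"
  by (auto simp: polys_def)

lemma polys_add: "f \<in> polys I \<Longrightarrow> g \<in> polys I \<Longrightarrow> f + g \<in> polys I"
  using Poly_Mapping.keys_add[of f g] by (fastforce simp: polys_def)

lemma polys_diff: "f \<in> polys I \<Longrightarrow> g \<in> polys I \<Longrightarrow> f - g \<in> polys I"
  using Poly_Mapping.keys_diff[of f g] by (fastforce simp: polys_def)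

lemma polys_mult:
  assumes "f \<in> polys I" "g \<in> polys I"
  shows "f * g \<in> polys I"
  unfolding polys_def
proof (intro CollectI ballI)
  fix k assume "k \<in> Poly_Mapping.keys (f * g)"
  then obtain m n where "k = m + n" "m \<in> Poly_Mapping.keys f" "n \<in> Poly_Mapping.keys g"
    using keys_mult[of f g] by auto
  then show "Poly_Mapping.keys k \<subseteq> I"
    using assms Poly_Mapping.keys_add[of m n] by (fastforce simp: polys_def)
qed

lemma polys_single: "Poly_Mapping.keys m \<subseteq> I \<Longrightarrow> Poly_Mapping.single m c \<in> polys I"
  by (auto simp: polys_def)

lemma polys_mono: "I \<subseteq> J \<Longrightarrow> polys I \<subseteq> polys J"
  by (auto simp: polys_def)

lemma forms_mono: "I \<subseteq> J \<Longrightarrow> forms I d \<subseteq> forms J d"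
  by (auto simp: forms_def)

lemma monom_eval_cong:
  "(\<And>i. i \<in> Poly_Mapping.keys m \<Longrightarrow> x i = y i) \<Longrightarrow> monom_eval m x = monom_eval m y"
  by (simp add: monom_eval_def)

lemma cpoly_eval_cong:
  "f \<in> polys I \<Longrightarrow> (\<And>i. i \<in> I \<Longrightarrow> x i = y i) \<Longrightarrow> cpoly_eval f x = cpoly_eval f y"
  unfolding cpoly_eval_def polys_def
  by (intro sum.cong refl) (auto intro!: monom_eval_cong)

lemma cpoly_eval_uminus: "cpoly_eval (- f) x = - cpoly_eval f x"
  using cpoly_eval_add[of f "-f" x] by (simp add: add_eq_0_iff)

lemma cpoly_eval_diff: "cpoly_eval (f - g) x = cpoly_eval f x - cpoly_eval g x"
  using cpoly_eval_add[of f "-g" x] by (simp add: cpoly_eval_uminus)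

lemma cpoly_eval_scale: "cpoly_eval (cpoly_scale c f) x = c * cpoly_eval f x"
  by (simp add: cpoly_scale_def cpoly_eval_mult cpoly_eval_single monom_eval_def)

lemma cpoly_eval_power: "cpoly_eval (f ^ n) x = cpoly_eval f x ^ n"
  by (induction n) (simp_all add: cpoly_eval_mult)

lemma cpoly_eval_prod: "cpoly_eval (prod f S) x = (\<Prod>s\<in>S. cpoly_eval (f s) x)"
  by (induction S rule: infinite_finite_induct) (simp_all add: cpoly_eval_mult)

lemma monom_eval_scale: "monom_eval m (\<lambda>i. c * x i) = c ^ monom_degree m * monom_eval m x"
  by (simp add: monom_eval_def monom_degree_def power_mult_distrib prod.distrib power_sum)

definition cvar :: "'i \<Rightarrow> 'i cpoly"
  where "cvar i = Poly_Mapping.single (Poly_Mapping.single i 1) 1"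

lemma cpoly_eval_cvar [simp]: "cpoly_eval (cvar i) x = x i"
  by (simp add: cvar_def cpoly_eval_single monom_eval_def)

lemma monom_degree_single [simp]: "monom_degree (Poly_Mapping.single i k) = k"
  by (simp add: monom_degree_def)

lemma monom_degree_0 [simp]: "monom_degree 0 = 0"
  by (simp add: monom_degree_def)

lemma monom_eval_0 [simp]: "monom_eval 0 x = 1"
  by (simp add: monom_eval_def)

lemma cvar_forms: "i \<in> I \<Longrightarrow> cvar i \<in> forms I 1"
  by (simp add: cvar_def forms_def)

lemma cvar_nonzero [simp]: "cvar i \<noteq> 0"
  using cpoly_eval_cvar[of i "\<lambda>_. 1"] by force

subsection \<open>Homogeneous components\<close>

definition hom_comp :: "nat \<Rightarrow> 'i cpoly \<Rightarrow> 'i cpoly"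
  where "hom_comp k f = (\<Sum>m\<in>{m\<in>Poly_Mapping.keys f. monom_degree m = k}.
    Poly_Mapping.single m (Poly_Mapping.lookup f m))"

lemma lookup_hom_comp:
  "Poly_Mapping.lookup (hom_comp k f) m = (if monom_degree m = k then Poly_Mapping.lookup f m else 0)"
proof -
  have "Poly_Mapping.lookup (hom_comp k f) m =
    (\<Sum>m'\<in>{m\<in>Poly_Mapping.keys f. monom_degree m = k}. if m' = m then Poly_Mapping.lookup f m' else 0)"
    by (simp add: hom_comp_def lookup_sum lookup_single when_def)
  also have "\<dots> = (if m \<in> {m\<in>Poly_Mapping.keys f. monom_degree m = k} then Poly_Mapping.lookup f m else 0)"
    by (rule sum.delta) simp
  finally show ?thesis by (auto simp: in_keys_iff)
qed

lemma hom_comp_forms: "f \<in> polys I \<Longrightarrow> hom_comp k f \<in> forms I k"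
  by (auto simp: forms_def polys_def in_keys_iff lookup_hom_comp split: if_splits)

lemma cpoly_eval_hom_comp:
  "cpoly_eval (hom_comp k f) x =
    (\<Sum>m\<in>{m\<in>Poly_Mapping.keys f. monom_degree m = k}. Poly_Mapping.lookup f m * monom_eval m x)"
  by (simp add: hom_comp_def cpoly_eval_sum cpoly_eval_single)

lemma cpoly_eval_scaled:
  assumes "\<And>m. m \<in> Poly_Mapping.keys f \<Longrightarrow> monom_degree m \<le> K"
  shows "cpoly_eval f (\<lambda>i. c * x i) = (\<Sum>k\<le>K. c ^ k * cpoly_eval (hom_comp k f) x)"
proof -
  have "(\<Sum>k\<le>K. c ^ k * cpoly_eval (hom_comp k f) x) =
    (\<Sum>k\<le>K. \<Sum>m\<in>{m\<in>Poly_Mapping.keys f. monom_degree m = k}.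
       Poly_Mapping.lookup f m * monom_eval m (\<lambda>i. c * x i))"
    unfolding cpoly_eval_hom_comp sum_distrib_left
    by (intro sum.cong refl) (auto simp: monom_eval_scale)
  also have "\<dots> = cpoly_eval f (\<lambda>i. c * x i)"
    unfolding cpoly_eval_def by (rule sum.group) (use assms in auto)
  finally show ?thesis by simp
qed

lemma cpoly_degree_bound:
  fixes f :: "'i cpoly"
  obtains K where "\<And>m. m \<in> Poly_Mapping.keys f \<Longrightarrow> monom_degree m \<le> K"
proof (rule that)
  show "m \<in> Poly_Mapping.keys f \<Longrightarrow> monom_degree m \<le> Max (monom_degree ` Poly_Mapping.keys f)" for m
    by (rule Max_ge) auto
qed

lemma poly_eq_0_if_zero_off_0:
  fixes p :: "complex poly"
  assumes "\<And>c. c \<noteq> 0 \<Longrightarrow> poly p c = 0"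
  shows "p = 0"
proof (rule ccontr)
  assume "p \<noteq> 0"
  then have "finite {c. poly p c = 0}" by (rule poly_roots_finite)
  moreover have "UNIV - {0} \<subseteq> {c. poly p c = 0}" using assms by auto
  moreover have "infinite (UNIV - {0::complex})" by (simp add: infinite_UNIV_char_0)
  ultimately show False using finite_subset by blast
qed

text \<open>As a function of the factor \<open>c\<close>, the value of \<open>f\<close> is a
  univariate polynomial whose coefficients are the values of the components at \<open>x\<close>, and
  it has infinitely many roots. In this way vanishing on a cone passes from polynomials to
  forms.\<close>

lemma hom_comp_vanish:
  assumes "\<And>c. c \<noteq> 0 \<Longrightarrow> cpoly_eval f (\<lambda>i. c * x i) = 0"
  shows "cpoly_eval (hom_comp k f) x = 0"
proof -
  obtain K where K: "\<And>m. m \<in> Poly_Mapping.keys f \<Longrightarrow> monom_degree m \<le> K"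
    using cpoly_degree_bound[of f] by blast
  define p where "p = (\<Sum>k\<le>K. monom (cpoly_eval (hom_comp k f) x) k)"
  have "poly p c = cpoly_eval f (\<lambda>i. c * x i)" for c
    by (simp add: p_def poly_sum poly_monom mult.commute cpoly_eval_scaled[of f K c x] K)
  then have "p = 0" using assms by (intro poly_eq_0_if_zero_off_0) simp
  have c: "coeff p k = (if k \<le> K then cpoly_eval (hom_comp k f) x else 0)"
    by (simp add: p_def coeff_sum)
  show ?thesis
  proof (cases "k \<le> K")
    case True then show ?thesis using c \<open>p = 0\<close> by simp
  next
    case False
    then have "{m\<in>Poly_Mapping.keys f. monom_degree m = k} = {}" using K by auto
    then show ?thesis by (simp only: cpoly_eval_hom_comp sum.empty)
  qed
qed

subsection \<open>Polynomial functions\<close>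

text \<open>Lets closure under substitution be derived by introduction rules for functions instead
  of constructing the substituted polynomial.\<close>

definition polyfun :: "'i set \<Rightarrow> (('i \<Rightarrow> complex) \<Rightarrow> complex) \<Rightarrow> bool"
  where "polyfun I F \<longleftrightarrow> (\<exists>f\<in>polys I. \<forall>x. F x = cpoly_eval f x)"

lemma polyfun_cpoly_eval: "f \<in> polys I \<Longrightarrow> polyfun I (cpoly_eval f)"
  by (auto simp: polyfun_def)

lemma polyfun_const [intro]: "polyfun I (\<lambda>x. c)"
  unfolding polyfun_def
  by (rule bexI[of _ "Poly_Mapping.single 0 c"]) (auto simp: cpoly_eval_single polys_def)

lemma polyfun_var [intro]: "i \<in> I \<Longrightarrow> polyfun I (\<lambda>x. x i)"
  unfolding polyfun_def
  by (metis cpoly_eval_cvar cvar_forms forms_subset_polys subsetD)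

lemma polyfun_add [intro]: "polyfun I F \<Longrightarrow> polyfun I G \<Longrightarrow> polyfun I (\<lambda>x. F x + G x)"
  unfolding polyfun_def by (metis polys_add cpoly_eval_add)

lemma polyfun_mult [intro]: "polyfun I F \<Longrightarrow> polyfun I G \<Longrightarrow> polyfun I (\<lambda>x. F x * G x)"
  unfolding polyfun_def by (metis polys_mult cpoly_eval_mult)

lemma polyfun_power [intro]: "polyfun I F \<Longrightarrow> polyfun I (\<lambda>x. F x ^ n)"
  by (induction n) auto

lemma polyfun_sum [intro]: "(\<And>s. s \<in> S \<Longrightarrow> polyfun I (F s)) \<Longrightarrow> polyfun I (\<lambda>x. \<Sum>s\<in>S. F s x)"
  by (induction S rule: infinite_finite_induct) auto

lemma polyfun_prod [intro]: "(\<And>s. s \<in> S \<Longrightarrow> polyfun I (F s)) \<Longrightarrow> polyfun I (\<lambda>x. \<Prod>s\<in>S. F s x)"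
  by (induction S rule: infinite_finite_induct) auto

lemma polyfun_compose:
  assumes "f \<in> polys I" "\<And>i. i \<in> I \<Longrightarrow> polyfun J (\<phi> i)"
  shows "polyfun J (\<lambda>x. cpoly_eval f (\<lambda>i. \<phi> i x))"
  unfolding cpoly_eval_def monom_eval_def
  by (intro polyfun_sum polyfun_mult polyfun_prod polyfun_power polyfun_const)
    (use assms in \<open>auto simp: polys_def\<close>)

text \<open>Distinct monomials are distinct characters of the torus, so they are independent (Artin).\<close>

lemma monomials_independent_on_torus:
  assumes "finite S"
    and "\<And>x. (\<And>i. x i \<noteq> 0) \<Longrightarrow> (\<Sum>m\<in>S. a m * monom_eval m x) = 0" and "m \<in> S"
  shows "a m = 0"
  using assms
proof (induction S arbitrary: a m rule: finite_induct)
  case (insert m0 S)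
  have S0: "a m1 = 0" if m1: "m1 \<in> S" for m1
  proof -
    have "m1 \<noteq> m0" using insert.hyps m1 by auto
    then obtain i where i: "Poly_Mapping.lookup m1 i \<noteq> Poly_Mapping.lookup m0 i"
      by (metis poly_mapping_eqI)
    \<comment> \<open>The point \<open>x0\<close> takes different values \<open>ch\<close> at
      \<open>m1\<close> and \<open>m0\<close>. Translating the relation by \<open>x0\<close> and
      subtracting \<open>ch m0\<close> times the original one cancels the term of
      \<open>m0\<close>.\<close>
    define x0 :: "'a \<Rightarrow> complex" where "x0 j = (if j = i then 2 else 1)" for j
    define ch where "ch m = monom_eval m x0" for m
    have ch: "ch m = 2 ^ Poly_Mapping.lookup m i" for m
      unfolding ch_def
      by (subst monom_eval_superset[of "insert i (Poly_Mapping.keys m)"])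
        (auto simp: x0_def prod.insert_remove)
    have mult: "monom_eval m (\<lambda>j. x0 j * x j) = ch m * monom_eval m x" for m x
      by (simp add: ch_def monom_eval_def power_mult_distrib prod.distrib)
    have "(\<Sum>m\<in>S. (a m * (ch m - ch m0)) * monom_eval m x) = 0" if x: "\<And>i. x i \<noteq> 0" for x
    proof -
      have "(\<Sum>m\<in>insert m0 S. a m * monom_eval m (\<lambda>j. x0 j * x j)) = 0"
        by (rule insert.prems) (use x in \<open>auto simp: x0_def\<close>)
      moreover have "ch m0 * (\<Sum>m\<in>insert m0 S. a m * monom_eval m x) = 0"
        using insert.prems(1)[OF x] by simp
      ultimately have "(\<Sum>m\<in>insert m0 S. a m * (ch m * monom_eval m x)) -
          (\<Sum>m\<in>insert m0 S. ch m0 * (a m * monom_eval m x)) = 0"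
        by (simp only: mult sum_distrib_left diff_self)
      then have "(\<Sum>m\<in>insert m0 S. (a m * (ch m - ch m0)) * monom_eval m x) = 0"
        unfolding sum_subtractf[symmetric] by (simp add: algebra_simps)
      then show ?thesis using insert.hyps by simp
    qed
    then have "a m1 * (ch m1 - ch m0) = 0" using insert.IH[of "\<lambda>m. a m * (ch m - ch m0)"] m1 by blast
    moreover have "ch m1 \<noteq> ch m0"
    proof
      assume "ch m1 = ch m0"
      then have "(of_nat (2 ^ Poly_Mapping.lookup m1 i) :: complex) = of_nat (2 ^ Poly_Mapping.lookup m0 i)"
        by (simp add: ch)
      then show False using i by (simp only: of_nat_eq_iff) simp
    qed
    ultimately show ?thesis by simp
  qed
  moreover have "a m0 = 0"
    using insert.prems(1)[of "\<lambda>_. 1"] insert.hyps S0 by (simp add: monom_eval_def)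
  ultimately show ?case using insert.prems by auto
qed simp

text \<open>Vanishing is assumed only off the coordinate hyperplanes, because only there do the
  generic coordinates specialize to secant points of torus elements.\<close>

lemma cpoly_eq_0I:
  assumes "\<And>x. (\<And>i. x i \<noteq> 0) \<Longrightarrow> cpoly_eval f x = 0"
  shows "f = 0"
proof (rule ccontr)
  assume "f \<noteq> 0"
  then obtain m where "m \<in> Poly_Mapping.keys f" by (metis keys_eq_empty all_not_in_conv)
  moreover have "Poly_Mapping.lookup f m = 0"
    by (rule monomials_independent_on_torus[of "Poly_Mapping.keys f" "Poly_Mapping.lookup f"])
      (use assms \<open>m \<in> _\<close> in \<open>auto simp: cpoly_eval_def\<close>)
  ultimately show False by (simp add: in_keys_iff)
qed

subsection \<open>Valuation rings\<close>

definition subring :: "'k::comm_ring_1 set \<Rightarrow> bool"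
  where "subring S \<longleftrightarrow> 1 \<in> S \<and> (\<forall>x\<in>S. \<forall>y\<in>S. x - y \<in> S \<and> x * y \<in> S)"

lemma subring_1: "subring S \<Longrightarrow> 1 \<in> S"
  and subring_diff: "subring S \<Longrightarrow> x \<in> S \<Longrightarrow> y \<in> S \<Longrightarrow> x - y \<in> S"
  and subring_mult: "subring S \<Longrightarrow> x \<in> S \<Longrightarrow> y \<in> S \<Longrightarrow> x * y \<in> S"
  by (auto simp: subring_def)

lemma subring_0: "subring S \<Longrightarrow> 0 \<in> S"
  using subring_1[of S] subring_diff[of S 1 1] by simp

lemma subring_uminus: "subring S \<Longrightarrow> x \<in> S \<Longrightarrow> - x \<in> S"
  using subring_diff[of S 0 x] subring_0[of S] by simp

lemma subring_add: "subring S \<Longrightarrow> x \<in> S \<Longrightarrow> y \<in> S \<Longrightarrow> x + y \<in> S"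
  using subring_diff[of S x "- y"] subring_uminus[of S y] by simp

lemma subring_sum: "subring S \<Longrightarrow> (\<And>i. i \<in> I \<Longrightarrow> f i \<in> S) \<Longrightarrow> sum f I \<in> S"
  by (induction I rule: infinite_finite_induct) (auto intro: subring_0 subring_add)

lemma subring_power: "subring S \<Longrightarrow> x \<in> S \<Longrightarrow> x ^ n \<in> S"
  by (induction n) (auto intro: subring_1 subring_mult)

definition adjoin :: "'k::comm_ring_1 set \<Rightarrow> 'k \<Rightarrow> 'k set"
  where "adjoin S y = {poly p y |p. \<forall>i. coeff p i \<in> S}"

lemma subring_adjoin:
  assumes S: "subring S"
  shows "subring (adjoin S y)"
  unfolding subring_def
proof (intro conjI ballI)
  show "1 \<in> adjoin S y" unfolding adjoin_def
    by (intro CollectI exI[of _ 1]) (auto intro: subring_1[OF S] subring_0[OF S])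
  fix a b assume "a \<in> adjoin S y" "b \<in> adjoin S y"
  then obtain p q where p: "a = poly p y" "\<forall>i. coeff p i \<in> S" and q: "b = poly q y" "\<forall>i. coeff q i \<in> S"
    by (auto simp: adjoin_def)
  show "a - b \<in> adjoin S y" unfolding adjoin_def
    by (intro CollectI exI[of _ "p - q"]) (use p q in \<open>auto intro: subring_diff[OF S]\<close>)
  show "a * b \<in> adjoin S y" unfolding adjoin_def
    by (intro CollectI exI[of _ "p * q"])
      (use p q in \<open>auto simp: coeff_mult intro!: subring_mult[OF S] subring_sum[OF S]\<close>)
qed

lemma subset_adjoin:
  assumes S: "subring S"
  shows "S \<subseteq> adjoin S y"
proof
  fix x assume "x \<in> S"
  then show "x \<in> adjoin S y" unfolding adjoin_def
    by (intro CollectI exI[of _ "[:x:]"]) (auto simp: coeff_pCons split: nat.split intro: subring_0[OF S])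
qed

lemma in_adjoin:
  assumes S: "subring S"
  shows "y \<in> adjoin S y"
  unfolding adjoin_def
  by (intro CollectI exI[of _ "[:0, 1:]"])
    (auto simp: coeff_pCons split: nat.split intro: subring_0[OF S] subring_1[OF S])

definition integral_over :: "'k::comm_ring_1 set \<Rightarrow> 'k \<Rightarrow> bool"
  where "integral_over R x \<longleftrightarrow> (\<exists>N\<ge>1. \<exists>r. (\<forall>i<N. r i \<in> R) \<and> x ^ N = (\<Sum>i<N. r i * x ^ i))"

definition valuation_ring :: "'k::field set \<Rightarrow> bool"
  where "valuation_ring V \<longleftrightarrow> subring V \<and> (\<forall>y. y \<in> V \<or> inverse y \<in> V)"

text \<open>
  Chevalley: a subring that is maximal among those containing \<open>1/x\<close> but not \<open>x\<close> is a valuation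
  ring.
\<close>

lemma maximal_subring_unit:
  fixes x :: "'k::field"
  assumes V: "subring V" and xV: "x \<notin> V" and wV: "inverse x \<in> V" and x0: "x \<noteq> 0"
    and max: "\<And>B. subring B \<Longrightarrow> V \<subseteq> B \<Longrightarrow> x \<notin> B \<Longrightarrow> B = V"
    and c: "c \<in> V"
  shows "inverse (1 - c * inverse x) \<in> V"
proof (rule ccontr)
  define b where "b = 1 - c * inverse x"
  assume "inverse (1 - c * inverse x) \<notin> V"
  then have nb: "inverse b \<notin> V" by (simp add: b_def)
  have b0: "b \<noteq> 0" using nb subring_0[OF V] by auto
  have "x \<in> adjoin V (inverse b)"
    using max[OF subring_adjoin[OF V] subset_adjoin[OF V]] in_adjoin[OF V, of "inverse b"] nb by metis
  then obtain p where p: "x = poly p (inverse b)" "\<And>i. coeff p i \<in> V" by (auto simp: adjoin_def)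
  define N where "N = degree p"
  have bV: "b \<in> V" using c wV by (auto simp: b_def intro: subring_diff[OF V] subring_1[OF V] subring_mult[OF V])
  have "x * b ^ N = (\<Sum>i\<le>N. coeff p i * b ^ (N - i))"
    unfolding p(1) poly_altdef N_def sum_distrib_right
    by (intro sum.cong refl) (use b0 in \<open>simp add: power_inverse power_diff field_simps\<close>)
  also have "\<dots> \<in> V" by (intro subring_sum[OF V] subring_mult[OF V] subring_power[OF V] p(2) bV)
  finally have 1: "x * b ^ N \<in> V" .
  \<comment> \<open>Since \<open>x * b = x - c\<close>, multiplication by \<open>b\<close> does not
    change \<open>x\<close> modulo \<open>V\<close>. With the preceding fact this puts
    \<open>x\<close> itself into \<open>V\<close>.\<close>
  have 2: "x * b ^ n - x \<in> V" for n
  proof (induction n)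
    case (Suc n)
    have "x * b ^ Suc n - x = (x * b ^ n - x) * b - c"
      using x0 by (simp add: b_def algebra_simps)
    then show ?case using Suc c bV by (auto intro: subring_diff[OF V] subring_mult[OF V])
  qed (simp add: subring_0[OF V])
  have "x \<in> V" using subring_diff[OF V 1 2[of N]] by simp
  with xV show False by simp
qed

text \<open>In \<open>x = poly q (inverse y)\<close> the constant coefficient is moved to the left
  and the resulting multiple of a unit is divided out. This writes 1 as a combination of positive
  powers of \<open>inverse y\<close>. Multiplying the leading term of \<open>p\<close> by it lowers
  the degree, and \<open>degree q \<le> degree p\<close> keeps the exponents natural.\<close>

lemma maximal_subring_degree_drop:
  fixes x :: "'k::field"
  assumes V: "subring V" and xV: "x \<notin> V" and wV: "inverse x \<in> V" and x0: "x \<noteq> 0"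
    and unit: "\<And>c. c \<in> V \<Longrightarrow> inverse (1 - c * inverse x) \<in> V"
    and p: "x = poly p y" "\<And>i. coeff p i \<in> V" and q: "x = poly q (inverse y)" "\<And>i. coeff q i \<in> V"
    and deg: "degree q \<le> degree p" and y0: "y \<noteq> 0"
  shows "\<exists>p'. x = poly p' y \<and> (\<forall>i. coeff p' i \<in> V) \<and> degree p' < degree p"
proof -
  define m n where "m = degree p" and "n = degree q"
  have n1: "n \<ge> 1"
  proof (rule ccontr)
    assume "\<not> n \<ge> 1"
    then obtain a where "q = [:a:]" unfolding n_def by (metis degree_eq_zeroE le_zero_eq not_less_eq_eq One_nat_def)
    then have "x = coeff q 0" using q(1) by simp
    then show False using xV q(2) by metis
  qed
  define u where "u = inverse (1 - coeff q 0 * inverse x)"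
  have uV: "u \<in> V" unfolding u_def using unit q(2) by blast
  have ne: "1 - coeff q 0 * inverse x \<noteq> 0"
  proof
    assume "1 - coeff q 0 * inverse x = 0"
    then have "coeff q 0 = x" using x0 by (simp add: field_simps)
    then show False using xV q(2) by metis
  qed
  define d where "d j = u * inverse x * coeff q j" for j
  have dV: "d j \<in> V" for j unfolding d_def using uV wV q(2) by (intro subring_mult[OF V])
  have "1 = inverse x * (\<Sum>j\<le>n. coeff q j * inverse y ^ j)"
    using q(1) x0 by (simp add: poly_altdef n_def)
  also have "(\<Sum>j\<le>n. coeff q j * inverse y ^ j) = coeff q 0 + (\<Sum>j=1..n. coeff q j * inverse y ^ j)"
    using n1 by (simp add: atMost_atLeast0 sum.atLeast_Suc_atMost)
  finally have "1 - coeff q 0 * inverse x = inverse x * (\<Sum>j=1..n. coeff q j * inverse y ^ j)"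
    by (simp add: algebra_simps)
  then have "u * (1 - coeff q 0 * inverse x) = (\<Sum>j=1..n. d j * inverse y ^ j)"
    by (simp add: d_def sum_distrib_left mult.assoc)
  then have one: "1 = (\<Sum>j=1..n. d j * inverse y ^ j)" using ne by (simp add: u_def)
  define p' where "p' = (\<Sum>i<m. monom (coeff p i) i) + (\<Sum>j=1..n. monom (coeff p m * d j) (m - j))"
  have "poly p' y = (\<Sum>i<m. coeff p i * y ^ i) + (\<Sum>j=1..n. coeff p m * d j * y ^ (m - j))"
    by (simp add: p'_def poly_sum poly_monom)
  also have "(\<Sum>j=1..n. coeff p m * d j * y ^ (m - j)) = coeff p m * y ^ m * (\<Sum>j=1..n. d j * inverse y ^ j)"
    unfolding sum_distrib_left
    by (intro sum.cong refl) (use deg y0 in \<open>simp add: m_def n_def power_diff power_inverse field_simps\<close>)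
  also have "\<dots> = coeff p m * y ^ m" using one by simp
  also have "(\<Sum>i<m. coeff p i * y ^ i) + coeff p m * y ^ m = x"
    unfolding p(1) poly_altdef m_def by (simp flip: lessThan_Suc_atMost)
  finally have "x = poly p' y" by simp
  moreover have "\<forall>i. coeff p' i \<in> V"
    unfolding p'_def
    by (auto simp: coeff_sum intro!: subring_add[OF V] subring_sum[OF V] subring_mult[OF V] subring_0[OF V] p(2) dV)
  moreover have "degree p' < m"
  proof -
    have "m > 0" using n1 deg by (simp add: m_def n_def)
    have "degree p' \<le> m - 1" unfolding p'_def
      by (intro degree_add_le degree_sum_le)
        (use \<open>m > 0\<close> in \<open>auto intro!: order_trans[OF degree_monom_le]\<close>)
    then show ?thesis using \<open>m > 0\<close> by simp
  qed
  ultimately show ?thesis unfolding m_def by blast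
qed

text \<open>If neither \<open>y\<close> nor \<open>inverse y\<close> were in \<open>V\<close>,
  adjoining either one would produce \<open>x\<close> by maximality. Of two expressions of
  \<open>x\<close> with minimal degrees, the one of larger degree could then be shortened.\<close>

lemma maximal_subring_valuation_ring:
  fixes x :: "'k::field"
  assumes V: "subring V" and xV: "x \<notin> V" and wV: "inverse x \<in> V" and x0: "x \<noteq> 0"
    and max: "\<And>B. subring B \<Longrightarrow> V \<subseteq> B \<Longrightarrow> x \<notin> B \<Longrightarrow> B = V"
  shows "valuation_ring V"
proof -
  have "y \<in> V \<or> inverse y \<in> V" for y
  proof (rule ccontr)
    assume "\<not> ?thesis"
    then have y: "y \<notin> V" "inverse y \<notin> V" by auto
    then have y0: "y \<noteq> 0" using subring_0[OF V] by auto
    define G where "G y = {p. x = poly p y \<and> (\<forall>i. coeff p i \<in> V)}" for y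
    have ne: "\<exists>p. p \<in> G y" if "y \<notin> V" for y
    proof -
      have "x \<in> adjoin V y"
        using max[OF subring_adjoin[OF V] subset_adjoin[OF V]] in_adjoin[OF V, of y] that by metis
      then show ?thesis by (auto simp: adjoin_def G_def)
    qed
    have "\<exists>p. p \<in> G y \<and> (\<forall>p'. p' \<in> G y \<longrightarrow> degree p \<le> degree p')" if "y \<notin> V" for y
      using ne[OF that] ex_has_least_nat[of "\<lambda>p. p \<in> G y" _ degree] by blast
    then obtain p q where p: "p \<in> G y" "\<And>p'. p' \<in> G y \<Longrightarrow> degree p \<le> degree p'"
      and q: "q \<in> G (inverse y)" "\<And>q'. q' \<in> G (inverse y) \<Longrightarrow> degree q \<le> degree q'"
      using y by metis
    note unit = maximal_subring_unit[OF V xV wV x0 max]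
    show False
    proof (cases "degree q \<le> degree p")
      case True
      then have "\<exists>p'. x = poly p' y \<and> (\<forall>i. coeff p' i \<in> V) \<and> degree p' < degree p"
        using p(1) q(1) y0 by (intro maximal_subring_degree_drop[OF V xV wV x0 unit, where q = q]) (auto simp: G_def)
      then show False using p(2) by (fastforce simp: G_def)
    next
      case False
      then have "\<exists>p'. x = poly p' (inverse y) \<and> (\<forall>i. coeff p' i \<in> V) \<and> degree p' < degree q"
        using p(1) q(1) y0 by (intro maximal_subring_degree_drop[OF V xV wV x0 unit, where q = p]) (auto simp: G_def)
      then show False using q(2) by (fastforce simp: G_def)
    qed
  qed
  then show ?thesis using V by (simp add: valuation_ring_def)
qed

text \<open>An expression of \<open>x\<close> as a polynomial in \<open>inverse x\<close> over
  \<open>R\<close>, multiplied by a power of \<open>x\<close>, is an integral equation. So if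
  \<open>x\<close> is not integral, some subring contains \<open>R\<close> and
  \<open>inverse x\<close> but not \<open>x\<close>; a maximal one exists by Zorn's lemma and is a
  valuation ring without \<open>x\<close>.\<close>

lemma integral_if_in_valuation_rings:
  fixes x :: "'k::field"
  assumes R: "subring R" and val: "\<And>V. valuation_ring V \<Longrightarrow> R \<subseteq> V \<Longrightarrow> x \<in> V"
  shows "integral_over R x"
proof (rule ccontr)
  assume nint: "\<not> integral_over R x"
  have x0: "x \<noteq> 0"
  proof
    assume "x = 0"
    then have "integral_over R x" unfolding integral_over_def
      by (intro exI[of _ 1] conjI exI[of _ "\<lambda>_. 0"]) (auto intro: subring_0[OF R])
    with nint show False by simp
  qed
  have xR: "x \<notin> adjoin R (inverse x)"
  proof
    assume "x \<in> adjoin R (inverse x)"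
    then obtain p where p: "x = poly p (inverse x)" "\<And>i. coeff p i \<in> R" by (auto simp: adjoin_def)
    define n where "n = degree p"
    have "x ^ Suc n = poly p (inverse x) * x ^ n" using p(1) by simp
    also have "\<dots> = (\<Sum>i\<le>n. coeff p i * x ^ (n - i))"
      unfolding poly_altdef sum_distrib_right n_def
      by (intro sum.cong refl) (use x0 in \<open>simp add: power_diff power_inverse field_simps\<close>)
    also have "\<dots> = (\<Sum>i\<le>n. coeff p (n - i) * x ^ i)"
      by (rule sum.reindex_bij_witness[of _ "\<lambda>i. n - i" "\<lambda>i. n - i"]) auto
    finally have "integral_over R x" unfolding integral_over_def
      by (intro exI[of _ "Suc n"] conjI exI[of _ "\<lambda>i. coeff p (n - i)"])
        (auto simp: p(2) lessThan_Suc_atMost)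
    with nint show False by simp
  qed
  define F where "F = {B. subring B \<and> R \<subseteq> B \<and> inverse x \<in> B \<and> x \<notin> B}"
  have "adjoin R (inverse x) \<in> F"
    unfolding F_def using xR subring_adjoin[OF R] subset_adjoin[OF R] in_adjoin[OF R] by blast
  then have ne: "F \<noteq> {}" by blast
  have "\<exists>M\<in>F. \<forall>X\<in>F. M \<subseteq> X \<longrightarrow> X = M"
  proof (rule subset_Zorn_nonempty[OF ne])
    fix C assume C: "C \<noteq> {}" "subset.chain F C"
    have CF: "\<And>B. B \<in> C \<Longrightarrow> B \<in> F" and tot: "\<And>B B'. B \<in> C \<Longrightarrow> B' \<in> C \<Longrightarrow> B \<subseteq> B' \<or> B' \<subseteq> B"
      using C(2) by (auto simp: subset_chain_def)
    have "subring (\<Union>C)" unfolding subring_def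
    proof (intro conjI ballI)
      show "1 \<in> \<Union>C" using C(1) CF by (auto simp: F_def intro: subring_1)
      fix a b assume "a \<in> \<Union>C" "b \<in> \<Union>C"
      then obtain B B' where "B \<in> C" "B' \<in> C" "a \<in> B" "b \<in> B'" by auto
      then obtain B'' where B: "B'' \<in> C" "a \<in> B''" "b \<in> B''" using tot by blast
      then have "subring B''" using CF by (auto simp: F_def)
      then show "a - b \<in> \<Union>C" "a * b \<in> \<Union>C" using B subring_diff subring_mult by blast+
    qed
    then show "\<Union>C \<in> F" using C(1) CF by (auto simp: F_def)
  qed
  then obtain V where V: "V \<in> F" "\<And>X. X \<in> F \<Longrightarrow> V \<subseteq> X \<Longrightarrow> X = V" by blast
  have "valuation_ring V"
    by (rule maximal_subring_valuation_ring[of V x]) (use V x0 in \<open>auto simp: F_def\<close>)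
  then show False using val[of V] V(1) by (auto simp: F_def)
qed


subsection \<open>Valuations of points on the secant variety\<close>

text \<open>Otherwise \<open>inverse y\<close> is in \<open>V\<close>, and \<open>y\<close> is the
  product of \<open>y ^ N\<close> and a power of it. Used to pass from a whole edge to its primitive
  vector.\<close>

lemma valuation_ring_root:
  fixes y :: "'k::field"
  assumes V: "valuation_ring V" and yN: "y ^ N \<in> V" and N: "N \<ge> 1"
  shows "y \<in> V"
proof (rule ccontr)
  assume nV: "y \<notin> V"
  then have iV: "inverse y \<in> V" using V by (auto simp: valuation_ring_def)
  have S: "subring V" using V by (simp add: valuation_ring_def)
  have y0: "y \<noteq> 0" using nV subring_0[OF S] by auto
  have "y = y ^ N * inverse y ^ (N - 1)"
    using y0 N by (cases N) (simp_all add: power_inverse)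
  also have "\<dots> \<in> V" by (intro subring_mult[OF S] subring_power[OF S] yN iV)
  finally show False using nV by simp
qed

lemma ex_minimal_total:
  assumes "finite S" "S \<noteq> {}"
    and tot: "\<And>x y. x \<in> S \<Longrightarrow> y \<in> S \<Longrightarrow> le x y \<or> le y x"
    and trans: "\<And>x y z. le x y \<Longrightarrow> le y z \<Longrightarrow> le x z"
  shows "\<exists>x\<in>S. \<forall>y\<in>S. le x y"
  using assms(1,2,3)
proof (induction S rule: finite_ne_induct)
  case (insert a S)
  then obtain x where x: "x \<in> S" "\<And>y. y \<in> S \<Longrightarrow> le x y" by blast
  show ?case
  proof (cases "le x a")
    case True then show ?thesis using x by blast
  next
    case False
    then have "le a x" using insert.prems x(1) by blast
    moreover have "le a a" using insert.prems by blast
    ultimately show ?thesis using x trans by blast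
  qed
qed auto

text \<open>
  \<open>L\<close> plays the role of the lattice points of a smooth polytope with vertex set \<open>Vt\<close>; in the
  chart at the vertex \<open>v\<close> the elements of \<open>B\<close> are the primitive edge vectors.
\<close>

definition vertex_charts :: "(int ^ 'n) set \<Rightarrow> (int ^ 'n) set \<Rightarrow> (int ^ 'n) set \<Rightarrow> bool"
  where "vertex_charts A L Vt \<longleftrightarrow> finite Vt \<and> Vt \<noteq> {} \<and> (\<forall>v\<in>Vt. v \<in> A \<and> (\<exists>B. finite B \<and>
    (\<forall>b\<in>B. v + b \<in> A \<and> (\<exists>N\<ge>(1::nat). \<exists>w\<in>Vt. int N *s b = w - v)) \<and>
    (\<forall>u\<in>L. \<exists>k :: int ^ 'n \<Rightarrow> nat. u - v = (\<Sum>b\<in>B. int (k b) *s b))))"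

lemma vertex_chartsD:
  fixes A L Vt :: "(int ^ 'n) set"
  assumes "vertex_charts A L Vt" "v \<in> Vt" "u \<in> L"
  obtains B and k :: "int ^ 'n \<Rightarrow> nat" where "finite B" "\<forall>b\<in>B. v + b \<in> A"
    "\<forall>b\<in>B. \<exists>N\<ge>(1::nat). \<exists>w\<in>Vt. int N *s b = w - v"
    "u - v = (\<Sum>b\<in>B. int (k b) *s b)"
proof -
  have "\<exists>B. finite B \<and>
    (\<forall>b\<in>B. v + b \<in> A \<and> (\<exists>N\<ge>(1::nat). \<exists>w\<in>Vt. int N *s b = w - v)) \<and>
    (\<forall>u\<in>L. \<exists>k :: int ^ 'n \<Rightarrow> nat. u - v = (\<Sum>b\<in>B. int (k b) *s b))"
    using assms(1,2) unfolding vertex_charts_def by simp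
  then obtain B where B: "finite B"
      "\<forall>b\<in>B. v + b \<in> A \<and> (\<exists>N\<ge>(1::nat). \<exists>w\<in>Vt. int N *s b = w - v)"
      "\<forall>u\<in>L. \<exists>k :: int ^ 'n \<Rightarrow> nat. u - v = (\<Sum>b\<in>B. int (k b) *s b)"
    by blast
  obtain k :: "int ^ 'n \<Rightarrow> nat" where "u - v = (\<Sum>b\<in>B. int (k b) *s b)"
    using B(3) assms(3) by blast
  then show ?thesis using B by (intro that[of B k]) blast+
qed

section \<open>Multiplicative characters with values in a valued field\<close>

definition char_hom :: "('g::ab_group_add \<Rightarrow> 'k::field) \<Rightarrow> bool"
  where "char_hom \<phi> \<longleftrightarrow> (\<forall>a b. \<phi> (a + b) = \<phi> a * \<phi> b) \<and> (\<forall>a. \<phi> a \<noteq> 0)"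

lemma char_hom_add: "char_hom \<phi> \<Longrightarrow> \<phi> (a + b) = \<phi> a * \<phi> b"
  and char_hom_nonzero: "char_hom \<phi> \<Longrightarrow> \<phi> a \<noteq> 0"
  by (auto simp: char_hom_def)

lemma char_hom_0: "char_hom \<phi> \<Longrightarrow> \<phi> 0 = 1"
  using char_hom_add[of \<phi> 0 0] char_hom_nonzero[of \<phi> 0] by simp

lemma char_hom_scale:
  fixes b :: "int ^ 'n"
  assumes "char_hom \<phi>"
  shows "\<phi> (int n *s b) = \<phi> b ^ n"
proof (induction n)
  case (Suc n)
  have "int (Suc n) *s b = int n *s b + b" by (simp add: vec_eq_iff algebra_simps)
  then show ?case using Suc char_hom_add[OF assms] by simp
qed (simp add: char_hom_0[OF assms])

text \<open>\<open>\<phi> (w - v) \<in> V\<close> says that the valuation of \<open>\<phi> w\<close>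
  is at least that of \<open>\<phi> v\<close>. This is a total preorder, since \<open>V\<close>
  contains every element or its inverse.\<close>

lemma char_hom_minimal_vertex:
  fixes \<phi> :: "int ^ 'n \<Rightarrow> 'k::field"
  assumes V: "valuation_ring V" and \<phi>: "char_hom \<phi>" and fin: "finite Vt" "Vt \<noteq> {}"
  shows "\<exists>v\<in>Vt. \<forall>w\<in>Vt. \<phi> (w - v) \<in> V"
proof (rule ex_minimal_total[OF fin])
  have S: "subring V" using V by (simp add: valuation_ring_def)
  fix x y
  have "\<phi> (x - y) * \<phi> (y - x) = 1"
    using char_hom_add[OF \<phi>, of "x - y" "y - x"] char_hom_0[OF \<phi>] by simp
  then have "\<phi> (x - y) = inverse (\<phi> (y - x))" by (metis inverse_unique mult.commute)
  then show "\<phi> (y - x) \<in> V \<or> \<phi> (x - y) \<in> V" using V by (metis valuation_ring_def)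
  fix z assume "\<phi> (y - x) \<in> V" "\<phi> (z - y) \<in> V"
  then have "\<phi> (y - x) * \<phi> (z - y) \<in> V" by (rule subring_mult[OF S])
  then show "\<phi> (z - x) \<in> V" by (simp flip: char_hom_add[OF \<phi>])
qed

lemma char_hom_chart:
  fixes \<phi> :: "int ^ 'n \<Rightarrow> 'k::field"
  assumes V: "valuation_ring V" and \<phi>: "char_hom \<phi>"
    and min: "\<And>w. w \<in> Vt \<Longrightarrow> \<phi> (w - v) \<in> V"
    and b: "N \<ge> 1" "w \<in> Vt" "int N *s b = w - v"
  shows "\<phi> b \<in> V"
  using valuation_ring_root[OF V, of "\<phi> b" N] char_hom_scale[OF \<phi>, of N b] min[OF b(2)] b by simp

lemma natural_combination_induct:
  fixes k :: "int ^ 'n \<Rightarrow> nat"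
  assumes "finite B" "Q 0" "\<And>g h. Q g \<Longrightarrow> Q h \<Longrightarrow> Q (g + h)" "\<And>b. b \<in> B \<Longrightarrow> Q b"
  shows "Q (\<Sum>b\<in>B. int (k b) *s b)"
proof -
  have 1: "Q (int n *s b)" if "b \<in> B" for n b
  proof (induction n)
    case (Suc n)
    have "int (Suc n) *s b = int n *s b + b" by (simp add: vec_eq_iff algebra_simps)
    then show ?case using Suc assms(3,4) that by simp
  qed (simp add: assms(2))
  have "Q (\<Sum>b\<in>C. int (k b) *s b)" if "C \<subseteq> B" for C
    using finite_subset[OF that assms(1)] that
    by (induction C rule: finite_induct) (auto intro!: assms(2,3) 1)
  then show ?thesis by blast
qed

lemma char_hom_in_valuation_ring:
  fixes \<phi> :: "int ^ 'n \<Rightarrow> 'k::field"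
  assumes V: "valuation_ring V" and \<phi>: "char_hom \<phi>" and ch: "vertex_charts A L Vt"
    and v: "v \<in> Vt" and min: "\<And>w. w \<in> Vt \<Longrightarrow> \<phi> (w - v) \<in> V" and u: "u \<in> L"
  shows "\<phi> (u - v) \<in> V"
proof -
  have S: "subring V" using V by (simp add: valuation_ring_def)
  obtain B k where B: "finite B" "\<forall>b\<in>B. v + b \<in> A"
      "\<forall>b\<in>B. \<exists>N\<ge>(1::nat). \<exists>w\<in>Vt. int N *s b = w - v"
    and k: "u - v = (\<Sum>b\<in>B. int (k b :: nat) *s b)"
    by (rule vertex_chartsD[OF ch v u])
  have bV: "\<phi> b \<in> V" if "b \<in> B" for b
    using bspec[OF B(3) that] char_hom_chart[OF V \<phi> min] by blast
  show ?thesis unfolding k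
  proof (rule natural_combination_induct[OF B(1), of "\<lambda>g. \<phi> g \<in> V"])
    show "\<phi> 0 \<in> V" using char_hom_0[OF \<phi>] subring_1[OF S] by simp
    show "\<phi> (g + h) \<in> V" if "\<phi> g \<in> V" "\<phi> h \<in> V" for g h
      using subring_mult[OF S that] by (simp add: char_hom_add[OF \<phi>])
  qed (rule bV)
qed

text \<open>
  If \<open>p\<close> is not in \<open>V\<close> then, \<open>p + q\<close> being in \<open>V\<close>, both points have their minimal
  valuation at the same vertex, and \<open>z u\<close> is computed in a common chart.
\<close>

lemma secant_coordinate_in_valuation_ring_aux:
  fixes \<phi> \<psi> :: "int ^ 'n \<Rightarrow> 'k::field"
  assumes V: "valuation_ring V" and \<phi>: "char_hom \<phi>" and \<psi>: "char_hom \<psi>"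
    and ch: "vertex_charts A L Vt" and nz: "l \<noteq> 0" "m \<noteq> 0"
    and zA: "\<And>a. a \<in> A \<Longrightarrow> l * \<phi> a + m * \<psi> a \<in> V" and u: "u \<in> L"
    and v: "v \<in> Vt" "\<And>w. w \<in> Vt \<Longrightarrow> \<phi> (w - v) \<in> V"
    and v': "v' \<in> Vt" "\<And>w. w \<in> Vt \<Longrightarrow> \<psi> (w - v') \<in> V"
    and le: "m * \<psi> v' / (l * \<phi> v) \<in> V"
  shows "l * \<phi> u + m * \<psi> u \<in> V"
proof -
  have S: "subring V" using V by (simp add: valuation_ring_def)
  define p where "p = l * \<phi> v"
  have p0: "p \<noteq> 0" using nz char_hom_nonzero[OF \<phi>] by (simp add: p_def)
  have \<phi>d: "\<phi> w = \<phi> v * \<phi> (w - v)" for w v using char_hom_add[OF \<phi>, of v "w - v"] by simp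
  have \<psi>d: "\<psi> w = \<psi> v * \<psi> (w - v)" for w v using char_hom_add[OF \<psi>, of v "w - v"] by simp
  show ?thesis
  proof (cases "p \<in> V")
    \<comment> \<open>By \<open>le\<close> the minimal term of \<open>\<phi>\<close> divides that of
      \<open>\<psi>\<close> in \<open>V\<close>, so both summands of the coordinate are multiples of
      \<open>p\<close> by elements of \<open>V\<close>.\<close>
    case True
    have "l * \<phi> u = p * \<phi> (u - v)" using \<phi>d[of u v] by (simp add: p_def)
    moreover have "m * \<psi> u = p * (m * \<psi> v' / (l * \<phi> v)) * \<psi> (u - v')"
      using \<psi>d[of u v'] p0 by (simp add: p_def)
    moreover have "p * \<phi> (u - v) \<in> V"
      using True char_hom_in_valuation_ring[OF V \<phi> ch v u] by (rule subring_mult[OF S])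
    moreover have "p * (m * \<psi> v' / (l * \<phi> v)) * \<psi> (u - v') \<in> V"
      using True le char_hom_in_valuation_ring[OF V \<psi> ch v' u] by (intro subring_mult[OF S])
    ultimately show ?thesis by (simp only: subring_add[OF S])
  next
    case False
    then have ip: "inverse p \<in> V" using V by (auto simp: valuation_ring_def)
    have vA: "v \<in> A" using ch v(1) by (auto simp: vertex_charts_def)
    define q where "q = m * \<psi> v"
    have q0: "q \<noteq> 0" using nz char_hom_nonzero[OF \<psi>] by (simp add: q_def)
    define z where "z = p + q"
    have zV: "z \<in> V" using zA[OF vA] by (simp add: z_def p_def q_def)
    \<comment> \<open>Up to sign this is \<open>q / p\<close>. That it is a unit of \<open>V\<close>
      means that the two terms at \<open>v\<close> have the same valuation, and this makes
      \<open>v\<close> a minimal vertex for \<open>\<psi>\<close> as well.\<close>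
    define s where "s = 1 - z * inverse p"
    have s: "s = - q / p" using p0 by (simp add: s_def z_def field_simps)
    have s0: "s \<noteq> 0" using s p0 q0 by simp
    have sV: "s \<in> V" unfolding s_def by (intro subring_diff[OF S] subring_1[OF S] subring_mult[OF S] zV ip)
    have isV: "inverse s \<in> V"
    proof -
      have "s * p = p - z" using p0 by (simp add: s_def algebra_simps)
      then have "s * p \<notin> V" using False subring_add[OF S _ zV, of "s * p"] by auto
      then have e: "inverse (s * p) \<in> V" using V by (auto simp: valuation_ring_def)
      have "inverse s = 1 + z * inverse (s * p)"
        using s0 p0 by (simp add: s_def field_simps)
      moreover have "1 + z * inverse (s * p) \<in> V"
        by (intro subring_add[OF S] subring_1[OF S] subring_mult[OF S] e zV)
      ultimately show ?thesis by simp
    qed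
    have \<psi>min: "\<psi> (w - v) \<in> V" if "w \<in> Vt" for w
    proof -
      have eq: "\<psi> (w - v) = - (m * \<psi> v' / (l * \<phi> v)) * \<psi> (w - v') * inverse s"
      proof -
        have "q * \<psi> (w - v) = m * \<psi> v' * \<psi> (w - v')"
          using \<psi>d[of w v] \<psi>d[of w v'] by (simp add: q_def)
        then show ?thesis unfolding s p_def[symmetric] using p0 q0 by (simp add: field_simps)
      qed
      show ?thesis unfolding eq
        by (intro subring_mult[OF S] subring_uminus[OF S] le v'(2)[OF that] isV)
    qed
    obtain B k where B: "finite B" "\<forall>b\<in>B. v + b \<in> A"
      "\<forall>b\<in>B. \<exists>N\<ge>(1::nat). \<exists>w\<in>Vt. int N *s b = w - v"
      and k: "u - v = (\<Sum>b\<in>B. int (k b :: nat) *s b)"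
      by (rule vertex_chartsD[OF ch v(1) u])
    \<comment> \<open>The product rule for differences makes \<open>Q\<close> stable under addition,
      so only the edge vectors \<open>b\<close> have to be checked. There
      \<open>v + b \<in> A\<close> supplies an element of \<open>V\<close>.\<close>
    define Q where "Q g \<longleftrightarrow> \<phi> g \<in> V \<and> \<psi> g \<in> V \<and> p * (\<phi> g - \<psi> g) \<in> V" for g
    have "Q (u - v)" unfolding k
    proof (rule natural_combination_induct[OF B(1), of Q])
      show "Q 0" using char_hom_0[OF \<phi>] char_hom_0[OF \<psi>] subring_0[OF S] subring_1[OF S] by (simp add: Q_def)
    next
      fix g h assume gh: "Q g" "Q h"
      have "p * (\<phi> (g + h) - \<psi> (g + h)) = \<phi> g * (p * (\<phi> h - \<psi> h)) + (p * (\<phi> g - \<psi> g)) * \<psi> h"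
        by (simp add: char_hom_add[OF \<phi>] char_hom_add[OF \<psi>] algebra_simps)
      also have "\<dots> \<in> V" using gh by (auto simp: Q_def intro!: subring_add[OF S] subring_mult[OF S])
      finally show "Q (g + h)" using gh
        by (auto simp: Q_def char_hom_add[OF \<phi>] char_hom_add[OF \<psi>] intro!: subring_mult[OF S])
    next
      fix b assume b: "b \<in> B"
      have \<phi>b: "\<phi> b \<in> V" using bspec[OF B(3) b] char_hom_chart[OF V \<phi> v(2)] by blast
      have \<psi>b: "\<psi> b \<in> V" using bspec[OF B(3) b] char_hom_chart[OF V \<psi> \<psi>min] by blast
      have "p * (\<phi> b - \<psi> b) = (l * \<phi> (v + b) + m * \<psi> (v + b)) - z * \<psi> b"
        by (simp add: p_def q_def z_def char_hom_add[OF \<phi>] char_hom_add[OF \<psi>] algebra_simps)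
      also have "\<dots> \<in> V" by (intro subring_diff[OF S] subring_mult[OF S] zA bspec[OF B(2) b] zV \<psi>b)
      finally show "Q b" using \<phi>b \<psi>b by (simp add: Q_def)
    qed
    moreover have "l * \<phi> u + m * \<psi> u = p * (\<phi> (u - v) - \<psi> (u - v)) + z * \<psi> (u - v)"
      using \<phi>d[of u v] \<psi>d[of u v] by (simp add: p_def q_def z_def algebra_simps)
    ultimately show ?thesis using zV by (auto simp: Q_def intro!: subring_add[OF S] subring_mult[OF S])
  qed
qed

text \<open>One of the two minimal terms is a multiple of the other in \<open>V\<close>; the roles
  of the two points are chosen accordingly.\<close>

lemma secant_coordinate_in_valuation_ring:
  fixes \<phi> \<psi> :: "int ^ 'n \<Rightarrow> 'k::field"
  assumes V: "valuation_ring V" and \<phi>: "char_hom \<phi>" and \<psi>: "char_hom \<psi>"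
    and ch: "vertex_charts A L Vt" and nz: "l \<noteq> 0" "m \<noteq> 0"
    and zA: "\<And>a. a \<in> A \<Longrightarrow> l * \<phi> a + m * \<psi> a \<in> V" and u: "u \<in> L"
  shows "l * \<phi> u + m * \<psi> u \<in> V"
proof -
  have fin: "finite Vt" "Vt \<noteq> {}" using ch by (auto simp: vertex_charts_def)
  obtain v where v: "v \<in> Vt" "\<And>w. w \<in> Vt \<Longrightarrow> \<phi> (w - v) \<in> V"
    using char_hom_minimal_vertex[OF V \<phi> fin] by blast
  obtain v' where v': "v' \<in> Vt" "\<And>w. w \<in> Vt \<Longrightarrow> \<psi> (w - v') \<in> V"
    using char_hom_minimal_vertex[OF V \<psi> fin] by blast
  have "m * \<psi> v' / (l * \<phi> v) = inverse (l * \<phi> v / (m * \<psi> v'))" by simp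
  then consider "m * \<psi> v' / (l * \<phi> v) \<in> V" | "l * \<phi> v / (m * \<psi> v') \<in> V"
    using V by (metis valuation_ring_def)
  then show ?thesis
  proof cases
    case 1
    then show ?thesis using secant_coordinate_in_valuation_ring_aux[OF V \<phi> \<psi> ch nz zA u v v'] by blast
  next
    case 2
    have "m * \<psi> a + l * \<phi> a \<in> V" if "a \<in> A" for a using zA[OF that] by (simp add: add.commute)
    then have "m * \<psi> u + l * \<phi> u \<in> V"
      using secant_coordinate_in_valuation_ring_aux[OF V \<psi> \<phi> ch nz(2,1) _ u v' v] 2 by blast
    then show ?thesis by (simp add: add.commute)
  qed
qed

definition torus :: "(complex ^ 'n) set"
  where "torus = {t. \<forall>i. t $ i \<noteq> 0}"

text \<open>The weights may be zero and the torus elements may coincide. The family is therefore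
  closed under scaling, and only the torus conditions restrict the parameters.\<close>

definition secant_point ::
    "(int ^ 'n) set \<Rightarrow> complex \<Rightarrow> complex \<Rightarrow> complex ^ 'n \<Rightarrow> complex ^ 'n \<Rightarrow> int ^ 'n \<Rightarrow> complex"
  where "secant_point L l m t s = (\<lambda>u. if u \<in> L then l * character u t + m * character u s else 0)"

subsection \<open>The generic secant point\<close>

text \<open>
  Variables 0 and 1 stand for the weights and the remaining ones for two torus elements; the
  shift \<open>c\<close> makes all exponents nonnegative.
\<close>

definition generic_coord :: "('n::finite \<Rightarrow> nat) \<Rightarrow> nat \<Rightarrow> int ^ 'n \<Rightarrow> nat cpoly"
  where "generic_coord idx c u =
    cvar 0 * (\<Prod>i\<in>UNIV. cvar (2 + 2 * idx i) ^ nat (u $ i + int c)) +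
    cvar 1 * (\<Prod>i\<in>UNIV. cvar (3 + 2 * idx i) ^ nat (u $ i + int c))"

lemma power_shift:
  fixes z :: "'k::field"
  assumes "z \<noteq> 0" "0 \<le> k + int c"
  shows "z ^ nat (k + int c) = z ^ c * z powi k"
proof -
  have "z ^ nat (k + int c) = z powi (k + int c)" using assms(2) by (simp add: power_int_def)
  also have "\<dots> = z powi k * z powi (int c)" using assms(1) by (simp add: power_int_add)
  finally show ?thesis by (simp add: mult.commute)
qed

lemma prod_power_shift:
  fixes z :: "'n::finite \<Rightarrow> 'k::field"
  assumes "\<And>i. z i \<noteq> 0" "\<And>i. 0 \<le> u i + int c"
  shows "(\<Prod>i\<in>UNIV. z i ^ nat (u i + int c)) = (\<Prod>i\<in>UNIV. z i ^ c) * (\<Prod>i\<in>UNIV. z i powi u i)"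
  unfolding prod.distrib[symmetric] by (intro prod.cong refl power_shift assms)

lemma cpoly_eval_generic_coord:
  "cpoly_eval (generic_coord idx c u) x =
    x 0 * (\<Prod>i\<in>UNIV. x (2 + 2 * idx i) ^ nat (u $ i + int c)) +
    x 1 * (\<Prod>i\<in>UNIV. x (3 + 2 * idx i) ^ nat (u $ i + int c))"
  by (simp add: generic_coord_def cpoly_eval_add cpoly_eval_mult cpoly_eval_prod cpoly_eval_power)

lemma generic_coord_eval_secant_point:
  assumes x: "\<And>j. x j \<noteq> 0" and c: "\<And>u i. u \<in> L \<Longrightarrow> 0 \<le> u $ i + int c"
  shows "\<exists>l m t s. t \<in> torus \<and> s \<in> torus \<and>
    (\<forall>u\<in>L. cpoly_eval (generic_coord idx c u) x = secant_point L l m t s u)"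
proof (intro exI conjI ballI)
  let ?t = "\<chi> i. x (2 + 2 * idx i)" and ?s = "\<chi> i. x (3 + 2 * idx i)"
  show "?t \<in> torus" "?s \<in> torus" using x by (auto simp: torus_def)
  fix u assume u: "u \<in> L"
  show "cpoly_eval (generic_coord idx c u) x =
    secant_point L (x 0 * (\<Prod>i\<in>UNIV. x (2 + 2 * idx i) ^ c)) (x 1 * (\<Prod>i\<in>UNIV. x (3 + 2 * idx i) ^ c)) ?t ?s u"
    unfolding cpoly_eval_generic_coord secant_point_def character_def
    using u by (simp add: prod_power_shift[OF x c[OF u]] mult.assoc)
qed

lemma secant_point_generic_coord_eval:
  assumes idx: "inj idx" and ts: "t \<in> torus" "s \<in> torus"
    and c: "\<And>u i. u \<in> L \<Longrightarrow> 0 \<le> u $ i + int c"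
  shows "\<exists>x. \<forall>u\<in>L. secant_point L l m t s u = cpoly_eval (generic_coord idx c u) x"
proof -
  \<comment> \<open>Dividing the weights by the \<open>c\<close>-th powers undoes the shift of the
    exponents. Even indices from 2 on carry \<open>t\<close>, odd ones from 3 on carry
    \<open>s\<close>.\<close>
  define x where "x j = (if j = 0 then l / (\<Prod>i\<in>UNIV. (t $ i) ^ c)
    else if j = 1 then m / (\<Prod>i\<in>UNIV. (s $ i) ^ c)
    else if even j then t $ (inv idx ((j - 2) div 2)) else s $ (inv idx ((j - 3) div 2)))" for j
  have x2: "x (2 + 2 * idx i) = t $ i" for i using idx by (simp add: x_def)
  have "\<not> even (3 + 2 * idx i)" for i by presburger
  then have x3: "x (3 + 2 * idx i) = s $ i" for i using idx by (simp add: x_def)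
  have nz: "t $ i \<noteq> 0" "s $ i \<noteq> 0" for i using ts by (auto simp: torus_def)
  have "secant_point L l m t s u = cpoly_eval (generic_coord idx c u) x" if u: "u \<in> L" for u
    unfolding cpoly_eval_generic_coord x2 x3 prod_power_shift[OF nz(1) c[OF u]] prod_power_shift[OF nz(2) c[OF u]]
    using u nz by (simp add: secant_point_def character_def x_def)
  then show ?thesis by blast
qed

lemma finite_int_vec_shift:
  fixes L :: "(int ^ 'n) set"
  assumes "finite L"
  shows "\<exists>c. \<forall>u\<in>L. \<forall>i. 0 \<le> u $ i + int c"
proof (intro exI ballI allI)
  fix u i assume u: "u \<in> L"
  let ?M = "\<Sum>u\<in>L. \<Sum>i\<in>UNIV. nat \<bar>u $ i\<bar>"
  have "nat \<bar>u $ i\<bar> \<le> (\<Sum>i\<in>UNIV. nat \<bar>u $ i\<bar>)" by (rule member_le_sum) auto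
  also have "\<dots> \<le> ?M" by (rule member_le_sum[OF u]) (use assms in auto)
  finally show "0 \<le> u $ i + int ?M" by linarith
qed

lemma ex_inj_finite_to_nat: "\<exists>idx :: 'n::finite \<Rightarrow> nat. inj idx"
  using finite_imp_inj_to_nat_seg[of "UNIV :: 'n set"] by auto

lemma polys_UNIV [simp]: "f \<in> polys UNIV"
  by (simp add: polys_def)

text \<open>Irreducibility of the secant variety in algebraic form: the generic point pulls
  \<open>f\<close> and \<open>g\<close> back to polynomials \<open>F\<close> and \<open>G\<close>
  with \<open>F * G = 0\<close>, and a polynomial ring is a domain.\<close>

lemma secant_points_domain:
  fixes L :: "(int ^ 'n) set"
  assumes fin: "finite L" and fg: "f \<in> polys L" "g \<in> polys L"
    and zero: "\<And>l m t s. t \<in> torus \<Longrightarrow> s \<in> torus \<Longrightarrow>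
      cpoly_eval f (secant_point L l m t s) * cpoly_eval g (secant_point L l m t s) = 0"
  shows "(\<forall>l m. \<forall>t\<in>torus. \<forall>s\<in>torus. cpoly_eval f (secant_point L l m t s) = 0) \<or>
    (\<forall>l m. \<forall>t\<in>torus. \<forall>s\<in>torus. cpoly_eval g (secant_point L l m t s) = 0)"
proof -
  obtain idx :: "'n \<Rightarrow> nat" where idx: "inj idx" using ex_inj_finite_to_nat by blast
  obtain c where c: "\<And>u i. u \<in> L \<Longrightarrow> 0 \<le> u $ i + int c" using finite_int_vec_shift[OF fin] by blast
  define Z where "Z x = (\<lambda>u. cpoly_eval (generic_coord idx c u) x)" for x
  have sub: "\<exists>F::nat cpoly. \<forall>x. cpoly_eval f (Z x) = cpoly_eval F x" if "f \<in> polys L" for f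
  proof -
    have "polyfun UNIV (\<lambda>x. cpoly_eval f (\<lambda>u. cpoly_eval (generic_coord idx c u) x))"
      by (rule polyfun_compose[OF that]) (simp add: polyfun_cpoly_eval)
    then show ?thesis by (auto simp: polyfun_def Z_def)
  qed
  obtain F G :: "nat cpoly" where F: "\<And>x. cpoly_eval f (Z x) = cpoly_eval F x"
    and G: "\<And>x. cpoly_eval g (Z x) = cpoly_eval G x" using sub[OF fg(1)] sub[OF fg(2)] by blast
  have "F * G = 0"
  proof (rule cpoly_eq_0I)
    fix x :: "nat \<Rightarrow> complex" assume x: "\<And>i. x i \<noteq> 0"
    obtain l m t s where ts: "t \<in> torus" "s \<in> torus"
      and eq: "\<forall>u\<in>L. cpoly_eval (generic_coord idx c u) x = secant_point L l m t s u"
      using generic_coord_eval_secant_point[where x = x and L = L and c = c and idx = idx] x c by blast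
    have "cpoly_eval f (Z x) = cpoly_eval f (secant_point L l m t s)"
      "cpoly_eval g (Z x) = cpoly_eval g (secant_point L l m t s)"
      using eq by (auto intro!: cpoly_eval_cong[OF fg(1)] cpoly_eval_cong[OF fg(2)] simp: Z_def)
    then show "cpoly_eval (F * G) x = 0" using zero[OF ts] F G by (simp add: cpoly_eval_mult)
  qed
  then have FG: "F = 0 \<or> G = 0" by simp
  have van: "cpoly_eval h (secant_point L l m t s) = 0"
    if h: "h \<in> polys L" "\<And>x. cpoly_eval h (Z x) = 0" "t \<in> torus" "s \<in> torus" for h l m t s
  proof -
    obtain x where x: "\<forall>u\<in>L. secant_point L l m t s u = cpoly_eval (generic_coord idx c u) x"
      using secant_point_generic_coord_eval[where L = L and c = c, OF idx h(3,4)] c by blast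
    have "cpoly_eval h (secant_point L l m t s) = cpoly_eval h (Z x)"
      by (rule cpoly_eval_cong[OF h(1)]) (use x in \<open>auto simp: Z_def\<close>)
    then show ?thesis using h(2) by simp
  qed
  show ?thesis
  proof (rule disjE[OF FG])
    assume "F = 0"
    then have "cpoly_eval f (Z x) = 0" for x using F by simp
    then show ?thesis using van[OF fg(1)] by blast
  next
    assume "G = 0"
    then have "cpoly_eval g (Z x) = 0" for x using G by simp
    then show ?thesis using van[OF fg(2)] by blast
  qed
qed

section \<open>Integral equations for the generic secant point, found in a fraction field\<close>

lemma char_hom_powi_prod:
  fixes z :: "'n::finite \<Rightarrow> 'k::field"
  assumes "\<And>i. z i \<noteq> 0"
  shows "char_hom (\<lambda>u :: int ^ 'n. \<Prod>i\<in>UNIV. z i powi (u $ i))"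
  unfolding char_hom_def using assms by (auto simp: power_int_add prod.distrib)

abbreviation embed :: "'a::idom \<Rightarrow> 'a fract"
  where "embed f \<equiv> Fract f 1"

lemma embed_mult: "embed (f * g) = embed f * embed g"
  and embed_add: "embed (f + g) = embed f + embed g"
  and embed_diff: "embed (f - g) = embed f - embed g"
  and embed_1: "embed 1 = 1"
  and embed_0: "embed 0 = 0"
  and embed_eq: "embed f = embed g \<longleftrightarrow> f = g"
  by (simp_all add: eq_fract fract_collapse)

lemma embed_power: "embed (f ^ n) = embed f ^ n"
  by (induction n) (simp_all only: power.simps embed_1 embed_mult)

lemma embed_sum: "embed (sum f S) = (\<Sum>s\<in>S. embed (f s))"
proof (induction S rule: infinite_finite_induct)
  case (insert x F)
  then show ?case by (simp only: sum.insert[OF insert.hyps] embed_add insert.IH)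
qed (simp_all add: embed_0)

lemma embed_prod: "embed (prod f S) = (\<Prod>s\<in>S. embed (f s))"
proof (induction S rule: infinite_finite_induct)
  case (insert x F)
  then show ?case by (simp only: prod.insert[OF insert.hyps] embed_mult insert.IH)
qed (simp_all add: embed_1)

text \<open>The valuation criterion is applied in the fraction field of the polynomial ring, over
  the image of the ring generated by the generic coordinates in \<open>A\<close>. A polynomial ring
  embeds into its fraction field, so the equation holds between polynomials and hence at every
  point.\<close>

lemma generic_coord_integral:
  fixes L A :: "(int ^ 'n) set" and idx :: "'n \<Rightarrow> nat"
  assumes ch: "vertex_charts A L Vt" and AL: "A \<subseteq> L" and u: "u \<in> L"
    and c: "\<And>u i. u \<in> L \<Longrightarrow> 0 \<le> u $ i + int c"
  defines "Z \<equiv> \<lambda>x u. cpoly_eval (generic_coord idx c u) x"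
  shows "\<exists>N\<ge>1. \<exists>g. (\<forall>i<N. g i \<in> polys A) \<and>
    (\<forall>x. Z x u ^ N = (\<Sum>i<N. cpoly_eval (g i) (Z x) * Z x u ^ i))"
proof -
  define R0 where "R0 = {F :: nat cpoly. \<exists>g\<in>polys A. \<forall>x. cpoly_eval F x = cpoly_eval g (Z x)}"
  have R0: "subring R0" unfolding subring_def
  proof (intro conjI ballI)
    show "1 \<in> R0" unfolding R0_def by (intro CollectI bexI[of _ 1]) auto
    fix F G assume "F \<in> R0" "G \<in> R0"
    then obtain f g where f: "f \<in> polys A" "\<And>x. cpoly_eval F x = cpoly_eval f (Z x)"
      and g: "g \<in> polys A" "\<And>x. cpoly_eval G x = cpoly_eval g (Z x)"
      unfolding R0_def by blast
    show "F - G \<in> R0" unfolding R0_def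
      by (intro CollectI bexI[of _ "f - g"]) (use f g in \<open>auto simp: cpoly_eval_diff intro: polys_diff\<close>)
    show "F * G \<in> R0" unfolding R0_def
      by (intro CollectI bexI[of _ "f * g"]) (use f g in \<open>auto simp: cpoly_eval_mult intro: polys_mult\<close>)
  qed
  define R where "R = embed ` R0"
  have R: "subring R" unfolding subring_def R_def
    using R0 by (auto simp only: subring_def embed_diff[symmetric] embed_mult[symmetric] embed_1[symmetric] intro!: imageI ballI conjI)
  define z0 z1 where "z0 i = embed (cvar (2 + 2 * idx i) :: nat cpoly)"
    and "z1 i = embed (cvar (3 + 2 * idx i) :: nat cpoly)" for i
  have nz: "z0 i \<noteq> 0" "z1 i \<noteq> 0" for i
    unfolding z0_def z1_def embed_0[symmetric] embed_eq by simp_all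
  define \<phi> \<psi> where "\<phi> u = (\<Prod>i\<in>UNIV. z0 i powi (u $ i))" and "\<psi> u = (\<Prod>i\<in>UNIV. z1 i powi (u $ i))" for u
  have hom: "char_hom \<phi>" "char_hom \<psi>" unfolding \<phi>_def \<psi>_def by (intro char_hom_powi_prod nz)+
  \<comment> \<open>The shift factors are absorbed into the weights; the generic coordinates then
    have the form \<open>l * \<phi> w + m * \<psi> w\<close> with multiplicative
    \<open>\<phi>\<close> and \<open>\<psi>\<close>.\<close>
  define l m where "l = embed (cvar 0 :: nat cpoly) * (\<Prod>i\<in>UNIV. z0 i ^ c)"
    and "m = embed (cvar 1 :: nat cpoly) * (\<Prod>i\<in>UNIV. z1 i ^ c)"
  have "embed (cvar 0 :: nat cpoly) \<noteq> 0" "embed (cvar 1 :: nat cpoly) \<noteq> 0"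
    unfolding embed_0[symmetric] embed_eq by simp_all
  then have lm: "l \<noteq> 0" "m \<noteq> 0" using nz by (auto simp: l_def m_def)
  have emb: "embed (generic_coord idx c w) = l * \<phi> w + m * \<psi> w" if "w \<in> L" for w
    unfolding generic_coord_def embed_add embed_mult embed_prod embed_power z0_def[symmetric] z1_def[symmetric]
      prod_power_shift[OF nz(1) c[OF that]] prod_power_shift[OF nz(2) c[OF that]] l_def m_def \<phi>_def \<psi>_def
    by (simp add: mult.assoc)
  have inR: "embed (generic_coord idx c a) \<in> R" if "a \<in> A" for a
    unfolding R_def R0_def
    by (intro imageI CollectI bexI[of _ "cvar a"])
      (use that cvar_forms[of a A] forms_subset_polys[of A 1] in \<open>auto simp: Z_def\<close>)
  have "integral_over R (embed (generic_coord idx c u))"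
  proof (rule integral_if_in_valuation_rings[OF R])
    fix V assume V: "valuation_ring V" "R \<subseteq> V"
    have "l * \<phi> a + m * \<psi> a \<in> V" if "a \<in> A" for a
    proof -
      have "embed (generic_coord idx c a) \<in> V" using inR[OF that] V(2) by (rule rev_subsetD)
      moreover have "a \<in> L" using that AL by (rule rev_subsetD)
      ultimately show ?thesis by (simp only: emb)
    qed
    then show "embed (generic_coord idx c u) \<in> V"
      unfolding emb[OF u] using secant_coordinate_in_valuation_ring[OF V(1) hom ch lm _ u] by blast
  qed
  then obtain N r where N: "N \<ge> 1" and r: "\<forall>i<N. r i \<in> R"
    and eq: "embed (generic_coord idx c u) ^ N = (\<Sum>i<N. r i * embed (generic_coord idx c u) ^ i)"
    unfolding integral_over_def by blast
  have "\<forall>i<N. \<exists>F g. r i = embed F \<and> g \<in> polys A \<and> (\<forall>x. cpoly_eval F x = cpoly_eval g (Z x))"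
    using r unfolding R_def R0_def by blast
  then obtain F g where Fg: "\<And>i. i < N \<Longrightarrow> r i = embed (F i)" "\<And>i. i < N \<Longrightarrow> g i \<in> polys A"
    "\<And>i x. i < N \<Longrightarrow> cpoly_eval (F i) x = cpoly_eval (g i) (Z x)" by metis
  have "embed (generic_coord idx c u ^ N) = embed (\<Sum>i<N. F i * generic_coord idx c u ^ i)"
    unfolding embed_power eq embed_sum embed_mult by (intro sum.cong refl) (simp add: Fg(1))
  then have gen: "generic_coord idx c u ^ N = (\<Sum>i<N. F i * generic_coord idx c u ^ i)"
    unfolding embed_eq .
  have "Z x u ^ N = (\<Sum>i<N. cpoly_eval (g i) (Z x) * Z x u ^ i)" for x
  proof -
    have "Z x u ^ N = cpoly_eval (generic_coord idx c u ^ N) x" by (simp add: Z_def cpoly_eval_power)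
    also have "\<dots> = (\<Sum>i<N. cpoly_eval (F i) x * Z x u ^ i)"
      unfolding gen by (simp add: cpoly_eval_sum cpoly_eval_mult cpoly_eval_power Z_def)
    finally show ?thesis by (simp add: Fg(3))
  qed
  then show ?thesis using N Fg(2) by blast
qed

text \<open>Both sides of the assumption are polynomials in \<open>c\<close>, and the coefficients
  of \<open>c ^ N\<close> are compared. In the term with index \<open>i\<close>, the component of
  degree \<open>k\<close> contributes to \<open>c ^ (k + i)\<close>, so the one of degree
  \<open>N - i\<close> survives.\<close>

lemma homogeneous_relation:
  fixes y :: "'i \<Rightarrow> complex"
  assumes "\<And>c. c \<noteq> 0 \<Longrightarrow> (c * y u) ^ N = (\<Sum>i<N. cpoly_eval (g i) (\<lambda>j. c * y j) * (c * y u) ^ i)"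
  shows "y u ^ N = (\<Sum>i<N. cpoly_eval (hom_comp (N - i) (g i)) y * y u ^ i)"
proof -
  obtain K0 where K0: "\<And>i m. m \<in> Poly_Mapping.keys (g i) \<Longrightarrow> monom_degree m \<le> K0 i"
  proof -
    have "\<exists>K. \<forall>m\<in>Poly_Mapping.keys (g i). monom_degree m \<le> K" for i
      using cpoly_degree_bound[of "g i"] by metis
    then show ?thesis using that by metis
  qed
  \<comment> \<open>The summand \<open>N\<close> ensures that all degrees \<open>N - i\<close> occur
    in the sums up to \<open>K\<close>.\<close>
  define K where "K = N + (\<Sum>i<N. K0 i)"
  have K: "monom_degree m \<le> K" if "m \<in> Poly_Mapping.keys (g i)" "i < N" for m i
  proof -
    have "K0 i \<le> (\<Sum>i<N. K0 i)" by (rule member_le_sum) (use that in auto)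
    then show ?thesis using K0[OF that(1)] by (simp add: K_def)
  qed
  define p where "p = monom (y u ^ N) N -
    (\<Sum>i<N. \<Sum>k\<le>K. monom (cpoly_eval (hom_comp k (g i)) y * y u ^ i) (k + i))"
  have "p = 0"
  proof (rule poly_eq_0_if_zero_off_0)
    fix c :: complex assume c: "c \<noteq> 0"
    have "cpoly_eval (g i) (\<lambda>j. c * y j) * (c * y u) ^ i =
      (\<Sum>k\<le>K. cpoly_eval (hom_comp k (g i)) y * y u ^ i * c ^ (k + i))" if "i < N" for i
      using cpoly_eval_scaled[of "g i" K c y] K that
      by (simp add: sum_distrib_left sum_distrib_right power_mult_distrib power_add mult_ac)
    then show "poly p c = 0"
      using assms[OF c] by (simp add: p_def poly_sum poly_monom power_mult_distrib mult.commute)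
  qed
  have "(\<Sum>i<N. \<Sum>k\<le>K. if k + i = N then cpoly_eval (hom_comp k (g i)) y * y u ^ i else 0) =
    (\<Sum>i<N. cpoly_eval (hom_comp (N - i) (g i)) y * y u ^ i)"
  proof (intro sum.cong refl)
    fix i assume i: "i \<in> {..<N}"
    have "(\<Sum>k\<le>K. if k + i = N then cpoly_eval (hom_comp k (g i)) y * y u ^ i else 0) =
      (\<Sum>k\<le>K. if k = N - i then cpoly_eval (hom_comp k (g i)) y * y u ^ i else 0)"
      using i by (intro sum.cong refl) auto
    also have "\<dots> = cpoly_eval (hom_comp (N - i) (g i)) y * y u ^ i"
      by (simp add: K_def)
    finally show "(\<Sum>k\<le>K. if k + i = N then cpoly_eval (hom_comp k (g i)) y * y u ^ i else 0) =
      cpoly_eval (hom_comp (N - i) (g i)) y * y u ^ i" .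
  qed
  moreover have "coeff p N = 0" using \<open>p = 0\<close> by simp
  ultimately show ?thesis by (simp add: p_def coeff_sum)
qed

lemma secant_point_scale:
  "(\<lambda>u. c * secant_point L l m t s u) = secant_point L (c * l) (c * m) t s"
  by (auto simp: secant_point_def algebra_simps)

text \<open>The equation for the generic point need not be homogeneous. It holds at all multiples of
  a secant point, which are secant points again, so its homogeneous part of degree \<open>N\<close>
  holds as well.\<close>

theorem secant_points_integral:
  fixes L A :: "(int ^ 'n) set"
  assumes fin: "finite L" and ch: "vertex_charts A L Vt" and AL: "A \<subseteq> L" and u: "u \<in> L"
  shows "\<exists>N\<ge>1. \<exists>h. (\<forall>i<N. h i \<in> forms A (N - i)) \<and>
    (\<forall>l m. \<forall>t\<in>torus. \<forall>s\<in>torus. secant_point L l m t s u ^ N =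
      (\<Sum>i<N. cpoly_eval (h i) (secant_point L l m t s) * secant_point L l m t s u ^ i))"
proof -
  obtain idx :: "'n \<Rightarrow> nat" where idx: "inj idx" using ex_inj_finite_to_nat by blast
  obtain c where c: "\<And>u i. u \<in> L \<Longrightarrow> 0 \<le> u $ i + int c" using finite_int_vec_shift[OF fin] by blast
  define Z where "Z x = (\<lambda>u. cpoly_eval (generic_coord idx c u) x)" for x
  obtain N g where N: "N \<ge> 1" and g: "\<And>i. i < N \<Longrightarrow> g i \<in> polys A"
    and eq: "\<And>x. Z x u ^ N = (\<Sum>i<N. cpoly_eval (g i) (Z x) * Z x u ^ i)"
    using generic_coord_integral[where c = c and idx = idx, OF ch AL u] c unfolding Z_def by blast
  have rel: "secant_point L l m t s u ^ N =
      (\<Sum>i<N. cpoly_eval (g i) (secant_point L l m t s) * secant_point L l m t s u ^ i)"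
    if ts: "t \<in> torus" "s \<in> torus" for l m t s
  proof -
    obtain x where x: "\<forall>u\<in>L. secant_point L l m t s u = Z x u"
      using secant_point_generic_coord_eval[where L = L and c = c, OF idx ts] c unfolding Z_def by blast
    have "cpoly_eval (g i) (secant_point L l m t s) = cpoly_eval (g i) (Z x)" if "i < N" for i
      by (rule cpoly_eval_cong[OF g[OF that]]) (use x AL in auto)
    then show ?thesis using eq[of x] x u by simp
  qed
  show ?thesis
  proof (intro exI[of _ N] exI[of _ "\<lambda>i. hom_comp (N - i) (g i)"] conjI allI impI ballI N)
    fix i assume "i < N" then show "hom_comp (N - i) (g i) \<in> forms A (N - i)" by (intro hom_comp_forms g)
  next
    fix l m and t s :: "complex ^ 'n" assume ts: "t \<in> torus" "s \<in> torus"
    show "secant_point L l m t s u ^ N =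
      (\<Sum>i<N. cpoly_eval (hom_comp (N - i) (g i)) (secant_point L l m t s) * secant_point L l m t s u ^ i)"
    proof (rule homogeneous_relation)
      fix c :: complex
      have "c * secant_point L l m t s u = secant_point L (c * l) (c * m) t s u"
        by (simp flip: secant_point_scale)
      then show "(c * secant_point L l m t s u) ^ N = (\<Sum>i<N. cpoly_eval (g i) (\<lambda>j. c * secant_point L l m t s j) *
          (c * secant_point L l m t s u) ^ i)"
        using rel[OF ts, of "c * l" "c * m"] by (simp add: secant_point_scale)
    qed
  qed
qed

subsection \<open>Eventually polynomial functions\<close>

definition poly_shift :: "rat \<Rightarrow> rat poly \<Rightarrow> rat poly"
  where "poly_shift c h = h \<circ>\<^sub>p [:c, 1:]"

lemma poly_poly_shift [simp]: "poly (poly_shift c h) x = poly h (x + c)"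
  by (simp add: poly_shift_def poly_pcompose add.commute)

lemma degree_poly_shift [simp]: "degree (poly_shift c h) = degree h"
  by (simp add: poly_shift_def degree_pcompose)

lemma lead_coeff_poly_shift [simp]: "lead_coeff (poly_shift c h) = lead_coeff h"
  by (simp add: poly_shift_def lead_coeff_comp)

lemma coeff_poly_shift_lead: "coeff (poly_shift c h) (degree h) = lead_coeff h"
  using lead_coeff_poly_shift[of c h] by simp

text \<open>The leading coefficients cancel. The zero polynomial is listed separately because the
  strict inequality fails when \<open>h\<close> is constant.\<close>

lemma degree_poly_shift_diff:
  "poly_shift c h - poly_shift e h = 0 \<or> degree (poly_shift c h - poly_shift e h) < degree h"
proof (cases "degree h = 0")
  case True
  then obtain a where "h = [:a:]" by (metis degree_eq_zeroE)
  then show ?thesis by (simp add: poly_shift_def)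
next
  case False
  have "degree (poly_shift c h - poly_shift e h) \<le> degree h" by (rule degree_diff_le) simp_all
  moreover have "degree (poly_shift c h - poly_shift e h) = degree h \<Longrightarrow> poly_shift c h - poly_shift e h = 0"
    by (metis coeff_diff coeff_poly_shift_lead diff_self leading_coeff_0_iff)
  ultimately show ?thesis by linarith
qed

lemma poly_eventually_eq:
  fixes p q :: "rat poly"
  assumes "\<forall>\<^sub>F d in sequentially. poly p (of_nat d) = poly q (of_nat d)"
  shows "p = q"
proof (rule ccontr)
  assume "p \<noteq> q"
  then have fin: "finite {x. poly (p - q) x = 0}" by (intro poly_roots_finite) simp
  obtain N where N: "\<And>d. d \<ge> N \<Longrightarrow> poly p (of_nat d) = poly q (of_nat d)"
    using assms by (auto simp: eventually_sequentially)
  have "(of_nat :: nat \<Rightarrow> rat) ` {N..} \<subseteq> {x. poly (p - q) x = 0}" using N by auto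
  then have "finite ((of_nat :: nat \<Rightarrow> rat) ` {N..})" using fin finite_subset by blast
  then have "finite {N..}" by (rule finite_imageD) (auto intro: inj_onI)
  then show False by (simp add: infinite_Ici)
qed

lemma one_plus_quotient_mult: "(l :: rat) > 0 \<Longrightarrow> (1 + a / l) * l = l + a"
  by (simp add: distrib_right)

lemma poly_eventually_gt_lead_coeff:
  fixes p :: "rat poly"
  assumes "lead_coeff p > 0"
  shows "\<exists>N. \<forall>d\<ge>N. poly p (of_nat d) \<ge> lead_coeff p"
  using assms
proof (induction p)
  case (pCons a p)
  show ?case
  proof (cases "p = 0")
    case True then show ?thesis by simp
  next
    case False
    then have lc: "lead_coeff p > 0" using pCons.prems by simp
    then obtain N where N: "\<And>d. d \<ge> N \<Longrightarrow> poly p (of_nat d) \<ge> lead_coeff p" using pCons.IH by blast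
    define M where "M = N + nat \<lceil>1 + \<bar>a\<bar> / lead_coeff p\<rceil>"
    have "poly (pCons a p) (of_nat d) \<ge> lead_coeff p" if d: "d \<ge> M" for d
    proof -
      have "1 + \<bar>a\<bar> / lead_coeff p \<le> of_nat (nat \<lceil>1 + \<bar>a\<bar> / lead_coeff p\<rceil>)" by (rule of_nat_ceiling)
      also have "\<dots> \<le> of_nat d" using d by (simp add: M_def)
      finally have "(1 + \<bar>a\<bar> / lead_coeff p) * lead_coeff p \<le> of_nat d * poly p (of_nat d)"
        using N[of d] d lc by (intro mult_mono) (auto simp: M_def)
      then have "lead_coeff p + \<bar>a\<bar> \<le> of_nat d * poly p (of_nat d)" using lc one_plus_quotient_mult[of "lead_coeff p" "\<bar>a\<bar>"] by simp
      then show ?thesis using abs_ge_minus_self[of a] by simp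
    qed
    then show ?thesis using False by (auto intro: exI[of _ M])
  qed
qed simp

lemma poly_eventually_nonneg:
  fixes p :: "rat poly"
  assumes "\<forall>\<^sub>F d in sequentially. poly p (of_nat d) \<ge> 0"
  shows "lead_coeff p \<ge> 0"
proof (rule ccontr)
  assume "\<not> lead_coeff p \<ge> 0"
  then have "lead_coeff (- p) > 0" by simp
  then obtain N where N: "\<And>d. d \<ge> N \<Longrightarrow> poly (- p) (of_nat d) \<ge> lead_coeff (- p)"
    using poly_eventually_gt_lead_coeff by blast
  obtain M where M: "\<And>d. d \<ge> M \<Longrightarrow> poly p (of_nat d) \<ge> 0"
    using assms by (auto simp: eventually_sequentially)
  show False using N[of "max N M"] M[of "max N M"] \<open>lead_coeff (- p) > 0\<close> by simp
qed

text \<open>Growth compares degrees. Zero is kept apart from the nonzero constants, which have the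
  same \<open>degree\<close>: a zero Hilbert polynomial and a nonzero constant one must not be
  confused in the dimension count.\<close>

lemma poly_eventually_dominated:
  fixes p q :: "rat poly"
  assumes p: "\<forall>\<^sub>F d in sequentially. poly p (of_nat d) \<ge> 0"
    and pq: "\<forall>\<^sub>F d in sequentially. poly p (of_nat d) \<le> poly q (of_nat d)"
  shows "p = 0 \<or> (q \<noteq> 0 \<and> degree p \<le> degree q)"
proof (rule ccontr)
  assume neg: "\<not> ?thesis"
  then have p0: "p \<noteq> 0" by simp
  have lcp: "lead_coeff p > 0" using poly_eventually_nonneg[OF p] p0 by (simp add: less_le)
  have "\<forall>\<^sub>F d in sequentially. poly (q - p) (of_nat d) \<ge> 0" using pq by (simp add: algebra_simps)
  then have "lead_coeff (q - p) \<ge> 0" by (rule poly_eventually_nonneg)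
  moreover have "lead_coeff (q - p) = - lead_coeff p"
  proof (cases "q = 0")
    case False
    then have "degree (- p) > degree q" using neg by simp
    then have "lead_coeff (q + - p) = lead_coeff (- p)" by (rule lead_coeff_add_le)
    then show ?thesis by simp
  qed simp
  ultimately show False using lcp by simp
qed

section \<open>Differences and sums of eventually polynomial functions\<close>

definition poly_diff :: "rat poly \<Rightarrow> rat poly"
  where "poly_diff h = poly_shift 1 h - h"

lemma coeff_poly_shift_monom:
  "coeff (poly_shift 1 (monom c n)) i = c * of_nat (n choose i)"
proof -
  have "poly (poly_shift 1 (monom c n)) = poly (smult c ([:1, 1:] ^ n))"
    by (rule ext) (simp add: poly_monom add.commute)
  then have eq: "poly_shift 1 (monom c n) = smult c ([:1, 1:] ^ n)"
    by (simp add: poly_eq_poly_eq_iff)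
  show ?thesis
  proof (cases "i \<le> n")
    case False
    have "degree ([:1, 1 :: rat:] ^ n) \<le> n" using degree_power_le[of "[:1, 1 :: rat:]" n] by simp
    then show ?thesis using False by (simp add: eq coeff_eq_0 binomial_eq_0)
  qed (simp add: eq coeff_linear_poly_power)
qed

lemma coeff_poly_diff:
  assumes "degree h \<le> n"
  shows "i \<ge> n \<Longrightarrow> coeff (poly_diff h) i = 0"
    and "n = Suc m \<Longrightarrow> coeff (poly_diff h) m = of_nat n * coeff h n"
proof -
  have h: "h = (\<Sum>j\<le>n. monom (coeff h j) j)" using poly_as_sum_of_monoms'[OF assms] by simp
  have c: "coeff (poly_shift 1 h) i = (\<Sum>j\<le>n. coeff h j * of_nat (j choose i))" for i
  proof -
    have "poly_shift 1 h = (\<Sum>j\<le>n. poly_shift 1 (monom (coeff h j) j))"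
      by (subst h) (simp add: poly_shift_def pcompose_sum)
    then show ?thesis by (simp add: coeff_sum coeff_poly_shift_monom)
  qed
  show "coeff (poly_diff h) i = 0" if "i \<ge> n"
  proof -
    have "(\<Sum>j\<le>n. coeff h j * of_nat (j choose i)) = (\<Sum>j\<le>n. if j = i then coeff h i else 0)"
      using that by (intro sum.cong refl) (auto simp: binomial_eq_0)
    also have "\<dots> = coeff h i" using that assms by (auto simp: coeff_eq_0)
    finally show ?thesis by (simp add: poly_diff_def c)
  qed
  show "coeff (poly_diff h) m = of_nat n * coeff h n" if "n = Suc m"
  proof -
    have "(\<Sum>j\<le>n. coeff h j * of_nat (j choose m)) = coeff h m + coeff h n * of_nat n"
    proof -
      have "(\<Sum>j\<le>m. coeff h j * of_nat (j choose m)) = (\<Sum>j\<le>m. if j = m then coeff h m else 0)"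
        by (intro sum.cong refl) (auto simp: binomial_eq_0)
      then show ?thesis by (simp add: that)
    qed
    then show ?thesis by (simp add: poly_diff_def c mult.commute)
  qed
qed

text \<open>The difference of \<open>x ^ (n + 1) / (n + 1)\<close> has leading term
  \<open>x ^ n\<close>; subtracting a suitable multiple leaves a polynomial of smaller degree or
  zero.\<close>

lemma poly_diff_surj: "\<exists>H. poly_diff H = h"
proof (induction "degree h" arbitrary: h rule: less_induct)
  case less
  define n where "n = degree h"
  define q where "q = monom (lead_coeff h / of_nat (Suc n)) (Suc n)"
  define r where "r = h - poly_diff q"
  have deg_q: "degree q \<le> Suc n" by (simp add: q_def degree_monom_le)
  have r0: "coeff r i = 0" if "i \<ge> n" for i
  proof (cases "i = n")
    case True
    then show ?thesis using coeff_poly_diff(2)[OF deg_q refl] by (simp add: r_def q_def n_def)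
  next
    case False
    then show ?thesis using that coeff_poly_diff(1)[OF deg_q, of i] by (simp add: r_def coeff_eq_0 n_def)
  qed
  have add: "poly_diff (a + b) = poly_diff a + poly_diff b" for a b
    by (simp add: poly_diff_def poly_shift_def pcompose_add)
  show ?case
  proof (cases "r = 0")
    case True then show ?thesis by (metis eq_iff_diff_eq_0 r_def)
  next
    case False
    then have "degree r < n" using r0 by (metis leading_coeff_0_iff not_le)
    then obtain H where "poly_diff H = r" using less unfolding n_def by blast
    then have "poly_diff (q + H) = h" by (simp add: add r_def)
    then show ?thesis by blast
  qed
qed

definition evpoly :: "(nat \<Rightarrow> nat) \<Rightarrow> bool"
  where "evpoly f \<longleftrightarrow> (\<exists>h :: rat poly. \<forall>\<^sub>F d in sequentially. poly h (of_nat d) = of_nat (f d))"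

lemma evpoly_cong:
  assumes "\<forall>\<^sub>F d in sequentially. f d = g d" "evpoly f"
  shows "evpoly g"
proof -
  obtain h :: "rat poly" where h: "\<forall>\<^sub>F d in sequentially. poly h (of_nat d) = of_nat (f d)"
    using assms(2) by (auto simp: evpoly_def)
  have "\<forall>\<^sub>F d in sequentially. poly h (of_nat d) = of_nat (g d)"
    using h assms(1) by eventually_elim simp
  then show ?thesis by (auto simp: evpoly_def)
qed

lemma evpoly_const [simp]: "evpoly (\<lambda>d. c)"
  unfolding evpoly_def by (rule exI[of _ "[:of_nat c:]"]) simp

lemma evpoly_add: "evpoly f \<Longrightarrow> evpoly g \<Longrightarrow> evpoly (\<lambda>d. f d + g d)"
  unfolding evpoly_def
proof (elim exE)
  fix h k :: "rat poly" assume "\<forall>\<^sub>F d in sequentially. poly h (of_nat d) = of_nat (f d)"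
    "\<forall>\<^sub>F d in sequentially. poly k (of_nat d) = of_nat (g d)"
  then have "\<forall>\<^sub>F d in sequentially. poly (h + k) (of_nat d) = of_nat (f d + g d)"
    by eventually_elim simp
  then show "\<exists>h :: rat poly. \<forall>\<^sub>F d in sequentially. poly h (of_nat d) = of_nat (f d + g d)" by blast
qed

lemma evpoly_sum: "(\<And>i. i \<in> S \<Longrightarrow> evpoly (f i)) \<Longrightarrow> evpoly (\<lambda>d. \<Sum>i\<in>S. f i d)"
  by (induction S rule: infinite_finite_induct) (simp_all add: evpoly_add)

lemma eventually_shift_right:
  assumes h: "\<forall>\<^sub>F d in sequentially. poly h (of_nat d) = of_nat (f d)"
  shows "\<forall>\<^sub>F d in sequentially. poly (poly_shift (- of_nat k) h) (of_nat d) = of_nat (f (d - k))"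
proof -
  obtain N where N: "\<And>d. d \<ge> N \<Longrightarrow> poly h (of_nat d) = of_nat (f d)"
    using h by (auto simp: eventually_sequentially)
  have "poly (poly_shift (- of_nat k) h) (of_nat d) = of_nat (f (d - k))" if "d \<ge> N + k" for d
    using N[of "d - k"] that by (simp add: of_nat_diff)
  then show ?thesis by (auto simp: eventually_sequentially)
qed

lemma evpoly_shift: "evpoly f \<Longrightarrow> evpoly (\<lambda>d. f (d - k))"
  using eventually_shift_right unfolding evpoly_def by blast

lemma evpoly_cumulative:
  assumes "evpoly f"
  shows "evpoly (\<lambda>d. \<Sum>k\<le>d. f k)"
proof -
  obtain h :: "rat poly" and N where N: "\<And>d. d \<ge> N \<Longrightarrow> poly h (of_nat d) = of_nat (f d)"
    using assms by (auto simp: evpoly_def eventually_sequentially)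
  obtain H where H: "poly_diff H = h" using poly_diff_surj by blast
  have Hd: "poly H (of_nat d + 1) = poly H (of_nat d) + poly h (of_nat d)" for d
    by (simp add: H[symmetric] poly_diff_def)
  \<comment> \<open>The constant adjusts the discrete antiderivative at the threshold
    \<open>N\<close> and thereby takes up the irregular values of \<open>f\<close> below it.\<close>
  define G where "G = poly_shift 1 H + [:of_nat (\<Sum>k\<le>N. f k) - poly H (of_nat N + 1):]"
  have "poly G (of_nat d) = of_nat (\<Sum>k\<le>d. f k)" if "d \<ge> N" for d
    using that
  proof (induction d rule: dec_induct)
    case base then show ?case by (simp add: G_def)
  next
    case (step d)
    have "poly G (of_nat (Suc d)) = poly G (of_nat d) + poly h (of_nat (Suc d))"
      using Hd[of "Suc d"] by (simp add: G_def algebra_simps)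
    then show ?case using step N[of "Suc d"] by simp
  qed
  then show ?thesis unfolding evpoly_def eventually_sequentially by blast
qed

text \<open>Iterated differences of an integer valued polynomial are integer valued.\<close>

lemma integer_valued_lead_coeff:
  assumes "\<forall>\<^sub>F d in sequentially. poly h (of_nat d) \<in> \<int>"
  shows "fact (degree h) * lead_coeff h \<in> (\<int> :: rat set)"
  using assms
proof (induction "degree h" arbitrary: h)
  case 0
  then obtain a where "h = [:a:]" by (metis degree_eq_zeroE)
  then show ?case using 0 by (auto simp: eventually_sequentially)
next
  case (Suc n)
  let ?g = "poly_diff h"
  obtain N where N: "\<And>d. d \<ge> N \<Longrightarrow> poly h (of_nat d) \<in> \<int>"
    using Suc.prems by (auto simp: eventually_sequentially)
  have "poly ?g (of_nat d) \<in> \<int>" if "d \<ge> N" for d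
    using N[of d] N[of "Suc d"] that by (simp add: poly_diff_def add.commute)
  then have ev: "\<forall>\<^sub>F d in sequentially. poly ?g (of_nat d) \<in> \<int>"
    by (auto simp: eventually_sequentially)
  have c: "coeff ?g n = of_nat (Suc n) * lead_coeff h" "\<And>i. i \<ge> Suc n \<Longrightarrow> coeff ?g i = 0"
    using coeff_poly_diff[of h "Suc n"] Suc.hyps(2) by simp_all
  have "coeff ?g n \<noteq> 0" using c(1) Suc.hyps(2) by auto
  then have "degree ?g = n" using c(2) by (metis le_degree le_antisym leading_coeff_0_iff not_less_eq_eq coeff_0)
  then have "fact n * (of_nat (Suc n) * lead_coeff h) \<in> \<int>"
    using Suc.hyps(1)[of ?g] ev c(1) by simp
  then show ?case using Suc.hyps(2)[symmetric] by (simp add: mult_ac)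
qed

subsection \<open>Dickson's lemma and counting in down-closed sets of monomials\<close>

definition monoms :: "'i set \<Rightarrow> ('i \<Rightarrow>\<^sub>0 nat) set"
  where "monoms I = {m. Poly_Mapping.keys m \<subseteq> I}"

definition monom_le :: "('i \<Rightarrow>\<^sub>0 nat) \<Rightarrow> ('i \<Rightarrow>\<^sub>0 nat) \<Rightarrow> bool"
  where "monom_le m m' \<longleftrightarrow> (\<forall>i. Poly_Mapping.lookup m i \<le> Poly_Mapping.lookup m' i)"

lemma monoms_down:
  assumes "monom_le m' m" "m \<in> monoms I"
  shows "m' \<in> monoms I"
proof -
  have "i \<in> Poly_Mapping.keys m" if "i \<in> Poly_Mapping.keys m'" for i
    using that assms(1) by (metis in_keys_iff le_zero_eq monom_le_def)
  then show ?thesis using assms(2) by (auto simp: monoms_def)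
qed

definition down_closed :: "('i \<Rightarrow>\<^sub>0 nat) set \<Rightarrow> bool"
  where "down_closed D \<longleftrightarrow> (\<forall>m\<in>D. \<forall>m'. monom_le m' m \<longrightarrow> m' \<in> D)"

text \<open>A monotone subsequence exists, and if it is decreasing it becomes constant.\<close>

lemma nat_seq_mono_subseq:
  fixes s :: "nat \<Rightarrow> nat"
  shows "\<exists>f :: nat \<Rightarrow> nat. strict_mono f \<and> mono (\<lambda>n. s (f n))"
proof -
  obtain f :: "nat \<Rightarrow> nat" where f: "strict_mono f" "monoseq (\<lambda>n. s (f n))" using seq_monosub by blast
  then consider "mono (\<lambda>n. s (f n))" | "\<And>m n. m \<le> n \<Longrightarrow> s (f n) \<le> s (f m)"
    by (auto simp: monoseq_def mono_def)
  then show ?thesis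
  proof cases
    case 1 then show ?thesis using f by blast
  next
    case 2
    obtain n0 where n0: "\<And>n. s (f n0) \<le> s (f n)"
      using ex_has_least_nat[of "\<lambda>_. True" 0 "\<lambda>n. s (f n)"] by auto
    have "s (f (n0 + n)) = s (f n0)" for n using n0[of "n0 + n"] 2[of n0 "n0 + n"] by simp
    moreover have "strict_mono (\<lambda>n. f (n0 + n))" using f(1) by (auto simp: strict_mono_def)
    ultimately show ?thesis by (intro exI[of _ "\<lambda>n. f (n0 + n)"]) (auto simp: mono_def)
  qed
qed

lemma monoms_mono_subseq:
  fixes s :: "nat \<Rightarrow> ('i \<Rightarrow>\<^sub>0 nat)"
  assumes "finite I"
  shows "\<exists>f :: nat \<Rightarrow> nat. strict_mono f \<and> (\<forall>i\<in>I. mono (\<lambda>n. Poly_Mapping.lookup (s (f n)) i))"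
  using assms
proof (induction I rule: finite_induct)
  case empty
  show ?case by (rule exI[of _ id]) (simp add: strict_mono_def)
next
  case (insert x I)
  then obtain f :: "nat \<Rightarrow> nat" where f: "strict_mono f" "\<And>i. i \<in> I \<Longrightarrow> mono (\<lambda>n. Poly_Mapping.lookup (s (f n)) i)" by blast
  obtain g :: "nat \<Rightarrow> nat" where g: "strict_mono g" "mono (\<lambda>n. Poly_Mapping.lookup (s (f (g n))) x)"
    using nat_seq_mono_subseq[of "\<lambda>n. Poly_Mapping.lookup (s (f n)) x"] by blast
  have "strict_mono (\<lambda>n. f (g n))" using f(1) g(1) by (auto simp: strict_mono_def)
  moreover have "mono (\<lambda>n. Poly_Mapping.lookup (s (f (g n))) i)" if "i \<in> I" for i
    using f(2)[OF that] g(1) by (auto simp: mono_def strict_mono_less_eq)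
  ultimately show ?case using g(2) by (intro exI[of _ "\<lambda>n. f (g n)"]) auto
qed

lemma dickson:
  fixes s :: "nat \<Rightarrow> ('i \<Rightarrow>\<^sub>0 nat)"
  assumes "finite I" "\<And>n. s n \<in> monoms I"
  shows "\<exists>m n. m < n \<and> monom_le (s m) (s n)"
proof -
  obtain f :: "nat \<Rightarrow> nat" where f: "strict_mono f" "\<And>i. i \<in> I \<Longrightarrow> mono (\<lambda>n. Poly_Mapping.lookup (s (f n)) i)"
    using monoms_mono_subseq[OF assms(1)] by blast
  have "monom_le (s (f 0)) (s (f 1))" unfolding monom_le_def
  proof
    fix i
    show "Poly_Mapping.lookup (s (f 0)) i \<le> Poly_Mapping.lookup (s (f 1)) i"
    proof (cases "i \<in> I")
      case True then show ?thesis using f(2) by (auto simp: mono_def)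
    next
      case False
      then have "Poly_Mapping.lookup (s (f 0)) i = 0"
        using assms(2)[of "f 0"] by (auto simp: monoms_def in_keys_iff)
      then show ?thesis by simp
    qed
  qed
  moreover have "f 0 < f 1" using f(1) by (simp add: strict_mono_def)
  ultimately show ?thesis by blast
qed

text \<open>Otherwise pick a monomial that is lost at each of infinitely many strict steps. By
  Dickson's lemma an earlier one divides a later one, which was still present after the earlier one
  had been lost.\<close>

lemma down_closed_chain_stabilizes:
  fixes D :: "nat \<Rightarrow> ('i \<Rightarrow>\<^sub>0 nat) set"
  assumes fin: "finite I" and D: "\<And>k. D k \<subseteq> monoms I" "\<And>k. down_closed (D k)" "\<And>k. D (Suc k) \<subseteq> D k"
  shows "\<exists>K. \<forall>k\<ge>K. D k = D K"
proof (rule ccontr)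
  assume "\<not> ?thesis"
  then have ne: "\<exists>k\<ge>K. D k \<noteq> D K" for K by blast
  have anti: "D l \<subseteq> D k" if "k \<le> l" for k l
    using that by (induction l rule: dec_induct) (use D(3) in auto)
  have "\<exists>f. \<forall>n. D (f (Suc n)) \<subset> D (f n) \<and> f n < f (Suc n)"
  proof -
    have "\<exists>f. \<forall>n. True \<and> (D (f (Suc n)) \<subset> D (f n) \<and> f n < f (Suc n))"
    proof (rule dependent_nat_choice)
      fix x n
      obtain k where "k \<ge> x" "D k \<noteq> D x" using ne by blast
      then show "\<exists>y. True \<and> D y \<subset> D x \<and> x < y" using anti[of x k] by (intro exI[of _ k]) (auto simp: less_le)
    qed auto
    then show ?thesis by blast
  qed
  then obtain f where f: "\<And>n. D (f (Suc n)) \<subset> D (f n)" "\<And>n. f n < f (Suc n)" by blast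
  then have "\<forall>n. \<exists>m. m \<in> D (f n) - D (f (Suc n))" by blast
  then obtain s where s: "\<And>n. s n \<in> D (f n) - D (f (Suc n))" by metis
  obtain m n where mn: "m < n" "monom_le (s m) (s n)"
    using dickson[OF fin, of s] s D(1) by blast
  have "f (Suc m) \<le> f n" using f(2) mn(1) by (metis Suc_leI lift_Suc_mono_le less_imp_le)
  then have "s n \<in> D (f (Suc m))" using anti s by blast
  then have "s m \<in> D (f (Suc m))" using D(2) mn(2) by (auto simp: down_closed_def)
  then show False using s by blast
qed

lemma finite_monoms_degree:
  assumes "finite J"
  shows "finite {m \<in> monoms J. monom_degree m = d}"
proof -
  have "{m \<in> monoms J. monom_degree m = d} \<subseteq>
      {m. Poly_Mapping.keys m \<subseteq> J \<and> (\<forall>i\<in>J. Poly_Mapping.lookup m i \<le> d)}"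
  proof
    fix m assume m: "m \<in> {m \<in> monoms J. monom_degree m = d}"
    have "Poly_Mapping.lookup m i \<le> d" if "i \<in> J" for i
    proof -
      have "Poly_Mapping.lookup m i \<le> (\<Sum>i\<in>J. Poly_Mapping.lookup m i)"
        by (rule member_le_sum[OF that]) (use assms in auto)
      also have "\<dots> = d" using m monom_degree_superset[OF assms, of m] by (auto simp: monoms_def)
      finally show ?thesis .
    qed
    then show "m \<in> {m. Poly_Mapping.keys m \<subseteq> J \<and> (\<forall>i\<in>J. Poly_Mapping.lookup m i \<le> d)}"
      using m by (auto simp: monoms_def)
  qed
  moreover have "finite {m. Poly_Mapping.keys m \<subseteq> J \<and> (\<forall>i\<in>J. Poly_Mapping.lookup m i \<le> d)}"
  proof (rule finite_imageD)
    show "inj_on Poly_Mapping.lookup {m. Poly_Mapping.keys m \<subseteq> J \<and> (\<forall>i\<in>J. Poly_Mapping.lookup m i \<le> d)}"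
      by (auto intro!: inj_onI poly_mapping_eqI)
    have "Poly_Mapping.lookup ` {m. Poly_Mapping.keys m \<subseteq> J \<and> (\<forall>i\<in>J. Poly_Mapping.lookup m i \<le> d)}
        \<subseteq> {f. \<forall>i. (i \<in> J \<longrightarrow> f i \<in> {..d}) \<and> (i \<notin> J \<longrightarrow> f i = 0)}"
      by (auto simp: in_keys_iff)
    then show "finite (Poly_Mapping.lookup ` {m. Poly_Mapping.keys m \<subseteq> J \<and> (\<forall>i\<in>J. Poly_Mapping.lookup m i \<le> d)})"
      by (rule finite_subset) (rule finite_set_of_finite_funs, use assms in auto)
  qed
  ultimately show ?thesis by (rule finite_subset)
qed

text \<open>Slicing by the exponent \<open>k\<close> of one variable gives down-closed sets
  \<open>S k\<close> in the other variables that decrease with \<open>k\<close>, hence are constant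
  from some \<open>K\<close> on. The count is a finite sum of shifts for \<open>k < K\<close> plus a
  cumulative sum for the stable slice.\<close>

lemma down_closed_count_evpoly:
  assumes "finite I" "D \<subseteq> monoms I" "down_closed D"
  shows "evpoly (\<lambda>d. card {m \<in> D. monom_degree m = d})"
  using assms
proof (induction I arbitrary: D rule: finite_induct)
  case empty
  have "\<forall>\<^sub>F d in sequentially. 0 = card {m \<in> D. monom_degree m = d}"
    unfolding eventually_sequentially
  proof (intro exI[of _ 1] allI impI)
    fix d :: nat assume "1 \<le> d"
    then have "{m \<in> D. monom_degree m = d} = {}" using empty by (auto simp: monoms_def)
    then show "0 = card {m \<in> D. monom_degree m = d}" by (metis card.empty)
  qed
  then show ?case by (rule evpoly_cong) simp
next
  case (insert x I)
  define S where "S k = {m \<in> monoms I. m + Poly_Mapping.single x k \<in> D}" for k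
  have Slookup: "Poly_Mapping.lookup m x = 0" if "m \<in> monoms I" for m
    using that insert.hyps by (auto simp: monoms_def in_keys_iff)
  have Ssub: "S k \<subseteq> monoms I" for k by (auto simp: S_def)
  have Sdown: "down_closed (S k)" for k
    unfolding down_closed_def
  proof (intro ballI allI impI)
    fix m m' assume m: "m \<in> S k" "monom_le m' m"
    have "monom_le (m' + Poly_Mapping.single x k) (m + Poly_Mapping.single x k)"
      using m(2) by (auto simp: monom_le_def lookup_add)
    then have "m' + Poly_Mapping.single x k \<in> D" using m(1) insert.prems(2) by (auto simp: down_closed_def S_def)
    moreover have "m' \<in> monoms I"
      using monoms_down[OF m(2)] m(1) by (simp add: S_def)
    ultimately show "m' \<in> S k" by (simp add: S_def)
  qed
  have Santi: "S (Suc k) \<subseteq> S k" for k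
  proof
    fix m assume m: "m \<in> S (Suc k)"
    have "monom_le (m + Poly_Mapping.single x k) (m + Poly_Mapping.single x (Suc k))"
      by (auto simp: monom_le_def lookup_add lookup_single when_def)
    then show "m \<in> S k" using m insert.prems(2) by (auto simp: down_closed_def S_def)
  qed
  obtain K where K: "\<And>k. k \<ge> K \<Longrightarrow> S k = S K"
    using down_closed_chain_stabilizes[of I S] insert.hyps(1) Ssub Sdown Santi by blast
  define c where "c k d = card {m \<in> S k. monom_degree m = d}" for k d
  have cev: "evpoly (c k)" for k unfolding c_def by (rule insert.IH[OF Ssub Sdown])
  have count: "card {m \<in> D. monom_degree m = d} = (\<Sum>k\<le>d. c k (d - k))" for d
  proof -
    define T where "T k = (\<lambda>m. m + Poly_Mapping.single x k) ` {m \<in> S k. monom_degree m = d - k}" for k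
    have "{m \<in> D. monom_degree m = d} = (\<Union>k\<in>{..d}. T k)"
    proof (intro equalityI subsetI)
      fix m assume m: "m \<in> {m \<in> D. monom_degree m = d}"
      define k where "k = Poly_Mapping.lookup m x"
      define m' where "m' = m - Poly_Mapping.single x k"
      have mm': "m = m' + Poly_Mapping.single x k"
        by (rule poly_mapping_eqI) (simp add: m'_def lookup_add lookup_minus lookup_single when_def k_def)
      have "m' \<in> monoms I"
      proof -
        have "Poly_Mapping.lookup m' x = 0" by (simp add: m'_def lookup_minus k_def)
        moreover have "monom_le m' m" by (simp add: monom_le_def m'_def lookup_minus)
        then have "m' \<in> monoms (insert x I)" using m insert.prems(1) by (blast intro: monoms_down)
        ultimately show ?thesis unfolding monoms_def by (metis (mono_tags, lifting) in_keys_iff insertE mem_Collect_eq subsetD subsetI)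
      qed
      then have "m' \<in> S k" using m mm' by (simp add: S_def)
      moreover have "monom_degree m = monom_degree m' + k"
        using mm' monom_degree_add[of m' "Poly_Mapping.single x k"] by simp
      ultimately show "m \<in> (\<Union>k\<in>{..d}. T k)" unfolding T_def using m mm' by (intro UN_I[of k]) auto
    next
      fix m assume "m \<in> (\<Union>k\<in>{..d}. T k)"
      then show "m \<in> {m \<in> D. monom_degree m = d}" by (auto simp: T_def S_def monom_degree_add)
    qed
    also have "card \<dots> = (\<Sum>k\<le>d. card (T k))"
    proof (rule card_UN_disjoint)
      show "\<forall>k\<in>{..d}. finite (T k)"
        unfolding T_def using Ssub
        by (intro ballI finite_imageI finite_subset[OF _ finite_monoms_degree[OF insert.hyps(1)]]) blast
      show "\<forall>i\<in>{..d}. \<forall>j\<in>{..d}. i \<noteq> j \<longrightarrow> T i \<inter> T j = {}"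
      proof (intro ballI impI)
        fix i j :: nat assume ij: "i \<noteq> j"
        have "Poly_Mapping.lookup m x = k" if mk: "m \<in> T k" for m k
        proof -
          obtain ma where "m = ma + Poly_Mapping.single x k" "ma \<in> S k" using mk by (auto simp: T_def)
          moreover have "Poly_Mapping.lookup ma x = 0" using Slookup Ssub calculation(2) by blast
          ultimately show ?thesis by (simp add: lookup_add)
        qed
        then show "T i \<inter> T j = {}" using ij by blast
      qed
    qed simp
    also have "\<dots> = (\<Sum>k\<le>d. c k (d - k))"
      unfolding T_def c_def by (intro sum.cong refl card_image) (auto intro: inj_onI)
    finally show ?thesis .
  qed
  have "\<forall>\<^sub>F d in sequentially. (\<Sum>k<K. c k (d - k)) + (\<Sum>j\<le>d - K. c K j) =
      card {m \<in> D. monom_degree m = d}"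
    unfolding eventually_sequentially
  proof (intro exI[of _ K] allI impI)
    fix d assume d: "K \<le> d"
    have "(\<Sum>k\<le>d. c k (d - k)) = (\<Sum>k<K. c k (d - k)) + (\<Sum>k=K..d. c k (d - k))"
      using d by (subst sum.union_disjoint[symmetric]) (auto intro!: sum.cong)
    also have "(\<Sum>k=K..d. c k (d - k)) = (\<Sum>k=K..d. c K (d - k))"
    proof (intro sum.cong refl)
      fix k assume "k \<in> {K..d}"
      then have "S k = S K" by (intro K) simp
      then show "c k (d - k) = c K (d - k)" by (simp add: c_def)
    qed
    also have "\<dots> = (\<Sum>j\<le>d - K. c K j)"
      by (rule sum.reindex_bij_witness[of _ "\<lambda>j. d - j" "\<lambda>k. d - k"]) (use d in auto)
    finally show "(\<Sum>k<K. c k (d - k)) + (\<Sum>j\<le>d - K. c K j) = card {m \<in> D. monom_degree m = d}"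
      by (simp add: count)
  qed
  moreover have "evpoly (\<lambda>d. (\<Sum>k<K. c k (d - k)) + (\<Sum>j\<le>d - K. c K j))"
    by (intro evpoly_add evpoly_sum evpoly_shift cev evpoly_shift[OF evpoly_cumulative[OF cev]])
  ultimately show ?case by (rule evpoly_cong)
qed

subsection \<open>Rank and nullity\<close>

text \<open>The spaces of polynomials and functions are infinite dimensional, so finiteness is
  expressed by a finite set whose span contains \<open>U\<close>. A basis of the kernel is extended
  to one of \<open>U\<close>, and the added vectors map to a basis of the image.\<close>

lemma (in vector_space_pair) rank_nullity:
  assumes f: "Vector_Spaces.linear s1 s2 f" and U: "vs1.subspace U"
    and G: "finite G" "U \<subseteq> vs1.span G"
  shows "vs1.dim U = vs1.dim {x \<in> U. f x = 0} + vs2.dim (f ` U)"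
proof -
  let ?K = "{x \<in> U. f x = 0}"
  obtain BK where BK: "BK \<subseteq> ?K" "vs1.independent BK" "?K \<subseteq> vs1.span BK" "card BK = vs1.dim ?K"
    by (rule vs1.basis_exists)
  have "BK \<subseteq> U" using BK(1) by blast
  then obtain B where B: "BK \<subseteq> B" "B \<subseteq> U" "vs1.independent B" "U \<subseteq> vs1.span B"
    using vs1.maximal_independent_subset_extend[OF _ BK(2)] by blast
  have finB: "finite B" using vs1.independent_span_bound[OF G(1) B(3)] B(2) G(2) by blast
  define C where "C = B - BK"
  have CB: "C \<subseteq> B" by (auto simp: C_def)
  have CU: "vs1.span C \<subseteq> U" using vs1.span_minimal[OF _ U, of C] CB B(2) by blast
  have inj: "inj_on f (vs1.span C)"
    unfolding linear_inj_on_iff_eq_0[OF f vs1.subspace_span]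
  proof (intro ballI impI)
    fix x assume x: "x \<in> vs1.span C" "f x = 0"
    then have xK: "x \<in> vs1.span BK" using CU BK(3) by blast
    let ?r = "vs1.representation B x"
    have 1: "?r = vs1.representation C x" by (rule vs1.representation_extend[OF B(3) x(1) CB])
    have 2: "?r = vs1.representation BK x" by (rule vs1.representation_extend[OF B(3) xK B(1)])
    have "?r b = 0" for b
    proof (rule ccontr)
      assume "?r b \<noteq> 0"
      then have "b \<in> C" "b \<in> BK"
        using 1 2 vs1.representation_ne_zero[of C x b] vs1.representation_ne_zero[of BK x b] by simp_all
      then show False by (simp add: C_def)
    qed
    moreover have "(\<Sum>b | ?r b \<noteq> 0. ?r b *a b) = x"
      using vs1.sum_nonzero_representation_eq[OF B(3)] x(1) CU B(4) by blast
    ultimately show "x = 0" by simp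
  qed
  have indC: "vs1.independent C" using B(3) CB vs1.independent_mono by blast
  have "vs2.independent (f ` C)" by (rule linear_independent_injective_image[OF f indC inj])
  moreover have "f ` C \<subseteq> f ` U" using CB B(2) by blast
  moreover have "f ` U \<subseteq> vs2.span (f ` C)"
  proof -
    have "f ` U \<subseteq> vs2.span (f ` B)" using B(4) linear_span_image[OF f, of B] by blast
    also have "\<dots> \<subseteq> vs2.span (f ` C)"
    proof (rule vs2.span_minimal[OF _ vs2.subspace_span])
      show "f ` B \<subseteq> vs2.span (f ` C)"
      proof (rule image_subsetI)
        fix b assume b: "b \<in> B"
        show "f b \<in> vs2.span (f ` C)"
        proof (cases "b \<in> BK")
          case True
          then have "f b = 0" using BK(1) by blast
          then show ?thesis by (simp add: vs2.span_zero)
        next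
          case False
          then show ?thesis using b by (intro vs2.span_base) (simp add: C_def)
        qed
      qed
    qed
    finally show ?thesis .
  qed
  ultimately have "card (f ` C) = vs2.dim (f ` U)" by (intro vs2.basis_card_eq_dim)
  moreover have "card (f ` C) = card C"
    using inj vs1.span_superset[of C] by (intro card_image) (rule inj_on_subset)
  moreover have "card B = vs1.dim U" using vs1.basis_card_eq_dim[OF B(2,4,3)] .
  moreover have "card C = card B - card BK" unfolding C_def
    using finB B(1) by (intro card_Diff_subset) (auto intro: finite_subset)
  moreover have "card BK \<le> card B" using finB B(1) by (rule card_mono)
  ultimately show ?thesis using BK(4) by simp
qed

lemma (in vector_space) dim_mono_finite:
  assumes "U \<subseteq> span W" "W \<subseteq> span G" "finite G"
  shows "dim U \<le> dim W"
proof -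
  obtain BU where BU: "BU \<subseteq> U" "independent BU" "U \<subseteq> span BU" "card BU = dim U" by (rule basis_exists)
  obtain BW where BW: "BW \<subseteq> W" "independent BW" "W \<subseteq> span BW" "card BW = dim W" by (rule basis_exists)
  have "finite BW" using independent_span_bound[OF assms(3) BW(2)] BW(1) assms(2) by blast
  moreover have "BU \<subseteq> span BW"
    using BU(1) assms(1) BW(3) span_minimal[OF BW(3) subspace_span] by blast
  ultimately have "card BU \<le> card BW" using independent_span_bound[OF _ BU(2)] by blast
  then show ?thesis using BU(4) BW(4) by simp
qed

text \<open>Running through the vectors in increasing order and keeping the new ones yields a basis.
  Membership is a condition on the single index \<open>m\<close>, which later makes it compatible
  with multiplication of monomials.\<close>

lemma (in vector_space) greedy_basis:
  fixes v :: "'m \<Rightarrow> 'b"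
  assumes fin: "finite M"
    and total: "\<And>x y. x \<in> M \<Longrightarrow> y \<in> M \<Longrightarrow> x \<noteq> y \<Longrightarrow> lt x y \<or> lt y x"
    and trans: "\<And>x y z. lt x y \<Longrightarrow> lt y z \<Longrightarrow> lt x z" and irrefl: "\<And>x. \<not> lt x x"
  defines "St \<equiv> \<lambda>M. {m \<in> M. v m \<notin> span (v ` {m' \<in> M. lt m' m})}"
  shows "inj_on v (St M) \<and> independent (v ` St M) \<and> span (v ` St M) = span (v ` M)"
  using fin total
proof (induction "card M" arbitrary: M)
  case 0
  then show ?case by (simp add: St_def independent_empty)
next
  case (Suc n)
  have "\<exists>a\<in>M. \<forall>y\<in>M. a = y \<or> lt y a"
  proof (rule ex_minimal_total[OF Suc.prems(1)])
    show "M \<noteq> {}" using Suc.hyps(2) by auto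
    show "(x = y \<or> lt y x) \<or> (y = x \<or> lt x y)" if "x \<in> M" "y \<in> M" for x y
      using Suc.prems(2)[OF that] by blast
    show "x = z \<or> lt z x" if "x = y \<or> lt y x" "y = z \<or> lt z y" for x y z
      using that trans[of z y x] by auto
  qed
  then obtain a where aM: "a \<in> M" "\<forall>y\<in>M. a = y \<or> lt y a" by (elim bexE)
  have a: "a \<in> M" "lt y a" if "y \<in> M" "y \<noteq> a" for y using aM bspec[OF aM(2) that(1)] that(2) by auto
  define N where "N = M - {a}"
  have N: "finite N" "card N = n" "M = insert a N" "a \<notin> N" using aM(1) Suc.prems(1) Suc.hyps(2) by (auto simp: N_def)
  have below_a: "{m' \<in> M. lt m' a} = N" using a(2) irrefl[of a] by (auto simp: N_def)
  have below: "{m' \<in> M. lt m' m} = {m' \<in> N. lt m' m}" if "m \<in> N" for m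
  proof -
    have "\<not> lt a m" using a(2)[of m] that trans[of m a m] irrefl[of m] by (auto simp: N_def)
    then show ?thesis by (auto simp: N_def)
  qed
  have StM: "St M = St N \<union> (if v a \<in> span (v ` N) then {} else {a})"
    unfolding St_def using N(3,4) below_a below by auto
  have IH: "inj_on v (St N)" "independent (v ` St N)" "span (v ` St N) = span (v ` N)"
    using Suc.hyps(1)[of N] N Suc.prems by auto
  show ?case
  proof (cases "v a \<in> span (v ` N)")
    case True
    then have "span (v ` M) = span (v ` N)" by (simp add: N(3) span_redundant)
    then show ?thesis using IH True StM by simp
  next
    case False
    have "v a \<notin> v ` St N"
      using False span_superset[of "v ` St N"] IH(3) by blast
    then have "inj_on v (St M)" using IH(1) False by (auto simp: StM)
    moreover have "independent (v ` St M)"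
      using independent_insertI[of "v a" "v ` St N"] False IH by (simp add: StM)
    moreover have "span (v ` St M) = span (v ` M)"
    proof -
      have "v ` St M = insert (v a) (v ` St N)" "v ` M = insert (v a) (v ` N)"
        using False StM N(3) by auto
      then show ?thesis using IH(3) by (simp add: span_insert)
    qed
    ultimately show ?thesis by blast
  qed
qed

subsection \<open>Functions on a cone\<close>

definition fun_scale :: "complex \<Rightarrow> ('x \<Rightarrow> complex) \<Rightarrow> 'x \<Rightarrow> complex"
  where "fun_scale c f = (\<lambda>x. c * f x)"

global_interpretation fs: vector_space fun_scale
  by unfold_locales (simp_all add: fun_scale_def fun_eq_iff algebra_simps)

global_interpretation cf: vector_space_pair cpoly_scale fun_scale ..

global_interpretation ff: vector_space_pair fun_scale fun_scale ..

text \<open>Extension by zero turns equality on \<open>C\<close> into equality of functions, so that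
  the coordinate ring of \<open>C\<close> is a subspace of a function space and not a
  quotient.\<close>

definition cone_eval :: "('i \<Rightarrow> complex) set \<Rightarrow> 'i cpoly \<Rightarrow> ('i \<Rightarrow> complex) \<Rightarrow> complex"
  where "cone_eval C f = (\<lambda>x. if x \<in> C then cpoly_eval f x else 0)"

definition coord_ring :: "'i set \<Rightarrow> ('i \<Rightarrow> complex) set \<Rightarrow> nat \<Rightarrow> (('i \<Rightarrow> complex) \<Rightarrow> complex) set"
  where "coord_ring I C d = cone_eval C ` forms I d"

definition hilb :: "'i set \<Rightarrow> ('i \<Rightarrow> complex) set \<Rightarrow> nat \<Rightarrow> nat"
  where "hilb I C d = fs.dim (coord_ring I C d)"

lemma linear_cone_eval: "Vector_Spaces.linear cpoly_scale fun_scale (cone_eval C)"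
  unfolding Vector_Spaces.linear_iff
  by (auto simp: cone_eval_def fun_eq_iff fun_scale_def cpoly_eval_add cpoly_eval_scale
      cpoly.vector_space_axioms fs.vector_space_axioms)

lemma subspace_forms: "cpoly.subspace (forms I d)"
  unfolding cpoly.subspace_def
proof (intro conjI ballI allI)
  show "0 \<in> forms I d" by (simp add: forms_def)
  show "f + g \<in> forms I d" if "f \<in> forms I d" "g \<in> forms I d" for f g
    using that Poly_Mapping.keys_add[of f g] by (fastforce simp: forms_def)
  show "cpoly_scale c f \<in> forms I d" if "f \<in> forms I d" for c f
  proof -
    have "Poly_Mapping.single 0 c \<in> forms I 0" by (auto simp: forms_def)
    then show ?thesis using forms_mult[of "Poly_Mapping.single 0 c" I 0 f d] that by (simp add: cpoly_scale_def)
  qed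
qed

abbreviation monoms_deg :: "'i set \<Rightarrow> nat \<Rightarrow> ('i \<Rightarrow>\<^sub>0 nat) set"
  where "monoms_deg I d \<equiv> {m \<in> monoms I. monom_degree m = d}"

lemma forms_eq_span: "forms I d = cpoly.span ((\<lambda>m. Poly_Mapping.single m 1) ` monoms_deg I d)"
proof
  show "forms I d \<subseteq> cpoly.span ((\<lambda>m. Poly_Mapping.single m 1) ` monoms_deg I d)"
  proof
    fix f assume f: "f \<in> forms I d"
    have "f = (\<Sum>m\<in>Poly_Mapping.keys f. cpoly_scale (Poly_Mapping.lookup f m) (Poly_Mapping.single m 1))"
      by (subst cpoly_sum_monomials) (simp add: cpoly_scale_def mult_single)
    also have "\<dots> \<in> cpoly.span ((\<lambda>m. Poly_Mapping.single m 1) ` monoms_deg I d)"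
      using f by (intro cpoly.span_sum cpoly.span_scale cpoly.span_base) (auto simp: forms_def monoms_def)
    finally show "f \<in> cpoly.span ((\<lambda>m. Poly_Mapping.single m 1) ` monoms_deg I d)" .
  qed
  show "cpoly.span ((\<lambda>m. Poly_Mapping.single m 1) ` monoms_deg I d) \<subseteq> forms I d"
    by (rule cpoly.span_minimal[OF _ subspace_forms]) (auto simp: forms_def monoms_def)
qed

definition monom_fun :: "('i \<Rightarrow> complex) set \<Rightarrow> ('i \<Rightarrow>\<^sub>0 nat) \<Rightarrow> ('i \<Rightarrow> complex) \<Rightarrow> complex"
  where "monom_fun C m = (\<lambda>x. if x \<in> C then monom_eval m x else 0)"

lemma cone_eval_single: "cone_eval C (Poly_Mapping.single m 1) = monom_fun C m"
  by (simp add: cone_eval_def monom_fun_def cpoly_eval_single fun_eq_iff)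

lemma coord_ring_eq_span: "coord_ring I C d = fs.span (monom_fun C ` monoms_deg I d)"
  unfolding coord_ring_def forms_eq_span cf.linear_span_image[OF linear_cone_eval, symmetric]
  by (simp add: image_image cone_eval_single)

lemma subspace_coord_ring: "fs.subspace (coord_ring I C d)"
  by (simp add: coord_ring_eq_span)

text \<open>Rank and nullity for evaluation on \<open>\<Union>X\<close>, whose kernel in degree
  \<open>d\<close> consists of the vanishing forms. For \<open>X\<close> in projective space,
  \<open>\<Union>X\<close> is the affine cone over \<open>X\<close> without the origin, as points
  are sets of representatives.\<close>

lemma hilbert_function_eq_hilb:
  assumes "finite I"
  shows "hilbert_function I X d = hilb I (\<Union>X) d"
proof -
  have "vanishing_forms I X d = {f \<in> forms I d. cone_eval (\<Union>X) f = 0}"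
    by (auto simp: vanishing_forms_def cone_eval_def fun_eq_iff)
  moreover have "cpoly.dim (forms I d) = cpoly.dim {f \<in> forms I d. cone_eval (\<Union>X) f = 0} +
      fs.dim (cone_eval (\<Union>X) ` forms I d)"
    by (rule cf.rank_nullity[OF linear_cone_eval subspace_forms, of "(\<lambda>m. Poly_Mapping.single m 1) ` monoms_deg I d"])
      (use forms_eq_span finite_monoms_degree[OF assms] in auto)
  ultimately show ?thesis by (simp add: hilbert_function_def hilb_def coord_ring_def)
qed

text \<open>The lexicographic order; only totality on \<open>monoms I\<close> and translation invariance matter.\<close>

definition lex_less :: "('i \<Rightarrow> nat) \<Rightarrow> 'i set \<Rightarrow> ('i \<Rightarrow>\<^sub>0 nat) \<Rightarrow> ('i \<Rightarrow>\<^sub>0 nat) \<Rightarrow> bool"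
  where "lex_less idx I m m' \<longleftrightarrow> (\<exists>i\<in>I. Poly_Mapping.lookup m i < Poly_Mapping.lookup m' i \<and>
    (\<forall>j\<in>I. idx j < idx i \<longrightarrow> Poly_Mapping.lookup m j = Poly_Mapping.lookup m' j))"

lemma lex_less_add: "lex_less idx I m m' \<Longrightarrow> lex_less idx I (k + m) (k + m')"
  by (auto simp: lex_less_def lookup_add)

lemma lex_less_irrefl: "\<not> lex_less idx I m m"
  by (auto simp: lex_less_def)

lemma lex_less_total:
  assumes idx: "inj_on idx I" and m: "m \<in> monoms I" "m' \<in> monoms I" "m \<noteq> m'"
  shows "lex_less idx I m m' \<or> lex_less idx I m' m"
proof -
  let ?P = "\<lambda>i. i \<in> I \<and> Poly_Mapping.lookup m i \<noteq> Poly_Mapping.lookup m' i"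
  obtain i0 where i0: "Poly_Mapping.lookup m i0 \<noteq> Poly_Mapping.lookup m' i0"
    using m(3) by (metis poly_mapping_eqI)
  have "i0 \<in> I"
  proof (rule ccontr)
    assume "i0 \<notin> I"
    then have "i0 \<notin> Poly_Mapping.keys m" "i0 \<notin> Poly_Mapping.keys m'" using m by (auto simp: monoms_def)
    then show False using i0 by (simp add: in_keys_iff)
  qed
  then obtain i where i: "?P i" "\<And>j. ?P j \<Longrightarrow> idx i \<le> idx j"
    using ex_has_least_nat[of ?P i0 idx] i0 by blast
  then have "\<forall>j\<in>I. idx j < idx i \<longrightarrow> Poly_Mapping.lookup m j = Poly_Mapping.lookup m' j"
    by (meson not_le)
  then show ?thesis using i(1) by (auto simp: lex_less_def neq_iff)
qed

lemma lex_less_trans: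
  assumes idx: "inj_on idx I" and "lex_less idx I a b" "lex_less idx I b c"
  shows "lex_less idx I a c"
proof -
  obtain i where i: "i \<in> I" "Poly_Mapping.lookup a i < Poly_Mapping.lookup b i"
    "\<And>j. j \<in> I \<Longrightarrow> idx j < idx i \<Longrightarrow> Poly_Mapping.lookup a j = Poly_Mapping.lookup b j"
    using assms(2) by (auto simp: lex_less_def)
  obtain k where k: "k \<in> I" "Poly_Mapping.lookup b k < Poly_Mapping.lookup c k"
    "\<And>j. j \<in> I \<Longrightarrow> idx j < idx k \<Longrightarrow> Poly_Mapping.lookup b j = Poly_Mapping.lookup c j"
    using assms(3) by (auto simp: lex_less_def)
  consider "i = k" | "idx i < idx k" | "idx k < idx i"
    using idx i(1) k(1) by (metis inj_onD linorder_neqE_nat)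
  then show ?thesis
  proof cases
    case 1 then show ?thesis using i k unfolding lex_less_def by (intro bexI[of _ i]) auto
  next
    case 2
    then show ?thesis using i k(3) unfolding lex_less_def
      by (intro bexI[of _ i]) (auto dest: less_trans)
  next
    case 3
    then show ?thesis using k i(3) unfolding lex_less_def
      by (intro bexI[of _ k]) (auto dest: less_trans)
  qed
qed

text \<open>These are the monomials that are not leading monomials of forms vanishing on
  \<open>C\<close>, expressed by linear dependence on smaller monomials of the same degree.\<close>

definition std_monoms :: "('i \<Rightarrow> nat) \<Rightarrow> 'i set \<Rightarrow> ('i \<Rightarrow> complex) set \<Rightarrow> ('i \<Rightarrow>\<^sub>0 nat) set"
  where "std_monoms idx I C = {m \<in> monoms I. monom_fun C m \<notin>
    fs.span (monom_fun C ` {m' \<in> monoms_deg I (monom_degree m). lex_less idx I m' m})}"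

lemma hilb_eq_card_std:
  assumes fin: "finite I" and idx: "inj_on idx I"
  shows "hilb I C d = card {m \<in> std_monoms idx I C. monom_degree m = d}"
proof -
  let ?M = "monoms_deg I d" and ?lt = "lex_less idx I"
  let ?St = "{m \<in> ?M. monom_fun C m \<notin> fs.span (monom_fun C ` {m' \<in> ?M. ?lt m' m})}"
  have gb: "inj_on (monom_fun C) ?St \<and> fs.independent (monom_fun C ` ?St) \<and>
      fs.span (monom_fun C ` ?St) = fs.span (monom_fun C ` ?M)"
    by (rule fs.greedy_basis[OF finite_monoms_degree[OF fin]])
      (use lex_less_total[OF idx] lex_less_trans[OF idx] lex_less_irrefl in blast)+
  have St: "?St = {m \<in> std_monoms idx I C. monom_degree m = d}"
    by (auto simp: std_monoms_def)
  have "hilb I C d = fs.dim (fs.span (monom_fun C ` ?St))"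
    using gb by (simp add: hilb_def coord_ring_eq_span)
  also have "\<dots> = card (monom_fun C ` ?St)" using gb by (intro fs.dim_span_eq_card_independent) blast
  also have "\<dots> = card ?St" using gb by (intro card_image) blast
  finally show ?thesis by (simp only: St)
qed

text \<open>A dependence of \<open>m'\<close> on smaller monomials can be multiplied by the monomial
  \<open>k\<close> with \<open>m = k + m'\<close>. The order is translation invariant, so this is a
  dependence of \<open>m\<close> on smaller monomials.\<close>

lemma down_closed_std_monoms: "down_closed (std_monoms idx I C)"
  unfolding down_closed_def
proof (intro ballI allI impI, rule ccontr)
  fix m m' assume m: "m \<in> std_monoms idx I C" and le: "monom_le m' m" and n: "m' \<notin> std_monoms idx I C"
  define k where "k = m - m'"
  have mk: "m = k + m'"
    using le by (intro poly_mapping_eqI) (simp add: k_def lookup_add lookup_minus monom_le_def)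
  have mI: "m \<in> monoms I" using m by (simp add: std_monoms_def)
  have m'I: "m' \<in> monoms I" using le mI by (rule monoms_down)
  have kI: "k \<in> monoms I" by (rule monoms_down[OF _ mI]) (simp add: k_def monom_le_def lookup_minus)
  define T where "T f = (\<lambda>x. monom_fun C k x * f x)" for f :: "('a \<Rightarrow> complex) \<Rightarrow> complex"
  have T: "Vector_Spaces.linear fun_scale fun_scale T"
    unfolding Vector_Spaces.linear_iff by (auto simp: T_def fun_scale_def fun_eq_iff algebra_simps fs.vector_space_axioms)
  have Tm: "T (monom_fun C n) = monom_fun C (k + n)" for n
    by (auto simp: T_def monom_fun_def monom_eval_add)
  let ?A = "{n \<in> monoms_deg I (monom_degree m'). lex_less idx I n m'}"
  let ?B = "{n \<in> monoms_deg I (monom_degree m). lex_less idx I n m}"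
  have "monom_fun C m' \<in> fs.span (monom_fun C ` ?A)" using n m'I by (simp add: std_monoms_def)
  then have 1: "T (monom_fun C m') \<in> fs.span (T ` monom_fun C ` ?A)"
    using ff.linear_span_image[OF T] by blast
  have 2: "T ` monom_fun C ` ?A \<subseteq> monom_fun C ` ?B"
  proof (intro subsetI)
    fix f assume "f \<in> T ` monom_fun C ` ?A"
    then obtain a where a: "a \<in> ?A" "f = monom_fun C (k + a)" by (auto simp: Tm)
    have "k + a \<in> monoms I" using a kI Poly_Mapping.keys_add[of k a] by (auto simp: monoms_def)
    then have "k + a \<in> ?B" using a(1) by (simp add: mk monom_degree_add lex_less_add)
    then show "f \<in> monom_fun C ` ?B" using a(2) by blast
  qed
  have "monom_fun C m \<in> fs.span (monom_fun C ` ?B)"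
    using subsetD[OF fs.span_mono[OF 2] 1] unfolding Tm mk[symmetric] .
  then show False using m by (simp add: std_monoms_def)
qed

lemma evpoly_hilb:
  assumes fin: "finite I"
  shows "evpoly (hilb I C)"
proof -
  obtain idx :: "'a \<Rightarrow> nat" where idx: "inj_on idx I" using finite_imp_inj_to_nat_seg[OF fin] by blast
  have eq: "hilb I C = (\<lambda>d. card {m \<in> std_monoms idx I C. monom_degree m = d})"
    by (rule ext) (rule hilb_eq_card_std[OF fin idx])
  show ?thesis unfolding eq
    by (rule down_closed_count_evpoly[OF fin _ down_closed_std_monoms]) (auto simp: std_monoms_def)
qed

definition restrict_fun :: "'x set \<Rightarrow> ('x \<Rightarrow> complex) \<Rightarrow> 'x \<Rightarrow> complex"
  where "restrict_fun C f = (\<lambda>x. if x \<in> C then f x else 0)"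

lemma linear_restrict_fun: "Vector_Spaces.linear fun_scale fun_scale (restrict_fun C)"
  unfolding Vector_Spaces.linear_iff by (auto simp: restrict_fun_def fun_scale_def fun_eq_iff fs.vector_space_axioms)

lemma restrict_cone_eval: "C' \<subseteq> C \<Longrightarrow> restrict_fun C' (cone_eval C f) = cone_eval C' f"
  by (auto simp: restrict_fun_def cone_eval_def fun_eq_iff)

lemma restrict_monom_fun: "C' \<subseteq> C \<Longrightarrow> restrict_fun C' (monom_fun C m) = monom_fun C' m"
  by (auto simp: restrict_fun_def monom_fun_def fun_eq_iff)

lemma std_monoms_mono:
  assumes "C' \<subseteq> C"
  shows "std_monoms idx I C' \<subseteq> std_monoms idx I C"
proof
  fix m assume m: "m \<in> std_monoms idx I C'"
  let ?A = "{m' \<in> monoms_deg I (monom_degree m). lex_less idx I m' m}"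
  have "monom_fun C m \<notin> fs.span (monom_fun C ` ?A)"
  proof
    assume "monom_fun C m \<in> fs.span (monom_fun C ` ?A)"
    then have "restrict_fun C' (monom_fun C m) \<in> fs.span (restrict_fun C' ` monom_fun C ` ?A)"
      using ff.linear_span_image[OF linear_restrict_fun] by blast
    then have "monom_fun C' m \<in> fs.span (monom_fun C' ` ?A)"
      by (simp add: image_image restrict_monom_fun[OF assms])
    then show False using m by (simp add: std_monoms_def)
  qed
  then show "m \<in> std_monoms idx I C" using m by (simp add: std_monoms_def)
qed

lemma hilb_restrict:
  assumes fin: "finite I" and C: "C' \<subseteq> C"
  shows "hilb I C d = fs.dim {f \<in> coord_ring I C d. restrict_fun C' f = 0} + hilb I C' d"
proof -
  have "restrict_fun C' ` coord_ring I C d = coord_ring I C' d"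
    by (simp add: coord_ring_def image_image restrict_cone_eval[OF C])
  moreover have "fs.dim (coord_ring I C d) = fs.dim {f \<in> coord_ring I C d. restrict_fun C' f = 0} +
      fs.dim (restrict_fun C' ` coord_ring I C d)"
    by (rule ff.rank_nullity[OF linear_restrict_fun subspace_coord_ring, of "monom_fun C ` monoms_deg I d"])
      (use finite_monoms_degree[OF fin] in \<open>auto simp: coord_ring_eq_span\<close>)
  ultimately show ?thesis by (simp add: hilb_def)
qed

text \<open>Restriction of functions from \<open>C\<close> to \<open>C'\<close> has a kernel of
  dimension 0 in degree \<open>d\<close>, and this kernel is trivial because the space is finite
  dimensional.\<close>

lemma vanish_if_hilb_eq:
  assumes fin: "finite I" and C: "C' \<subseteq> C" and eq: "hilb I C d = hilb I C' d"
    and f: "f \<in> forms I d" "\<And>x. x \<in> C' \<Longrightarrow> cpoly_eval f x = 0" and x: "x \<in> C"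
  shows "cpoly_eval f x = 0"
proof -
  let ?K = "{f \<in> coord_ring I C d. restrict_fun C' f = 0}"
  have dim: "fs.dim ?K = 0" using hilb_restrict[OF fin C, of d] eq by simp
  obtain B where B: "B \<subseteq> ?K" "fs.independent B" "?K \<subseteq> fs.span B" "card B = fs.dim ?K"
    by (rule fs.basis_exists)
  have "finite B" using fs.independent_span_bound[OF finite_imageI[OF finite_monoms_degree[OF fin]] B(2), of "monom_fun C" d]
      B(1) by (auto simp: coord_ring_eq_span)
  then have "B = {}" using B(4) dim by simp
  moreover have "restrict_fun C' (cone_eval C f) = 0"
    unfolding restrict_cone_eval[OF C] using f(2) by (simp add: cone_eval_def fun_eq_iff)
  then have "cone_eval C f \<in> ?K" using f(1) by (simp add: coord_ring_def)
  ultimately have "cone_eval C f = 0" using B(3) by auto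
  then show ?thesis using x by (metis cone_eval_def zero_fun_def)
qed

section \<open>Integral cones and finite generation of their coordinate rings\<close>

text \<open>The degrees \<open>N - i\<close> make each equation homogeneous of degree
  \<open>N\<close>. It can then be tested on projective points, and it yields generators compatible
  with the grading.\<close>

definition integral_cone :: "'i set \<Rightarrow> 'i set \<Rightarrow> ('i \<Rightarrow> complex) set \<Rightarrow> bool"
  where "integral_cone A L C \<longleftrightarrow> (\<forall>u\<in>L. \<exists>N\<ge>1. \<exists>h. (\<forall>i<N. h i \<in> forms A (N - i)) \<and>
    (\<forall>x\<in>C. x u ^ N = (\<Sum>i<N. cpoly_eval (h i) x * x u ^ i)))"

text \<open>The coefficients allowed in degree \<open>d\<close> for a generator of degree
  \<open>k\<close>. The case \<open>d < k\<close> is separate since the truncated difference would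
  admit constants.\<close>

definition shifted_forms :: "'i set \<Rightarrow> nat \<Rightarrow> nat \<Rightarrow> 'i cpoly set"
  where "shifted_forms A d k = (if k \<le> d then forms A (d - k) else {0})"

lemma forms_0 [simp]: "0 \<in> forms I d"
  and forms_add: "f \<in> forms I d \<Longrightarrow> g \<in> forms I d \<Longrightarrow> f + g \<in> forms I d"
  and forms_scale: "f \<in> forms I d \<Longrightarrow> cpoly_scale c f \<in> forms I d"
  using cpoly.subspace_0[OF subspace_forms] cpoly.subspace_add[OF subspace_forms]
    cpoly.subspace_scale[OF subspace_forms] by blast+

lemma forms_one [simp]: "1 \<in> forms I 0"
  by (simp add: forms_def)

lemma shifted_forms_0 [simp]: "0 \<in> shifted_forms A d k"
  by (simp add: shifted_forms_def)

lemma shifted_forms_add: "f \<in> shifted_forms A d k \<Longrightarrow> g \<in> shifted_forms A d k \<Longrightarrow> f + g \<in> shifted_forms A d k"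
  by (auto simp: shifted_forms_def forms_add split: if_splits)

lemma shifted_forms_mult:
  assumes "f \<in> shifted_forms A d k" "h \<in> forms A e"
  shows "h * f \<in> shifted_forms A (d + e) k"
proof (cases "k \<le> d")
  case True
  then have "h * f \<in> forms A (e + (d - k))" using assms by (intro forms_mult) (simp_all add: shifted_forms_def)
  moreover have "e + (d - k) = d + e - k" using True by simp
  ultimately show ?thesis using True by (simp add: shifted_forms_def)
qed (use assms in \<open>simp add: shifted_forms_def\<close>)

definition module_rep :: "'i set \<Rightarrow> ('i \<Rightarrow> complex) set \<Rightarrow> ('i \<Rightarrow>\<^sub>0 nat) set \<Rightarrow> nat \<Rightarrow>
    (('i \<Rightarrow> complex) \<Rightarrow> complex) \<Rightarrow> bool"
  where "module_rep A C M d F \<longleftrightarrow> (\<exists>g. (\<forall>m\<in>M. g m \<in> shifted_forms A d (monom_degree m)) \<and>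
    (\<forall>x\<in>C. F x = (\<Sum>m\<in>M. cpoly_eval (g m) x * monom_eval m x)))"

lemma module_rep_0: "module_rep A C M d (\<lambda>x. 0)"
  unfolding module_rep_def by (intro exI[of _ "\<lambda>_. 0"]) auto

lemma module_rep_add:
  assumes "module_rep A C M d F" "module_rep A C M d G"
  shows "module_rep A C M d (\<lambda>x. F x + G x)"
proof -
  obtain g where g: "\<forall>m\<in>M. g m \<in> shifted_forms A d (monom_degree m)"
    "\<forall>x\<in>C. F x = (\<Sum>m\<in>M. cpoly_eval (g m) x * monom_eval m x)"
    using assms(1) by (auto simp: module_rep_def)
  obtain g' where g': "\<forall>m\<in>M. g' m \<in> shifted_forms A d (monom_degree m)"
    "\<forall>x\<in>C. G x = (\<Sum>m\<in>M. cpoly_eval (g' m) x * monom_eval m x)"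
    using assms(2) by (auto simp: module_rep_def)
  show ?thesis unfolding module_rep_def
    by (intro exI[of _ "\<lambda>m. g m + g' m"])
      (use g g' in \<open>auto simp: shifted_forms_add cpoly_eval_add algebra_simps sum.distrib\<close>)
qed

lemma module_rep_sum:
  "(\<And>s. s \<in> S \<Longrightarrow> module_rep A C M d (F s)) \<Longrightarrow> module_rep A C M d (\<lambda>x. \<Sum>s\<in>S. F s x)"
  by (induction S rule: infinite_finite_induct) (auto simp: module_rep_0 module_rep_add)

lemma module_rep_mult:
  assumes "module_rep A C M d F" "h \<in> forms A e"
  shows "module_rep A C M (d + e) (\<lambda>x. cpoly_eval h x * F x)"
proof -
  obtain g where g: "\<forall>m\<in>M. g m \<in> shifted_forms A d (monom_degree m)"
    "\<forall>x\<in>C. F x = (\<Sum>m\<in>M. cpoly_eval (g m) x * monom_eval m x)"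
    using assms(1) by (auto simp: module_rep_def)
  show ?thesis unfolding module_rep_def
    by (intro exI[of _ "\<lambda>m. h * g m"])
      (use g assms(2) in \<open>auto simp: shifted_forms_mult cpoly_eval_mult sum_distrib_left mult.assoc\<close>)
qed

lemma module_rep_scale:
  assumes "module_rep A C M d F"
  shows "module_rep A C M d (\<lambda>x. c * F x)"
proof -
  have "cpoly_scale c 1 \<in> forms A 0" by (intro forms_scale) simp
  then have "module_rep A C M (d + 0) (\<lambda>x. cpoly_eval (cpoly_scale c 1) x * F x)"
    by (rule module_rep_mult[OF assms])
  then show ?thesis by (simp add: cpoly_eval_scale)
qed

lemma module_rep_cong:
  "(\<And>x. x \<in> C \<Longrightarrow> F x = G x) \<Longrightarrow> module_rep A C M d F \<Longrightarrow> module_rep A C M d G"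
  unfolding module_rep_def by force

lemma module_rep_generator:
  assumes "finite M" "m \<in> M"
  shows "module_rep A C M (monom_degree m) (monom_eval m)"
  unfolding module_rep_def
proof (intro exI[of _ "\<lambda>m'. if m' = m then 1 else 0"] conjI ballI)
  fix x
  have "(\<Sum>m'\<in>M. cpoly_eval (if m' = m then 1 else 0) x * monom_eval m' x) =
    (\<Sum>m'\<in>M. if m' = m then monom_eval m x else 0)"
    by (intro sum.cong refl) auto
  then show "monom_eval m x = (\<Sum>m'\<in>M. cpoly_eval (if m' = m then 1 else 0) x * monom_eval m' x)"
    using assms by simp
qed (auto simp: shifted_forms_def)

lemma monom_eval_single_power: "monom_eval (Poly_Mapping.single u k) x = x u ^ k"
  by (cases "k = 0") (auto simp: monom_eval_def)

text \<open>The monomials whose exponents stay below the degrees \<open>N u\<close> of the integral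
  equations generate. Multiplying one of them by a variable either gives another one or raises an
  exponent to \<open>N u\<close>, and then the equation rewrites it. That the constant monomial is
  among them is used with Nakayama's lemma.\<close>

lemma integral_cone_module_finite:
  assumes fin: "finite L" and int: "integral_cone A L C"
  shows "\<exists>M. finite M \<and> M \<subseteq> monoms L \<and> 0 \<in> M \<and>
    (\<forall>d. \<forall>f\<in>forms L d. module_rep A C M d (cpoly_eval f))"
proof -
  obtain N h where N: "\<And>u. u \<in> L \<Longrightarrow> N u \<ge> (1::nat)"
    and h: "\<And>u i. u \<in> L \<Longrightarrow> i < N u \<Longrightarrow> h u i \<in> forms A (N u - i)"
    and eq: "\<And>u x. u \<in> L \<Longrightarrow> x \<in> C \<Longrightarrow> x u ^ N u = (\<Sum>i<N u. cpoly_eval (h u i) x * x u ^ i)"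
  proof -
    obtain N where N: "\<forall>u\<in>L. N u \<ge> (1::nat) \<and> (\<exists>h. (\<forall>i<N u. h i \<in> forms A (N u - i)) \<and>
        (\<forall>x\<in>C. x u ^ N u = (\<Sum>i<N u. cpoly_eval (h i) x * x u ^ i)))"
      using bchoice[OF int[unfolded integral_cone_def]] by blast
    then have "\<forall>u\<in>L. \<exists>h. (\<forall>i<N u. h i \<in> forms A (N u - i)) \<and>
        (\<forall>x\<in>C. x u ^ N u = (\<Sum>i<N u. cpoly_eval (h i) x * x u ^ i))" by blast
    from bchoice[OF this] obtain h where "\<forall>u\<in>L. (\<forall>i<N u. h u i \<in> forms A (N u - i)) \<and>
        (\<forall>x\<in>C. x u ^ N u = (\<Sum>i<N u. cpoly_eval (h u i) x * x u ^ i))" by blast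
    with N show ?thesis by (intro that[of N h]) auto
  qed
  define M where "M = {m \<in> monoms L. \<forall>u\<in>L. Poly_Mapping.lookup m u < N u}"
  have finM: "finite M"
  proof (rule finite_imageD)
    show "inj_on Poly_Mapping.lookup M" by (auto intro!: inj_onI poly_mapping_eqI)
    have "Poly_Mapping.lookup ` M \<subseteq> {f. \<forall>i. (i \<in> L \<longrightarrow> f i \<in> {..\<Sum>u\<in>L. N u}) \<and> (i \<notin> L \<longrightarrow> f i = 0)}"
    proof
      fix f assume "f \<in> Poly_Mapping.lookup ` M"
      then obtain m where m: "m \<in> M" "f = Poly_Mapping.lookup m" by blast
      have "f i \<le> (\<Sum>u\<in>L. N u)" if "i \<in> L" for i
        using m that member_le_sum[OF that, of N] fin by (force simp: M_def)
      moreover have "f i = 0" if "i \<notin> L" for i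
        using m that by (auto simp: M_def monoms_def in_keys_iff)
      ultimately show "f \<in> {f. \<forall>i. (i \<in> L \<longrightarrow> f i \<in> {..\<Sum>u\<in>L. N u}) \<and> (i \<notin> L \<longrightarrow> f i = 0)}" by auto
    qed
    then show "finite (Poly_Mapping.lookup ` M)"
      by (rule finite_subset) (rule finite_set_of_finite_funs, use fin in auto)
  qed
  have var_gen: "module_rep A C M (Suc (monom_degree m)) (\<lambda>x. x u * monom_eval m x)"
    if m: "m \<in> M" and u: "u \<in> L" for m u
  proof (cases "Suc (Poly_Mapping.lookup m u) < N u")
    case True
    let ?m = "Poly_Mapping.single u 1 + m"
    have "?m \<in> M" using m u True Poly_Mapping.keys_add[of "Poly_Mapping.single u 1" m]
      by (auto simp: M_def monoms_def lookup_add lookup_single when_def)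
    then have "module_rep A C M (monom_degree ?m) (monom_eval ?m)"
      by (rule module_rep_generator[OF finM])
    moreover have "monom_eval ?m = (\<lambda>x. x u * monom_eval m x)"
      by (rule ext) (simp only: monom_eval_add monom_eval_single_power power_one_right)
    ultimately show ?thesis by (simp add: monom_degree_add)
  next
    case False
    define k where "k = Poly_Mapping.lookup m u"
    have "k < N u" using m u by (auto simp: M_def k_def)
    then have Nk: "N u = Suc k" using False by (simp add: k_def)
    define m' where "m' = m - Poly_Mapping.single u k"
    have mm': "m = Poly_Mapping.single u k + m'"
      by (rule poly_mapping_eqI) (simp add: m'_def lookup_add lookup_minus lookup_single when_def k_def)
    have "monom_le m' m" by (simp add: monom_le_def m'_def lookup_minus)
    then have m'L: "m' \<in> monoms L" using m monoms_down by (auto simp: M_def)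
    have deg: "monom_degree m = k + monom_degree m'"
      unfolding mm' monom_degree_add by simp
    have "module_rep A C M (Suc (monom_degree m)) (\<lambda>x. \<Sum>i<N u. cpoly_eval (h u i) x *
        monom_eval (Poly_Mapping.single u i + m') x)"
    proof (rule module_rep_sum)
      fix i assume i: "i \<in> {..<N u}"
      let ?m = "Poly_Mapping.single u i + m'"
      have "Poly_Mapping.lookup ?m v < N v" if "v \<in> L" for v
        using m i that by (auto simp: M_def m'_def lookup_add lookup_minus lookup_single when_def k_def)
      then have "?m \<in> M" using m'L u Poly_Mapping.keys_add[of "Poly_Mapping.single u i" m']
        by (auto simp: M_def monoms_def split: if_splits)
      then have "module_rep A C M (monom_degree ?m + (N u - i))
          (\<lambda>x. cpoly_eval (h u i) x * monom_eval ?m x)"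
        using i by (intro module_rep_mult module_rep_generator[OF finM] h[OF u]) auto
      moreover have "monom_degree ?m + (N u - i) = Suc (monom_degree m)"
        using i Nk deg by (simp add: monom_degree_add)
      ultimately show "module_rep A C M (Suc (monom_degree m))
          (\<lambda>x. cpoly_eval (h u i) x * monom_eval ?m x)" by simp
    qed
    moreover have "(\<Sum>i<N u. cpoly_eval (h u i) x * monom_eval (Poly_Mapping.single u i + m') x) =
        x u * monom_eval m x" if "x \<in> C" for x
    proof -
      have "(\<Sum>i<N u. cpoly_eval (h u i) x * monom_eval (Poly_Mapping.single u i + m') x) =
        x u ^ N u * monom_eval m' x"
        unfolding eq[OF u that] by (simp add: monom_eval_add monom_eval_single_power sum_distrib_right mult.assoc)
      also have "\<dots> = x u * monom_eval m x"
        unfolding mm' monom_eval_add monom_eval_single_power Nk by simp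
      finally show ?thesis .
    qed
    ultimately show ?thesis by (rule module_rep_cong[rotated])
  qed
  have var: "module_rep A C M (Suc d) (\<lambda>x. x u * F x)" if F: "module_rep A C M d F" and u: "u \<in> L" for F d u
  proof -
    obtain g where g: "\<forall>m\<in>M. g m \<in> shifted_forms A d (monom_degree m)"
      "\<forall>x\<in>C. F x = (\<Sum>m\<in>M. cpoly_eval (g m) x * monom_eval m x)"
      using F by (auto simp: module_rep_def)
    have "module_rep A C M (Suc d) (\<lambda>x. \<Sum>m\<in>M. cpoly_eval (g m) x * (x u * monom_eval m x))"
    proof (rule module_rep_sum)
      fix m assume m: "m \<in> M"
      show "module_rep A C M (Suc d) (\<lambda>x. cpoly_eval (g m) x * (x u * monom_eval m x))"
      proof (cases "monom_degree m \<le> d")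
        case True
        then have "g m \<in> forms A (d - monom_degree m)" using g(1) m by (auto simp: shifted_forms_def)
        then have "module_rep A C M (Suc (monom_degree m) + (d - monom_degree m))
            (\<lambda>x. cpoly_eval (g m) x * (x u * monom_eval m x))"
          by (intro module_rep_mult var_gen m u)
        then show ?thesis using True by simp
      next
        case False
        then have "g m = 0" using g(1) m by (auto simp: shifted_forms_def)
        then show ?thesis by (simp add: module_rep_0)
      qed
    qed
    then show ?thesis
      by (rule module_rep_cong[rotated]) (use g(2) in \<open>simp add: sum_distrib_left mult_ac\<close>)
  qed
  have 0: "0 \<in> M" using N by (auto simp: M_def monoms_def Suc_le_eq)
  have mon: "module_rep A C M d (monom_eval m)" if "m \<in> monoms L" "monom_degree m = d" for m d
    using that
  proof (induction d arbitrary: m)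
    case 0
    then have "m = 0"
      using monom_degree_superset[OF fin, of m] fin
      by (intro poly_mapping_eqI) (auto simp: monoms_def in_keys_iff)
    then show ?case using module_rep_generator[OF finM \<open>0 \<in> M\<close>, of A C] by (simp only: monom_degree_0)
  next
    case (Suc d)
    have "Poly_Mapping.keys m \<noteq> {}" using Suc.prems(2) by (auto simp: monom_degree_def)
    then obtain u where u: "u \<in> Poly_Mapping.keys m" by blast
    define m' where "m' = m - Poly_Mapping.single u 1"
    have mm': "m = Poly_Mapping.single u 1 + m'"
      by (rule poly_mapping_eqI)
        (use u in \<open>auto simp: m'_def lookup_add lookup_minus lookup_single when_def in_keys_iff\<close>)
    have "monom_le m' m" by (simp add: monom_le_def m'_def lookup_minus)
    then have m'L: "m' \<in> monoms L" using Suc.prems(1) by (rule monoms_down)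
    have "monom_degree m = Suc (monom_degree m')" by (subst mm') (simp add: monom_degree_add)
    then have "module_rep A C M d (monom_eval m')" using Suc.IH[OF m'L] Suc.prems(2) by simp
    moreover have "u \<in> L" using u Suc.prems(1) by (auto simp: monoms_def)
    ultimately have "module_rep A C M (Suc d) (\<lambda>x. x u * monom_eval m' x)" by (rule var)
    moreover have "monom_eval m = (\<lambda>x. x u * monom_eval m' x)"
      by (subst mm') (rule ext, simp only: monom_eval_add monom_eval_single_power power_one_right)
    ultimately show ?case by simp
  qed
  have "module_rep A C M d (cpoly_eval f)" if "f \<in> forms L d" for f d
    unfolding cpoly_eval_def
    by (intro module_rep_sum module_rep_scale mon) (use that in \<open>auto simp: forms_def monoms_def\<close>)
  then show ?thesis using finM 0 by (intro exI[of _ M]) (auto simp: M_def)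
qed

subsection \<open>Dimensions of sums\<close>

lemma fun_scale_mult_left: "fun_scale c f * g = fun_scale c (f * g)"
  by (simp add: fun_scale_def fun_eq_iff mult.assoc)

lemma dim_module_sum_le:
  fixes S :: "('x \<Rightarrow> complex) set"
  assumes T: "finite T" and U: "\<And>t. t \<in> T \<Longrightarrow> U t \<subseteq> fs.span (G t)" "\<And>t. t \<in> T \<Longrightarrow> finite (G t)"
    and S: "\<And>f. f \<in> S \<Longrightarrow> \<exists>b. (\<forall>t\<in>T. b t \<in> U t) \<and> f = (\<Sum>t\<in>T. b t * w t)"
  shows "fs.dim S \<le> (\<Sum>t\<in>T. fs.dim (U t))"
proof -
  have "\<exists>B. B \<subseteq> U t \<and> fs.independent B \<and> U t \<subseteq> fs.span B \<and> card B = fs.dim (U t)" for t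
    by (metis fs.basis_exists)
  then obtain B where B: "\<And>t. B t \<subseteq> U t" "\<And>t. fs.independent (B t)" "\<And>t. U t \<subseteq> fs.span (B t)"
    "\<And>t. card (B t) = fs.dim (U t)" by metis
  have finB: "finite (B t)" if "t \<in> T" for t
    using fs.independent_span_bound[OF U(2)[OF that] B(2)[of t]] B(1)[of t] U(1)[OF that] by blast
  define W where "W = (\<Union>t\<in>T. (\<lambda>b. b * w t) ` B t)"
  have lin: "Vector_Spaces.linear fun_scale fun_scale (\<lambda>b. b * v)" for v :: "'x \<Rightarrow> complex"
    unfolding Vector_Spaces.linear_iff
    by (auto simp: fun_scale_def fun_eq_iff algebra_simps fs.vector_space_axioms)
  have "S \<subseteq> fs.span W"
  proof
    fix f assume "f \<in> S"
    then obtain b where b: "\<forall>t\<in>T. b t \<in> U t" "f = (\<Sum>t\<in>T. b t * w t)" using S by blast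
    have "b t * w t \<in> fs.span W" if "t \<in> T" for t
    proof -
      have "b t \<in> fs.span (B t)" using b(1) B(3) that by blast
      moreover have "fs.span ((\<lambda>b. b * w t) ` B t) = (\<lambda>b. b * w t) ` fs.span (B t)"
        by (rule ff.linear_span_image[OF lin])
      ultimately have "b t * w t \<in> fs.span ((\<lambda>b. b * w t) ` B t)" by blast
      also have "\<dots> \<subseteq> fs.span W" by (rule fs.span_mono) (use that in \<open>auto simp: W_def\<close>)
      finally show ?thesis .
    qed
    then show "f \<in> fs.span W" unfolding b(2) by (rule fs.span_sum)
  qed
  moreover have "finite W" using T finB by (auto simp: W_def)
  ultimately have "fs.dim S \<le> card W" by (rule fs.dim_le_card)
  also have "\<dots> \<le> (\<Sum>t\<in>T. card ((\<lambda>b. b * w t) ` B t))" unfolding W_def by (rule card_UN_le[OF T])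
  also have "\<dots> \<le> (\<Sum>t\<in>T. card (B t))" by (intro sum_mono card_image_le finB)
  finally show ?thesis by (simp add: B(4))
qed

text \<open>By \<open>ind\<close> the products of \<open>w t\<close> with the members of a basis of
  \<open>U t\<close>, for all \<open>t\<close>, are pairwise different and linearly
  independent.\<close>

lemma dim_module_sum_ge:
  assumes T: "finite T" and U: "\<And>t. t \<in> T \<Longrightarrow> fs.subspace (U t)"
      "\<And>t. t \<in> T \<Longrightarrow> U t \<subseteq> fs.span (G t)" "\<And>t. t \<in> T \<Longrightarrow> finite (G t)"
    and S: "\<And>t b. t \<in> T \<Longrightarrow> b \<in> U t \<Longrightarrow> b * w t \<in> S" "S \<subseteq> fs.span H" "finite H"
    and ind: "\<And>b. (\<And>t. t \<in> T \<Longrightarrow> b t \<in> U t) \<Longrightarrow> (\<Sum>t\<in>T. b t * w t) = 0 \<Longrightarrow> (\<forall>t\<in>T. b t = 0)"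
  shows "(\<Sum>t\<in>T. fs.dim (U t)) \<le> fs.dim S"
proof -
  have "\<exists>B. B \<subseteq> U t \<and> fs.independent B \<and> U t \<subseteq> fs.span B \<and> card B = fs.dim (U t)" for t
    by (metis fs.basis_exists)
  then obtain B where B: "\<And>t. B t \<subseteq> U t" "\<And>t. fs.independent (B t)" "\<And>t. U t \<subseteq> fs.span (B t)"
    "\<And>t. card (B t) = fs.dim (U t)" by metis
  have finB: "finite (B t)" if "t \<in> T" for t
    using fs.independent_span_bound[OF U(3)[OF that] B(2)[of t]] B(1)[of t] U(2)[OF that] by blast
  define J where "J = Sigma T B"
  define v where "v = (\<lambda>(t, b). b * w t)"
  have finJ: "finite J" using T finB by (auto simp: J_def)
  have U0: "0 \<in> U t" if "t \<in> T" for t using U(1)[OF that] fs.subspace_0 by blast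
  have inj: "inj_on v J"
  proof (rule inj_onI, clarify)
    fix t b t' b' assume tb: "(t, b) \<in> J" "(t', b') \<in> J" and eq: "v (t, b) = v (t', b')"
    then have t: "t \<in> T" "t' \<in> T" "b \<in> B t" "b' \<in> B t'" by (auto simp: J_def)
    have bne: "b \<noteq> 0" using B(2)[of t] t(3) fs.dependent_zero by blast
    \<comment> \<open>A coincidence of two products is read as a relation with coefficients
      \<open>b\<close> and \<open>- b'\<close>, or \<open>b - b'\<close> if both belong to the same
      \<open>t\<close>; a basis vector \<open>b\<close> is nonzero.\<close>
    define c where "c s = (if s = t then (if t' = t then b - b' else b) else if s = t' then - b' else 0)" for s
    have "c s \<in> U s" if "s \<in> T" for s
      using that t B(1) U0[OF that] fs.subspace_diff[OF U(1)] fs.subspace_neg[OF U(1)]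
      by (auto simp: c_def subset_iff)
    moreover have "(\<Sum>s\<in>T. c s * w s) = 0"
    proof (cases "t' = t")
      case True
      have "(\<Sum>s\<in>T. c s * w s) = (\<Sum>s\<in>T. if s = t then (b - b') * w t else 0)"
        by (intro sum.cong refl) (auto simp: c_def True)
      then show ?thesis using eq True T t by (simp add: v_def algebra_simps)
    next
      case False
      have "(\<Sum>s\<in>T. c s * w s) = (\<Sum>s\<in>T. (if s = t then b * w t else 0) + (if s = t' then - b' * w t' else 0))"
        by (intro sum.cong refl) (use False in \<open>auto simp: c_def\<close>)
      then show ?thesis using eq T t by (simp add: v_def sum.distrib)
    qed
    ultimately have "c t = 0" using ind t(1) by blast
    then show "t = t' \<and> b = b'" using bne by (auto simp: c_def split: if_splits)
  qed
  have "fs.independent (v ` J)"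
    unfolding fs.dependent_finite[OF finite_imageI[OF finJ]]
  proof (rule notI, elim exE conjE bexE)
    fix u y assume u: "(\<Sum>z\<in>v ` J. fun_scale (u z) z) = 0" and y: "y \<in> v ` J" "u y \<noteq> 0"
    define b where "b t = (\<Sum>z\<in>B t. fun_scale (u (z * w t)) z)" for t
    have "(\<Sum>z\<in>v ` J. fun_scale (u z) z) = (\<Sum>j\<in>J. fun_scale (u (v j)) (v j))"
      by (rule sum.reindex[OF inj, unfolded o_def])
    also have "\<dots> = (\<Sum>t\<in>T. \<Sum>z\<in>B t. fun_scale (u (z * w t)) (z * w t))"
      unfolding J_def using T finB by (subst sum.Sigma) (auto simp: v_def split_def)
    also have "\<dots> = (\<Sum>t\<in>T. b t * w t)"
      by (intro sum.cong refl) (simp add: b_def sum_distrib_right fun_scale_mult_left)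
    finally have "(\<Sum>t\<in>T. b t * w t) = 0" using u by simp
    moreover have "b t \<in> U t" if "t \<in> T" for t
      unfolding b_def using B(1)[of t] by (intro fs.subspace_sum fs.subspace_scale U(1)[OF that]) auto
    ultimately have b0: "\<forall>t\<in>T. b t = 0" using ind by blast
    obtain t z where tz: "t \<in> T" "z \<in> B t" "y = z * w t" using y(1) by (auto simp: J_def v_def)
    have "(\<Sum>z\<in>B t. fun_scale (u (z * w t)) z) = 0" using b0 tz(1) by (simp add: b_def)
    moreover have "u (z * w t) \<noteq> 0" using y(2) tz(3) by simp
    ultimately have "fs.dependent (B t)"
      unfolding fs.dependent_finite[OF finB[OF tz(1)]]
      by (intro exI[of _ "\<lambda>z. u (z * w t)"] conjI bexI[of _ z] tz(2))
    then show False using B(2) by blast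
  qed
  moreover have "v ` J \<subseteq> S" using S(1) B(1) by (auto simp: J_def v_def)
  ultimately have "card (v ` J) \<le> fs.dim S"
  proof -
    assume i: "fs.independent (v ` J)" and s: "v ` J \<subseteq> S"
    have "card (v ` J) = fs.dim (v ` J)" using fs.dim_eq_card_independent[OF i] by simp
    also have "\<dots> \<le> fs.dim S"
      by (rule fs.dim_mono_finite[OF _ S(2,3)]) (use s fs.span_superset in blast)
    finally show ?thesis .
  qed
  moreover have "card (v ` J) = (\<Sum>t\<in>T. fs.dim (U t))"
    using card_image[OF inj] T finB by (simp add: J_def card_SigmaI B(4))
  ultimately show ?thesis by simp
qed

subsection \<open>The rank of a finite extension of graded domains\<close>

text \<open>Irreducibility in algebraic terms: the graded coordinate ring of \<open>C\<close> has no
  homogeneous zero divisors. Sets without points are included.\<close>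

definition domain_cone :: "'i set \<Rightarrow> ('i \<Rightarrow> complex) set \<Rightarrow> bool"
  where "domain_cone L C \<longleftrightarrow> (\<forall>d e. \<forall>f\<in>forms L d. \<forall>g\<in>forms L e.
    (\<forall>x\<in>C. cpoly_eval f x * cpoly_eval g x = 0) \<longrightarrow>
    (\<forall>x\<in>C. cpoly_eval f x = 0) \<or> (\<forall>x\<in>C. cpoly_eval g x = 0))"

definition shifted_ring :: "'i set \<Rightarrow> ('i \<Rightarrow> complex) set \<Rightarrow> nat \<Rightarrow> nat \<Rightarrow> (('i \<Rightarrow> complex) \<Rightarrow> complex) set"
  where "shifted_ring A C d k = (if k \<le> d then coord_ring A C (d - k) else {0})"

lemma cone_eval_mult: "cone_eval C (f * g) = cone_eval C f * cone_eval C g"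
  by (simp add: cone_eval_def fun_eq_iff cpoly_eval_mult)

lemma coord_ring_mult: "f \<in> coord_ring I C d \<Longrightarrow> g \<in> coord_ring I C e \<Longrightarrow> f * g \<in> coord_ring I C (d + e)"
  unfolding coord_ring_def by (auto simp: cone_eval_mult[symmetric] intro!: imageI forms_mult)

lemma coord_ring_mono: "A \<subseteq> L \<Longrightarrow> coord_ring A C d \<subseteq> coord_ring L C d"
  unfolding coord_ring_def by (intro image_mono forms_mono)

lemma coord_ring_0 [simp]: "0 \<in> coord_ring I C d"
  using fs.subspace_0[OF subspace_coord_ring] .

lemma domain_cone_nonzero:
  assumes "domain_cone L C" "f \<in> coord_ring L C d" "g \<in> coord_ring L C e" "f * g = 0"
  shows "f = 0 \<or> g = 0"
proof -
  obtain f' g' where f': "f' \<in> forms L d" "f = cone_eval C f'" and g': "g' \<in> forms L e" "g = cone_eval C g'"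
    using assms(2,3) by (auto simp: coord_ring_def)
  have "cpoly_eval f' x * cpoly_eval g' x = 0" if "x \<in> C" for x
    using fun_cong[OF assms(4), of x] that by (simp add: f' g' cone_eval_def)
  then have "(\<forall>x\<in>C. cpoly_eval f' x = 0) \<or> (\<forall>x\<in>C. cpoly_eval g' x = 0)"
    using assms(1) f'(1) g'(1) unfolding domain_cone_def by blast
  then show ?thesis by (auto simp: f' g' cone_eval_def fun_eq_iff)
qed

text \<open>The unit of the coordinate ring. The constant function 1 need not vanish off
  \<open>C\<close>, so products that may be empty are multiplied by this element to stay in the
  ring.\<close>

definition cone_one :: "('i \<Rightarrow> complex) set \<Rightarrow> ('i \<Rightarrow> complex) \<Rightarrow> complex"
  where "cone_one C = cone_eval C 1"

lemma cone_one_coord_ring: "cone_one C \<in> coord_ring I C 0"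
  by (auto simp: cone_one_def coord_ring_def)

lemma coord_ring_prod:
  assumes "finite S" "\<And>s. s \<in> S \<Longrightarrow> q s \<in> coord_ring I C (e s)"
  shows "cone_one C * prod q S \<in> coord_ring I C (sum e S)"
  using assms
proof (induction S rule: finite_induct)
  case empty then show ?case by (simp add: cone_one_coord_ring)
next
  case (insert s S)
  have "cone_one C * prod q S \<in> coord_ring I C (sum e S)" by (rule insert.IH) (use insert.prems in blast)
  with insert.prems[of s] have *: "q s * (cone_one C * prod q S) \<in> coord_ring I C (e s + sum e S)"
    by (intro coord_ring_mult) simp_all
  have eq: "cone_one C * prod q (insert s S) = q s * (cone_one C * prod q S)"
    by (simp only: prod.insert[OF insert.hyps] mult.left_commute)
  show ?case unfolding eq sum.insert[OF insert.hyps] by (rule *)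
qed

lemma subspace_shifted_ring: "fs.subspace (shifted_ring A C d k)"
  by (simp add: shifted_ring_def subspace_coord_ring fs.subspace_single_0)

lemma shifted_ring_mult:
  assumes "f \<in> coord_ring A C e" "g \<in> shifted_ring A C d k"
  shows "f * g \<in> shifted_ring A C (d + e) k"
proof (cases "k \<le> d")
  case True
  then have "f * g \<in> coord_ring A C (e + (d - k))" using assms by (intro coord_ring_mult) (simp_all add: shifted_ring_def)
  moreover have "e + (d - k) = d + e - k" using True by simp
  ultimately show ?thesis using True by (simp add: shifted_ring_def)
qed (use assms fs.subspace_0[OF subspace_shifted_ring] in \<open>simp add: shifted_ring_def\<close>)

lemma coord_ring_finite_dim: "finite L \<Longrightarrow> \<exists>G. finite G \<and> coord_ring L C d \<subseteq> fs.span G"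
  unfolding coord_ring_eq_span
  by (intro exI[of _ "monom_fun C ` monoms_deg L d"] conjI finite_imageI finite_monoms_degree order_refl)

lemma shifted_ring_finite_dim: "finite L \<Longrightarrow> \<exists>G. finite G \<and> shifted_ring L C d k \<subseteq> fs.span G"
  using coord_ring_finite_dim[of L C "d - k"] by (auto simp: shifted_ring_def intro: fs.span_zero)

lemma monom_fun_coord_ring: "m \<in> monoms L \<Longrightarrow> monom_fun C m \<in> coord_ring L C (monom_degree m)"
  unfolding coord_ring_eq_span by (rule fs.span_base) simp

definition module_gens :: "'i set \<Rightarrow> 'i set \<Rightarrow> ('i \<Rightarrow> complex) set \<Rightarrow> ('i \<Rightarrow>\<^sub>0 nat) set \<Rightarrow> bool"
  where "module_gens A L C M \<longleftrightarrow> finite M \<and> M \<subseteq> monoms L \<and> (\<forall>d. \<forall>f\<in>coord_ring L C d.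
    \<exists>g. (\<forall>m\<in>M. g m \<in> shifted_ring A C d (monom_degree m)) \<and> f = (\<Sum>m\<in>M. g m * monom_fun C m))"

lemma sum_fun_apply: "(\<Sum>s\<in>S. f s) x = (\<Sum>s\<in>S. f s x)"
  by (induction S rule: infinite_finite_induct) simp_all

lemma integral_cone_module_gens:
  assumes "finite L" "integral_cone A L C"
  shows "\<exists>M. module_gens A L C M"
proof -
  obtain M where M: "finite M" "M \<subseteq> monoms L"
    and rep: "\<And>d f. f \<in> forms L d \<Longrightarrow> module_rep A C M d (cpoly_eval f)"
    using integral_cone_module_finite[OF assms] by blast
  have "\<exists>g. (\<forall>m\<in>M. g m \<in> shifted_ring A C d (monom_degree m)) \<and> f = (\<Sum>m\<in>M. g m * monom_fun C m)"
    if "f \<in> coord_ring L C d" for d f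
  proof -
    obtain f' where f': "f' \<in> forms L d" "f = cone_eval C f'" using \<open>f \<in> _\<close> by (auto simp: coord_ring_def)
    obtain g where g: "\<forall>m\<in>M. g m \<in> shifted_forms A d (monom_degree m)"
      "\<forall>x\<in>C. cpoly_eval f' x = (\<Sum>m\<in>M. cpoly_eval (g m) x * monom_eval m x)"
      using rep[OF f'(1)] by (auto simp: module_rep_def)
    have "\<forall>m\<in>M. cone_eval C (g m) \<in> shifted_ring A C d (monom_degree m)"
    proof
      fix m assume "m \<in> M"
      then have "g m \<in> shifted_forms A d (monom_degree m)" using g(1) by blast
      moreover have "cone_eval C 0 = 0" by (simp add: cone_eval_def fun_eq_iff)
      ultimately show "cone_eval C (g m) \<in> shifted_ring A C d (monom_degree m)"
        by (auto simp: shifted_ring_def shifted_forms_def coord_ring_def split: if_splits)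
    qed
    moreover have "f = (\<Sum>m\<in>M. cone_eval C (g m) * monom_fun C m)"
      using g(2) by (auto simp: f'(2) cone_eval_def monom_fun_def fun_eq_iff sum_fun_apply)
    ultimately show ?thesis by (intro exI[of _ "\<lambda>m. cone_eval C (g m)"] conjI)
  qed
  then show ?thesis using M unfolding module_gens_def by blast
qed

lemma hilb_le_sum_gens:
  assumes fin: "finite L" "A \<subseteq> L" and M: "module_gens A L C M"
  shows "hilb L C d \<le> (\<Sum>m\<in>M. fs.dim (shifted_ring A C d (monom_degree m)))"
proof -
  have finA: "finite A" using fin finite_subset by blast
  define G where "G m = (SOME G. finite G \<and> shifted_ring A C d (monom_degree m) \<subseteq> fs.span G)" for m :: "'a \<Rightarrow>\<^sub>0 nat"
  have "finite (G m) \<and> shifted_ring A C d (monom_degree m) \<subseteq> fs.span (G m)" for m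
    unfolding G_def by (rule someI_ex) (rule shifted_ring_finite_dim[OF finA])
  then have G: "\<And>m. finite (G m)" "\<And>m. shifted_ring A C d (monom_degree m) \<subseteq> fs.span (G m)" by blast+
  show ?thesis unfolding hilb_def
    by (rule dim_module_sum_le[where G = G and w = "monom_fun C"])
      (use G M in \<open>auto simp: module_gens_def\<close>)
qed

definition free_over :: "'i set \<Rightarrow> ('i \<Rightarrow> complex) set \<Rightarrow> ('i \<Rightarrow>\<^sub>0 nat) set \<Rightarrow> bool"
  where "free_over A C T \<longleftrightarrow> (\<forall>d b. (\<forall>t\<in>T. b t \<in> shifted_ring A C d (monom_degree t)) \<longrightarrow>
    (\<Sum>t\<in>T. b t * monom_fun C t) = 0 \<longrightarrow> (\<forall>t\<in>T. b t = 0))"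

lemma ex_maximal_free:
  assumes "finite M"
  obtains T where "T \<subseteq> M" "free_over A C T" "\<And>m. m \<in> M - T \<Longrightarrow> \<not> free_over A C (insert m T)"
proof -
  let ?P = "\<lambda>n. \<exists>T. T \<subseteq> M \<and> free_over A C T \<and> card T = n"
  have "?P 0" by (intro exI[of _ "{}"]) (simp add: free_over_def)
  moreover have "\<forall>n. ?P n \<longrightarrow> n \<le> card M" using assms card_mono by blast
  ultimately obtain n where n: "?P n" "\<And>k. ?P k \<Longrightarrow> k \<le> n"
    using GreatestI_nat[of ?P 0 "card M"] Greatest_le_nat[of ?P _ "card M"] by blast
  then obtain T where T: "T \<subseteq> M" "free_over A C T" "card T = n" by blast
  have "\<not> free_over A C (insert m T)" if "m \<in> M - T" for m
  proof
    assume "free_over A C (insert m T)"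
    moreover have "card (insert m T) = Suc n" using that T assms finite_subset by (metis DiffE card_insert_disjoint)
    ultimately have "?P (Suc n)" using that T(1) by (intro exI[of _ "insert m T"]) auto
    then show False using n(2) by fastforce
  qed
  then show ?thesis using that T by blast
qed

lemma dim_mult_nonzero:
  assumes fin: "finite L" and dom: "domain_cone L C" and s: "s \<in> coord_ring L C e" "s \<noteq> 0"
  shows "fs.dim ((\<lambda>f. s * f) ` coord_ring L C d) = hilb L C d"
proof -
  have lin: "Vector_Spaces.linear fun_scale fun_scale (\<lambda>f. s * f)"
    unfolding Vector_Spaces.linear_iff
    by (auto simp: fun_scale_def fun_eq_iff algebra_simps fs.vector_space_axioms)
  obtain G where G: "finite G" "coord_ring L C d \<subseteq> fs.span G" using coord_ring_finite_dim[OF fin] by blast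
  have "{f \<in> coord_ring L C d. s * f = 0} = {0}"
    using domain_cone_nonzero[OF dom s(1)] s(2) by auto
  then have "fs.dim {f \<in> coord_ring L C d. s * f = 0} = 0"
    using fs.dim_le_card[of "{0}" "{}"] by simp
  then show ?thesis
    using ff.rank_nullity[OF lin subspace_coord_ring G] by (simp add: hilb_def)
qed

text \<open>\<open>T\<close> is a maximal free family among finitely many module generators, and
  freeness gives the lower bound. By maximality each other generator has a nonzero multiple in the
  free module on \<open>T\<close>. The product \<open>s\<close> of these multipliers, of degree
  \<open>\<delta>\<close>, maps the whole ring into that module, and multiplication by
  \<open>s\<close> is injective because the ring is a domain.\<close>

lemma hilb_rank_sandwich:
  fixes L :: "'i set"
  assumes fin: "finite L" and AL: "A \<subseteq> L" and dom: "domain_cone L C" and int: "integral_cone A L C"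
    and x0: "x0 \<in> C"
  shows "\<exists>(T :: ('i \<Rightarrow>\<^sub>0 nat) set) \<delta>. finite T \<and> (\<forall>d. (\<Sum>t\<in>T. fs.dim (shifted_ring A C d (monom_degree t))) \<le> hilb L C d \<and>
    hilb L C d \<le> (\<Sum>t\<in>T. fs.dim (shifted_ring A C (d + \<delta>) (monom_degree t))))"
proof -
  have finA: "finite A" using fin AL finite_subset by blast
  obtain M where M: "module_gens A L C M" using integral_cone_module_gens[OF fin int] by blast
  then have finM: "finite M" "M \<subseteq> monoms L" by (auto simp: module_gens_def)
  let ?\<mu> = "monom_fun C" and ?deg = "monom_degree"
  let ?R = "shifted_ring A C"
  obtain T where T: "T \<subseteq> M" "free_over A C T" "\<And>m. m \<in> M - T \<Longrightarrow> \<not> free_over A C (insert m T)"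
    using ex_maximal_free[OF finM(1)] by blast
  have finT: "finite T" using T(1) finM finite_subset by blast
  define G where "G d m = (SOME G. finite G \<and> ?R d (?deg m) \<subseteq> fs.span G)" for d and m :: "'i \<Rightarrow>\<^sub>0 nat"
  have "finite (G d m) \<and> ?R d (?deg m) \<subseteq> fs.span (G d m)" for d m
    unfolding G_def by (rule someI_ex) (rule shifted_ring_finite_dim[OF finA])
  then have G: "\<And>d m. finite (G d m)" "\<And>d m. ?R d (?deg m) \<subseteq> fs.span (G d m)" by blast+
  have R_sub: "b * ?\<mu> t \<in> coord_ring L C d" if "t \<in> T" "b \<in> ?R d (?deg t)" for t b d
  proof (cases "?deg t \<le> d")
    case True
    have "?\<mu> t \<in> coord_ring L C (?deg t)" using that(1) T(1) finM(2) by (intro monom_fun_coord_ring) blast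
    moreover have "b \<in> coord_ring L C (d - ?deg t)"
      using that(2) True coord_ring_mono[OF AL] by (auto simp: shifted_ring_def)
    ultimately have "b * ?\<mu> t \<in> coord_ring L C ((d - ?deg t) + ?deg t)" by (rule coord_ring_mult[rotated])
    then show ?thesis using True by simp
  next
    case False
    then show ?thesis using that(2) by (simp add: shifted_ring_def)
  qed
  have low: "(\<Sum>t\<in>T. fs.dim (?R d (?deg t))) \<le> hilb L C d" for d
  proof -
    obtain H where H: "finite H" "coord_ring L C d \<subseteq> fs.span H" using coord_ring_finite_dim[OF fin] by blast
    show ?thesis unfolding hilb_def
    proof (rule dim_module_sum_ge[where G = "G d" and w = ?\<mu> and H = H])
      show "\<forall>t\<in>T. b t = 0" if "\<And>t. t \<in> T \<Longrightarrow> b t \<in> ?R d (?deg t)" "(\<Sum>t\<in>T. b t * ?\<mu> t) = 0" for b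
        using T(2) that unfolding free_over_def by blast
    qed (use finT G H R_sub subspace_shifted_ring in auto)
  qed
  have "\<exists>q e D b. q \<noteq> 0 \<and> D = e + ?deg m \<and> q \<in> coord_ring A C e \<and> (\<forall>t\<in>T. b t \<in> ?R D (?deg t)) \<and>
      q * ?\<mu> m = - (\<Sum>t\<in>T. b t * ?\<mu> t)" if m: "m \<in> M - T" for m
  proof -
    obtain d b where b: "\<forall>t\<in>insert m T. b t \<in> ?R d (?deg t)" "(\<Sum>t\<in>insert m T. b t * ?\<mu> t) = 0"
      "\<not> (\<forall>t\<in>insert m T. b t = 0)"
      using T(3)[OF m] unfolding free_over_def by blast
    have sum: "b m * ?\<mu> m + (\<Sum>t\<in>T. b t * ?\<mu> t) = 0" using b(2) m finT by simp
    have bm: "b m \<noteq> 0"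
    proof
      assume 0: "b m = 0"
      then have "(\<Sum>t\<in>T. b t * ?\<mu> t) = 0" using sum by simp
      then have "\<forall>t\<in>T. b t = 0" using T(2) b(1) unfolding free_over_def by blast
      then show False using b(3) 0 by simp
    qed
    have le: "?deg m \<le> d" using bm b(1) by (auto simp: shifted_ring_def split: if_splits)
    have "b m * ?\<mu> m = - (\<Sum>t\<in>T. b t * ?\<mu> t)" using sum by (simp add: eq_neg_iff_add_eq_0)
    moreover have "b m \<in> coord_ring A C (d - ?deg m)" using b(1) le by (simp add: shifted_ring_def)
    ultimately show ?thesis using bm le b(1)
      by (intro exI[of _ "b m"] exI[of _ "d - ?deg m"] exI[of _ d] exI[of _ b]) auto
  qed
  then obtain q e b where q: "\<And>m. m \<in> M - T \<Longrightarrow> q m \<noteq> 0" "\<And>m. m \<in> M - T \<Longrightarrow> q m \<in> coord_ring A C (e m)"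
    and b: "\<And>m t. m \<in> M - T \<Longrightarrow> t \<in> T \<Longrightarrow> b m t \<in> ?R (e m + ?deg m) (?deg t)"
    and qb: "\<And>m. m \<in> M - T \<Longrightarrow> q m * ?\<mu> m = - (\<Sum>t\<in>T. b m t * ?\<mu> t)"
  proof -
    assume hyp: "\<And>q e b. (\<And>m. m \<in> M - T \<Longrightarrow> q m \<noteq> 0) \<Longrightarrow> (\<And>m. m \<in> M - T \<Longrightarrow> q m \<in> coord_ring A C (e m)) \<Longrightarrow>
      (\<And>m t. m \<in> M - T \<Longrightarrow> t \<in> T \<Longrightarrow> b m t \<in> ?R (e m + ?deg m) (?deg t)) \<Longrightarrow>
      (\<And>m. m \<in> M - T \<Longrightarrow> q m * ?\<mu> m = - (\<Sum>t\<in>T. b m t * ?\<mu> t)) \<Longrightarrow> thesis"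
    assume ex: "\<And>m. m \<in> M - T \<Longrightarrow> \<exists>q e D b. q \<noteq> 0 \<and> D = e + ?deg m \<and> q \<in> coord_ring A C e \<and>
      (\<forall>t\<in>T. b t \<in> ?R D (?deg t)) \<and> q * ?\<mu> m = - (\<Sum>t\<in>T. b t * ?\<mu> t)"
    have "\<forall>m\<in>M - T. \<exists>qeb. fst qeb \<noteq> 0 \<and> fst qeb \<in> coord_ring A C (fst (snd qeb)) \<and>
      (\<forall>t\<in>T. snd (snd qeb) t \<in> ?R (fst (snd qeb) + ?deg m) (?deg t)) \<and>
      fst qeb * ?\<mu> m = - (\<Sum>t\<in>T. snd (snd qeb) t * ?\<mu> t)"
    proof
      fix m assume "m \<in> M - T"
      then obtain q e b where "q \<noteq> 0 \<and> q \<in> coord_ring A C e \<and>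
        (\<forall>t\<in>T. b t \<in> ?R (e + ?deg m) (?deg t)) \<and> q * ?\<mu> m = - (\<Sum>t\<in>T. b t * ?\<mu> t)"
        using ex by blast
      then show "\<exists>qeb. fst qeb \<noteq> 0 \<and> fst qeb \<in> coord_ring A C (fst (snd qeb)) \<and>
        (\<forall>t\<in>T. snd (snd qeb) t \<in> ?R (fst (snd qeb) + ?deg m) (?deg t)) \<and>
        fst qeb * ?\<mu> m = - (\<Sum>t\<in>T. snd (snd qeb) t * ?\<mu> t)"
        by (intro exI[of _ "(q, e, b)"]) simp
    qed
    from bchoice[OF this] obtain F where F: "\<forall>m\<in>M - T. fst (F m) \<noteq> 0 \<and> fst (F m) \<in> coord_ring A C (fst (snd (F m))) \<and>
      (\<forall>t\<in>T. snd (snd (F m)) t \<in> ?R (fst (snd (F m)) + ?deg m) (?deg t)) \<and>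
      fst (F m) * ?\<mu> m = - (\<Sum>t\<in>T. snd (snd (F m)) t * ?\<mu> t)" by blast
    show thesis
      by (rule hyp[of "\<lambda>m. fst (F m)" "\<lambda>m. fst (snd (F m))" "\<lambda>m. snd (snd (F m))"]) (use F in blast)+
  qed
  define \<delta> where "\<delta> = sum e (M - T)"
  define s where "s = cone_one C * prod q (M - T)"
  \<comment> \<open>The product of the multipliers of all other generators:
    \<open>s = s' m * q m\<close>, so the relation for \<open>m\<close> can be applied to
    \<open>s\<close> times that generator.\<close>
  define s' where "s' m = cone_one C * prod q (M - T - {m})" for m
  have fMT: "finite (M - T)" using finM by simp
  have sR: "s \<in> coord_ring A C \<delta>" unfolding s_def \<delta>_def by (rule coord_ring_prod[OF fMT q(2)])
  have s'R: "s' m \<in> coord_ring A C (sum e (M - T - {m}))" for m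
    unfolding s'_def by (rule coord_ring_prod) (use fMT q(2) in auto)
  have ss': "s = s' m * q m" if "m \<in> M - T" for m
    unfolding s_def s'_def using prod.remove[OF fMT that, of q] by (simp add: mult_ac)
  have \<delta>': "\<delta> = e m + sum e (M - T - {m})" if "m \<in> M - T" for m
    unfolding \<delta>_def using sum.remove[OF fMT that, of e] by simp
  have one0: "cone_one C \<noteq> 0" using x0 by (auto simp: cone_one_def cone_eval_def fun_eq_iff)
  have "cone_one C * prod q S \<noteq> 0" if "S \<subseteq> M - T" for S
    using finite_subset[OF that fMT] that
  proof (induction S rule: finite_induct)
    case empty then show ?case using one0 by (simp only: prod.empty mult_1_right) simp
  next
    case (insert m S)
    have "q m \<in> coord_ring L C (e m)" using q(2)[of m] insert.prems coord_ring_mono[OF AL] by blast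
    moreover have "cone_one C * prod q S \<in> coord_ring L C (sum e S)"
      using coord_ring_prod[OF insert.hyps(1), of q A C e] q(2) insert.prems coord_ring_mono[OF AL] by blast
    moreover have "q m \<noteq> 0" using q(1)[of m] insert.prems by blast
    moreover have "cone_one C * prod q S \<noteq> 0" by (rule insert.IH) (use insert.prems in blast)
    ultimately have *: "q m * (cone_one C * prod q S) \<noteq> 0" using domain_cone_nonzero[OF dom] by blast
    have eq: "cone_one C * prod q (insert m S) = q m * (cone_one C * prod q S)"
      by (simp only: prod.insert[OF insert.hyps] mult.left_commute)
    show ?case unfolding eq by (rule *)
  qed
  then have s0: "s \<noteq> 0" unfolding s_def by blast
  have up: "hilb L C d \<le> (\<Sum>t\<in>T. fs.dim (?R (d + \<delta>) (?deg t)))" for d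
  proof -
    have "hilb L C d = fs.dim ((\<lambda>f. s * f) ` coord_ring L C d)"
      by (rule dim_mult_nonzero[OF fin dom subsetD[OF coord_ring_mono[OF AL] sR] s0, symmetric])
    also have "\<dots> \<le> (\<Sum>t\<in>T. fs.dim (?R (d + \<delta>) (?deg t)))"
    proof (rule dim_module_sum_le[where G = "G (d + \<delta>)" and w = ?\<mu>])
      fix h assume "h \<in> (\<lambda>f. s * f) ` coord_ring L C d"
      then obtain f where f: "f \<in> coord_ring L C d" "h = s * f" by blast
      obtain g where g: "\<forall>m\<in>M. g m \<in> ?R d (?deg m)" "f = (\<Sum>m\<in>M. g m * ?\<mu> m)"
        using M f(1) unfolding module_gens_def by blast
      \<comment> \<open>The coefficients of \<open>h\<close> over \<open>T\<close> once every
        generator outside \<open>T\<close> has been rewritten by its relation \<open>qb\<close>,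
        which carries a minus sign.\<close>
      define c where "c t = s * g t - (\<Sum>m\<in>M - T. s' m * g m * b m t)" for t
      have "c t \<in> ?R (d + \<delta>) (?deg t)" if t: "t \<in> T" for t
      proof -
        have "s * g t \<in> ?R (d + \<delta>) (?deg t)" using sR g(1) t T(1) by (intro shifted_ring_mult) auto
        moreover have "s' m * g m * b m t \<in> ?R (d + \<delta>) (?deg t)" if m: "m \<in> M - T" for m
        proof (cases "?deg m \<le> d")
          case True
          then have "g m \<in> coord_ring A C (d - ?deg m)" using g(1) m by (auto simp: shifted_ring_def)
          then have "s' m * g m \<in> coord_ring A C (sum e (M - T - {m}) + (d - ?deg m))"
            by (rule coord_ring_mult[OF s'R])
          then have "s' m * g m * b m t \<in> ?R (e m + ?deg m + (sum e (M - T - {m}) + (d - ?deg m))) (?deg t)"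
            by (rule shifted_ring_mult) (rule b[OF m t])
          moreover have "e m + ?deg m + (sum e (M - T - {m}) + (d - ?deg m)) = d + \<delta>"
            using True \<delta>'[OF m] by simp
          ultimately show ?thesis by simp
        next
          case False
          then have "g m = 0" using g(1) m by (auto simp: shifted_ring_def)
          then show ?thesis using fs.subspace_0[OF subspace_shifted_ring] by simp
        qed
        ultimately show ?thesis unfolding c_def
          by (intro fs.subspace_diff[OF subspace_shifted_ring] fs.subspace_sum[OF subspace_shifted_ring])
      qed
      moreover have "h = (\<Sum>t\<in>T. c t * ?\<mu> t)"
      proof -
        have "h = (\<Sum>m\<in>M. s * g m * ?\<mu> m)" by (simp add: f(2) g(2) sum_distrib_left mult.assoc)
        also have "\<dots> = (\<Sum>m\<in>T. s * g m * ?\<mu> m) + (\<Sum>m\<in>M - T. s * g m * ?\<mu> m)"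
          using sum.subset_diff[OF T(1) finM(1), of "\<lambda>m. s * g m * ?\<mu> m"] by (simp add: add.commute)
        also have "(\<Sum>m\<in>M - T. s * g m * ?\<mu> m) = (\<Sum>m\<in>M - T. \<Sum>t\<in>T. - (s' m * g m * b m t * ?\<mu> t))"
        proof (intro sum.cong refl)
          fix m assume m: "m \<in> M - T"
          have "s * g m * ?\<mu> m = s' m * g m * (q m * ?\<mu> m)" using ss'[OF m] by (simp add: mult_ac)
          also have "\<dots> = (\<Sum>t\<in>T. - (s' m * g m * b m t * ?\<mu> t))"
            unfolding qb[OF m] by (simp add: sum_distrib_left sum_negf mult.assoc)
          finally show "s * g m * ?\<mu> m = (\<Sum>t\<in>T. - (s' m * g m * b m t * ?\<mu> t))" .
        qed
        also have "\<dots> = (\<Sum>t\<in>T. \<Sum>m\<in>M - T. - (s' m * g m * b m t * ?\<mu> t))" by (rule sum.swap)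
        also have "(\<Sum>m\<in>T. s * g m * ?\<mu> m) + \<dots> = (\<Sum>t\<in>T. c t * ?\<mu> t)"
          unfolding sum.distrib[symmetric]
          by (intro sum.cong refl) (simp add: c_def left_diff_distrib sum_distrib_right sum_negf)
        finally show ?thesis .
      qed
      ultimately show "\<exists>b. (\<forall>t\<in>T. b t \<in> ?R (d + \<delta>) (?deg t)) \<and> h = (\<Sum>t\<in>T. b t * ?\<mu> t)" by blast
    qed (use finT G in auto)
    finally show ?thesis .
  qed
  show ?thesis by (intro exI[of _ T] exI[of _ \<delta>] conjI allI finT low up)
qed

subsection \<open>Comparison of Hilbert polynomials\<close>

definition is_hilb_poly :: "'i set \<Rightarrow> ('i \<Rightarrow> complex) set \<Rightarrow> rat poly \<Rightarrow> bool"
  where "is_hilb_poly I C h \<longleftrightarrow> (\<forall>\<^sub>F d in sequentially. poly h (of_nat d) = of_nat (hilb I C d))"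

lemma ex_hilb_poly: "finite I \<Longrightarrow> \<exists>h. is_hilb_poly I C h"
  using evpoly_hilb by (auto simp: is_hilb_poly_def evpoly_def)

lemma is_hilb_poly_nonneg: "is_hilb_poly I C h \<Longrightarrow> \<forall>\<^sub>F d in sequentially. poly h (of_nat d) \<ge> 0"
  unfolding is_hilb_poly_def by (erule eventually_mono) simp

lemma fs_dim_0: "fs.dim {0 :: 'x \<Rightarrow> complex} = 0"
  using fs.dim_le_card[of "{0 :: 'x \<Rightarrow> complex}" "{}"] by simp

lemma dim_shifted_ring: "fs.dim (shifted_ring A C d k) = (if k \<le> d then hilb A C (d - k) else 0)"
  by (simp add: shifted_ring_def hilb_def fs_dim_0)

lemma eventually_sum_dim_shifted_ring:
  assumes h: "is_hilb_poly A C h" and T: "finite T"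
  shows "\<forall>\<^sub>F d in sequentially. poly (\<Sum>t\<in>T. poly_shift (of_nat \<delta> - of_nat (k t)) h) (of_nat d) =
    of_nat (\<Sum>t\<in>T. fs.dim (shifted_ring A C (d + \<delta>) (k t)))"
proof -
  obtain N where N: "\<And>d. d \<ge> N \<Longrightarrow> poly h (of_nat d) = of_nat (hilb A C d)"
    using h by (auto simp: is_hilb_poly_def eventually_sequentially)
  have "poly (\<Sum>t\<in>T. poly_shift (of_nat \<delta> - of_nat (k t)) h) (of_nat d) =
    of_nat (\<Sum>t\<in>T. fs.dim (shifted_ring A C (d + \<delta>) (k t)))" if d: "d \<ge> N + (\<Sum>t\<in>T. k t)" for d
    unfolding poly_sum of_nat_sum
  proof (intro sum.cong refl)
    fix t assume t: "t \<in> T"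
    have "k t \<le> (\<Sum>t\<in>T. k t)" using t T by (intro member_le_sum) auto
    then have le: "k t \<le> d + \<delta>" and "d + \<delta> - k t \<ge> N" using d by auto
    then have "poly h (of_nat (d + \<delta> - k t)) = of_nat (hilb A C (d + \<delta> - k t))" using N by blast
    moreover have "of_nat (d + \<delta> - k t) = of_nat d + (of_nat \<delta> - of_nat (k t) :: rat)"
      using le by (simp add: of_nat_diff)
    ultimately show "poly (poly_shift (of_nat \<delta> - of_nat (k t)) h) (of_nat d) =
      of_nat (fs.dim (shifted_ring A C (d + \<delta>) (k t)))"
      using le by (simp add: dim_shifted_ring)
  qed
  then show ?thesis by (auto simp: eventually_sequentially)
qed

lemma degree_sum_poly_shift:
  assumes "finite T"
  shows "degree (\<Sum>t\<in>T. poly_shift (c t) h) \<le> degree h"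
    and "coeff (\<Sum>t\<in>T. poly_shift (c t) h) (degree h) = of_nat (card T) * lead_coeff h"
  by (auto simp: coeff_sum coeff_poly_shift_lead intro: degree_sum_le[OF assms])

lemma hilb_mono: "finite L \<Longrightarrow> A \<subseteq> L \<Longrightarrow> hilb A C d \<le> hilb L C d"
  unfolding hilb_def
  by (rule fs.dim_mono_finite[of _ _ "monom_fun C ` monoms_deg L d"])
    (simp_all add: finite_monoms_degree order_trans[OF coord_ring_mono fs.span_superset]
      coord_ring_eq_span[symmetric])

text \<open>Both bounds are sums of \<open>card T\<close> shifts of \<open>hA\<close>, so they have
  the same coefficient in degree \<open>degree hA\<close> and force that of \<open>hL\<close> to be
  \<open>card T\<close> times the leading coefficient of \<open>hA\<close>. The degree of
  \<open>hL\<close> is not smaller because the ring of \<open>A\<close> is contained in that of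
  \<open>L\<close>.\<close>

lemma hilb_poly_degree_lead_coeff:
  fixes L :: "'i set"
  assumes fin: "finite L" and AL: "A \<subseteq> L" and dom: "domain_cone L C" and int: "integral_cone A L C"
    and x0: "x0 \<in> C" and hA: "is_hilb_poly A C hA" and hL: "is_hilb_poly L C hL"
  shows "degree hL = degree hA \<and> (\<exists>e. lead_coeff hL = of_nat e * lead_coeff hA)"
proof -
  obtain T :: "('i \<Rightarrow>\<^sub>0 nat) set" and \<delta> where T: "finite T"
    and low: "\<And>d. (\<Sum>t\<in>T. fs.dim (shifted_ring A C d (monom_degree t))) \<le> hilb L C d"
    and up: "\<And>d. hilb L C d \<le> (\<Sum>t\<in>T. fs.dim (shifted_ring A C (d + \<delta>) (monom_degree t)))"
    using hilb_rank_sandwich[OF fin AL dom int x0] by blast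
  define lo where "lo = (\<Sum>t\<in>T. poly_shift (of_nat 0 - of_nat (monom_degree t)) hA)"
  define hi where "hi = (\<Sum>t\<in>T. poly_shift (of_nat \<delta> - of_nat (monom_degree t)) hA)"
  note ev_lo = eventually_sum_dim_shifted_ring[OF hA T, of 0 monom_degree]
  note ev_hi = eventually_sum_dim_shifted_ring[OF hA T, of \<delta> monom_degree]
  have q0: "\<forall>\<^sub>F d in sequentially. poly (hL - lo) (of_nat d) \<ge> 0"
    using ev_lo hL[unfolded is_hilb_poly_def]
  proof eventually_elim
    case (elim d)
    have "(of_nat (\<Sum>t\<in>T. fs.dim (shifted_ring A C d (monom_degree t))) :: rat) \<le> of_nat (hilb L C d)"
      using low[of d] by (simp only: of_nat_le_iff)
    then show ?case using elim unfolding lo_def poly_diff by (simp only: add_0_right diff_ge_0_iff_ge)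
  qed
  have qw: "\<forall>\<^sub>F d in sequentially. poly (hL - lo) (of_nat d) \<le> poly (hi - lo) (of_nat d)"
    using ev_hi hL[unfolded is_hilb_poly_def]
  proof eventually_elim
    case (elim d)
    have "(of_nat (hilb L C d) :: rat) \<le> of_nat (\<Sum>t\<in>T. fs.dim (shifted_ring A C (d + \<delta>) (monom_degree t)))"
      using up[of d] by (simp only: of_nat_le_iff)
    then show ?case using elim unfolding hi_def poly_diff by simp
  qed
  have w: "hi - lo = 0 \<or> degree (hi - lo) < degree hA"
  proof (cases "degree hA = 0")
    case True
    then obtain a where "hA = [:a:]" by (metis degree_eq_zeroE)
    then show ?thesis by (simp add: hi_def lo_def poly_shift_def)
  next
    case False
    have "coeff (hi - lo) i = 0" if "i \<ge> degree hA" for i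
    proof (cases "i = degree hA")
      case True
      then show ?thesis using degree_sum_poly_shift(2)[OF T] by (simp add: hi_def lo_def)
    next
      case False
      then show ?thesis
        using that degree_sum_poly_shift(1)[OF T, of "\<lambda>t. of_nat \<delta> - of_nat (monom_degree t)" hA]
          degree_sum_poly_shift(1)[OF T, of "\<lambda>t. of_nat 0 - of_nat (monom_degree t)" hA]
        by (simp add: hi_def lo_def coeff_eq_0)
    qed
    then show ?thesis by (metis leading_coeff_0_iff not_le)
  qed
  have q: "hL - lo = 0 \<or> degree (hL - lo) < degree hA"
    using poly_eventually_dominated[OF q0 qw] w by auto
  have qc: "coeff (hL - lo) i = 0" if "i \<ge> degree hA" for i
    using q that by (metis coeff_0 coeff_eq_0 order_less_le_trans)
  have cL: "coeff hL (degree hA) = of_nat (card T) * lead_coeff hA"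
    using qc[of "degree hA"] degree_sum_poly_shift(2)[OF T] by (simp add: lo_def)
  have dL: "degree hL \<le> degree hA"
  proof (rule degree_le, intro allI impI)
    fix i assume i: "degree hA < i"
    then have "coeff lo i = 0"
      using degree_sum_poly_shift(1)[OF T, of "\<lambda>t. of_nat 0 - of_nat (monom_degree t)" hA]
      by (simp add: lo_def coeff_eq_0)
    then show "coeff hL i = 0" using qc[of i] i by simp
  qed
  have AleL: "\<forall>\<^sub>F d in sequentially. poly hA (of_nat d) \<le> poly hL (of_nat d)"
    using hA[unfolded is_hilb_poly_def] hL[unfolded is_hilb_poly_def]
    by eventually_elim (simp add: hilb_mono[OF fin AL])
  have dA: "hA = 0 \<or> degree hA \<le> degree hL"
    using poly_eventually_dominated[OF is_hilb_poly_nonneg[OF hA] AleL] by auto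
  have deg: "degree hL = degree hA" using dA dL by auto
  then show ?thesis using cL by auto
qed

lemma dim_0_subset:
  assumes "U \<subseteq> fs.span G" "finite G" "fs.dim U = 0"
  shows "U \<subseteq> {0}"
proof -
  obtain B where B: "B \<subseteq> U" "fs.independent B" "U \<subseteq> fs.span B" "card B = fs.dim U"
    by (rule fs.basis_exists)
  have "finite B" using fs.independent_span_bound[OF assms(2) B(2)] B(1) assms(1) by blast
  then have "B = {}" using B(4) assms(3) by simp
  then show ?thesis using B(3) by simp
qed

lemma hilb_pos:
  assumes fin: "finite L" and x: "x \<in> C" "i \<in> L" "x i \<noteq> 0"
  shows "hilb L C d > 0"
proof (rule ccontr)
  assume "\<not> hilb L C d > 0"
  then have "coord_ring L C d \<subseteq> {0}"
    using dim_0_subset[of "coord_ring L C d" "monom_fun C ` monoms_deg L d"] finite_monoms_degree[OF fin]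
    by (auto simp: hilb_def coord_ring_eq_span)
  moreover have "monom_fun C (Poly_Mapping.single i d) \<in> coord_ring L C d"
    using monom_fun_coord_ring[of "Poly_Mapping.single i d" L C] x(2) by (simp add: monoms_def)
  ultimately have "monom_fun C (Poly_Mapping.single i d) = 0" by blast
  from fun_cong[OF this, of x] show False using x by (simp add: monom_fun_def monom_eval_single_power)
qed

text \<open>
  Incomparability: forms on \<open>C\<close> that vanish on \<open>C'\<close> make the Hilbert polynomial drop its
  degree, while the subring of forms in \<open>A\<close> bounds it from below.
\<close>

lemma integral_cone_incomparable:
  assumes fin: "finite L" and AL: "A \<subseteq> L" and dom: "domain_cone L C" and int: "integral_cone A L C"
    and C': "C' \<subseteq> C" and x: "x \<in> C" "i \<in> L" "x i \<noteq> 0"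
    and eq: "\<And>d f. f \<in> forms A d \<Longrightarrow> (\<forall>x\<in>C'. cpoly_eval f x = 0) \<Longrightarrow> (\<forall>x\<in>C. cpoly_eval f x = 0)"
    and f: "f \<in> forms L \<delta>" "\<forall>x\<in>C'. cpoly_eval f x = 0"
  shows "\<forall>x\<in>C. cpoly_eval f x = 0"
proof (rule ccontr)
  assume neg: "\<not> ?thesis"
  define F where "F = cone_eval C f"
  have F: "F \<in> coord_ring L C \<delta>" using f(1) by (simp add: F_def coord_ring_def)
  have F0: "F \<noteq> 0" using neg by (auto simp: F_def cone_eval_def fun_eq_iff)
  have finA: "finite A" using fin AL finite_subset by blast
  obtain p where p: "is_hilb_poly L C p" using ex_hilb_poly[OF fin] by blast
  obtain q where q: "is_hilb_poly A C q" using ex_hilb_poly[OF finA] by blast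
  have qC': "hilb A C d \<le> hilb L C' d" for d
  proof -
    have "{g \<in> coord_ring A C d. restrict_fun C' g = 0} \<subseteq> {0}"
    proof
      fix g assume g: "g \<in> {g \<in> coord_ring A C d. restrict_fun C' g = 0}"
      then obtain g' where g': "g' \<in> forms A d" "g = cone_eval C g'" by (auto simp: coord_ring_def)
      have "cone_eval C' g' = 0" using g by (simp add: g'(2) restrict_cone_eval[OF C'])
      then have "\<forall>x\<in>C'. cpoly_eval g' x = 0" by (auto simp: cone_eval_def fun_eq_iff split: if_splits)
      then have "\<forall>x\<in>C. cpoly_eval g' x = 0" using eq[OF g'(1)] by blast
      then show "g \<in> {0}" by (simp add: g'(2) cone_eval_def fun_eq_iff)
    qed
    then have "fs.dim {g \<in> coord_ring A C d. restrict_fun C' g = 0} = 0"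
      using fs.dim_le_card[of "{g \<in> coord_ring A C d. restrict_fun C' g = 0}" "{}"] by simp
    then have "hilb A C d = hilb A C' d" using hilb_restrict[OF finA C', of d] by simp
    then show ?thesis using hilb_mono[OF fin AL, of C' d] by simp
  qed
  \<comment> \<open>The multiples of \<open>F\<close> vanish on \<open>C'\<close> and in degree
    \<open>d\<close> form a copy of the degree \<open>d - \<delta>\<close> part of the ring;
    restriction to \<open>C'\<close> loses at least that much.\<close>
  have drop: "hilb L C' d + hilb L C (d - \<delta>) \<le> hilb L C d" if "d \<ge> \<delta>" for d
  proof -
    let ?K = "{g \<in> coord_ring L C d. restrict_fun C' g = 0}"
    have sub: "(\<lambda>g. F * g) ` coord_ring L C (d - \<delta>) \<subseteq> ?K"
    proof (rule image_subsetI)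
      fix g assume g: "g \<in> coord_ring L C (d - \<delta>)"
      have "F * g \<in> coord_ring L C (\<delta> + (d - \<delta>))" by (rule coord_ring_mult[OF F g])
      moreover have "restrict_fun C' (F * g) = 0"
        using f(2) by (auto simp: restrict_fun_def F_def cone_eval_def fun_eq_iff)
      ultimately show "F * g \<in> ?K" using that by simp
    qed
    have "fs.dim ((\<lambda>g. F * g) ` coord_ring L C (d - \<delta>)) \<le> fs.dim ?K"
    proof (rule fs.dim_mono_finite)
      show "(\<lambda>g. F * g) ` coord_ring L C (d - \<delta>) \<subseteq> fs.span ?K"
        by (rule order_trans[OF sub fs.span_superset])
      show "?K \<subseteq> fs.span (monom_fun C ` monoms_deg L d)" by (auto simp: coord_ring_eq_span)
      show "finite (monom_fun C ` monoms_deg L d)" by (intro finite_imageI finite_monoms_degree fin)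
    qed
    then show ?thesis using dim_mult_nonzero[OF fin dom F F0, of "d - \<delta>"] hilb_restrict[OF fin C', of d] by simp
  qed
  have ev1: "\<forall>\<^sub>F d in sequentially. poly q (of_nat d) \<le> poly (poly_shift 0 p - poly_shift (- of_nat \<delta>) p) (of_nat d)"
    using q[unfolded is_hilb_poly_def] p[unfolded is_hilb_poly_def]
      eventually_shift_right[OF p[unfolded is_hilb_poly_def], of \<delta>] eventually_ge_at_top[of \<delta>]
  proof eventually_elim
    case (elim d)
    have "hilb A C d + hilb L C (d - \<delta>) \<le> hilb L C d" using qC'[of d] drop[OF elim(4)] by simp
    then have "(of_nat (hilb A C d) :: rat) + of_nat (hilb L C (d - \<delta>)) \<le> of_nat (hilb L C d)"
      by (metis of_nat_add of_nat_le_iff)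
    then show ?case using elim(1-3) by simp
  qed
  \<comment> \<open>Finite generation bounds \<open>p\<close> by a sum of shifts of
    \<open>q\<close>, hence \<open>degree p \<le> degree q\<close>. The estimate before bounds
    \<open>q\<close> by a difference of shifts of \<open>p\<close>, which has smaller degree than
    \<open>p\<close> or is zero.\<close>
  obtain M where M: "module_gens A L C M" using integral_cone_module_gens[OF fin int] by blast
  then have finM: "finite M" by (simp add: module_gens_def)
  let ?s = "\<Sum>t\<in>M. poly_shift (of_nat 0 - of_nat (monom_degree t)) q"
  have ev2: "\<forall>\<^sub>F d in sequentially. poly p (of_nat d) \<le> poly ?s (of_nat d)"
    using eventually_sum_dim_shifted_ring[OF q finM, of 0 monom_degree] p[unfolded is_hilb_poly_def]
  proof eventually_elim
    case (elim d)
    have "(of_nat (hilb L C d) :: rat) \<le> of_nat (\<Sum>m\<in>M. fs.dim (shifted_ring A C d (monom_degree m)))"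
      using hilb_le_sum_gens[OF fin AL M, of d] by (simp only: of_nat_le_iff)
    then show ?case using elim by (simp only: add_0_right)
  qed
  have p0: "p \<noteq> 0"
  proof
    assume "p = 0"
    then have "\<forall>\<^sub>F d in sequentially. hilb L C d = 0" using p by (simp add: is_hilb_poly_def)
    then obtain N where "hilb L C N = 0" by (auto simp: eventually_sequentially)
    then show False using hilb_pos[OF fin x, of N] by simp
  qed
  have 1: "q = 0 \<or> (poly_shift 0 p - poly_shift (- of_nat \<delta>) p \<noteq> 0 \<and>
      degree q \<le> degree (poly_shift 0 p - poly_shift (- of_nat \<delta>) p))"
    by (rule poly_eventually_dominated[OF is_hilb_poly_nonneg[OF q] ev1])
  have 2: "?s \<noteq> 0 \<and> degree p \<le> degree ?s"
    using poly_eventually_dominated[OF is_hilb_poly_nonneg[OF p] ev2] p0 by blast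
  have "q \<noteq> 0" using 2 by (auto simp: poly_shift_def)
  then have "degree q < degree p" using 1 degree_poly_shift_diff[of 0 p "- of_nat \<delta>"] by auto
  moreover have "degree p \<le> degree q" using 2 degree_sum_poly_shift(1)[OF finM, of _ q] by (meson order_trans)
  ultimately show False by simp
qed

subsection \<open>The degree\<close>

lemma hilbert_polynomial_eq:
  assumes fin: "finite I" and h: "is_hilb_poly I (\<Union>X) h"
  shows "hilbert_polynomial I X = h"
  unfolding hilbert_polynomial_def hilbert_function_eq_hilb[OF fin]
proof (rule the_equality)
  show "\<forall>\<^sub>F d in sequentially. poly h (of_nat d) = of_nat (hilb I (\<Union>X) d)"
    using h by (simp add: is_hilb_poly_def)
  fix k :: "rat poly" assume k: "\<forall>\<^sub>F d in sequentially. poly k (of_nat d) = of_nat (hilb I (\<Union>X) d)"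
  show "k = h"
    by (rule poly_eventually_eq) (use k h[unfolded is_hilb_poly_def] in eventually_elim, simp)
qed

text \<open>The description in \<open>proj_degree\<close> denotes a natural number: the product is
  an integer since the Hilbert polynomial is eventually integer valued, and nonnegative since its
  values are.\<close>

lemma of_nat_proj_degree:
  assumes fin: "finite I" and h: "is_hilb_poly I (\<Union>X) h"
  shows "of_nat (proj_degree I X) = fact (degree h) * lead_coeff h"
proof -
  have "\<forall>\<^sub>F d in sequentially. poly h (of_nat d) \<in> \<int>"
    using h[unfolded is_hilb_poly_def] by eventually_elim simp
  then have "fact (degree h) * lead_coeff h \<in> \<int>" by (rule integer_valued_lead_coeff)
  then obtain z where z: "fact (degree h) * lead_coeff h = of_int z" by (auto elim: Ints_cases)
  have "lead_coeff h \<ge> 0" by (rule poly_eventually_nonneg[OF is_hilb_poly_nonneg[OF h]])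
  then have "(0 :: rat) \<le> fact (degree h) * lead_coeff h" by simp
  then have "z \<ge> 0" using z by simp
  then have e: "of_nat (nat z) = fact (degree h) * lead_coeff h" using z by simp
  have "proj_degree I X = nat z"
    unfolding proj_degree_def hilbert_polynomial_eq[OF fin h] e[symmetric]
    by (rule the_equality) auto
  then show ?thesis using e by simp
qed

text \<open>\<open>link\<close> allows the Hilbert polynomial of \<open>Y\<close> to be computed on
  the cone over \<open>X\<close> with the variables in \<open>A\<close>, so that both polynomials
  belong to one cone. Their degrees agree, so the factorials do too.\<close>

lemma proj_degree_dvd:
  assumes fin: "finite L" and AL: "A \<subseteq> L" and dom: "domain_cone L (\<Union>X)" and int: "integral_cone A L (\<Union>X)"
    and x0: "x0 \<in> \<Union>X" and link: "\<And>d. hilb A (\<Union>Y) d = hilb A (\<Union>X) d"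
  shows "proj_degree A Y dvd proj_degree L X"
proof -
  have finA: "finite A" using fin AL finite_subset by blast
  obtain hL where hL: "is_hilb_poly L (\<Union>X) hL" using ex_hilb_poly[OF fin] by blast
  obtain hA where hA: "is_hilb_poly A (\<Union>X) hA" using ex_hilb_poly[OF finA] by blast
  have hA': "is_hilb_poly A (\<Union>Y) hA" using hA by (simp add: is_hilb_poly_def link)
  obtain e where e: "degree hL = degree hA" "lead_coeff hL = of_nat e * lead_coeff hA"
    using hilb_poly_degree_lead_coeff[OF fin AL dom int x0 hA hL] by blast
  have "(of_nat (proj_degree L X) :: rat) = of_nat (e * proj_degree A Y)"
    unfolding of_nat_proj_degree[OF fin hL] of_nat_mult of_nat_proj_degree[OF finA hA']
    using e by simp
  then have "proj_degree L X = e * proj_degree A Y" by (simp only: of_nat_eq_iff)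
  then show ?thesis by simp
qed

subsection \<open>Forms vanishing on a secant variety\<close>

lemma mem_proj_pt: "y \<in> proj_pt x \<longleftrightarrow> (\<exists>c. c \<noteq> 0 \<and> y = (\<lambda>i. c * x i))"
  by (auto simp: proj_pt_def)

lemma proj_pt_self: "x \<in> proj_pt x"
  unfolding mem_proj_pt by (rule exI[of _ 1]) simp

lemma proj_pt_scale:
  assumes "c \<noteq> 0"
  shows "proj_pt (\<lambda>i. c * x i) = proj_pt x"
proof (intro equalityI subsetI)
  fix y assume "y \<in> proj_pt (\<lambda>i. c * x i)"
  then obtain e where "e \<noteq> 0" "y = (\<lambda>i. e * (c * x i))" by (auto simp: mem_proj_pt)
  then show "y \<in> proj_pt x" unfolding mem_proj_pt
    using assms by (intro exI[of _ "e * c"]) (auto simp: mult.assoc)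
next
  fix y assume "y \<in> proj_pt x"
  then obtain e where "e \<noteq> 0" "y = (\<lambda>i. e * x i)" by (auto simp: mem_proj_pt)
  then show "y \<in> proj_pt (\<lambda>i. c * x i)" unfolding mem_proj_pt
    using assms by (intro exI[of _ "e / c"]) auto
qed

lemma proj_space_mem_scale:
  assumes "p \<in> proj_space I" "x \<in> p" "c \<noteq> 0"
  shows "(\<lambda>i. c * x i) \<in> p"
  using assms unfolding proj_space_def
  by (auto simp: mem_proj_pt) (metis mult.assoc mult_eq_0_iff)

lemma proj_space_mem:
  assumes "p \<in> proj_space I" "x \<in> p"
  shows "x \<in> coord_space I" "x \<noteq> (\<lambda>_. 0)" "p = proj_pt x"
proof -
  obtain z where z: "z \<in> coord_space I" "z \<noteq> (\<lambda>_. 0)" "p = proj_pt z"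
    using assms(1) by (auto simp: proj_space_def)
  then obtain c where c: "c \<noteq> 0" "x = (\<lambda>i. c * z i)" using assms(2) by (auto simp: mem_proj_pt)
  show "x \<in> coord_space I" using z(1) c by (auto simp: coord_space_def)
  show "x \<noteq> (\<lambda>_. 0)" using z(2) c by (auto simp: fun_eq_iff)
  show "p = proj_pt x" unfolding c(2) proj_pt_scale[OF c(1)] by (rule z(3))
qed

lemma proj_space_nonzero_coord:
  assumes "p \<in> proj_space I" "x \<in> p"
  obtains i where "i \<in> I" "x i \<noteq> 0"
proof -
  obtain i where "x i \<noteq> 0" using proj_space_mem(2)[OF assms] by auto
  moreover have "i \<in> I" using proj_space_mem(1)[OF assms] calculation by (auto simp: coord_space_def)
  ultimately show ?thesis using that by blast
qed

lemma proj_pt_in_proj_space: "x \<in> coord_space I \<Longrightarrow> x \<noteq> (\<lambda>_. 0) \<Longrightarrow> proj_pt x \<in> proj_space I"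
  by (auto simp: proj_space_def)

lemma closure_forms_vanish:
  assumes T: "T \<subseteq> proj_space I" and f: "f \<in> forms I d" "\<And>x. x \<in> \<Union>T \<Longrightarrow> cpoly_eval f x = 0"
    and x: "x \<in> \<Union>(zariski I closure_of T)"
  shows "cpoly_eval f x = 0"
proof -
  have "closedin (zariski I) (zero_locus I {f})"
    unfolding closedin_zariski using f(1) by (intro exI[of _ "{f}"]) auto
  moreover have "T \<subseteq> zero_locus I {f}" using T f(2) by (auto simp: zero_locus_def)
  ultimately have "zariski I closure_of T \<subseteq> zero_locus I {f}" by (rule closure_of_minimal[rotated])
  then show ?thesis using x by (auto simp: zero_locus_def)
qed

lemma hom_comp_sum_eval:
  assumes "\<And>k. cpoly_eval (hom_comp k g) x = 0"
  shows "cpoly_eval g x = 0"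
proof -
  obtain K where K: "\<And>m. m \<in> Poly_Mapping.keys g \<Longrightarrow> monom_degree m \<le> K"
    using cpoly_degree_bound[of g] by blast
  show ?thesis using cpoly_eval_scaled[of g K 1 x] K assms by simp
qed

text \<open>Fixing some arguments of a form leaves an inhomogeneous polynomial. Its vanishing still
  passes to the closure, component by component, because a point of \<open>T\<close> contains all
  nonzero multiples of its representatives.\<close>

lemma closure_polys_vanish:
  assumes T: "T \<subseteq> proj_space I" and g: "g \<in> polys I" "\<And>x. x \<in> \<Union>T \<Longrightarrow> cpoly_eval g x = 0"
    and x: "x \<in> \<Union>(zariski I closure_of T)"
  shows "cpoly_eval g x = 0"
proof (rule hom_comp_sum_eval)
  fix k
  show "cpoly_eval (hom_comp k g) x = 0"
  proof (rule closure_forms_vanish[OF T hom_comp_forms[OF g(1)] _ x])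
    fix y assume y: "y \<in> \<Union>T"
    then obtain p where p: "p \<in> T" "y \<in> p" by blast
    show "cpoly_eval (hom_comp k g) y = 0"
      by (rule hom_comp_vanish) (use proj_space_mem_scale[of p I y] p T g(2) in blast)
  qed
qed

section \<open>Torus orbits, secant lines and the forms vanishing on their union\<close>

definition torus_point :: "(int ^ 'n) set \<Rightarrow> complex ^ 'n \<Rightarrow> int ^ 'n \<Rightarrow> complex"
  where "torus_point A t = (\<lambda>u. if u \<in> A then character u t else 0)"

lemma toric_variety_eq: "toric_variety A = zariski A closure_of ((\<lambda>t. proj_pt (torus_point A t)) ` torus)"
  unfolding toric_variety_def torus_point_def torus_def
  by (rule arg_cong[of _ _ "\<lambda>T. zariski A closure_of T"]) blast

lemma character_nonzero: "t \<in> torus \<Longrightarrow> character u t \<noteq> 0"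
  by (simp add: character_def torus_def)

lemma torus_point_nonzero: "a \<in> A \<Longrightarrow> t \<in> torus \<Longrightarrow> torus_point A t \<noteq> (\<lambda>_. 0)"
  using character_nonzero[of t a] by (auto simp: torus_point_def fun_eq_iff)

lemma torus_point_coord_space: "torus_point A t \<in> coord_space A"
  by (auto simp: torus_point_def coord_space_def)

lemma secant_point_eq: "secant_point A l m t s = (\<lambda>u. l * torus_point A t u + m * torus_point A s u)"
  by (auto simp: secant_point_def torus_point_def)

lemma torus_orbit_subset: "a \<in> A \<Longrightarrow> (\<lambda>t. proj_pt (torus_point A t)) ` torus \<subseteq> proj_space A"
  using proj_pt_in_proj_space[OF torus_point_coord_space torus_point_nonzero] by blast

lemma torus_point_in_toric_variety: "a \<in> A \<Longrightarrow> t \<in> torus \<Longrightarrow> proj_pt (torus_point A t) \<in> toric_variety A"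
  unfolding toric_variety_eq
  by (rule subsetD[OF closure_of_subset]) (use torus_orbit_subset[of a A] in auto)

lemma toric_variety_polys_vanish:
  assumes a: "a \<in> A" and F: "polyfun A F" "\<And>t c. t \<in> torus \<Longrightarrow> c \<noteq> 0 \<Longrightarrow> F (\<lambda>i. c * torus_point A t i) = 0"
    and x: "x \<in> \<Union>(toric_variety A)"
  shows "F x = 0"
proof -
  obtain g where g: "g \<in> polys A" "\<And>x. F x = cpoly_eval g x" using F(1) by (auto simp: polyfun_def)
  have "cpoly_eval g x = 0"
    by (rule closure_polys_vanish[OF torus_orbit_subset[OF a] g(1) _ x[unfolded toric_variety_eq]])
      (use F(2) g(2) in \<open>auto simp: mem_proj_pt\<close>)
  then show ?thesis using g(2) by simp
qed

text \<open>The closure is taken in one argument at a time: in \<open>x\<close> with a torus point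
  as the other argument, then in \<open>y\<close> with an arbitrary \<open>x\<close> of the
  variety.\<close>

lemma join_forms_vanish:
  assumes a: "a \<in> A" and f: "f \<in> forms A d"
    and van: "\<And>l m t s. t \<in> torus \<Longrightarrow> s \<in> torus \<Longrightarrow> cpoly_eval f (secant_point A l m t s) = 0"
    and xy: "x \<in> \<Union>(toric_variety A)" "y \<in> \<Union>(toric_variety A)"
  shows "cpoly_eval f (\<lambda>i. l * x i + m * y i) = 0"
proof -
  have fp: "f \<in> polys A" using f forms_subset_polys by blast
  have 1: "cpoly_eval f (\<lambda>i. l * x i + m * torus_point A s i) = 0" if s: "s \<in> torus" for l m s
  proof (rule toric_variety_polys_vanish[OF a _ _ xy(1), where F = "\<lambda>x. cpoly_eval f (\<lambda>i. l * x i + m * torus_point A s i)"])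
    show "polyfun A (\<lambda>x. cpoly_eval f (\<lambda>i. l * x i + m * torus_point A s i))"
      by (rule polyfun_compose[OF fp]) (intro polyfun_add polyfun_mult polyfun_const polyfun_var)
    fix t c assume "t \<in> (torus :: (complex ^ 'a) set)"
    then show "cpoly_eval f (\<lambda>i. l * (c * torus_point A t i) + m * torus_point A s i) = 0"
      using van[OF _ s, of t "l * c" m] by (simp add: secant_point_eq mult.assoc)
  qed
  show ?thesis
  proof (rule toric_variety_polys_vanish[OF a _ _ xy(2), where F = "\<lambda>y. cpoly_eval f (\<lambda>i. l * x i + m * y i)"])
    show "polyfun A (\<lambda>y. cpoly_eval f (\<lambda>i. l * x i + m * y i))"
      by (rule polyfun_compose[OF fp]) (intro polyfun_add polyfun_mult polyfun_const polyfun_var)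
    fix s c assume s: "s \<in> (torus :: (complex ^ 'a) set)"
    then show "cpoly_eval f (\<lambda>i. l * x i + m * (c * torus_point A s i)) = 0"
      using 1[OF s, of l "m * c"] by (simp add: mult.assoc)
  qed
qed

lemma independent_combination_nonzero:
  assumes "x \<noteq> (\<lambda>_. 0)" "y \<noteq> (\<lambda>_. 0)" "proj_pt x \<noteq> proj_pt y" "(a, b) \<noteq> (0, 0 :: complex)"
  shows "(\<lambda>i. a * x i + b * y i) \<noteq> (\<lambda>_. 0)"
proof
  assume "(\<lambda>i. a * x i + b * y i) = (\<lambda>_. 0)"
  then have "a * x i + b * y i = 0" for i by (rule fun_cong)
  then have eq: "a * x i = - b * y i" for i by (simp add: eq_neg_iff_add_eq_0)
  show False
  proof (cases "a = 0 \<or> b = 0")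
    case True
    then have "(\<forall>i. x i = 0) \<or> (\<forall>i. y i = 0)" using eq assms(4) by auto
    then show False using assms(1,2) by auto
  next
    case False
    then have "x = (\<lambda>i. (- b / a) * y i)" using eq by (auto simp: field_simps fun_eq_iff)
    then have "proj_pt x = proj_pt y" using proj_pt_scale[of "- b / a" y] False by simp
    then show False using assms(3) by simp
  qed
qed

lemma proj_line_subset:
  assumes "K \<in> proj_lines I"
  shows "K \<subseteq> proj_space I"
proof
  obtain x y where K: "K = {proj_pt (\<lambda>i. a * x i + b * y i) |a b. (a, b) \<noteq> (0, 0)}"
    and xy: "x \<in> coord_space I" "x \<noteq> (\<lambda>_. 0)" "y \<in> coord_space I" "y \<noteq> (\<lambda>_. 0)" "proj_pt x \<noteq> proj_pt y"
    using assms unfolding proj_lines_def by blast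
  fix r assume "r \<in> K"
  then obtain a b where ab: "(a, b) \<noteq> (0, 0)" "r = proj_pt (\<lambda>i. a * x i + b * y i)" using K by blast
  have "(\<lambda>i. a * x i + b * y i) \<in> coord_space I" using xy by (simp add: coord_space_def)
  then show "r \<in> proj_space I"
    unfolding ab(2) by (rule proj_pt_in_proj_space) (rule independent_combination_nonzero[OF xy(2,4,5) ab(1)])
qed

text \<open>Cramer's rule replaces the two points spanning \<open>K\<close> by \<open>p\<close> and
  \<open>q\<close>. The determinant \<open>D\<close> is nonzero, as otherwise \<open>p\<close> and
  \<open>q\<close> would coincide.\<close>

lemma proj_line_through:
  assumes K: "K \<in> proj_lines I" and pq: "p \<in> K" "q \<in> K" "p \<noteq> q" and r: "r \<in> K"
  obtains x y a b where "x \<in> p" "y \<in> q" "r = proj_pt (\<lambda>i. a * x i + b * y i)"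
proof -
  obtain x0 y0 where K_eq: "K = {proj_pt (\<lambda>i. a * x0 i + b * y0 i) |a b. (a, b) \<noteq> (0, 0)}"
    using K by (auto simp: proj_lines_def)
  obtain a1 b1 where p: "(a1, b1) \<noteq> (0, 0)" "p = proj_pt (\<lambda>i. a1 * x0 i + b1 * y0 i)" using pq(1) K_eq by blast
  obtain a2 b2 where q: "(a2, b2) \<noteq> (0, 0)" "q = proj_pt (\<lambda>i. a2 * x0 i + b2 * y0 i)" using pq(2) K_eq by blast
  obtain a b where r: "r = proj_pt (\<lambda>i. a * x0 i + b * y0 i)" using r K_eq by blast
  define D where "D = a1 * b2 - a2 * b1"
  have "D \<noteq> 0"
  proof
    assume "D = 0"
    then have D: "a1 * b2 = a2 * b1" by (simp add: D_def)
    have "\<exists>c. c \<noteq> 0 \<and> a2 = c * a1 \<and> b2 = c * b1"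
    proof (cases "a1 = 0")
      case True
      then have "b1 \<noteq> 0" "a2 = 0" using p(1) D by auto
      then show ?thesis using True q(1) by (intro exI[of _ "b2 / b1"]) auto
    next
      case False
      then have "b2 = a2 / a1 * b1" using D by (simp add: field_simps)
      then show ?thesis using False q(1) by (intro exI[of _ "a2 / a1"]) auto
    qed
    then obtain c where c: "c \<noteq> 0" "a2 = c * a1" "b2 = c * b1" by blast
    have "q = proj_pt (\<lambda>i. c * (a1 * x0 i + b1 * y0 i))" by (simp add: q(2) c algebra_simps)
    then have "q = p" using proj_pt_scale[OF c(1)] p(2) by simp
    then show False using pq(3) by simp
  qed
  define \<alpha> \<beta> where "\<alpha> = (a * b2 - b * a2) / D" and "\<beta> = (b * a1 - a * b1) / D"
  have "\<alpha> * a1 + \<beta> * a2 = (a * D) / D" "\<alpha> * b1 + \<beta> * b2 = (b * D) / D"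
    by (simp_all add: \<alpha>_def \<beta>_def D_def algebra_simps flip: add_divide_distrib diff_divide_distrib)
  then have ab: "\<alpha> * a1 + \<beta> * a2 = a" "\<alpha> * b1 + \<beta> * b2 = b" using \<open>D \<noteq> 0\<close> by simp_all
  have "(\<lambda>i. a * x0 i + b * y0 i) = (\<lambda>i. \<alpha> * (a1 * x0 i + b1 * y0 i) + \<beta> * (a2 * x0 i + b2 * y0 i))"
    by (auto simp: ab[symmetric] algebra_simps)
  then have "r = proj_pt (\<lambda>i. \<alpha> * (a1 * x0 i + b1 * y0 i) + \<beta> * (a2 * x0 i + b2 * y0 i))"
    using r by simp
  then show ?thesis using that[of "\<lambda>i. a1 * x0 i + b1 * y0 i" "\<lambda>i. a2 * x0 i + b2 * y0 i"] proj_pt_self p(2) q(2)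
    by blast
qed

definition secant_lines_union :: "'i set \<Rightarrow> ('i \<Rightarrow> complex) set set \<Rightarrow> ('i \<Rightarrow> complex) set set"
  where "secant_lines_union I X = \<Union>{K \<in> proj_lines I. \<exists>p q. p \<in> K \<inter> X \<and> q \<in> K \<inter> X \<and> p \<noteq> q}"

lemma Sec_eq: "Sec I X = zariski I closure_of secant_lines_union I X"
  by (simp add: Sec_def secant_lines_union_def)

lemma secant_lines_union_subset: "secant_lines_union I X \<subseteq> proj_space I"
  using proj_line_subset[of _ I] by (auto simp: secant_lines_union_def)

lemma closedin_Sec: "closedin (zariski I) (Sec I X)"
  by (simp add: Sec_eq)

lemma secant_point_in_Sec:
  assumes a: "a \<in> A" and ts: "t \<in> torus" "s \<in> torus" "proj_pt (torus_point A t) \<noteq> proj_pt (torus_point A s)"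
    and lm: "(l, m) \<noteq> (0, 0)"
  shows "secant_point A l m t s \<in> \<Union>(Sec A (toric_variety A))"
proof -
  let ?x = "torus_point A t" and ?y = "torus_point A s"
  define K where "K = {proj_pt (\<lambda>i. a * ?x i + b * ?y i) |a b. (a, b) \<noteq> (0, 0)}"
  have "K \<in> proj_lines A"
    unfolding proj_lines_def K_def
    using torus_point_nonzero[OF a] torus_point_coord_space ts by blast
  moreover have "proj_pt ?x \<in> K" unfolding K_def
    by (intro CollectI exI[of _ 1] exI[of _ 0]) simp
  moreover have "proj_pt ?y \<in> K" unfolding K_def
    by (intro CollectI exI[of _ 0] exI[of _ 1]) simp
  moreover have "proj_pt ?x \<in> toric_variety A" "proj_pt ?y \<in> toric_variety A"
    using torus_point_in_toric_variety[OF a] ts by auto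
  ultimately have "K \<subseteq> secant_lines_union A (toric_variety A)"
    unfolding secant_lines_union_def using ts(3) by blast
  moreover have "secant_lines_union A (toric_variety A) \<subseteq> Sec A (toric_variety A)"
    unfolding Sec_eq by (rule closure_of_subset) (simp add: secant_lines_union_subset)
  moreover have "proj_pt (secant_point A l m t s) \<in> K"
    unfolding K_def secant_point_eq using lm by blast
  ultimately show ?thesis using proj_pt_self by blast
qed

text \<open>Doubling a coordinate of \<open>t\<close> in which the exponents \<open>v\<close> and
  \<open>w\<close> differ changes the ratio of the two characters. A second point is needed because
  only lines through two different points contribute to \<open>Sec\<close>.\<close>

lemma ex_distinct_torus_point:
  assumes vw: "v \<in> A" "w \<in> A" "v \<noteq> w" and t: "t \<in> torus"
  shows "\<exists>s\<in>torus. proj_pt (torus_point A t) \<noteq> proj_pt (torus_point A s)"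
proof -
  obtain i where i: "w $ i \<noteq> v $ i" using vw(3) unfolding vec_eq_iff by metis
  define s where "s = (\<chi> j. if j = i then 2 * t $ j else t $ j)"
  have s: "s \<in> torus" using t by (auto simp: torus_def s_def)
  have cs: "character u s = 2 powi (u $ i) * character u t" for u
  proof -
    have "character u s = (\<Prod>j\<in>UNIV. (if j = i then 2 powi (u $ i) else 1) * (t $ j) powi (u $ j))"
      unfolding character_def by (intro prod.cong refl) (auto simp: s_def power_int_mult_distrib)
    then show ?thesis by (simp add: prod.distrib character_def)
  qed
  have "proj_pt (torus_point A t) \<noteq> proj_pt (torus_point A s)"
  proof
    assume "proj_pt (torus_point A t) = proj_pt (torus_point A s)"
    then have "torus_point A s \<in> proj_pt (torus_point A t)" using proj_pt_self by blast
    then obtain c where c: "torus_point A s = (\<lambda>u. c * torus_point A t u)" by (auto simp: mem_proj_pt)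
    have "2 powi (u $ i) = c" if "u \<in> A" for u
      using fun_cong[OF c, of u] that character_nonzero[OF t, of u] by (simp add: torus_point_def cs)
    then have "(2 :: complex) powi (v $ i) = 2 powi (w $ i)" using vw by metis
    then have "norm ((2 :: complex) powi (v $ i)) = norm ((2 :: complex) powi (w $ i))" by simp
    then have "(2 :: real) powi (v $ i) = 2 powi (w $ i)" by (simp add: norm_power_int)
    then have "v $ i = w $ i" using power_int_strict_increasing[of "v $ i" "w $ i" "2 :: real"]
        power_int_strict_increasing[of "w $ i" "v $ i" "2 :: real"] by (cases "v $ i" "w $ i" rule: linorder_cases) auto
    then show False using i by simp
  qed
  then show ?thesis using s by blast
qed

text \<open>Reduces questions about \<open>Sec\<close> to the parametrized family. The degenerate
  members, with proportional torus points or both weights zero, are multiples of one torus point,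
  which lies on a secant line through some other one.\<close>

theorem Sec_forms_vanish_iff:
  assumes vw: "v \<in> A" "w \<in> A" "v \<noteq> w" and f: "f \<in> forms A d"
  shows "(\<forall>x\<in>\<Union>(Sec A (toric_variety A)). cpoly_eval f x = 0) \<longleftrightarrow>
    (\<forall>l m. \<forall>t\<in>torus. \<forall>s\<in>torus. cpoly_eval f (secant_point A l m t s) = 0)"
proof
  assume van: "\<forall>x\<in>\<Union>(Sec A (toric_variety A)). cpoly_eval f x = 0"
  show "\<forall>l m. \<forall>t\<in>torus. \<forall>s\<in>torus. cpoly_eval f (secant_point A l m t s) = 0"
  proof (intro allI ballI)
    fix l m and t s :: "complex ^ 'a" assume ts: "t \<in> torus" "s \<in> torus"
    obtain s' where s': "s' \<in> torus" "proj_pt (torus_point A t) \<noteq> proj_pt (torus_point A s')"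
      using ex_distinct_torus_point[OF vw ts(1)] by blast
    have t0: "cpoly_eval f (torus_point A t) = 0"
      using secant_point_in_Sec[OF vw(1) ts(1) s', of 1 0] van by (auto simp: secant_point_eq)
    have mult: "cpoly_eval f (\<lambda>u. c * torus_point A t u) = 0" for c
      using t0 by (simp add: cpoly_eval_homogeneous[OF f])
    show "cpoly_eval f (secant_point A l m t s) = 0"
    proof (cases "proj_pt (torus_point A t) = proj_pt (torus_point A s)")
      case True
      then have "torus_point A s \<in> proj_pt (torus_point A t)" using proj_pt_self by blast
      then obtain c where "torus_point A s = (\<lambda>u. c * torus_point A t u)" by (auto simp: mem_proj_pt)
      then have "secant_point A l m t s = (\<lambda>u. (l + m * c) * torus_point A t u)"
        by (simp add: secant_point_eq algebra_simps)
      then show ?thesis using mult by simp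
    next
      case ne: False
      show ?thesis
      proof (cases "(l, m) = (0, 0)")
        case True
        then show ?thesis using mult[of 0] by (simp add: secant_point_eq)
      next
        case False
        then show ?thesis
          using secant_point_in_Sec[OF vw(1) ts ne] van by blast
      qed
    qed
  qed
next
  assume van: "\<forall>l m. \<forall>t\<in>torus. \<forall>s\<in>torus. cpoly_eval f (secant_point A l m t s) = 0"
  show "\<forall>x\<in>\<Union>(Sec A (toric_variety A)). cpoly_eval f x = 0"
    unfolding Sec_eq
  proof (intro ballI, rule closure_forms_vanish[OF secant_lines_union_subset f])
    fix z assume "z \<in> \<Union>(secant_lines_union A (toric_variety A))"
    then obtain r K p q where r: "z \<in> r" "r \<in> K" "K \<in> proj_lines A"
      and pq: "p \<in> K" "q \<in> K" "p \<in> toric_variety A" "q \<in> toric_variety A" "p \<noteq> q"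
      by (auto simp: secant_lines_union_def)
    obtain x y a b where xy: "x \<in> p" "y \<in> q" "r = proj_pt (\<lambda>i. a * x i + b * y i)"
      using proj_line_through[OF r(3) pq(1,2,5) r(2)] .
    obtain c where c: "z = (\<lambda>i. c * (a * x i + b * y i))" using r(1) xy(3) by (auto simp: mem_proj_pt)
    have "cpoly_eval f (\<lambda>i. a * x i + b * y i) = 0"
      by (rule join_forms_vanish[OF vw(1) f]) (use van xy pq in auto)
    then show "cpoly_eval f z = 0" unfolding c by (simp add: cpoly_eval_homogeneous[OF f])
  qed
qed

lemma Sec_nonempty:
  assumes vw: "v \<in> A" "w \<in> A" "v \<noteq> w"
  shows "\<exists>x. x \<in> \<Union>(Sec A (toric_variety A))"
proof -
  have t: "(\<chi> i. 1) \<in> torus" by (simp add: torus_def)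
  then obtain s where "s \<in> torus" "proj_pt (torus_point A (\<chi> i. 1)) \<noteq> proj_pt (torus_point A s)"
    using ex_distinct_torus_point[OF vw t] by blast
  from secant_point_in_Sec[OF vw(1) t this, of 1 0] show ?thesis by auto
qed

lemma Sec_domain_cone:
  assumes vw: "v \<in> L" "w \<in> L" "v \<noteq> w" and fin: "finite L"
  shows "domain_cone L (\<Union>(Sec L (toric_variety L)))"
  unfolding domain_cone_def
proof (intro allI ballI impI)
  fix d e f g assume f: "f \<in> forms L d" and g: "g \<in> forms L e"
    and z: "\<forall>x\<in>\<Union>(Sec L (toric_variety L)). cpoly_eval f x * cpoly_eval g x = 0"
  have fg: "f * g \<in> forms L (d + e)" by (rule forms_mult[OF f g])
  have "\<forall>x\<in>\<Union>(Sec L (toric_variety L)). cpoly_eval (f * g) x = 0" using z by (simp only: cpoly_eval_mult)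
  then have fgz: "\<forall>l m. \<forall>t\<in>torus. \<forall>s\<in>torus. cpoly_eval (f * g) (secant_point L l m t s) = 0"
    by (rule iffD1[OF Sec_forms_vanish_iff[OF vw fg]])
  have "(\<forall>l m. \<forall>t\<in>torus. \<forall>s\<in>torus. cpoly_eval f (secant_point L l m t s) = 0) \<or>
    (\<forall>l m. \<forall>t\<in>torus. \<forall>s\<in>torus. cpoly_eval g (secant_point L l m t s) = 0)"
  proof (rule secant_points_domain[OF fin])
    show "f \<in> polys L" "g \<in> polys L" using f g forms_subset_polys by blast+
    show "cpoly_eval f (secant_point L l m t s) * cpoly_eval g (secant_point L l m t s) = 0"
      if "t \<in> torus" "s \<in> torus" for l m t s
      using fgz that by (simp add: cpoly_eval_mult)
  qed
  then show "(\<forall>x\<in>\<Union>(Sec L (toric_variety L)). cpoly_eval f x = 0) \<or>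
    (\<forall>x\<in>\<Union>(Sec L (toric_variety L)). cpoly_eval g x = 0)"
    unfolding Sec_forms_vanish_iff[OF vw f] Sec_forms_vanish_iff[OF vw g] .
qed

lemma forms_sum: "(\<And>s. s \<in> S \<Longrightarrow> f s \<in> forms I d) \<Longrightarrow> sum f S \<in> forms I d"
  using cpoly.subspace_sum[OF subspace_forms] by blast

lemma forms_diff: "f \<in> forms I d \<Longrightarrow> g \<in> forms I d \<Longrightarrow> f - g \<in> forms I d"
  using cpoly.subspace_diff[OF subspace_forms] by blast

lemma forms_var_power: "u \<in> L \<Longrightarrow> cvar u ^ k \<in> forms L k"
proof (induction k)
  case (Suc k)
  then show ?case using forms_mult[OF cvar_forms[of u L], of "cvar u ^ k" k] by simp
qed simp

text \<open>Being homogeneous, the integral equation is itself a form of degree \<open>N\<close>, so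
  that its validity at the secant points extends to the closure.\<close>

lemma Sec_integral_cone:
  assumes vw: "v \<in> L" "w \<in> L" "v \<noteq> w" and fin: "finite L" and ch: "vertex_charts A L Vt" and AL: "A \<subseteq> L"
  shows "integral_cone A L (\<Union>(Sec L (toric_variety L)))"
  unfolding integral_cone_def
proof
  fix u assume u: "u \<in> L"
  obtain N h where N: "N \<ge> 1" and h: "\<And>i. i < N \<Longrightarrow> h i \<in> forms A (N - i)"
    and eq: "\<And>l m t s. t \<in> torus \<Longrightarrow> s \<in> torus \<Longrightarrow> secant_point L l m t s u ^ N =
      (\<Sum>i<N. cpoly_eval (h i) (secant_point L l m t s) * secant_point L l m t s u ^ i)"
    using secant_points_integral[OF fin ch AL u] by blast
  define r where "r = cvar u ^ N - (\<Sum>i<N. h i * cvar u ^ i)"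
  have "h i * cvar u ^ i \<in> forms L N" if "i < N" for i
  proof -
    have "h i \<in> forms L (N - i)" using h[OF that] forms_mono[OF AL] by blast
    then have "h i * cvar u ^ i \<in> forms L (N - i + i)" by (intro forms_mult forms_var_power u)
    then show ?thesis using that by simp
  qed
  then have r: "r \<in> forms L N" unfolding r_def by (intro forms_diff forms_sum forms_var_power u) auto
  have ev: "cpoly_eval r x = x u ^ N - (\<Sum>i<N. cpoly_eval (h i) x * x u ^ i)" for x
    by (simp add: r_def cpoly_eval_diff cpoly_eval_sum cpoly_eval_mult cpoly_eval_power)
  have "\<forall>l m. \<forall>t\<in>torus. \<forall>s\<in>torus. cpoly_eval r (secant_point L l m t s) = 0"
    using eq by (simp add: ev)
  then have "\<forall>x\<in>\<Union>(Sec L (toric_variety L)). cpoly_eval r x = 0"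
    using Sec_forms_vanish_iff[OF vw r] by blast
  then show "\<exists>N\<ge>1. \<exists>h. (\<forall>i<N. h i \<in> forms A (N - i)) \<and>
      (\<forall>x\<in>\<Union>(Sec L (toric_variety L)). x u ^ N = (\<Sum>i<N. cpoly_eval (h i) x * x u ^ i))"
  proof (intro exI[of _ N] conjI exI[of _ h] N allI impI ballI)
    show "h i \<in> forms A (N - i)" if "i < N" for i by (rule h[OF that])
    fix x assume "x \<in> \<Union>(Sec L (toric_variety L))"
    then have "cpoly_eval r x = 0" by (rule bspec[OF \<open>\<forall>x\<in>\<Union>(Sec L (toric_variety L)). cpoly_eval r x = 0\<close>])
    then show "x u ^ N = (\<Sum>i<N. cpoly_eval (h i) x * x u ^ i)" by (simp only: ev right_minus_eq)
  qed
qed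

text \<open>The secant points for \<open>A\<close> and for \<open>L\<close> have the same
  coordinates in \<open>A\<close>. The projection between the two secant varieties enters the main
  argument only through this equivalence.\<close>

lemma Sec_vanish_projection:
  assumes vw: "v \<in> A" "w \<in> A" "v \<noteq> w" and AL: "A \<subseteq> L" and f: "f \<in> forms A d"
  shows "(\<forall>x\<in>\<Union>(Sec A (toric_variety A)). cpoly_eval f x = 0) \<longleftrightarrow>
    (\<forall>x\<in>\<Union>(Sec L (toric_variety L)). cpoly_eval f x = 0)"
proof -
  have fL: "f \<in> forms L d" using f forms_mono[OF AL] by blast
  have fA: "f \<in> polys A" using f forms_subset_polys by blast
  have "cpoly_eval f (secant_point A l m t s) = cpoly_eval f (secant_point L l m t s)" for l m t s
    by (rule cpoly_eval_cong[OF fA]) (use AL in \<open>auto simp: secant_point_def\<close>)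
  moreover have vwL: "v \<in> L" "w \<in> L" using vw AL by auto
  ultimately show ?thesis
    unfolding Sec_forms_vanish_iff[OF vw f] Sec_forms_vanish_iff[OF vwL vw(3) fL] by simp
qed

subsection \<open>Lifting points along a finite projection\<close>

text \<open>Nakayama's lemma, with all identities read as identities of functions on \<open>C\<close>.\<close>

lemma nakayama:
  fixes \<mu> :: "'m \<Rightarrow> ('i \<Rightarrow> complex) \<Rightarrow> complex"
  assumes "finite M"
    and "\<And>m. m \<in> M \<Longrightarrow> s m \<in> polys A" "\<And>m. m \<in> M \<Longrightarrow> cpoly_eval (s m) y \<noteq> 0"
    and "\<And>m m'. m \<in> M \<Longrightarrow> m' \<in> M \<Longrightarrow> B m m' \<in> polys A"
    and "\<And>m m'. m \<in> M \<Longrightarrow> m' \<in> M \<Longrightarrow> cpoly_eval (B m m') y = 0"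
    and "\<And>m x. m \<in> M \<Longrightarrow> x \<in> C \<Longrightarrow> cpoly_eval (s m) x * \<mu> m x = (\<Sum>m'\<in>M. cpoly_eval (B m m') x * \<mu> m' x)"
  shows "\<exists>r\<in>polys A. cpoly_eval r y \<noteq> 0 \<and> (\<forall>m\<in>M. \<forall>x\<in>C. cpoly_eval r x * \<mu> m x = 0)"
  using assms
proof (induction M arbitrary: s B rule: finite_induct)
  case empty
  show ?case by (intro bexI[of _ 1]) auto
next
  case (insert k M)
  \<comment> \<open>The pivot for eliminating the generator \<open>k\<close>. The remaining
    relations get multiplied by it, which is why the statement allows factors \<open>s m\<close>
    that are only required to be nonzero at \<open>y\<close>.\<close>
  define rk where "rk = s k - B k k"
  have rkA: "rk \<in> polys A" unfolding rk_def using insert.prems(1,3) by (intro polys_diff) auto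
  have rky: "cpoly_eval rk y \<noteq> 0" using insert.prems(2,4) by (simp add: rk_def cpoly_eval_diff)
  have rk\<mu>: "cpoly_eval rk x * \<mu> k x = (\<Sum>m'\<in>M. cpoly_eval (B k m') x * \<mu> m' x)" if "x \<in> C" for x
    using insert.prems(5)[of k x] insert.hyps that by (simp add: rk_def cpoly_eval_diff algebra_simps)
  have "\<exists>r\<in>polys A. cpoly_eval r y \<noteq> 0 \<and> (\<forall>m\<in>M. \<forall>x\<in>C. cpoly_eval r x * \<mu> m x = 0)"
  proof (rule insert.IH[of "\<lambda>m. rk * s m" "\<lambda>m m'. rk * B m m' + B m k * B k m'"])
    fix m assume m: "m \<in> M"
    show "rk * s m \<in> polys A" using rkA insert.prems(1) m by (intro polys_mult) auto
    show "cpoly_eval (rk * s m) y \<noteq> 0" using rky insert.prems(2) m by (simp add: cpoly_eval_mult)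
    show "rk * B m m' + B m k * B k m' \<in> polys A" if "m' \<in> M" for m'
      using rkA insert.prems(3) m that by (intro polys_add polys_mult) auto
    show "cpoly_eval (rk * B m m' + B m k * B k m') y = 0" if "m' \<in> M" for m'
      using insert.prems(4) m that by (simp add: cpoly_eval_add cpoly_eval_mult)
    fix x assume x: "x \<in> C"
    have "cpoly_eval (rk * s m) x * \<mu> m x = cpoly_eval rk x * (cpoly_eval (s m) x * \<mu> m x)"
      by (simp add: cpoly_eval_mult mult.assoc)
    also have "cpoly_eval (s m) x * \<mu> m x =
        cpoly_eval (B m k) x * \<mu> k x + (\<Sum>m'\<in>M. cpoly_eval (B m m') x * \<mu> m' x)"
      using insert.prems(5)[of m x] m x insert.hyps by simp
    also have "cpoly_eval rk x * \<dots> = cpoly_eval (B m k) x * (cpoly_eval rk x * \<mu> k x) +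
        (\<Sum>m'\<in>M. cpoly_eval (rk * B m m') x * \<mu> m' x)"
      by (simp add: cpoly_eval_mult distrib_left sum_distrib_left mult_ac)
    also have "\<dots> = (\<Sum>m'\<in>M. cpoly_eval (rk * B m m' + B m k * B k m') x * \<mu> m' x)"
      unfolding rk\<mu>[OF x] sum_distrib_left sum.distrib[symmetric]
      by (intro sum.cong refl) (simp add: cpoly_eval_add cpoly_eval_mult algebra_simps)
    finally show "cpoly_eval (rk * s m) x * \<mu> m x =
      (\<Sum>m'\<in>M. cpoly_eval (rk * B m m' + B m k * B k m') x * \<mu> m' x)" .
  qed
  then obtain r where r: "r \<in> polys A" "cpoly_eval r y \<noteq> 0" "\<And>m x. m \<in> M \<Longrightarrow> x \<in> C \<Longrightarrow> cpoly_eval r x * \<mu> m x = 0"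
    by blast
  have "cpoly_eval (r * rk) x * \<mu> m x = 0" if m: "m \<in> insert k M" and x: "x \<in> C" for m x
  proof (cases "m = k")
    case True
    have "cpoly_eval (r * rk) x * \<mu> m x = cpoly_eval r x * (cpoly_eval rk x * \<mu> k x)"
      by (simp add: True cpoly_eval_mult mult.assoc)
    also have "\<dots> = (\<Sum>m'\<in>M. cpoly_eval (B k m') x * (cpoly_eval r x * \<mu> m' x))"
      unfolding rk\<mu>[OF x] by (simp add: sum_distrib_left mult_ac)
    also have "\<dots> = 0" by (intro sum.neutral ballI) (simp add: r(3) x)
    finally show ?thesis .
  next
    case False
    then show ?thesis using r(3)[of m x] m x by (auto simp: cpoly_eval_mult)
  qed
  moreover have "r * rk \<in> polys A" "cpoly_eval (r * rk) y \<noteq> 0"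
    using r rkA rky by (auto intro: polys_mult simp: cpoly_eval_mult)
  ultimately show ?case by blast
qed

section \<open>Ideals of points and the choice of the missing coordinates\<close>

text \<open>The functions \<open>F\<close> for which \<open>F x - F y\<close> has such an expansion
  contain constants and variables and are closed under sums, and under products by the product
  rule.\<close>

lemma polys_difference:
  assumes "finite U" "f \<in> polys U"
  shows "\<exists>g. (\<forall>u\<in>U. g u \<in> polys U) \<and>
    (\<forall>x. cpoly_eval f x - cpoly_eval f y = (\<Sum>u\<in>U. (x u - y u) * cpoly_eval (g u) x))"
proof -
  define G where "G F \<longleftrightarrow> polyfun U F \<and> (\<exists>g. (\<forall>u\<in>U. g u \<in> polys U) \<and>
    (\<forall>x. F x - F y = (\<Sum>u\<in>U. (x u - y u) * cpoly_eval (g u) x)))" for F :: "('a \<Rightarrow> complex) \<Rightarrow> complex"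
  have const: "G (\<lambda>x. c)" for c unfolding G_def
    by (intro conjI polyfun_const exI[of _ "\<lambda>_. 0"]) auto
  have var: "G (\<lambda>x. x i)" if "i \<in> U" for i
    unfolding G_def
  proof (intro conjI polyfun_var that exI[of _ "\<lambda>u. if u = i then 1 else 0"] ballI allI)
    fix x
    have "(\<Sum>u\<in>U. (x u - y u) * cpoly_eval (if u = i then 1 else 0) x) = (\<Sum>u\<in>U. if u = i then x i - y i else 0)"
      by (intro sum.cong refl) auto
    then show "x i - y i = (\<Sum>u\<in>U. (x u - y u) * cpoly_eval (if u = i then 1 else 0) x)"
      using that assms(1) by simp
  qed auto
  have add: "G (\<lambda>x. F x + H x)" if "G F" "G H" for F H
  proof -
    obtain g where g: "\<forall>u\<in>U. g u \<in> polys U" "\<And>x. F x - F y = (\<Sum>u\<in>U. (x u - y u) * cpoly_eval (g u) x)"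
      using \<open>G F\<close> unfolding G_def by blast
    obtain h where h: "\<forall>u\<in>U. h u \<in> polys U" "\<And>x. H x - H y = (\<Sum>u\<in>U. (x u - y u) * cpoly_eval (h u) x)"
      using \<open>G H\<close> unfolding G_def by blast
    have "F x + H x - (F y + H y) = (\<Sum>u\<in>U. (x u - y u) * cpoly_eval (g u + h u) x)" for x
    proof -
      have "F x + H x - (F y + H y) = (F x - F y) + (H x - H y)" by simp
      also have "\<dots> = (\<Sum>u\<in>U. (x u - y u) * cpoly_eval (g u + h u) x)"
        unfolding g(2) h(2) by (simp add: cpoly_eval_add distrib_left sum.distrib)
      finally show ?thesis .
    qed
    moreover have "\<forall>u\<in>U. g u + h u \<in> polys U" using g(1) h(1) polys_add by blast
    moreover have "polyfun U (\<lambda>x. F x + H x)" using that by (intro polyfun_add) (auto simp: G_def)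
    ultimately show ?thesis unfolding G_def by (intro conjI exI[of _ "\<lambda>u. g u + h u"]) auto
  qed
  have mult: "G (\<lambda>x. F x * H x)" if "G F" "G H" for F H
  proof -
    obtain g where g: "\<forall>u\<in>U. g u \<in> polys U" "\<And>x. F x - F y = (\<Sum>u\<in>U. (x u - y u) * cpoly_eval (g u) x)"
      using \<open>G F\<close> unfolding G_def by blast
    obtain h where h: "\<forall>u\<in>U. h u \<in> polys U" "\<And>x. H x - H y = (\<Sum>u\<in>U. (x u - y u) * cpoly_eval (h u) x)"
      using \<open>G H\<close> unfolding G_def by blast
    obtain H' where H': "H' \<in> polys U" "\<And>x. H x = cpoly_eval H' x" using \<open>G H\<close> by (auto simp: G_def polyfun_def)
    define k where "k u = g u * H' + cpoly_scale (F y) (h u)" for u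
    have "cpoly_scale c p = Poly_Mapping.single 0 c * p" for c and p :: "'a cpoly" by (simp add: cpoly_scale_def)
    then have "\<forall>u\<in>U. k u \<in> polys U"
      using g(1) h(1) H'(1) by (auto simp: k_def intro!: polys_add polys_mult polys_single)
    moreover have "F x * H x - F y * H y = (\<Sum>u\<in>U. (x u - y u) * cpoly_eval (k u) x)" for x
    proof -
      have "F x * H x - F y * H y = (F x - F y) * H x + F y * (H x - H y)" by (simp add: algebra_simps)
      also have "\<dots> = (\<Sum>u\<in>U. (x u - y u) * cpoly_eval (k u) x)"
        unfolding g(2) h(2) k_def sum_distrib_left sum_distrib_right sum.distrib[symmetric]
        by (intro sum.cong refl) (simp add: cpoly_eval_add cpoly_eval_mult cpoly_eval_scale H'(2) algebra_simps)
      finally show ?thesis .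
    qed
    moreover have "polyfun U (\<lambda>x. F x * H x)" using that by (intro polyfun_mult) (auto simp: G_def)
    ultimately show ?thesis unfolding G_def by (intro conjI exI[of _ k]) auto
  qed
  have power: "G (\<lambda>x. F x ^ n)" if "G F" for F n
    by (induction n) (simp_all add: const mult that)
  have prod: "G (\<lambda>x. \<Prod>s\<in>S. F s x)" if "\<And>s. s \<in> S \<Longrightarrow> G (F s)" for S and F :: "'a \<Rightarrow> ('a \<Rightarrow> complex) \<Rightarrow> complex"
    using that by (induction S rule: infinite_finite_induct) (simp_all add: const mult)
  have sum: "G (\<lambda>x. \<Sum>s\<in>S. F s x)" if "\<And>s. s \<in> S \<Longrightarrow> G (F s)" for S and F :: "('a \<Rightarrow>\<^sub>0 nat) \<Rightarrow> ('a \<Rightarrow> complex) \<Rightarrow> complex"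
    using that by (induction S rule: infinite_finite_induct) (simp_all add: const add)
  have "G (cpoly_eval f)" unfolding cpoly_eval_def monom_eval_def
    by (intro sum mult const prod power var) (use assms(2) in \<open>auto simp: polys_def\<close>)
  then show ?thesis unfolding G_def by blast
qed

text \<open>
  Membership in the ideal generated by \<open>x u - c u\<close>, \<open>u \<in> U\<close>, in the ring of polynomial
  functions on \<open>C\<close>.
\<close>

definition point_ideal :: "'i set \<Rightarrow> ('i \<Rightarrow> complex) set \<Rightarrow> 'i set \<Rightarrow> ('i \<Rightarrow> complex) \<Rightarrow>
    (('i \<Rightarrow> complex) \<Rightarrow> complex) \<Rightarrow> bool"
  where "point_ideal L C U c F \<longleftrightarrow> (\<exists>h. (\<forall>u\<in>U. h u \<in> polys L) \<and>
    (\<forall>x\<in>C. F x = (\<Sum>u\<in>U. (x u - c u) * cpoly_eval (h u) x)))"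

lemma point_ideal_add:
  assumes "point_ideal L C U c F" "point_ideal L C U c G"
  shows "point_ideal L C U c (\<lambda>x. F x + G x)"
proof -
  obtain f where f: "\<forall>u\<in>U. f u \<in> polys L" "\<forall>x\<in>C. F x = (\<Sum>u\<in>U. (x u - c u) * cpoly_eval (f u) x)"
    using assms(1) by (auto simp: point_ideal_def)
  obtain g where g: "\<forall>u\<in>U. g u \<in> polys L" "\<forall>x\<in>C. G x = (\<Sum>u\<in>U. (x u - c u) * cpoly_eval (g u) x)"
    using assms(2) by (auto simp: point_ideal_def)
  show ?thesis unfolding point_ideal_def
    by (intro exI[of _ "\<lambda>u. f u + g u"])
      (use f g in \<open>auto simp: cpoly_eval_add distrib_left sum.distrib intro: polys_add\<close>)
qed

lemma point_ideal_0: "point_ideal L C U c (\<lambda>x. 0)"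
  unfolding point_ideal_def by (intro exI[of _ "\<lambda>_. 0"]) auto

lemma point_ideal_mult:
  assumes "point_ideal L C U c F" "polyfun L H"
  shows "point_ideal L C U c (\<lambda>x. H x * F x)"
proof -
  obtain f where f: "\<forall>u\<in>U. f u \<in> polys L" "\<forall>x\<in>C. F x = (\<Sum>u\<in>U. (x u - c u) * cpoly_eval (f u) x)"
    using assms(1) by (auto simp: point_ideal_def)
  obtain h where h: "h \<in> polys L" "\<And>x. H x = cpoly_eval h x" using assms(2) by (auto simp: polyfun_def)
  show ?thesis unfolding point_ideal_def
    by (intro exI[of _ "\<lambda>u. h * f u"])
      (use f h in \<open>auto simp: cpoly_eval_mult sum_distrib_left mult_ac intro: polys_mult\<close>)
qed

lemma point_ideal_cong:
  "(\<And>x. x \<in> C \<Longrightarrow> F x = G x) \<Longrightarrow> point_ideal L C U c F \<Longrightarrow> point_ideal L C U c G"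
  unfolding point_ideal_def by force

lemma point_ideal_sum:
  "(\<And>s. s \<in> S \<Longrightarrow> point_ideal L C U c (F s)) \<Longrightarrow> point_ideal L C U c (\<lambda>x. \<Sum>s\<in>S. F s x)"
  by (induction S rule: infinite_finite_induct) (auto simp: point_ideal_0 point_ideal_add)

text \<open>Let \<open>z\<close> be a root of \<open>q\<close> and \<open>q'\<close> the quotient by
  the linear factor. If 1 were in the ideal extended by \<open>x u - z\<close>, multiplying its
  expression by \<open>q'\<close> would show that \<open>q'\<close> is in the old ideal. Descent on
  the degree ends with a nonzero constant, which \<open>n1\<close> excludes.\<close>

lemma point_ideal_extend:
  assumes n1: "\<not> point_ideal L C U c (\<lambda>x. 1)" and u: "u \<in> L" "u \<notin> U" and U: "finite U"
    and q: "q \<noteq> 0" "point_ideal L C U c (\<lambda>x. poly q (x u))"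
  shows "\<exists>z. \<not> point_ideal L C (insert u U) (c(u := z)) (\<lambda>x. 1)"
  using q
proof (induction "degree q" arbitrary: q)
  case 0
  then obtain k where k: "q = [:k:]" "k \<noteq> 0" by (metis degree_eq_zeroE pCons_eq_0_iff)
  have "point_ideal L C U c (\<lambda>x. (1 / k) * poly q (x u))"
    by (rule point_ideal_mult[OF 0(3)]) (rule polyfun_const)
  then have "point_ideal L C U c (\<lambda>x. 1)" by (rule point_ideal_cong[rotated]) (simp add: k)
  with n1 show ?case by simp
next
  case (Suc n)
  have "\<not> constant (poly q)" using Suc.hyps(2) by (simp add: constant_degree)
  then obtain z where z: "poly q z = 0" using fundamental_theorem_of_algebra by blast
  then obtain q' where q': "q = [:- z, 1:] * q'" by (metis poly_eq_0_iff_dvd dvdE)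
  have q'0: "q' \<noteq> 0" using q' Suc.prems(1) by auto
  have "degree q = degree [:- z, 1:] + degree q'" unfolding q' by (rule degree_mult_eq) (use q'0 in auto)
  then have deg: "degree q' = n" using Suc.hyps(2) by simp
  show ?case
  proof (cases "point_ideal L C (insert u U) (c(u := z)) (\<lambda>x. 1)")
    case False then show ?thesis by blast
  next
    case True
    then obtain h where h: "\<forall>v\<in>insert u U. h v \<in> polys L"
      "\<forall>x\<in>C. 1 = (\<Sum>v\<in>insert u U. (x v - (c(u := z)) v) * cpoly_eval (h v) x)"
      unfolding point_ideal_def by blast
    have pf: "polyfun L (\<lambda>x. poly q' (x u))"
      unfolding poly_altdef by (intro polyfun_sum polyfun_mult polyfun_const polyfun_power polyfun_var u)
    have 1: "point_ideal L C U c (\<lambda>x. \<Sum>v\<in>U. (x v - c v) * cpoly_eval (h v) x)"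
      unfolding point_ideal_def using h(1) by (intro exI[of _ h]) auto
    have "point_ideal L C U c (\<lambda>x. poly q' (x u) * (\<Sum>v\<in>U. (x v - c v) * cpoly_eval (h v) x) +
        cpoly_eval (h u) x * poly q (x u))"
      using h(1) by (intro point_ideal_add point_ideal_mult[OF 1 pf] point_ideal_mult[OF Suc.prems(2)] polyfun_cpoly_eval) auto
    then have "point_ideal L C U c (\<lambda>x. poly q' (x u))"
    proof (rule point_ideal_cong[rotated])
      fix x assume x: "x \<in> C"
      have eq: "(\<Sum>v\<in>U. (x v - (c(u := z)) v) * cpoly_eval (h v) x) = (\<Sum>v\<in>U. (x v - c v) * cpoly_eval (h v) x)"
        using u(2) by (intro sum.cong refl) auto
      have one: "1 = (x u - z) * cpoly_eval (h u) x + (\<Sum>v\<in>U. (x v - c v) * cpoly_eval (h v) x)"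
        using bspec[OF h(2) x] unfolding sum.insert[OF U u(2)] eq fun_upd_same .
      have "poly q' (x u) * (\<Sum>v\<in>U. (x v - c v) * cpoly_eval (h v) x) + cpoly_eval (h u) x * poly q (x u) =
        poly q' (x u) * ((x u - z) * cpoly_eval (h u) x + (\<Sum>v\<in>U. (x v - c v) * cpoly_eval (h v) x))"
        by (simp add: q' algebra_simps)
      then show "poly q' (x u) * (\<Sum>v\<in>U. (x v - c v) * cpoly_eval (h v) x) + cpoly_eval (h u) x * poly q (x u) =
        poly q' (x u)" using one by simp
    qed
    then show ?thesis using Suc.hyps(1)[of q'] deg q'0 by simp
  qed
qed

lemma polys_module_rep:
  assumes M: "finite M" and rep: "\<And>d f. f \<in> forms L d \<Longrightarrow> module_rep A C M d (cpoly_eval f)" and f: "f \<in> polys L"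
  shows "\<exists>g. (\<forall>m\<in>M. g m \<in> polys A) \<and> (\<forall>x\<in>C. cpoly_eval f x = (\<Sum>m\<in>M. cpoly_eval (g m) x * monom_eval m x))"
proof -
  obtain K where K: "\<And>m. m \<in> Poly_Mapping.keys f \<Longrightarrow> monom_degree m \<le> K"
    using cpoly_degree_bound[of f] by blast
  have "\<exists>g. (\<forall>m\<in>M. g m \<in> polys A) \<and>
    (\<forall>x\<in>C. cpoly_eval (hom_comp k f) x = (\<Sum>m\<in>M. cpoly_eval (g m) x * monom_eval m x))" for k
  proof -
    obtain g where g: "\<forall>m\<in>M. g m \<in> shifted_forms A k (monom_degree m)"
      "\<forall>x\<in>C. cpoly_eval (hom_comp k f) x = (\<Sum>m\<in>M. cpoly_eval (g m) x * monom_eval m x)"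
      using rep[OF hom_comp_forms[OF f], of k] unfolding module_rep_def by blast
    have "shifted_forms A k j \<subseteq> polys A" for j
      using forms_subset_polys[of A "k - j"] by (auto simp: shifted_forms_def)
    then show ?thesis using g by (intro exI[of _ g]) blast
  qed
  then have "\<forall>k. \<exists>g. (\<forall>m\<in>M. g m \<in> polys A) \<and>
    (\<forall>x\<in>C. cpoly_eval (hom_comp k f) x = (\<Sum>m\<in>M. cpoly_eval (g m) x * monom_eval m x))" ..
  from choice[OF this] obtain g where g: "\<And>k m. m \<in> M \<Longrightarrow> g k m \<in> polys A"
    "\<And>k x. x \<in> C \<Longrightarrow> cpoly_eval (hom_comp k f) x = (\<Sum>m\<in>M. cpoly_eval (g k m) x * monom_eval m x)" by blast
  have "cpoly_eval f x = (\<Sum>m\<in>M. cpoly_eval (\<Sum>k\<le>K. g k m) x * monom_eval m x)" if "x \<in> C" for x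
  proof -
    have "cpoly_eval f x = (\<Sum>k\<le>K. cpoly_eval (hom_comp k f) x)"
      using cpoly_eval_scaled[of f K 1 x] K by simp
    also have "\<dots> = (\<Sum>k\<le>K. \<Sum>m\<in>M. cpoly_eval (g k m) x * monom_eval m x)" by (simp add: g(2)[OF that])
    also have "\<dots> = (\<Sum>m\<in>M. \<Sum>k\<le>K. cpoly_eval (g k m) x * monom_eval m x)" by (rule sum.swap)
    finally show ?thesis by (simp add: cpoly_eval_sum sum_distrib_right)
  qed
  moreover have "(\<Sum>k\<in>S. g k m) \<in> polys A" if "m \<in> M" for m S
    by (induction S rule: infinite_finite_induct) (auto intro: polys_add g(1)[OF that])
  ultimately show ?thesis by (intro exI[of _ "\<lambda>m. \<Sum>k\<le>K. g k m"]) auto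
qed

text \<open>If 1 were in the ideal, the module of polynomial functions on \<open>C\<close> would
  equal its product with the maximal ideal of \<open>y\<close>. Nakayama's lemma then gives
  \<open>r\<close> over \<open>A\<close>, nonzero at \<open>y\<close>, that annihilates the
  generators. One of them is 1, so \<open>r\<close> vanishes on \<open>C\<close>, and by assumption
  at \<open>y\<close>.\<close>

lemma point_lift_start:
  assumes fin: "finite L" and AL: "A \<subseteq> L" and int: "integral_cone A L C"
    and C: "\<And>x c. x \<in> C \<Longrightarrow> c \<noteq> 0 \<Longrightarrow> (\<lambda>i. c * x i) \<in> C"
    and y: "\<And>d f. f \<in> forms A d \<Longrightarrow> (\<forall>x\<in>C. cpoly_eval f x = 0) \<Longrightarrow> cpoly_eval f y = 0"
  shows "\<not> point_ideal L C A y (\<lambda>x. 1)"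
proof
  assume "point_ideal L C A y (\<lambda>x. 1)"
  then obtain h where h: "\<And>u. u \<in> A \<Longrightarrow> h u \<in> polys L"
    "\<And>x. x \<in> C \<Longrightarrow> 1 = (\<Sum>u\<in>A. (x u - y u) * cpoly_eval (h u) x)"
    unfolding point_ideal_def by blast
  obtain M where M: "finite M" "M \<subseteq> monoms L" "0 \<in> M"
    and rep: "\<And>d f. f \<in> forms L d \<Longrightarrow> module_rep A C M d (cpoly_eval f)"
    using integral_cone_module_finite[OF fin int] by blast
  have finA: "finite A" using fin AL finite_subset by blast
  have "\<exists>b. (\<forall>m'\<in>M. b m' \<in> polys A) \<and> (\<forall>x\<in>C. cpoly_eval (h u * Poly_Mapping.single m 1) x =
      (\<Sum>m'\<in>M. cpoly_eval (b m') x * monom_eval m' x))" if "u \<in> A" "m \<in> M" for u m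
    by (rule polys_module_rep[OF M(1) rep])
      (use h(1)[OF that(1)] M(2) that(2) in \<open>auto intro!: polys_mult polys_single simp: monoms_def\<close>)
  then have "\<forall>u\<in>A. \<forall>m\<in>M. \<exists>b. (\<forall>m'\<in>M. b m' \<in> polys A) \<and> (\<forall>x\<in>C. cpoly_eval (h u * Poly_Mapping.single m 1) x =
      (\<Sum>m'\<in>M. cpoly_eval (b m') x * monom_eval m' x))" by blast
  then obtain b where b: "\<And>u m m'. u \<in> A \<Longrightarrow> m \<in> M \<Longrightarrow> m' \<in> M \<Longrightarrow> b u m m' \<in> polys A"
    "\<And>u m x. u \<in> A \<Longrightarrow> m \<in> M \<Longrightarrow> x \<in> C \<Longrightarrow> cpoly_eval (h u) x * monom_eval m x =
      (\<Sum>m'\<in>M. cpoly_eval (b u m m') x * monom_eval m' x)"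
    by (simp add: bchoice_iff cpoly_eval_mult cpoly_eval_single) blast
  define lin where "lin u = cvar u - Poly_Mapping.single 0 (y u)" for u
  have linA: "lin u \<in> polys A" if "u \<in> A" for u
    unfolding lin_def using that cvar_forms[of u A] forms_subset_polys[of A 1] by (intro polys_diff polys_single) auto
  have line: "cpoly_eval (lin u) x = x u - y u" for u x
    by (simp add: lin_def cpoly_eval_diff cpoly_eval_single)
  \<comment> \<open>The matrix expressing each generator by all of them, after multiplication with
    the expression of 1; the factors \<open>lin u\<close> make its entries vanish at
    \<open>y\<close>.\<close>
  define B where "B m m' = (\<Sum>u\<in>A. lin u * b u m m')" for m m'
  have BA: "B m m' \<in> polys A" if "m \<in> M" "m' \<in> M" for m m'
  proof -
    have "(\<Sum>u\<in>S. lin u * b u m m') \<in> polys A" if "S \<subseteq> A" for S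
      using finite_subset[OF that finA] that
      by (induction S rule: finite_induct) (auto intro!: polys_add polys_mult linA b(1) \<open>m \<in> M\<close> \<open>m' \<in> M\<close>)
    then show ?thesis unfolding B_def by blast
  qed
  have eq: "cpoly_eval 1 x * monom_eval m x = (\<Sum>m'\<in>M. cpoly_eval (B m m') x * monom_eval m' x)"
    if m: "m \<in> M" and x: "x \<in> C" for m x
  proof -
    have "cpoly_eval 1 x * monom_eval m x = (\<Sum>u\<in>A. (x u - y u) * cpoly_eval (h u) x) * monom_eval m x"
      using h(2)[OF x] by simp
    also have "\<dots> = (\<Sum>u\<in>A. (x u - y u) * (cpoly_eval (h u) x * monom_eval m x))"
      by (simp add: sum_distrib_right mult.assoc)
    also have "\<dots> = (\<Sum>u\<in>A. \<Sum>m'\<in>M. (x u - y u) * (cpoly_eval (b u m m') x * monom_eval m' x))"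
      by (intro sum.cong refl) (simp add: b(2) m x sum_distrib_left)
    also have "\<dots> = (\<Sum>m'\<in>M. \<Sum>u\<in>A. (x u - y u) * (cpoly_eval (b u m m') x * monom_eval m' x))" by (rule sum.swap)
    also have "\<dots> = (\<Sum>m'\<in>M. cpoly_eval (B m m') x * monom_eval m' x)"
      by (simp add: B_def cpoly_eval_sum cpoly_eval_mult line sum_distrib_right mult.assoc)
    finally show ?thesis .
  qed
  have "\<exists>r\<in>polys A. cpoly_eval r y \<noteq> 0 \<and> (\<forall>m\<in>M. \<forall>x\<in>C. cpoly_eval r x * monom_eval m x = 0)"
    by (rule nakayama[OF M(1), of "\<lambda>_. 1" A y B C monom_eval])
      (use BA eq in \<open>auto simp: B_def cpoly_eval_sum cpoly_eval_mult line\<close>)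
  then obtain r where r: "r \<in> polys A" "cpoly_eval r y \<noteq> 0" "\<And>x. x \<in> C \<Longrightarrow> cpoly_eval r x = 0"
    using M(3) by force
  have "cpoly_eval r y = 0"
  proof (rule hom_comp_sum_eval)
    fix k
    show "cpoly_eval (hom_comp k r) y = 0"
      by (rule y[OF hom_comp_forms[OF r(1)]]) (intro ballI hom_comp_vanish r(3) C)
  qed
  with r(2) show False by simp
qed

text \<open>The coefficients of the integral equation involve only variables in \<open>U\<close>, so
  replacing them by their values at \<open>c\<close> changes the equation by elements of the ideal.
  The resulting \<open>q\<close> is monic.\<close>

lemma integral_coordinate_point_ideal:
  assumes fin: "finite L" and AU: "A \<subseteq> U" "U \<subseteq> L" and int: "integral_cone A L C" and u: "u \<in> L"
  shows "\<exists>q. q \<noteq> 0 \<and> point_ideal L C U c (\<lambda>x. poly q (x u))"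
proof -
  obtain N h where N: "N \<ge> 1" and h: "\<And>i. i < N \<Longrightarrow> h i \<in> forms A (N - i)"
    and eq: "\<And>x. x \<in> C \<Longrightarrow> x u ^ N = (\<Sum>i<N. cpoly_eval (h i) x * x u ^ i)"
    using int u unfolding integral_cone_def by blast
  have finU: "finite U" using fin AU finite_subset by blast
  define q where "q = monom 1 N - (\<Sum>i<N. monom (cpoly_eval (h i) c) i)"
  have "coeff q N = 1" by (simp add: q_def coeff_sum)
  then have "q \<noteq> 0" by auto
  moreover have "point_ideal L C U c (\<lambda>x. poly q (x u))"
  proof (rule point_ideal_cong)
    fix x assume x: "x \<in> C"
    show "(\<Sum>i<N. x u ^ i * (cpoly_eval (h i) x - cpoly_eval (h i) c)) = poly q (x u)"
      using eq[OF x] by (simp add: q_def poly_sum poly_monom algebra_simps sum_subtractf)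
  next
    show "point_ideal L C U c (\<lambda>x. \<Sum>i<N. x u ^ i * (cpoly_eval (h i) x - cpoly_eval (h i) c))"
    proof (intro point_ideal_sum point_ideal_mult polyfun_power polyfun_var u)
      fix i assume i: "i \<in> {..<N}"
      have "h i \<in> polys U" using h[of i] i forms_subset_polys polys_mono[OF AU(1)] by blast
      then obtain g where g: "\<forall>v\<in>U. g v \<in> polys U"
        "\<forall>x. cpoly_eval (h i) x - cpoly_eval (h i) c = (\<Sum>v\<in>U. (x v - c v) * cpoly_eval (g v) x)"
        using polys_difference[OF finU] by blast
      then show "point_ideal L C U c (\<lambda>x. cpoly_eval (h i) x - cpoly_eval (h i) c)"
        unfolding point_ideal_def using polys_mono[OF AU(2)] by (intro exI[of _ g]) auto
    qed
  qed
  ultimately show ?thesis by blast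
qed

text \<open>Lying over for points: values for the coordinates outside \<open>A\<close> are chosen
  one at a time while the ideal stays proper. Once every coordinate has a value, a form vanishing on
  \<open>C\<close> but not at the chosen point would make 1 a member of the ideal.\<close>

theorem point_lift:
  assumes fin: "finite L" and AL: "A \<subseteq> L" and int: "integral_cone A L C"
    and C: "\<And>x c. x \<in> C \<Longrightarrow> c \<noteq> 0 \<Longrightarrow> (\<lambda>i. c * x i) \<in> C"
    and y: "\<And>d f. f \<in> forms A d \<Longrightarrow> (\<forall>x\<in>C. cpoly_eval f x = 0) \<Longrightarrow> cpoly_eval f y = 0"
  shows "\<exists>x\<in>coord_space L. (\<forall>a\<in>A. x a = y a) \<and>
    (\<forall>d. \<forall>f\<in>forms L d. (\<forall>x\<in>C. cpoly_eval f x = 0) \<longrightarrow> cpoly_eval f x = 0)"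
proof -
  have "\<exists>c. (\<forall>a\<in>A. c a = y a) \<and> \<not> point_ideal L C (A \<union> V) c (\<lambda>x. 1)" if "V \<subseteq> L - A" for V
    using finite_subset[OF that] fin that
  proof (induction V rule: infinite_finite_induct)
    case (infinite V) then show ?case by simp
  next
    case empty
    have "\<not> point_ideal L C A y (\<lambda>x. 1)" by (rule point_lift_start[OF fin AL int C y])
    then show ?case by (intro exI[of _ y]) simp
  next
    case (insert u V)
    then obtain c where c: "\<forall>a\<in>A. c a = y a" "\<not> point_ideal L C (A \<union> V) c (\<lambda>x. 1)" by auto
    have u: "u \<in> L" "u \<notin> A \<union> V" "u \<notin> A" using insert by auto
    have sub: "A \<subseteq> A \<union> V" "A \<union> V \<subseteq> L" using insert AL by auto
    have finU: "finite (A \<union> V)" using sub(2) fin finite_subset by blast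
    obtain q where "q \<noteq> 0" "point_ideal L C (A \<union> V) c (\<lambda>x. poly q (x u))"
      using integral_coordinate_point_ideal[OF fin sub int u(1)] by blast
    from point_ideal_extend[OF c(2) u(1,2) finU this]
    obtain z where "\<not> point_ideal L C (insert u (A \<union> V)) (c(u := z)) (\<lambda>x. 1)" by blast
    moreover have "\<forall>a\<in>A. (c(u := z)) a = y a" using c(1) u(3) by auto
    ultimately show ?case unfolding Un_insert_right by (intro exI[of _ "c(u := z)"] conjI)
  qed
  from this[of "L - A"] obtain c where c: "\<forall>a\<in>A. c a = y a" "\<not> point_ideal L C L c (\<lambda>x. 1)"
    using AL by (auto simp: Un_absorb1)
  define x where "x i = (if i \<in> L then c i else 0)" for i
  have "cpoly_eval f x = 0" if f: "f \<in> forms L d" "\<forall>x\<in>C. cpoly_eval f x = 0" for f d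
  proof (rule ccontr)
    assume nz: "cpoly_eval f x \<noteq> 0"
    have fL: "f \<in> polys L" using f(1) forms_subset_polys by blast
    have xc: "cpoly_eval f x = cpoly_eval f c" by (rule cpoly_eval_cong[OF fL]) (simp add: x_def)
    obtain g where g: "\<forall>v\<in>L. g v \<in> polys L"
      "\<And>z. cpoly_eval f z - cpoly_eval f c = (\<Sum>v\<in>L. (z v - c v) * cpoly_eval (g v) z)"
      using polys_difference[OF fin fL] by blast
    have "point_ideal L C L c (\<lambda>z. cpoly_eval f z - cpoly_eval f c)"
      unfolding point_ideal_def using g by blast
    then have "point_ideal L C L c (\<lambda>z. (- 1 / cpoly_eval f c) * (cpoly_eval f z - cpoly_eval f c))"
      by (rule point_ideal_mult) (rule polyfun_const)
    then have "point_ideal L C L c (\<lambda>z. 1)"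
      by (rule point_ideal_cong[rotated]) (use f(2) nz xc in auto)
    with c(2) show False by simp
  qed
  moreover have "x \<in> coord_space L" "\<forall>a\<in>A. x a = y a" using c(1) AL by (auto simp: x_def coord_space_def)
  ultimately show ?thesis by blast
qed

subsection \<open>Dimension of a finite projection\<close>

lemma closedin_zariski_mem:
  assumes Z: "closedin (zariski I) Z" and p: "p \<in> proj_space I"
    and van: "\<And>d f x. f \<in> forms I d \<Longrightarrow> (\<forall>x\<in>\<Union>Z. cpoly_eval f x = 0) \<Longrightarrow> x \<in> p \<Longrightarrow> cpoly_eval f x = 0"
  shows "p \<in> Z"
proof -
  obtain F where F: "F \<subseteq> (\<Union>d. forms I d)" "Z = zero_locus I F" using Z by (auto simp: closedin_zariski)
  have "cpoly_eval f x = 0" if f: "f \<in> F" and x: "x \<in> p" for f x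
  proof -
    obtain d where "f \<in> forms I d" using F(1) f by blast
    moreover have "\<forall>x\<in>\<Union>Z. cpoly_eval f x = 0" using F(2) f by (auto simp: zero_locus_def)
    ultimately show ?thesis using van x by blast
  qed
  then show ?thesis using p by (auto simp: F(2) zero_locus_def)
qed

lemma closedin_zariski_subset: "closedin (zariski I) Z \<Longrightarrow> Z \<subseteq> proj_space I"
  using closedin_subset by fastforce

lemma closedin_zero_locus_form: "f \<in> forms I d \<Longrightarrow> closedin (zariski I) (zero_locus I {f})"
  unfolding closedin_zariski by (intro exI[of _ "{f}"]) auto

lemma zero_locus_form_mem:
  assumes "p \<in> proj_space I" "f \<in> forms I d" "x \<in> p" "cpoly_eval f x = 0"
  shows "p \<in> zero_locus I {f}"
  using assms zero_locus_rep[OF assms(1,2,3)] by (auto simp: zero_locus_def)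

lemma irreducible_iff_domain_cone:
  assumes Z: "closedin (zariski I) Z"
  shows "(\<forall>B C. closedin (zariski I) B \<and> closedin (zariski I) C \<and> Z = B \<union> C \<longrightarrow> Z = B \<or> Z = C) \<longleftrightarrow>
    domain_cone I (\<Union>Z)"
proof
  assume irr: "\<forall>B C. closedin (zariski I) B \<and> closedin (zariski I) C \<and> Z = B \<union> C \<longrightarrow> Z = B \<or> Z = C"
  show "domain_cone I (\<Union>Z)" unfolding domain_cone_def
  proof (intro allI ballI impI)
    fix d e f g assume f: "f \<in> forms I d" and g: "g \<in> forms I e"
      and fg: "\<forall>x\<in>\<Union>Z. cpoly_eval f x * cpoly_eval g x = 0"
    let ?B = "Z \<inter> zero_locus I {f}" and ?C = "Z \<inter> zero_locus I {g}"
    have "Z \<subseteq> ?B \<union> ?C"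
    proof
      fix p assume p: "p \<in> Z"
      then have pI: "p \<in> proj_space I" using closedin_zariski_subset[OF Z] by blast
      then obtain x where x: "x \<in> p" by (auto simp: proj_space_def intro: proj_pt_self)
      have "cpoly_eval f x = 0 \<or> cpoly_eval g x = 0" using fg p x by auto
      then show "p \<in> ?B \<union> ?C"
        using zero_locus_form_mem[OF pI f x] zero_locus_form_mem[OF pI g x] p by blast
    qed
    then have "Z = ?B \<union> ?C" by blast
    moreover have "closedin (zariski I) ?B" "closedin (zariski I) ?C"
      by (intro closedin_Int Z closedin_zero_locus_form[OF f] closedin_zero_locus_form[OF g])+
    ultimately have "Z = ?B \<or> Z = ?C" using irr by blast
    then show "(\<forall>x\<in>\<Union>Z. cpoly_eval f x = 0) \<or> (\<forall>x\<in>\<Union>Z. cpoly_eval g x = 0)"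
      by (auto simp: zero_locus_def)
  qed
next
  assume dom: "domain_cone I (\<Union>Z)"
  show "\<forall>B C. closedin (zariski I) B \<and> closedin (zariski I) C \<and> Z = B \<union> C \<longrightarrow> Z = B \<or> Z = C"
  proof (intro allI impI, elim conjE, rule ccontr)
    fix B C assume B: "closedin (zariski I) B" and C: "closedin (zariski I) C" and ZBC: "Z = B \<union> C"
      and ne: "\<not> (Z = B \<or> Z = C)"
    have sep: "\<exists>d f. f \<in> forms I d \<and> (\<forall>x\<in>\<Union>D. cpoly_eval f x = 0) \<and> (\<exists>x\<in>\<Union>Z. cpoly_eval f x \<noteq> 0)"
      if D: "closedin (zariski I) D" "D \<subseteq> Z" "Z \<noteq> D" for D
    proof -
      obtain p where p: "p \<in> Z" "p \<notin> D" using D by blast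
      have pI: "p \<in> proj_space I" using closedin_zariski_subset[OF Z] p by blast
      obtain d f x where "f \<in> forms I d" "\<forall>x\<in>\<Union>D. cpoly_eval f x = 0" "x \<in> p" "cpoly_eval f x \<noteq> 0"
        using closedin_zariski_mem[OF D(1) pI] p(2) by blast
      then show ?thesis using p(1) by blast
    qed
    obtain d f where f: "f \<in> forms I d" "\<forall>x\<in>\<Union>B. cpoly_eval f x = 0" "\<exists>x\<in>\<Union>Z. cpoly_eval f x \<noteq> 0"
      using sep[OF B] ZBC ne by blast
    obtain e g where g: "g \<in> forms I e" "\<forall>x\<in>\<Union>C. cpoly_eval g x = 0" "\<exists>x\<in>\<Union>Z. cpoly_eval g x \<noteq> 0"
      using sep[OF C] ZBC ne by blast
    have "\<forall>x\<in>\<Union>Z. cpoly_eval f x * cpoly_eval g x = 0" using f(2) g(2) ZBC by auto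
    then have "(\<forall>x\<in>\<Union>Z. cpoly_eval f x = 0) \<or> (\<forall>x\<in>\<Union>Z. cpoly_eval g x = 0)"
      using dom f(1) g(1) unfolding domain_cone_def by blast
    then show False using f(3) g(3) by blast
  qed
qed

lemma irreducible_closedin_subtopology_zariski:
  assumes X: "closedin (zariski I) X"
  shows "irreducible_closedin (subtopology (zariski I) X) Z \<longleftrightarrow>
    closedin (zariski I) Z \<and> Z \<subseteq> X \<and> Z \<noteq> {} \<and> domain_cone I (\<Union>Z)"
proof -
  have cl: "closedin (subtopology (zariski I) X) S \<longleftrightarrow> S \<subseteq> X \<and> closedin (zariski I) S" for S
    using closedin_closed_subtopology[OF X] by blast
  show ?thesis
  proof (cases "closedin (zariski I) Z \<and> Z \<subseteq> X")
    case True
    then show ?thesis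
      unfolding irreducible_closedin_def cl irreducible_iff_domain_cone[OF conjunct1[OF True], symmetric] by blast
  next
    case False
    then show ?thesis unfolding irreducible_closedin_def cl by blast
  qed
qed

text \<open>The standard monomials decrease along the chain and stabilize. From then on consecutive
  sets have equal Hilbert functions, hence the same vanishing forms, and closed sets are determined
  by these.\<close>

lemma zariski_no_descending_chain:
  assumes fin: "finite I" and Z: "\<And>n. closedin (zariski I) (Z n)" "\<And>n. Z (Suc n) \<subset> Z n"
  shows False
proof -
  obtain idx :: "'a \<Rightarrow> nat" where idx: "inj_on idx I" using finite_imp_inj_to_nat_seg[OF fin] by blast
  have sub: "\<Union>(Z (Suc n)) \<subseteq> \<Union>(Z n)" for n using Z(2)[of n] by blast
  obtain K where K: "\<And>k. k \<ge> K \<Longrightarrow> std_monoms idx I (\<Union>(Z k)) = std_monoms idx I (\<Union>(Z K))"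
    using down_closed_chain_stabilizes[of I "\<lambda>n. std_monoms idx I (\<Union>(Z n))"]
      fin down_closed_std_monoms std_monoms_mono[OF sub] by (auto simp: std_monoms_def)
  have eq: "hilb I (\<Union>(Z K)) d = hilb I (\<Union>(Z (Suc K))) d" for d
    using K[of "Suc K"] by (simp add: hilb_eq_card_std[OF fin idx])
  have "Z K \<subseteq> Z (Suc K)"
  proof
    fix p assume p: "p \<in> Z K"
    show "p \<in> Z (Suc K)"
    proof (rule closedin_zariski_mem[OF Z(1)])
      show "p \<in> proj_space I" using closedin_zariski_subset[OF Z(1)] p by blast
      show "cpoly_eval f x = 0" if "f \<in> forms I d" "\<forall>x\<in>\<Union>(Z (Suc K)). cpoly_eval f x = 0" "x \<in> p" for d f x
        using vanish_if_hilb_eq[OF fin sub eq that(1)] that(2,3) p by blast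
    qed
  qed
  then show False using Z(2)[of K] by blast
qed

lemma zariski_minimal_closed:
  assumes fin: "finite I" and P: "P W0" and cl: "\<And>W. P W \<Longrightarrow> closedin (zariski I) W"
  obtains W where "P W" "\<And>W'. P W' \<Longrightarrow> W' \<subseteq> W \<Longrightarrow> W' = W"
proof -
  define r where "r = {(W', W). P W' \<and> P W \<and> W' \<subset> W}"
  have "wf r"
    unfolding wf_iff_no_infinite_down_chain
  proof
    assume "\<exists>f. \<forall>i. (f (Suc i), f i) \<in> r"
    then obtain f where f: "\<And>i. (f (Suc i), f i) \<in> r" by blast
    then have "closedin (zariski I) (f n)" "f (Suc n) \<subset> f n" for n using cl by (auto simp: r_def)
    then show False by (rule zariski_no_descending_chain[OF fin])
  qed
  then obtain W where "W \<in> Collect P" "\<And>W'. (W', W) \<in> r \<Longrightarrow> W' \<notin> Collect P"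
    using P wfE_min[of r W0 "Collect P"] by blast
  then show ?thesis by (intro that[of W]) (auto simp: r_def)
qed

text \<open>
  \<open>proj_image A W\<close> is the closure of the image of \<open>W\<close> under the linear projection that keeps the
  coordinates in \<open>A\<close>.
\<close>

definition proj_image :: "'i set \<Rightarrow> ('i \<Rightarrow> complex) set set \<Rightarrow> ('i \<Rightarrow> complex) set set"
  where "proj_image A W = zero_locus A (\<Union>d. {f \<in> forms A d. \<forall>x\<in>\<Union>W. cpoly_eval f x = 0})"

lemma proj_imageI:
  assumes "p \<in> proj_space A"
    and "\<And>d f x. f \<in> forms A d \<Longrightarrow> (\<forall>x\<in>\<Union>W. cpoly_eval f x = 0) \<Longrightarrow> x \<in> p \<Longrightarrow> cpoly_eval f x = 0"
  shows "p \<in> proj_image A W"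
  unfolding proj_image_def zero_locus_def
proof (intro CollectI conjI ballI assms(1))
  fix f x assume "f \<in> (\<Union>d. {f \<in> forms A d. \<forall>x\<in>\<Union>W. cpoly_eval f x = 0})" and x: "x \<in> p"
  then obtain d where "f \<in> forms A d" "\<forall>x\<in>\<Union>W. cpoly_eval f x = 0" by blast
  then show "cpoly_eval f x = 0" using x by (rule assms(2))
qed

lemma proj_imageD:
  assumes "p \<in> proj_image A W"
  shows "p \<in> proj_space A"
    and "f \<in> forms A d \<Longrightarrow> \<forall>x\<in>\<Union>W. cpoly_eval f x = 0 \<Longrightarrow> x \<in> p \<Longrightarrow> cpoly_eval f x = 0"
  using assms unfolding proj_image_def zero_locus_def by auto

lemma proj_image_mono:
  assumes "W \<subseteq> W'"
  shows "proj_image A W \<subseteq> proj_image A W'"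
proof
  fix p assume p: "p \<in> proj_image A W"
  show "p \<in> proj_image A W'"
  proof (rule proj_imageI[OF proj_imageD(1)[OF p]])
    fix d f x assume f: "f \<in> forms A d" "\<forall>x\<in>\<Union>W'. cpoly_eval f x = 0" and x: "x \<in> p"
    have "\<forall>x\<in>\<Union>W. cpoly_eval f x = 0" using f(2) assms by auto
    then show "cpoly_eval f x = 0" by (rule proj_imageD(2)[OF p f(1) _ x])
  qed
qed

definition restrict_coords :: "'i set \<Rightarrow> ('i \<Rightarrow> complex) \<Rightarrow> 'i \<Rightarrow> complex"
  where "restrict_coords A x = (\<lambda>i. if i \<in> A then x i else 0)"

lemma cpoly_eval_restrict_coords: "f \<in> forms A d \<Longrightarrow> cpoly_eval f (restrict_coords A x) = cpoly_eval f x"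
  using forms_subset_polys by (intro cpoly_eval_cong[of f A]) (auto simp: restrict_coords_def)

lemma closedin_proj_image: "closedin (zariski A) (proj_image A W)"
  unfolding proj_image_def closedin_zariski
  by (rule exI[of _ "\<Union>d. {f \<in> forms A d. \<forall>x\<in>\<Union>W. cpoly_eval f x = 0}"]) (rule conjI[OF UN_mono refl]; simp)

lemma integral_cone_mono: "integral_cone A L C \<Longrightarrow> C' \<subseteq> C \<Longrightarrow> integral_cone A L C'"
  unfolding integral_cone_def by (meson subsetD)

lemma integral_coneE:
  assumes "integral_cone A L C" "u \<in> L"
  obtains N h where "N \<ge> 1" "\<forall>i<N. h i \<in> forms A (N - i)"
    "\<forall>x\<in>C. x u ^ N = (\<Sum>i<N. cpoly_eval (h i) x * x u ^ i)"
  using bspec[OF assms(1)[unfolded integral_cone_def] assms(2)] by (elim exE conjE)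

lemma form_at_zero:
  assumes "f \<in> forms A d" "d > 0"
  shows "cpoly_eval f (\<lambda>_. 0) = 0"
  using cpoly_eval_homogeneous[OF assms(1), of 0 "\<lambda>_. 0"] assms(2) by (cases d) auto

text \<open>The coefficients of an integral equation have positive degree and vanish where all
  coordinates in \<open>A\<close> do, which leaves \<open>x u ^ N = 0\<close>. So the projection is
  defined at every point of \<open>W\<close>.\<close>

lemma integral_cone_restrict_nonzero:
  assumes int: "integral_cone A L (\<Union>W)" and W: "W \<subseteq> proj_space L" and x: "x \<in> \<Union>W"
  shows "restrict_coords A x \<noteq> (\<lambda>_. 0)"
proof
  assume 0: "restrict_coords A x = (\<lambda>_. 0)"
  obtain u where u: "u \<in> L" "x u \<noteq> 0" using proj_space_nonzero_coord x W by blast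
  obtain N h where N: "N \<ge> 1" and h: "\<forall>i<N. h i \<in> forms A (N - i)"
    and eq: "\<forall>x\<in>\<Union>W. x u ^ N = (\<Sum>i<N. cpoly_eval (h i) x * x u ^ i)"
    by (rule integral_coneE[OF int u(1)])
  have "cpoly_eval (h i) x = 0" if "i < N" for i
    using cpoly_eval_restrict_coords[of "h i" A "N - i" x] form_at_zero[of "h i" A "N - i"] h that 0 by simp
  then have "x u ^ N = 0" using bspec[OF eq x] by simp
  then show False using u(2) by simp
qed

lemma proj_image_mem:
  assumes int: "integral_cone A L (\<Union>W)" and W: "W \<subseteq> proj_space L" and x: "x \<in> \<Union>W"
  shows "proj_pt (restrict_coords A x) \<in> proj_image A W"
proof (rule proj_imageI)
  show "proj_pt (restrict_coords A x) \<in> proj_space A"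
    by (intro proj_pt_in_proj_space integral_cone_restrict_nonzero[OF int W x])
      (auto simp: coord_space_def restrict_coords_def)
  fix d f y assume f: "f \<in> forms A d" "\<forall>x\<in>\<Union>W. cpoly_eval f x = 0" and y: "y \<in> proj_pt (restrict_coords A x)"
  obtain c where "y = (\<lambda>i. c * restrict_coords A x i)" using y by (auto simp: mem_proj_pt)
  moreover have "cpoly_eval f x = 0" using f(2) x by (rule bspec)
  ultimately show "cpoly_eval f y = 0"
    by (simp add: cpoly_eval_homogeneous[OF f(1)] cpoly_eval_restrict_coords[OF f(1)])
qed

lemma proj_image_vanish_iff:
  assumes int: "integral_cone A L (\<Union>W)" and W: "W \<subseteq> proj_space L" and f: "f \<in> forms A d"
  shows "(\<forall>x\<in>\<Union>(proj_image A W). cpoly_eval f x = 0) \<longleftrightarrow> (\<forall>x\<in>\<Union>W. cpoly_eval f x = 0)"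
proof
  assume van: "\<forall>x\<in>\<Union>(proj_image A W). cpoly_eval f x = 0"
  show "\<forall>x\<in>\<Union>W. cpoly_eval f x = 0"
  proof
    fix x assume "x \<in> \<Union>W"
    then have "proj_pt (restrict_coords A x) \<in> proj_image A W" by (rule proj_image_mem[OF int W])
    then have "cpoly_eval f (restrict_coords A x) = 0" using van proj_pt_self by blast
    then show "cpoly_eval f x = 0" by (simp add: cpoly_eval_restrict_coords[OF f])
  qed
next
  assume van: "\<forall>x\<in>\<Union>W. cpoly_eval f x = 0"
  then show "\<forall>x\<in>\<Union>(proj_image A W). cpoly_eval f x = 0"
    using proj_imageD(2)[OF _ f] by auto
qed

lemma proj_image_irreducible:
  assumes int: "integral_cone A L (\<Union>W)" and W: "W \<subseteq> proj_space L" "W \<noteq> {}" and AL: "A \<subseteq> L"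
    and dom: "domain_cone L (\<Union>W)"
  shows "proj_image A W \<noteq> {} \<and> domain_cone A (\<Union>(proj_image A W))"
proof
  obtain p where p: "p \<in> W" using W(2) by blast
  then obtain x where "x \<in> p" using W(1) by (auto simp: proj_space_def intro: proj_pt_self)
  then show "proj_image A W \<noteq> {}" using proj_image_mem[OF int W(1)] p by blast
  show "domain_cone A (\<Union>(proj_image A W))"
    unfolding domain_cone_def
  proof (intro allI ballI impI)
    fix d e f g assume f: "f \<in> forms A d" and g: "g \<in> forms A e"
      and z: "\<forall>x\<in>\<Union>(proj_image A W). cpoly_eval f x * cpoly_eval g x = 0"
    have "\<forall>x\<in>\<Union>W. cpoly_eval (f * g) x = 0"
      using proj_image_vanish_iff[OF int W(1) forms_mult[OF f g]] z by (simp only: cpoly_eval_mult)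
    moreover have "f \<in> forms L d" "g \<in> forms L e" using f g forms_mono[OF AL] by blast+
    ultimately have "(\<forall>x\<in>\<Union>W. cpoly_eval f x = 0) \<or> (\<forall>x\<in>\<Union>W. cpoly_eval g x = 0)"
      using dom unfolding domain_cone_def cpoly_eval_mult by blast
    then show "(\<forall>x\<in>\<Union>(proj_image A W). cpoly_eval f x = 0) \<or> (\<forall>x\<in>\<Union>(proj_image A W). cpoly_eval g x = 0)"
      unfolding proj_image_vanish_iff[OF int W(1) f] proj_image_vanish_iff[OF int W(1) g] .
  qed
qed

text \<open>Equal images would mean that the same forms in \<open>A\<close> vanish on
  \<open>W\<close> and \<open>W'\<close>. By incomparability the same forms in \<open>L\<close>
  would then vanish on both.\<close>

lemma proj_image_strict:
  assumes fin: "finite L" and AL: "A \<subseteq> L" and int: "integral_cone A L (\<Union>W')"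
    and W': "closedin (zariski L) W'" "domain_cone L (\<Union>W')" and W: "closedin (zariski L) W" "W \<subset> W'"
  shows "proj_image A W \<subset> proj_image A W'"
proof -
  have W'I: "W' \<subseteq> proj_space L" by (rule closedin_zariski_subset[OF W'(1)])
  have WI: "W \<subseteq> proj_space L" by (rule closedin_zariski_subset[OF W(1)])
  have sub: "\<Union>W \<subseteq> \<Union>W'" using W(2) by blast
  have intW: "integral_cone A L (\<Union>W)" by (rule integral_cone_mono[OF int sub])
  have "proj_image A W \<subseteq> proj_image A W'" using W(2) by (intro proj_image_mono) blast
  moreover have "proj_image A W \<noteq> proj_image A W'"
  proof
    assume eq: "proj_image A W = proj_image A W'"
    obtain p where p: "p \<in> W'" "p \<notin> W" using W(2) by blast
    have pL: "p \<in> proj_space L" using p(1) W'I by blast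
    then obtain x where x: "x \<in> p" by (auto simp: proj_space_def intro: proj_pt_self)
    obtain i where i: "i \<in> L" "x i \<noteq> 0" using proj_space_nonzero_coord[OF pL x] .
    have "p \<in> W"
    proof (rule closedin_zariski_mem[OF W(1) pL])
      fix d f y assume f: "f \<in> forms L d" "\<forall>x\<in>\<Union>W. cpoly_eval f x = 0" and y: "y \<in> p"
      have "\<forall>x\<in>\<Union>W'. cpoly_eval f x = 0"
      proof (rule integral_cone_incomparable[where x = x and i = i, OF fin AL W'(2) int sub])
        show "i \<in> L" "x i \<noteq> 0" "f \<in> forms L d" "\<forall>x\<in>\<Union>W. cpoly_eval f x = 0" by (fact i f)+
        show "x \<in> \<Union>W'" using x p(1) by blast
        show "\<forall>x\<in>\<Union>W'. cpoly_eval g x = 0" if g: "g \<in> forms A e" "\<forall>x\<in>\<Union>W. cpoly_eval g x = 0" for e g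
          using proj_image_vanish_iff[OF intW WI g(1)] proj_image_vanish_iff[OF int W'I g(1)] g(2) eq by simp
      qed
      then show "cpoly_eval f y = 0" using y p(1) by blast
    qed
    with p(2) show False by simp
  qed
  ultimately show ?thesis by blast
qed

text \<open>Among the closed subsets of \<open>W'\<close> on which the same forms in
  \<open>A\<close> vanish as on \<open>Z\<close>, a minimal one is taken. Lifting of points is what
  shows that the full preimage \<open>W0\<close> is one of them; irreducibility follows from
  minimality and the irreducibility of \<open>Z\<close>.\<close>

lemma lift_irreducible:
  assumes fin: "finite L" and AL: "A \<subseteq> L" and W': "closedin (zariski L) W'" and int: "integral_cone A L (\<Union>W')"
    and Z: "closedin (zariski A) Z" "Z \<noteq> {}" "domain_cone A (\<Union>Z)" and ZW': "Z \<subseteq> proj_image A W'"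
  obtains W where "closedin (zariski L) W" "W \<subseteq> W'" "W \<noteq> {}" "domain_cone L (\<Union>W)" "proj_image A W = Z"
proof -
  have ZA: "Z \<subseteq> proj_space A" by (rule closedin_zariski_subset[OF Z(1)])
  have W'L: "W' \<subseteq> proj_space L" by (rule closedin_zariski_subset[OF W'])
  define van where "van W f \<longleftrightarrow> (\<forall>x\<in>\<Union>W. cpoly_eval f x = 0)" for W and f :: "'a cpoly"
  define P where "P W \<longleftrightarrow> closedin (zariski L) W \<and> W \<subseteq> W' \<and> (\<forall>d. \<forall>f\<in>forms A d. van W f \<longleftrightarrow> van Z f)" for W
  define FZ where "FZ = (\<Union>d. {f \<in> forms A d. van Z f})"
  define W0 where "W0 = W' \<inter> zero_locus L FZ"
  have FZ: "FZ \<subseteq> (\<Union>d. forms L d)" using forms_mono[OF AL] by (fastforce simp: FZ_def)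
  have W0c: "closedin (zariski L) W0"
    unfolding W0_def by (intro closedin_Int W') (use FZ in \<open>auto simp: closedin_zariski\<close>)
  have P0: "P W0" unfolding P_def
  proof (intro conjI allI ballI iffI W0c)
    show "W0 \<subseteq> W'" by (simp add: W0_def)
    fix d f assume f: "f \<in> forms A d"
    show "van W0 f" if "van Z f"
    proof -
      have "f \<in> FZ" unfolding FZ_def using f that by blast
      then show ?thesis by (auto simp: van_def W0_def zero_locus_def)
    qed
    assume vf: "van W0 f"
    show "van Z f" unfolding van_def
    proof
      fix y assume "y \<in> \<Union>Z"
      then obtain p where p: "p \<in> Z" "y \<in> p" by blast
      have pA: "p \<in> proj_space A" using p ZA by blast
      have yA: "y \<in> coord_space A" "y \<noteq> (\<lambda>_. 0)" "p = proj_pt y" using proj_space_mem[OF pA p(2)] by auto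
      have "\<exists>x\<in>coord_space L. (\<forall>a\<in>A. x a = y a) \<and>
        (\<forall>d. \<forall>g\<in>forms L d. (\<forall>x\<in>\<Union>W'. cpoly_eval g x = 0) \<longrightarrow> cpoly_eval g x = 0)"
      proof (rule point_lift[OF fin AL int])
        show "(\<lambda>i. c * x i) \<in> \<Union>W'" if "x \<in> \<Union>W'" "c \<noteq> 0" for x c
          using that proj_space_mem_scale[of _ L x c] W'L by blast
        show "cpoly_eval g y = 0" if "g \<in> forms A e" "\<forall>x\<in>\<Union>W'. cpoly_eval g x = 0" for e g
        proof -
          have "p \<in> proj_image A W'" using p(1) ZW' by blast
          then show ?thesis using that p(2) by (rule proj_imageD(2))
        qed
      qed
      then obtain x where x: "x \<in> coord_space L" "\<forall>a\<in>A. x a = y a"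
        "\<And>d g. g \<in> forms L d \<Longrightarrow> (\<forall>x\<in>\<Union>W'. cpoly_eval g x = 0) \<Longrightarrow> cpoly_eval g x = 0" by blast
      have same: "cpoly_eval g x = cpoly_eval g y" if "g \<in> forms A e" for g e
        using that forms_subset_polys x(2) by (intro cpoly_eval_cong[of g A]) auto
      have xn: "x \<noteq> (\<lambda>_. 0)"
      proof
        assume "x = (\<lambda>_. 0)"
        then have "y i = 0" for i using x(2) yA(1) by (cases "i \<in> A") (auto simp: coord_space_def)
        then show False using yA(2) by auto
      qed
      have xL: "proj_pt x \<in> proj_space L" by (rule proj_pt_in_proj_space[OF x(1) xn])
      have "proj_pt x \<in> W'"
      proof (rule closedin_zariski_mem[OF W' xL])
        fix e g z assume g: "g \<in> forms L e" "\<forall>x\<in>\<Union>W'. cpoly_eval g x = 0" and z: "z \<in> proj_pt x"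
        then obtain c where "z = (\<lambda>i. c * x i)" by (auto simp: mem_proj_pt)
        then show "cpoly_eval g z = 0" using x(3)[OF g] by (simp add: cpoly_eval_homogeneous[OF g(1)])
      qed
      moreover have "proj_pt x \<in> zero_locus L FZ"
        unfolding zero_locus_def
      proof (intro CollectI conjI ballI xL)
        fix g z assume g: "g \<in> FZ" and z: "z \<in> proj_pt x"
        obtain e where e: "g \<in> forms A e" "van Z g" using g by (auto simp: FZ_def)
        obtain c where c: "z = (\<lambda>i. c * x i)" using z by (auto simp: mem_proj_pt)
        have "cpoly_eval g y = 0" using e(2) p by (auto simp: van_def)
        then show "cpoly_eval g z = 0" by (simp add: c cpoly_eval_homogeneous[OF e(1)] same[OF e(1)])
      qed
      ultimately have "x \<in> \<Union>W0" unfolding W0_def using proj_pt_self by blast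
      with vf[unfolded van_def] have "cpoly_eval f x = 0" by (rule bspec)
      then show "cpoly_eval f y = 0" using same[OF f] by simp
    qed
  qed
  obtain W where W: "P W" and min: "\<And>V. P V \<Longrightarrow> V \<subseteq> W \<Longrightarrow> V = W"
    by (rule zariski_minimal_closed[OF fin, of P W0]) (use P0 in \<open>auto simp: P_def\<close>)
  have Wc: "closedin (zariski L) W" and WW': "W \<subseteq> W'"
    and vW: "\<And>d f. f \<in> forms A d \<Longrightarrow> van W f \<longleftrightarrow> van Z f" using W by (auto simp: P_def)
  have WL: "W \<subseteq> proj_space L" by (rule closedin_zariski_subset[OF Wc])
  have sub: "\<Union>W \<subseteq> \<Union>W'" using WW' by blast
  have intW: "integral_cone A L (\<Union>W)" by (rule integral_cone_mono[OF int sub])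
  have "W \<noteq> {}"
  proof
    assume "W = {}"
    then have "van Z 1" using vW[of 1 0] by (simp add: van_def)
    moreover obtain p where "p \<in> Z" using Z(2) by blast
    moreover then obtain y where "y \<in> p" using ZA by (auto simp: proj_space_def intro: proj_pt_self)
    ultimately show False by (auto simp: van_def)
  qed
  moreover have "domain_cone L (\<Union>W)"
    unfolding irreducible_iff_domain_cone[OF Wc, symmetric]
  proof (intro allI impI, elim conjE)
    fix B C assume B: "closedin (zariski L) B" and C: "closedin (zariski L) C" and WBC: "W = B \<union> C"
    \<comment> \<open>A product of a form vanishing on \<open>B\<close> and one vanishing on
      \<open>C\<close> vanishes on \<open>Z\<close>, which is irreducible. Hence one of the two
      parts satisfies \<open>P\<close>, and by minimality it is all of \<open>W\<close>.\<close>
    have split: "(\<forall>d. \<forall>f\<in>forms A d. van B f \<longrightarrow> van Z f) \<or> (\<forall>d. \<forall>f\<in>forms A d. van C f \<longrightarrow> van Z f)"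
    proof (rule ccontr)
      assume "\<not> ?thesis"
      then obtain d f e g where f: "f \<in> forms A d" "van B f" "\<not> van Z f" and g: "g \<in> forms A e" "van C g" "\<not> van Z g"
        by blast
      have "van W (f * g)" using f(2) g(2) WBC by (auto simp: van_def cpoly_eval_mult)
      then have "van Z (f * g)" using vW[OF forms_mult[OF f(1) g(1)]] by blast
      then have "van Z f \<or> van Z g"
        using Z(3) f(1) g(1) unfolding domain_cone_def van_def cpoly_eval_mult by blast
      then show False using f(3) g(3) by blast
    qed
    have PD: "P D" if D: "closedin (zariski L) D" "D \<subseteq> W" "\<forall>d. \<forall>f\<in>forms A d. van D f \<longrightarrow> van Z f" for D
    proof -
      have "van D f" if "f \<in> forms A d" "van Z f" for f d
      proof -
        have "van W f" using vW[OF that(1)] that(2) by simp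
        then show ?thesis using D(2) by (auto simp: van_def)
      qed
      then show ?thesis using D WW' by (auto simp: P_def)
    qed
    show "W = B \<or> W = C"
      using split PD[OF B] PD[OF C] min[of B] min[of C] WBC by blast
  qed
  moreover have "proj_image A W = Z"
  proof (intro equalityI subsetI)
    fix p assume p: "p \<in> proj_image A W"
    show "p \<in> Z"
    proof (rule closedin_zariski_mem[OF Z(1)])
      show "p \<in> proj_space A" by (rule proj_imageD(1)[OF p])
      fix d f x assume f: "f \<in> forms A d" "\<forall>x\<in>\<Union>Z. cpoly_eval f x = 0" and x: "x \<in> p"
      have "\<forall>x\<in>\<Union>W. cpoly_eval f x = 0" using vW[OF f(1)] f(2) by (simp add: van_def)
      then show "cpoly_eval f x = 0" by (rule proj_imageD(2)[OF p f(1) _ x])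
    qed
  next
    fix p assume p: "p \<in> Z"
    show "p \<in> proj_image A W"
    proof (rule proj_imageI)
      show "p \<in> proj_space A" using p ZA by blast
      fix d f x assume f: "f \<in> forms A d" "\<forall>x\<in>\<Union>W. cpoly_eval f x = 0" and x: "x \<in> p"
      then have "van Z f" using vW[OF f(1)] by (simp add: van_def)
      then show "cpoly_eval f x = 0" using p x by (auto simp: van_def)
    qed
  qed
  ultimately show ?thesis using that[OF Wc WW'] by blast
qed

text \<open>The chain is lifted from the top: the lift \<open>V\<close> of the largest member
  becomes the new ambient set, and lying over is applied inside it. Integrality passes to closed
  subsets.\<close>

lemma lift_chain:
  assumes fin: "finite L" and AL: "A \<subseteq> L" and W': "closedin (zariski L) W'" "integral_cone A L (\<Union>W')"
    and Z: "\<And>i. i \<le> k \<Longrightarrow> closedin (zariski A) (Z i) \<and> Z i \<noteq> {} \<and> domain_cone A (\<Union>(Z i))"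
    and chain: "\<And>i. i < k \<Longrightarrow> Z i \<subset> Z (Suc i)" and top: "Z k \<subseteq> proj_image A W'"
  shows "\<exists>W. (\<forall>i\<le>k. closedin (zariski L) (W i) \<and> W i \<subseteq> W' \<and> W i \<noteq> {} \<and> domain_cone L (\<Union>(W i)) \<and>
    proj_image A (W i) = Z i) \<and> (\<forall>i<k. W i \<subset> W (Suc i))"
  using W' Z chain top
proof (induction k arbitrary: W')
  case 0
  obtain W where "closedin (zariski L) W" "W \<subseteq> W'" "W \<noteq> {}" "domain_cone L (\<Union>W)" "proj_image A W = Z 0"
    using lift_irreducible[OF fin AL 0(1,2), of "Z 0"] 0(3)[of 0] 0(5) by blast
  then show ?case by (intro exI[of _ "\<lambda>_. W"]) auto
next
  case (Suc k)
  obtain V where V: "closedin (zariski L) V" "V \<subseteq> W'" "V \<noteq> {}" "domain_cone L (\<Union>V)" "proj_image A V = Z (Suc k)"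
    using lift_irreducible[OF fin AL Suc.prems(1,2), of "Z (Suc k)"] Suc.prems(3)[of "Suc k"] Suc.prems(5) by blast
  have intV: "integral_cone A L (\<Union>V)" using integral_cone_mono[OF Suc.prems(2)] V(2) by blast
  have "\<exists>W. (\<forall>i\<le>k. closedin (zariski L) (W i) \<and> W i \<subseteq> V \<and> W i \<noteq> {} \<and> domain_cone L (\<Union>(W i)) \<and>
    proj_image A (W i) = Z i) \<and> (\<forall>i<k. W i \<subset> W (Suc i))"
  proof (rule Suc.IH[OF V(1) intV])
    show "closedin (zariski A) (Z i) \<and> Z i \<noteq> {} \<and> domain_cone A (\<Union>(Z i))" if "i \<le> k" for i
      using Suc.prems(3)[of i] that by simp
    show "Z i \<subset> Z (Suc i)" if "i < k" for i using Suc.prems(4)[of i] that by simp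
    show "Z k \<subseteq> proj_image A V" using Suc.prems(4)[of k] V(5) by auto
  qed
  then obtain W where W: "\<And>i. i \<le> k \<Longrightarrow> closedin (zariski L) (W i) \<and> W i \<subseteq> V \<and> W i \<noteq> {} \<and>
      domain_cone L (\<Union>(W i)) \<and> proj_image A (W i) = Z i" "\<And>i. i < k \<Longrightarrow> W i \<subset> W (Suc i)" by blast
  define U where "U i = (if i \<le> k then W i else V)" for i
  have "W k \<noteq> V"
  proof
    assume "W k = V"
    then have "Z k = Z (Suc k)" using W(1)[of k] V(5) by simp
    then show False using Suc.prems(4)[of k] by simp
  qed
  then have Wk: "W k \<subset> V" using W(1)[of k] by blast
  have U1: "closedin (zariski L) (U i) \<and> U i \<subseteq> W' \<and> U i \<noteq> {} \<and> domain_cone L (\<Union>(U i)) \<and> proj_image A (U i) = Z i"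
    if "i \<le> Suc k" for i
  proof (cases "i \<le> k")
    case True
    then show ?thesis using W(1)[OF True] V(2) True by (simp add: U_def order_trans[OF _ V(2)])
  next
    case False
    then have "i = Suc k" using that by simp
    then show ?thesis using V by (simp add: U_def)
  qed
  have U2: "U i \<subset> U (Suc i)" if "i < Suc k" for i
  proof (cases "i < k")
    case True
    then show ?thesis using W(2)[OF True] by (simp add: U_def)
  next
    case False
    then have "i = k" using that by simp
    then show ?thesis using Wk by (simp add: U_def)
  qed
  show ?case using U1 U2 by (intro exI[of _ U] conjI allI impI) simp_all
qed

text \<open>Chains of irreducible closed sets of any length exist on both sides or on neither:
  chains in \<open>Y\<close> lift to \<open>X\<close>, and the images of a strict chain in
  \<open>X\<close> are strict by incomparability.\<close>

theorem proj_dim_finite_projection: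
  assumes fin: "finite L" and AL: "A \<subseteq> L" and X: "closedin (zariski L) X" and Y: "closedin (zariski A) Y"
    and int: "integral_cone A L (\<Union>X)"
    and link: "\<And>d f. f \<in> forms A d \<Longrightarrow> (\<forall>x\<in>\<Union>Y. cpoly_eval f x = 0) \<longleftrightarrow> (\<forall>x\<in>\<Union>X. cpoly_eval f x = 0)"
  shows "proj_dim A Y = proj_dim L X"
proof -
  have YX: "Y = proj_image A X"
  proof (intro equalityI subsetI)
    fix p assume p: "p \<in> Y"
    show "p \<in> proj_image A X"
    proof (intro proj_imageI)
      show "p \<in> proj_space A" using p closedin_zariski_subset[OF Y] by blast
      fix d f x assume f: "f \<in> forms A d" "\<forall>x\<in>\<Union>X. cpoly_eval f x = 0" and x: "x \<in> p"
      have "\<forall>x\<in>\<Union>Y. cpoly_eval f x = 0" using link[OF f(1)] f(2) by simp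
      then show "cpoly_eval f x = 0" using p x by auto
    qed
  next
    fix p assume p: "p \<in> proj_image A X"
    show "p \<in> Y"
    proof (rule closedin_zariski_mem[OF Y])
      show "p \<in> proj_space A" by (rule proj_imageD(1)[OF p])
      fix d f x assume f: "f \<in> forms A d" "\<forall>x\<in>\<Union>Y. cpoly_eval f x = 0" and x: "x \<in> p"
      have "\<forall>x\<in>\<Union>X. cpoly_eval f x = 0" using link[OF f(1)] f(2) by simp
      then show "cpoly_eval f x = 0" by (rule proj_imageD(2)[OF p f(1) _ x])
    qed
  qed
  have iff: "(\<exists>Z. (\<forall>i\<le>k. irreducible_closedin (subtopology (zariski A) Y) (Z i)) \<and> (\<forall>i<k. Z i \<subset> Z (Suc i))) \<longleftrightarrow>
    (\<exists>W. (\<forall>i\<le>k. irreducible_closedin (subtopology (zariski L) X) (W i)) \<and> (\<forall>i<k. W i \<subset> W (Suc i)))" for k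
  proof
    assume ex: "\<exists>Z. (\<forall>i\<le>k. irreducible_closedin (subtopology (zariski A) Y) (Z i)) \<and> (\<forall>i<k. Z i \<subset> Z (Suc i))"
    obtain Z where Z0: "\<forall>i\<le>k. irreducible_closedin (subtopology (zariski A) Y) (Z i)"
      and chain0: "\<forall>i<k. Z i \<subset> Z (Suc i)"
      using ex by (elim exE conjE)
    have Z: "\<And>i. i \<le> k \<Longrightarrow> closedin (zariski A) (Z i) \<and> Z i \<subseteq> Y \<and> Z i \<noteq> {} \<and> domain_cone A (\<Union>(Z i))"
      and chain: "\<And>i. i < k \<Longrightarrow> Z i \<subset> Z (Suc i)"
      using Z0 chain0 irreducible_closedin_subtopology_zariski[OF Y] by simp_all
    have "\<exists>W. (\<forall>i\<le>k. closedin (zariski L) (W i) \<and> W i \<subseteq> X \<and> W i \<noteq> {} \<and> domain_cone L (\<Union>(W i)) \<and>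
      proj_image A (W i) = Z i) \<and> (\<forall>i<k. W i \<subset> W (Suc i))"
    proof (rule lift_chain[OF fin AL X int])
      show "closedin (zariski A) (Z i) \<and> Z i \<noteq> {} \<and> domain_cone A (\<Union>(Z i))" if "i \<le> k" for i
        using Z[OF that] by simp
      show "Z i \<subset> Z (Suc i)" if "i < k" for i by (rule chain[OF that])
      show "Z k \<subseteq> proj_image A X" using Z[of k] YX by simp
    qed
    then obtain W where W: "\<forall>i\<le>k. closedin (zariski L) (W i) \<and> W i \<subseteq> X \<and> W i \<noteq> {} \<and> domain_cone L (\<Union>(W i)) \<and>
      proj_image A (W i) = Z i" "\<forall>i<k. W i \<subset> W (Suc i)" by (elim exE conjE)
    then show "\<exists>W. (\<forall>i\<le>k. irreducible_closedin (subtopology (zariski L) X) (W i)) \<and> (\<forall>i<k. W i \<subset> W (Suc i))"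
      using irreducible_closedin_subtopology_zariski[OF X] by (intro exI[of _ W] conjI) simp_all
  next
    assume ex: "\<exists>W. (\<forall>i\<le>k. irreducible_closedin (subtopology (zariski L) X) (W i)) \<and> (\<forall>i<k. W i \<subset> W (Suc i))"
    obtain W where W0: "\<forall>i\<le>k. irreducible_closedin (subtopology (zariski L) X) (W i)"
      and chain0: "\<forall>i<k. W i \<subset> W (Suc i)"
      using ex by (elim exE conjE)
    have W: "\<And>i. i \<le> k \<Longrightarrow> closedin (zariski L) (W i) \<and> W i \<subseteq> X \<and> W i \<noteq> {} \<and> domain_cone L (\<Union>(W i))"
      and chain: "\<And>i. i < k \<Longrightarrow> W i \<subset> W (Suc i)"
      using W0 chain0 irreducible_closedin_subtopology_zariski[OF X] by simp_all
    have intW: "integral_cone A L (\<Union>(W i))" if "i \<le> k" for i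
      using integral_cone_mono[OF int] W[OF that] by blast
    have img: "closedin (zariski A) (proj_image A (W i)) \<and> proj_image A (W i) \<subseteq> Y \<and> proj_image A (W i) \<noteq> {} \<and>
      domain_cone A (\<Union>(proj_image A (W i)))" if i: "i \<le> k" for i
    proof -
      have "proj_image A (W i) \<subseteq> Y" unfolding YX using W[OF i] by (intro proj_image_mono) simp
      then show ?thesis
        using proj_image_irreducible[OF intW[OF i] closedin_zariski_subset _ AL] W[OF i]
        by (simp add: closedin_proj_image)
    qed
    have str: "proj_image A (W i) \<subset> proj_image A (W (Suc i))" if "i < k" for i
      using proj_image_strict[OF fin AL intW[of "Suc i"]] W[of i] W[of "Suc i"] chain[OF that] that by simp
    show "\<exists>Z. (\<forall>i\<le>k. irreducible_closedin (subtopology (zariski A) Y) (Z i)) \<and> (\<forall>i<k. Z i \<subset> Z (Suc i))"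
      using img str irreducible_closedin_subtopology_zariski[OF Y]
      by (intro exI[of _ "\<lambda>i. proj_image A (W i)"] conjI) simp_all
  qed
  show ?thesis unfolding proj_dim_def krull_dim_def iff ..
qed

section \<open>The charts of a smooth polytope and the conclusion\<close>

text \<open>Two different vertices exist because the dimension of \<open>P\<close> is
  \<open>CARD('n)\<close>, hence positive. They are the two exponents that separate torus points and
  so provide a secant line.\<close>

lemma smooth_polytope_vertex_charts:
  fixes P :: "(real ^ 'n) set" and A :: "(int ^ 'n) set"
  assumes P: "smooth_polytope P" and dim: "aff_dim P = int CARD('n)"
    and vertices: "\<And>v. real_vec v extreme_point_of P \<Longrightarrow> v \<in> A"
    and neighbors: "\<And>v \<sigma> w. real_vec v extreme_point_of P \<Longrightarrow> \<sigma> edge_of P \<Longrightarrow> real_vec v \<in> \<sigma> \<Longrightarrow>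
           nearest_neighbor v \<sigma> w \<Longrightarrow> w \<in> A"
  defines "Vt \<equiv> {v. real_vec v extreme_point_of P}"
  shows "vertex_charts A (lattice_points P) Vt" and "\<exists>v\<in>Vt. \<exists>w\<in>Vt. v \<noteq> w"
proof -
  have pol: "polytope P" using P by (auto simp: smooth_polytope_def simple_polytope_def)
  obtain V where V: "finite V" "P = convex hull (real_vec ` V)"
    using P by (auto simp: smooth_polytope_def lattice_polytope_def)
  have lat: "\<exists>v. w = real_vec v \<and> v \<in> Vt" if "w extreme_point_of P" for w
    using extreme_point_of_convex_hull that V(2) by (fastforce simp: Vt_def)
  have hull: "P = convex hull {x. x extreme_point_of P}" by (rule polytope_eq_convex_hull_extreme[OF pol])
  have two: "\<exists>v\<in>Vt. \<exists>w\<in>Vt. v \<noteq> w"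
  proof (rule ccontr)
    assume "\<not> ?thesis"
    then have eq: "\<forall>v\<in>Vt. \<forall>w\<in>Vt. v = w" by simp
    have "\<exists>v. \<forall>w\<in>Vt. w = v"
    proof (cases "Vt = {}")
      case False
      then obtain v where "v \<in> Vt" by blast
      with eq show ?thesis by (intro exI[of _ v]) simp
    qed simp
    then obtain v where v: "\<forall>w\<in>Vt. w = v" by (elim exE)
    have "{x. x extreme_point_of P} \<subseteq> {real_vec v}"
    proof
      fix x assume "x \<in> {x. x extreme_point_of P}"
      then obtain w where "x = real_vec w" "w \<in> Vt" using lat by blast
      then show "x \<in> {real_vec v}" using v by simp
    qed
    from hull_mono[OF this, of convex] have "convex hull {x. x extreme_point_of P} \<subseteq> {real_vec v}" by simp
    from ord_eq_le_trans[OF hull this] have "P \<subseteq> {real_vec v}" .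
    then have "aff_dim P \<le> 0" using aff_dim_subset[of P "{real_vec v}"] by simp
    then show False using dim zero_less_card_finite[where 'a = 'n] by linarith
  qed
  then show "\<exists>v\<in>Vt. \<exists>w\<in>Vt. v \<noteq> w" .
  have "inj_on real_vec Vt" by (simp add: inj_on_def)
  moreover have "finite (real_vec ` Vt)"
    by (rule finite_subset[OF _ finite_extreme_points_polytope[OF pol]]) (auto simp: Vt_def)
  ultimately have finVt: "finite Vt" by (rule finite_imageD[rotated])
  show "vertex_charts A (lattice_points P) Vt"
    unfolding vertex_charts_def
  proof (intro conjI ballI finVt)
    show "Vt \<noteq> {}" using two by blast
    fix v assume v: "v \<in> Vt"
    then have vP: "real_vec v extreme_point_of P" by (simp add: Vt_def)
    show "v \<in> A" by (rule vertices[OF vP])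
    obtain B where B: "finite B"
      "\<forall>b\<in>B. (\<exists>\<sigma>. \<sigma> edge_of P \<and> real_vec v \<in> \<sigma> \<and> nearest_neighbor v \<sigma> (v + b)) \<and>
       (\<exists>N\<ge>(1::nat). \<exists>w. real_vec w extreme_point_of P \<and> int N *s b = w - v)"
      "\<forall>u\<in>lattice_points P. \<exists>k :: int ^ 'n \<Rightarrow> nat. u - v = (\<Sum>b\<in>B. int (k b) *s b)"
      using smooth_polytope_vertex_chart[OF P vP] by (elim exE conjE)
    have "v + b \<in> A \<and> (\<exists>N\<ge>(1::nat). \<exists>w\<in>Vt. int N *s b = w - v)" if b: "b \<in> B" for b
    proof
      show "v + b \<in> A" using bspec[OF B(2) b] neighbors[OF vP] by blast
      obtain N w where "N \<ge> (1::nat)" "real_vec w extreme_point_of P" "int N *s b = w - v"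
        using bspec[OF B(2) b] by blast
      then show "\<exists>N\<ge>(1::nat). \<exists>w\<in>Vt. int N *s b = w - v" unfolding Vt_def by blast
    qed
    then show "\<exists>B. finite B \<and> (\<forall>b\<in>B. v + b \<in> A \<and> (\<exists>N\<ge>(1::nat). \<exists>w\<in>Vt. int N *s b = w - v)) \<and>
      (\<forall>u\<in>lattice_points P. \<exists>k :: int ^ 'n \<Rightarrow> nat. u - v = (\<Sum>b\<in>B. int (k b) *s b))"
      using B(1,3) by (intro exI[of _ B] conjI ballI) simp_all
  qed
qed

theorem theorem5p1:
  fixes P :: "(real ^ 'n) set" and A :: "(int ^ 'n) set"
  assumes "smooth_polytope P"
    and "aff_dim P = int CARD('n)"
    and "A \<subseteq> lattice_points P"
    and "\<And>v. real_vec v extreme_point_of P \<Longrightarrow> v \<in> A"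
    and "\<And>v \<sigma> w. real_vec v extreme_point_of P \<Longrightarrow> \<sigma> edge_of P \<Longrightarrow> real_vec v \<in> \<sigma> \<Longrightarrow>
           nearest_neighbor v \<sigma> w \<Longrightarrow> w \<in> A"
  shows "proj_dim A (Sec A (toric_variety A)) =
           proj_dim (lattice_points P) (Sec (lattice_points P) (toric_variety (lattice_points P)))
       \<and> proj_degree A (Sec A (toric_variety A)) dvd
           proj_degree (lattice_points P) (Sec (lattice_points P) (toric_variety (lattice_points P)))"
proof -
  define L where "L = lattice_points P"
  define Vt where "Vt = {v. real_vec v extreme_point_of P}"
  note AL = assms(3)[folded L_def]
  have pol: "polytope P" using assms(1) by (auto simp: smooth_polytope_def simple_polytope_def)
  have fin: "finite L" unfolding L_def
    by (intro finite_lattice_points compact_imp_bounded polytope_imp_compact pol)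
  have ch: "vertex_charts A L Vt"
    unfolding L_def Vt_def by (rule smooth_polytope_vertex_charts(1)[OF assms(1,2,4,5)])
  have "\<exists>v\<in>Vt. \<exists>w\<in>Vt. v \<noteq> w"
    unfolding Vt_def by (rule smooth_polytope_vertex_charts(2)[OF assms(1,2,4,5)])
  then obtain v w where vw: "v \<in> A" "w \<in> A" "v \<noteq> w" using assms(4) by (auto simp: Vt_def)
  then have vwL: "v \<in> L" "w \<in> L" using AL by auto
  let ?X = "Sec L (toric_variety L)" and ?Y = "Sec A (toric_variety A)"
  have dom: "domain_cone L (\<Union>?X)" by (rule Sec_domain_cone[OF vwL vw(3) fin])
  have int: "integral_cone A L (\<Union>?X)" by (rule Sec_integral_cone[OF vwL vw(3) fin ch AL])
  have link: "(\<forall>x\<in>\<Union>?Y. cpoly_eval f x = 0) \<longleftrightarrow> (\<forall>x\<in>\<Union>?X. cpoly_eval f x = 0)" if "f \<in> forms A d" for d f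
    by (rule Sec_vanish_projection[OF vw AL that])
  have finA: "finite A" using fin AL finite_subset by blast
  have "vanishing_forms A ?Y d = vanishing_forms A ?X d" for d
    using link by (fastforce simp: vanishing_forms_def)
  then have "hilb A (\<Union>?Y) d = hilb A (\<Union>?X) d" for d
    unfolding hilbert_function_eq_hilb[OF finA, symmetric] hilbert_function_def by simp
  moreover obtain x0 where "x0 \<in> \<Union>?X" using Sec_nonempty[OF vwL vw(3)] by blast
  ultimately have "proj_degree A ?Y dvd proj_degree L ?X" using proj_degree_dvd[OF fin AL dom int] by blast
  moreover have "proj_dim A ?Y = proj_dim L ?X"
    by (rule proj_dim_finite_projection[OF fin AL closedin_Sec closedin_Sec int link])
  ultimately show ?thesis by (simp add: L_def)
qed

end
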